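(* Let $n\ge1$, $0<s<1$, $p>1$, and let $g$ be a real function on $(0,\infty)$ for which there is $s_0>0$ such that $g$ is differentiable on $(0,s_0)$ with $g'(t)\le 0$ for $0<t<s_0$. Assume $u\in C^{1,1}_{loc}(\mathbb{R}^n)\cap L_{sp}$ is a positive solution of $$(-\Delta)^s_p u(x)=g(u(x)),\qquad x\in\mathbb{R}^n,$$ with $\lim_{|x|\to\infty}u(x)=0$. Then $u$ is radially symmetric and monotone decreasing about some point of $\mathbb{R}^n$.
   Context: The fractional $p$-Laplacian is $$(-\Delta)^s_p u(x)=C_{n,sp}\,\lim_{\epsilon\to 0}\int_{\mathbb{R}^n\setminus B_\epsilon(x)}\frac{|u(x)-u(y)|^{p-2}[u(x)-u(y)]}{|x-y|^{n+sp}}\,dy,$$ with $C_{n,sp}>0$ a normalizing constant, and $$L_{sp}=\Big\{u\in L^1_{loc}(\mathbb{R}^n)\ :\ \int_{\mathbb{R}^n}\frac{|u(x)|}{1+|x|^{n+sp}}\,dx<\infty\Big\}.$$ *)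

theory Defs
  imports "HOL-Analysis.Analysis"
begin

definition frac_kernel :: "real \<Rightarrow> real \<Rightarrow> ('a::euclidean_space \<Rightarrow> real) \<Rightarrow> 'a \<Rightarrow> 'a \<Rightarrow> real" where
  "frac_kernel s p u x y =
     \<bar>u x - u y\<bar> powr (p - 2) * (u x - u y) / norm (x - y) powr (real DIM('a) + s * p)"

text \<open>(-Delta)^s_p u(x) = L (pointwise, as a principal value with normalizing constant C):
  for every eps > 0 the integral over the complement of B_eps(x) exists, and
  C times these integrals converge to L as eps -> 0+.\<close>
definition frac_p_laplacian_eq ::
    "real \<Rightarrow> real \<Rightarrow> real \<Rightarrow> ('a::euclidean_space \<Rightarrow> real) \<Rightarrow> 'a \<Rightarrow> real \<Rightarrow> bool" where
  "frac_p_laplacian_eq C s p u x L \<longleftrightarrow>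
     (\<forall>\<epsilon>>0. set_integrable lborel {y. \<epsilon> \<le> dist x y} (frac_kernel s p u x)) \<and>
     ((\<lambda>\<epsilon>. C * (LINT y:{y. \<epsilon> \<le> dist x y}|lborel. frac_kernel s p u x y)) \<longlongrightarrow> L) (at_right 0)"

definition L_sp :: "real \<Rightarrow> real \<Rightarrow> ('a::euclidean_space \<Rightarrow> real) set" where
  "L_sp s p = {u. (\<forall>K. compact K \<longrightarrow> set_integrable lborel K u) \<and>
      integrable lborel (\<lambda>x. \<bar>u x\<bar> / (1 + norm x powr (real DIM('a) + s * p)))}"

definition C11_loc :: "('a::euclidean_space \<Rightarrow> real) set" where
  "C11_loc = {u. \<exists>Du::'a \<Rightarrow> 'a.
      (\<forall>x. (u has_derivative (\<lambda>h. Du x \<bullet> h)) (at x)) \<and>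
      (\<forall>K. compact K \<longrightarrow> (\<exists>L. \<forall>x\<in>K. \<forall>y\<in>K. dist (Du x) (Du y) \<le> L * dist x y))}"

end

theory Submission
  imports Defs
begin

text \<open>
  The planes are moved with the smooth kernels $(|x|^2+\<epsilon>^2)^{-N/2}$, $N=n+sp$; the corresponding operators
  $h_\<epsilon>$ converge pointwise to the fractional $p$-Laplacian. At a negative minimum of
  $u(x^\<lambda>)-u(x)$ the value of $g(u)$ drops strictly under the reflection, which is impossible where $g$ is
  nonincreasing. So such minima have $u \<ge> s_0$, the planes start, and at the critical plane $u$ is either symmetric or
  strictly smaller than its reflection.

  Nothing is known about $g$ above $s_0$, so the second case is excluded by a test that does not see $g$: an infinitesimal Steiner
  symmetrization. For each level $t$ the components $(a,b)$ of $\{u>t\}$ on lines in direction $e$ with centre slightly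
  beyond the critical plane are translated. Since $u(a)=u(b)=t$, the right-hand side contributes $g(t)-g(t)=0$, while
  the nonlocal energy changes at a definite rate because $u$ is strictly asymmetric far to the left. With the level weight
  $\<tau>(t)=e^{K(t-t_1)}-1$ the error is at most $M^\<theta>\<tau>'$, $M$ being the size of the violation of
  monotonicity beyond the critical plane; taking $K$ of order $M^{-\<theta>}$ forces an exponentially large quantity to stay bounded
  as $M$ tends to 0.
\<close>

section \<open>The power nonlinearity\<close>

text \<open>The smooth kernels make every integral absolutely convergent, so reflections become
  pointwise sign comparisons under one integral, uniformly in \<epsilon>; the equation enters only
  through limits at single points. In the symmetrization test the weight subtracts the part of the
  superlevel set that is moved along. That part is symmetric in the two levels and cancels against
  the odd derivative of the kernel, so it costs nothing; what it buys is that a violation at levels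
  t > r costs \<tau>(t) - \<tau>(r) instead of \<tau>(t). The extra factor t - r tames the
  singularity |t - r|^(p-2) and makes the loss integrable for every s < 1, with some room:
  interpolation spends 2\<theta> < p(1 - s) of it on the factor M^\<theta>. A second obstacle is the
  limit \<epsilon> -> 0 in the test, because for p < 2 the regularized operators need not stay
  bounded near critical points. They are controlled there by a negative power of the slope along e,
  and 1/slope at the component ends is integrable over levels and components by a coarea
  argument.\<close>

definition Gp :: "real \<Rightarrow> real \<Rightarrow> real" where
  "Gp p x = \<bar>x\<bar> powr (p - 2) * x"

lemma Gp_minus [simp]: "Gp p (- x) = - Gp p x"
  by (simp add: Gp_def)

lemma Gp_0 [simp]: "Gp p 0 = 0"
  by (simp add: Gp_def)

lemma Gp_nonneg_eq:
  assumes "x \<ge> 0" shows "Gp p x = x powr (p - 1)"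
proof (cases "x = 0")
  case False
  then show ?thesis using assms powr_mult_base[of x "p - 2"] by (simp add: Gp_def mult.commute)
qed (simp add: Gp_def)

lemma abs_Gp: "\<bar>Gp p x\<bar> = \<bar>x\<bar> powr (p - 1)"
proof -
  have "\<bar>Gp p x\<bar> = Gp p \<bar>x\<bar>" by (simp add: Gp_def abs_mult)
  then show ?thesis by (simp add: Gp_nonneg_eq)
qed

lemma continuous_Gp:
  assumes "1 < p" shows "continuous_on A (Gp p)"
proof -
  have "isCont (Gp p) x" for x
  proof (cases "x = 0")
    case True
    have "((\<lambda>x. \<bar>x\<bar> powr (p - 1)) \<longlongrightarrow> \<bar>0\<bar> powr (p - 1)) (at (0::real))"
      using assms by (intro tendsto_powr' tendsto_intros) auto
    then have "((\<lambda>x. \<bar>Gp p x\<bar>) \<longlongrightarrow> 0) (at 0)"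
      using assms by (simp add: abs_Gp)
    then show ?thesis using True by (simp add: isCont_def tendsto_rabs_zero_iff)
  next
    case False
    then show ?thesis unfolding Gp_def[abs_def] by (intro continuous_intros) auto
  qed
  then show ?thesis by (simp add: continuous_at_imp_continuous_on)
qed

lemma Gp_measurable [measurable]: "Gp p \<in> borel_measurable borel"
  unfolding Gp_def[abs_def] by measurable

lemma Gp_strict_mono:
  assumes "1 < p" "x < y" shows "Gp p x < Gp p y"
proof -
  have pos: "Gp p a < Gp p b" if "0 \<le> a" "a < b" for a b
    using that assms by (simp add: Gp_nonneg_eq powr_less_mono2)
  consider "0 \<le> x" | "y \<le> 0" | "x < 0" "0 < y" by linarith
  then show ?thesis
  proof cases
    case 1 then show ?thesis using pos assms by auto
  next
    case 2 then show ?thesis using pos[of "-y" "-x"] assms by auto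
  next
    case 3 then show ?thesis using pos[of 0 "-x"] pos[of 0 y] assms by auto
  qed
qed

lemma Gp_mono: "1 < p \<Longrightarrow> x \<le> y \<Longrightarrow> Gp p x \<le> Gp p y"
  using Gp_strict_mono[of p x y] by (cases "x = y") auto

text \<open>The derivative has no positive lower bound: it vanishes at 0 if p > 2 and decays at
  infinity if p < 2. Compactness of the range of \<open>a\<close> replaces such a bound;
  \<open>b\<close> may be arbitrarily large by monotonicity.\<close>

lemma Gp_gap:
  assumes "1 < p" "0 < d"
  obtains g0 where "0 < g0" "\<And>a b. \<bar>a\<bar> \<le> U \<Longrightarrow> a + d \<le> b \<Longrightarrow> g0 \<le> Gp p b - Gp p a"
proof (cases "0 \<le> U")
  case True
  have "continuous_on {-U..U} (\<lambda>a. Gp p (a + d))"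
    by (rule continuous_on_compose2[OF continuous_Gp[OF assms(1), of UNIV], of _ "\<lambda>a. a + d"])
       (auto intro!: continuous_intros)
  then have "continuous_on {-U..U} (\<lambda>a. Gp p (a + d) - Gp p a)"
    by (intro continuous_on_diff continuous_Gp assms)
  then obtain a0 where a0: "a0 \<in> {-U..U}" "\<forall>a\<in>{-U..U}. Gp p (a0 + d) - Gp p a0 \<le> Gp p (a + d) - Gp p a"
    using continuous_attains_inf[of "{-U..U}" "\<lambda>a. Gp p (a + d) - Gp p a"] True by auto
  have "0 < Gp p (a0 + d) - Gp p a0"
    using Gp_strict_mono[of p a0 "a0 + d"] assms by auto
  moreover have "Gp p (a0 + d) - Gp p a0 \<le> Gp p b - Gp p a" if "\<bar>a\<bar> \<le> U" "a + d \<le> b" for a b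
  proof -
    have "a \<in> {-U..U}" using that by auto
    with a0 have "Gp p (a0 + d) - Gp p a0 \<le> Gp p (a + d) - Gp p a" by blast
    also have "\<dots> \<le> Gp p b - Gp p a" using Gp_mono[OF assms(1) that(2)] by simp
    finally show ?thesis .
  qed
  ultimately show ?thesis using that by blast
next
  case False
  then show ?thesis using that[of 1] by auto
qed

lemma Gp_has_derivative:
  assumes "x \<noteq> 0"
  shows "(Gp p has_real_derivative (p - 1) * \<bar>x\<bar> powr (p - 2)) (at x)"
proof -
  have pos: "(Gp p has_real_derivative (p - 1) * \<bar>x\<bar> powr (p - 2)) (at x)" if "x > 0" for x
  proof -
    have "((\<lambda>x. x powr (p - 1)) has_real_derivative (p - 1) * x powr (p - 2)) (at x)"
      using that by (auto intro!: derivative_eq_intros)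
    then have "(Gp p has_real_derivative (p - 1) * x powr (p - 2)) (at x)"
      by (rule DERIV_cong_ev[THEN iffD1, rotated -1])
         (use that eventually_nhds_in_open[of "{0<..}" x] in \<open>auto elim!: eventually_mono simp: Gp_nonneg_eq\<close>)
    then show ?thesis using that by simp
  qed
  show ?thesis
  proof (cases "x > 0")
    case False
    have "(Gp p has_real_derivative (p - 1) * \<bar>- x\<bar> powr (p - 2)) (at (- x))"
      using pos[of "- x"] assms False by auto
    then have "((\<lambda>x. Gp p (- x)) has_real_derivative ((p - 1) * \<bar>- x\<bar> powr (p - 2)) * (- 1)) (at x)"
      by (rule DERIV_chain2[where g = uminus]) (auto intro!: derivative_eq_intros)
    from DERIV_minus[OF this]
    have "((\<lambda>x. - Gp p (- x)) has_real_derivative (p - 1) * \<bar>x\<bar> powr (p - 2)) (at x)"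
      by simp
    then show ?thesis by simp
  qed (use pos in auto)
qed

text \<open>Layer-cake form of the nonlinearity: it turns \<open>Gp p (t - u y)\<close> into an
  integral over superlevel sets of \<open>u\<close>. For p < 2 the density is unbounded at r = t,
  but the primitive is continuous there, so the fundamental theorem may omit that point; absolute
  integrability then follows from the sign.\<close>

lemma Gp_layer_integral:
  assumes "1 < p" "\<alpha> \<le> \<beta>"
  shows "set_integrable lborel {\<alpha>..\<beta>} (\<lambda>r. (p - 1) * \<bar>t - r\<bar> powr (p - 2))"
    and "(LINT r:{\<alpha>..\<beta>}|lborel. (p - 1) * \<bar>t - r\<bar> powr (p - 2)) = Gp p (t - \<alpha>) - Gp p (t - \<beta>)"
proof -
  let ?f = "\<lambda>r. (p - 1) * \<bar>t - r\<bar> powr (p - 2)"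
  have hi: "(?f has_integral (- Gp p (t - \<beta>) - (- Gp p (t - \<alpha>)))) {\<alpha>..\<beta>}"
  proof (rule fundamental_theorem_of_calculus_interior_strong[of "{t}"])
    show "((\<lambda>r. - Gp p (t - r)) has_vector_derivative ?f x) (at x)" if "x \<in> {\<alpha><..<\<beta>} - {t}" for x
    proof -
      have "((\<lambda>r. Gp p (t - r)) has_real_derivative ((p - 1) * \<bar>t - x\<bar> powr (p - 2)) * (- 1)) (at x)"
        by (rule DERIV_chain2[where g = "\<lambda>r. t - r"])
           (use that in \<open>auto intro!: derivative_eq_intros Gp_has_derivative\<close>)
      from DERIV_minus[OF this] show ?thesis
        by (simp add: has_real_derivative_iff_has_vector_derivative)
    qed
    show "continuous_on {\<alpha>..\<beta>} (\<lambda>r. - Gp p (t - r))"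
      by (intro continuous_on_minus
          continuous_on_compose2[OF continuous_Gp[OF assms(1), of UNIV], where f = "\<lambda>r. t - r"])
         (auto intro!: continuous_intros)
  qed (use assms in auto)
  have "?f absolutely_integrable_on {\<alpha>..\<beta>}"
    using hi assms by (intro nonnegative_absolutely_integrable_1) auto
  then have "set_integrable lebesgue {\<alpha>..\<beta>} ?f" .
  then show si: "set_integrable lborel {\<alpha>..\<beta>} ?f"
    unfolding set_integrable_def by (subst (asm) integrable_completion) auto
  show "(LINT r:{\<alpha>..\<beta>}|lborel. ?f r) = Gp p (t - \<alpha>) - Gp p (t - \<beta>)"
    using set_borel_integral_eq_integral(2)[OF si] integral_unique[OF hi] by (simp only:)
qed

lemma Gp_diff_le_ge2:
  assumes "2 \<le> p" "\<bar>x\<bar> \<le> m" "\<bar>y\<bar> \<le> m"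
  shows "\<bar>Gp p x - Gp p y\<bar> \<le> (p - 1) * m powr (p - 2) * \<bar>x - y\<bar>"
proof -
  have *: "Gp p y - Gp p x \<le> (p - 1) * m powr (p - 2) * (y - x)" if xy: "x \<le> y" and b: "\<bar>x\<bar> \<le> m" "\<bar>y\<bar> \<le> m" for x y
  proof -
    let ?f = "\<lambda>r. (p - 1) * \<bar>0 - r\<bar> powr (p - 2)"
    have "Gp p y - Gp p x = (LINT r:{x..y}|lborel. ?f r)"
      using Gp_layer_integral(2)[of p x y 0] assms xy by simp
    also have "\<dots> \<le> (LINT r:{x..y}|lborel. (p - 1) * m powr (p - 2))"
    proof (rule set_integral_mono)
      show "?f r \<le> (p - 1) * m powr (p - 2)" if "r \<in> {x..y}" for r
        using that assms b by (intro mult_left_mono powr_mono2) auto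
    qed (use Gp_layer_integral(1)[of p x y 0] assms xy in \<open>auto simp: set_integrable_def\<close>)
    also have "\<dots> = (p - 1) * m powr (p - 2) * (y - x)"
      using xy by (simp add: set_lebesgue_integral_def)
    finally show ?thesis .
  qed
  show ?thesis
    using *[of x y] *[of y x] Gp_mono[of p x y] Gp_mono[of p y x] assms by (cases "x \<le> y") auto
qed

text \<open>For p < 2 there is no Lipschitz bound near 0, so the estimate is relative to a reference
  value \<alpha>, later the linear Taylor term. If E is at most |\<alpha>|/2, both points stay away
  from 0. Otherwise |\<alpha>| < 2E, and the crude size (3E)^(p-1) of each term is already at most
  3E|\<alpha>|^(p-2).\<close>

lemma Gp_diff_le_lt2:
  assumes "1 < p" "p < 2" "\<alpha> \<noteq> 0" "\<bar>x - \<alpha>\<bar> \<le> E" "\<bar>y - \<alpha>\<bar> \<le> E"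
  shows "\<bar>Gp p x - Gp p y\<bar> \<le> 12 * E * \<bar>\<alpha>\<bar> powr (p - 2)"
proof (cases "E \<le> \<bar>\<alpha>\<bar> / 2")
  case True
  have pw: "(\<bar>\<alpha>\<bar> / 2) powr (p - 2) \<le> 2 * \<bar>\<alpha>\<bar> powr (p - 2)"
  proof -
    have "(\<bar>\<alpha>\<bar> / 2) powr (p - 2) = \<bar>\<alpha>\<bar> powr (p - 2) * 2 powr (2 - p)"
      by (simp add: powr_divide powr_diff field_simps)
    also have "\<dots> \<le> \<bar>\<alpha>\<bar> powr (p - 2) * 2 powr 1"
      using assms by (intro mult_left_mono powr_mono) auto
    finally show ?thesis by simp
  qed
  have E0: "0 \<le> E" using assms by linarith
  have *: "Gp p y - Gp p x \<le> 4 * E * \<bar>\<alpha>\<bar> powr (p - 2)" if xy: "x \<le> y" and b: "\<bar>x - \<alpha>\<bar> \<le> E" "\<bar>y - \<alpha>\<bar> \<le> E" for x y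
  proof -
    let ?f = "\<lambda>r. (p - 1) * \<bar>0 - r\<bar> powr (p - 2)"
    have "Gp p y - Gp p x = (LINT r:{x..y}|lborel. ?f r)"
      using Gp_layer_integral(2)[of p x y 0] assms xy by simp
    also have "\<dots> \<le> (LINT r:{x..y}|lborel. 1 * (\<bar>\<alpha>\<bar> / 2) powr (p - 2))"
    proof (rule set_integral_mono)
      show "?f r \<le> 1 * (\<bar>\<alpha>\<bar> / 2) powr (p - 2)" if "r \<in> {x..y}" for r
      proof -
        have "\<bar>\<alpha>\<bar> / 2 \<le> \<bar>0 - r\<bar>" using that b True by (auto simp: abs_if split: if_splits)
        then show ?thesis using assms by (intro mult_mono powr_mono2') auto
      qed
    qed (use Gp_layer_integral(1)[of p x y 0] assms xy in \<open>auto simp: set_integrable_def\<close>)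
    also have "\<dots> = (\<bar>\<alpha>\<bar> / 2) powr (p - 2) * (y - x)"
      using xy by (simp add: set_lebesgue_integral_def)
    also have "\<dots> \<le> (2 * \<bar>\<alpha>\<bar> powr (p - 2)) * (2 * E)"
      using pw b xy by (intro mult_mono) auto
    finally show ?thesis by (simp add: mult_ac)
  qed
  have "\<bar>Gp p x - Gp p y\<bar> \<le> 4 * E * \<bar>\<alpha>\<bar> powr (p - 2)"
    using *[of x y] *[of y x] Gp_mono[of p x y] Gp_mono[of p y x] assms by (cases "x \<le> y") auto
  also have "\<dots> \<le> 12 * E * \<bar>\<alpha>\<bar> powr (p - 2)"
    using E0 by (intro mult_right_mono) auto
  finally show ?thesis .
next
  case False
  then have E: "\<bar>\<alpha>\<bar> < 2 * E" "0 < E" using assms by auto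
  have one: "\<bar>Gp p z\<bar> \<le> 6 * E * \<bar>\<alpha>\<bar> powr (p - 2)" if "\<bar>z - \<alpha>\<bar> \<le> E" for z
  proof -
    have "\<bar>z\<bar> \<le> 3 * E" using that E by linarith
    then have "\<bar>Gp p z\<bar> \<le> (3 * E) powr (p - 1)"
      unfolding abs_Gp using assms by (intro powr_mono2) auto
    also have "\<dots> = 3 * E * (3 * E) powr (p - 2)"
      using E powr_mult_base[of "3 * E" "p - 2"] by simp
    also have "\<dots> \<le> 3 * E * \<bar>\<alpha>\<bar> powr (p - 2)"
      using E assms by (intro mult_left_mono powr_mono2') auto
    also have "\<dots> \<le> 6 * E * \<bar>\<alpha>\<bar> powr (p - 2)"
      using E by (intro mult_right_mono) auto
    finally show ?thesis .
  qed
  show ?thesis using one[OF assms(4)] one[OF assms(5)] by linarith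
qed

section \<open>Reflections and singular integrals\<close>

lemma ball_measurable [measurable]: "ball (x::'a::metric_space) r \<in> sets borel" "cball x r \<in> sets borel"
  by simp_all

lemma nn_integral_lborel_translate:
  fixes f :: "'a::euclidean_space \<Rightarrow> ennreal"
  assumes [measurable]: "f \<in> borel_measurable borel"
  shows "(\<integral>\<^sup>+x. f (x + v) \<partial>lborel) = (\<integral>\<^sup>+x. f x \<partial>lborel)"
proof -
  have "(\<integral>\<^sup>+x. f x \<partial>lborel) = (\<integral>\<^sup>+x. f x \<partial>distr lborel borel ((+) v))"
    by (simp add: lborel_distr_plus)
  also have "\<dots> = (\<integral>\<^sup>+x. f (x + v) \<partial>lborel)"
    by (subst nn_integral_distr) (auto simp: add.commute)
  finally show ?thesis by simp
qed

text \<open>Uses only translation invariance and Fubini. The measure of the unit ball B times the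
  integral of f(L x) is the double integral of 1_B(y) f(L x + y); substituting z = L x + y and
  interchanging leaves, for each z, the measure of those x with |z - L x| < 1, which is a translate
  of B because L is an isometry.\<close>

lemma nn_integral_linear_isometry:
  fixes L :: "'a::euclidean_space \<Rightarrow> 'a" and f :: "'a \<Rightarrow> ennreal"
  assumes L: "linear L" "\<And>x. norm (L x) = norm x" and f[measurable]: "f \<in> borel_measurable borel"
  shows "(\<integral>\<^sup>+x. f (L x) \<partial>lborel) = (\<integral>\<^sup>+x. f x \<partial>lborel)"
proof -
  have [measurable]: "L \<in> borel_measurable borel"
    using linear_continuous_on[of L UNIV] L(1)
    by (intro borel_measurable_continuous_onI) (simp add: linear_conv_bounded_linear)
  have "inj L" using L by (simp add: linear_injective_0) (metis norm_eq_zero)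
  then have "surj L" using L(1) linear_injective_imp_surjective by blast
  define B where "B = ball (0::'a) 1"
  have B[measurable]: "B \<in> sets borel" by (simp add: B_def)
  have \<beta>: "emeasure lborel B \<noteq> 0" "emeasure lborel B \<noteq> \<infinity>"
    using emeasure_bounded_finite[of B] open_not_negligible[of B]
    by (auto simp: B_def negligible_iff_emeasure0 emeasure_lborel_ball_finite less_top)
  have "emeasure lborel B * (\<integral>\<^sup>+x. f (L x) \<partial>lborel) = (\<integral>\<^sup>+y. indicator B y * (\<integral>\<^sup>+x. f (L x) \<partial>lborel) \<partial>lborel)"
    by (simp add: nn_integral_multc)
  also have "\<dots> = (\<integral>\<^sup>+y. (\<integral>\<^sup>+x. indicator B y * f (L x + y) \<partial>lborel) \<partial>lborel)"
  proof (rule nn_integral_cong)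
    fix y :: 'a
    obtain y' where y': "y = L y'" using \<open>surj L\<close> by (metis surjD)
    have "(\<integral>\<^sup>+x. f (L x) \<partial>lborel) = (\<integral>\<^sup>+x. f (L (x + y')) \<partial>lborel)"
      by (subst nn_integral_lborel_translate[of "\<lambda>x. f (L x)" y']) auto
    then show "indicator B y * (\<integral>\<^sup>+x. f (L x) \<partial>lborel) = (\<integral>\<^sup>+x. indicator B y * f (L x + y) \<partial>lborel)"
      using L(1) by (simp add: nn_integral_cmult y' linear_add)
  qed
  also have "\<dots> = (\<integral>\<^sup>+x. (\<integral>\<^sup>+y. indicator B y * f (L x + y) \<partial>lborel) \<partial>lborel)"
    by (rule lborel_pair.Fubini') simp
  also have "\<dots> = (\<integral>\<^sup>+x. (\<integral>\<^sup>+z. indicator B (z - L x) * f z \<partial>lborel) \<partial>lborel)"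
  proof (rule nn_integral_cong)
    fix x
    show "(\<integral>\<^sup>+y. indicator B y * f (L x + y) \<partial>lborel) = (\<integral>\<^sup>+z. indicator B (z - L x) * f z \<partial>lborel)"
      using nn_integral_lborel_translate[of "\<lambda>z. indicator B (z - L x) * f z" "L x"] by (simp add: add.commute)
  qed
  also have "\<dots> = (\<integral>\<^sup>+z. (\<integral>\<^sup>+x. indicator B (z - L x) * f z \<partial>lborel) \<partial>lborel)"
    by (rule lborel_pair.Fubini') simp
  also have "\<dots> = (\<integral>\<^sup>+z. emeasure lborel B * f z \<partial>lborel)"
  proof (rule nn_integral_cong)
    fix z
    obtain z' where z': "z = L z'" using \<open>surj L\<close> by (metis surjD)
    have *: "indicator B (z - L x) = (indicator B (x + (- z')) :: ennreal)" for x
    proof -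
      have "norm (z - L x) = norm (x + (- z'))"
        using L(2)[of "z' - x"] L(1) by (simp add: z' linear_diff norm_minus_commute)
      then show ?thesis by (simp add: B_def indicator_def)
    qed
    have "(\<integral>\<^sup>+x. indicator B (z - L x) \<partial>lborel) = emeasure lborel B"
      unfolding * by (subst nn_integral_lborel_translate) auto
    then show "(\<integral>\<^sup>+x. indicator B (z - L x) * f z \<partial>lborel) = emeasure lborel B * f z"
      by (simp add: nn_integral_multc)
  qed
  also have "\<dots> = emeasure lborel B * (\<integral>\<^sup>+z. f z \<partial>lborel)"
    by (simp add: nn_integral_cmult)
  finally show ?thesis
    using \<beta> ennreal_mult_cancel_left by (metis infinity_ennreal_def)
qed

definition refl_at :: "'a::euclidean_space \<Rightarrow> real \<Rightarrow> 'a \<Rightarrow> 'a" where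
  "refl_at e c x = x + (2 * (c - x \<bullet> e)) *\<^sub>R e"

lemma continuous_on_refl_at [continuous_intros]: "continuous_on A (refl_at e c)"
  unfolding refl_at_def[abs_def] by (intro continuous_intros)

lemma refl_at_measurable [measurable]: "refl_at e c \<in> borel_measurable borel"
  by (rule borel_measurable_continuous_onI) (rule continuous_on_refl_at)

lemma refl_at_inner: "norm e = 1 \<Longrightarrow> refl_at e c x \<bullet> e = 2 * c - x \<bullet> e"
  by (simp add: refl_at_def inner_add_left dot_square_norm)

lemma refl_at_refl_at [simp]: "norm e = 1 \<Longrightarrow> refl_at e c (refl_at e c x) = x"
  unfolding refl_at_def[of e c "refl_at e c x"] by (simp add: refl_at_inner) (simp add: refl_at_def algebra_simps)

lemma refl_at_diff: "refl_at e c x - refl_at e c y = refl_at e 0 (x - y)"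
  by (simp add: refl_at_def inner_diff_left algebra_simps)

lemma norm_refl_at_0:
  assumes "norm e = 1" shows "norm (refl_at e 0 x) = norm x"
proof -
  have "e \<bullet> e = 1" using assms by (simp add: dot_square_norm)
  then have "(norm (refl_at e 0 x))\<^sup>2 = (norm x)\<^sup>2"
    unfolding refl_at_def power2_norm_eq_inner
    by (simp add: inner_add_left inner_add_right inner_diff_left inner_diff_right inner_commute)
  then show ?thesis by simp
qed

lemma norm_refl_at_diff: "norm e = 1 \<Longrightarrow> norm (refl_at e c x - refl_at e c y) = norm (x - y)"
  by (simp add: refl_at_diff norm_refl_at_0)

lemma norm_refl_at_swap: "norm e = 1 \<Longrightarrow> norm (refl_at e c x - y) = norm (x - refl_at e c y)"
  using norm_refl_at_diff[of e c x "refl_at e c y"] by simp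

lemma nn_integral_refl_at:
  fixes f :: "'a::euclidean_space \<Rightarrow> ennreal"
  assumes e: "norm e = 1" and [measurable]: "f \<in> borel_measurable borel"
  shows "(\<integral>\<^sup>+x. f (refl_at e c x) \<partial>lborel) = (\<integral>\<^sup>+x. f x \<partial>lborel)"
proof -
  have eq: "refl_at e c x = refl_at e 0 x + (2 * c) *\<^sub>R e" for x
    by (simp add: refl_at_def algebra_simps)
  have lin: "linear (refl_at e 0)"
    by (rule linearI) (simp_all add: refl_at_def algebra_simps)
  have "(\<integral>\<^sup>+x. f (refl_at e c x) \<partial>lborel) = (\<integral>\<^sup>+x. f (x + (2 * c) *\<^sub>R e) \<partial>lborel)"
    unfolding eq by (rule nn_integral_linear_isometry[OF lin norm_refl_at_0[OF e]]) simp
  then show ?thesis by (simp add: nn_integral_lborel_translate)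
qed

lemma distr_refl_at:
  assumes "norm (e::'a::euclidean_space) = 1"
  shows "distr lborel borel (refl_at e c) = lborel"
proof (rule measure_eqI)
  fix A assume "A \<in> sets (distr lborel borel (refl_at e c))"
  then have [measurable]: "A \<in> sets borel" by simp
  have "emeasure (distr lborel borel (refl_at e c)) A = (\<integral>\<^sup>+x. indicator A x \<partial>distr lborel borel (refl_at e c))"
    by simp
  also have "\<dots> = (\<integral>\<^sup>+x. indicator A (refl_at e c x) \<partial>lborel)"
    by (rule nn_integral_distr) auto
  also have "\<dots> = emeasure lborel A"
    by (subst nn_integral_refl_at[OF assms]) auto
  finally show "emeasure (distr lborel borel (refl_at e c)) A = emeasure lborel A" .
qed simp

lemma integral_refl_at:
  fixes f :: "'a::euclidean_space \<Rightarrow> real"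
  assumes e: "norm e = 1" and [measurable]: "f \<in> borel_measurable borel"
  shows "(\<integral>x. f (refl_at e c x) \<partial>lborel) = (\<integral>x. f x \<partial>lborel)"
  using integral_distr[of "refl_at e c" lborel borel f] by (simp add: distr_refl_at[OF e])

lemma integrable_refl_at:
  fixes f :: "'a::euclidean_space \<Rightarrow> real"
  assumes e: "norm e = 1" and "integrable lborel f"
  shows "integrable lborel (\<lambda>x. f (refl_at e c x))"
  using integrable_distr[of "refl_at e c" lborel borel f] assms(2) by (simp add: distr_refl_at[OF e])

lemma integral_lborel_translate:
  fixes f :: "'a::euclidean_space \<Rightarrow> real"
  assumes [measurable]: "f \<in> borel_measurable borel"
  shows "(\<integral>x. f (x + v) \<partial>lborel) = (\<integral>x. f x \<partial>lborel)"
  using integral_distr[of "(+) v" lborel borel f] by (simp add: lborel_distr_plus add.commute)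

lemma integrable_lborel_translate:
  fixes f :: "'a::euclidean_space \<Rightarrow> real"
  assumes "integrable lborel f"
  shows "integrable lborel (\<lambda>x. f (x + v))"
  using integrable_distr[of "(+) v" lborel borel f] assms by (simp add: lborel_distr_plus add.commute)

lemma distr_uminus_lborel: "distr lborel borel uminus = (lborel :: 'a::euclidean_space measure)"
proof (rule measure_eqI)
  fix A :: "'a set" assume "A \<in> sets (distr lborel borel uminus)"
  then have [measurable]: "A \<in> sets borel" by simp
  have "emeasure (distr lborel borel uminus) A = (\<integral>\<^sup>+x. indicator A x \<partial>distr lborel borel uminus)"
    by simp
  also have "\<dots> = (\<integral>\<^sup>+x. indicator A (- x) \<partial>lborel)"
    by (rule nn_integral_distr) auto
  also have "\<dots> = emeasure lborel A"
    by (subst nn_integral_linear_isometry[of uminus]) (auto intro: linearI)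
  finally show "emeasure (distr lborel borel uminus) A = emeasure lborel A" .
qed simp

lemma integral_lborel_uminus:
  fixes f :: "'a::euclidean_space \<Rightarrow> real"
  assumes [measurable]: "f \<in> borel_measurable borel"
  shows "(\<integral>x. f (- x) \<partial>lborel) = (\<integral>x. f x \<partial>lborel)"
  using integral_distr[of uminus lborel borel f] by (simp add: distr_uminus_lborel)

lemma integrable_lborel_uminus:
  fixes f :: "'a::euclidean_space \<Rightarrow> real"
  assumes "integrable lborel f"
  shows "integrable lborel (\<lambda>x. f (- x))"
  using integrable_distr[of uminus lborel borel f] assms by (simp add: distr_uminus_lborel)

text \<open>The shells need only cover the part of X where f is nonzero, and overlaps are harmless,
  since f is merely dominated by the sum. It serves for dyadic shells shrinking to the origin and
  for shells growing to infinity.\<close>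

lemma nn_integral_shells:
  fixes f :: "'a \<Rightarrow> ennreal" and S :: "nat \<Rightarrow> 'a set"
  assumes [measurable]: "f \<in> borel_measurable M" "\<And>j. S j \<in> sets M"
    and cover: "\<And>x. x \<in> space M \<Longrightarrow> f x \<noteq> 0 \<Longrightarrow> x \<in> X \<Longrightarrow> x \<in> (\<Union>j. S j)"
    and bound: "\<And>j. (\<integral>\<^sup>+x. f x * indicator (S j) x \<partial>M) \<le> ennreal (c * q ^ j)"
    and c: "0 \<le> c" "0 \<le> q" "q < 1"
  shows "(\<integral>\<^sup>+x. f x * indicator X x \<partial>M) \<le> ennreal (c / (1 - q))"
proof -
  have "(\<integral>\<^sup>+x. f x * indicator X x \<partial>M) \<le> (\<integral>\<^sup>+x. (\<Sum>j. f x * indicator (S j) x) \<partial>M)"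
  proof (rule nn_integral_mono)
    fix x assume x: "x \<in> space M"
    show "f x * indicator X x \<le> (\<Sum>j. f x * indicator (S j) x)"
    proof (cases "x \<in> X \<and> f x \<noteq> 0")
      case True
      then obtain j where "x \<in> S j" using cover x by auto
      then have "f x * indicator X x = (\<Sum>i\<in>{j}. f x * indicator (S i) x)" using True by simp
      also have "\<dots> \<le> (\<Sum>j. f x * indicator (S j) x)"
        by (rule sum_le_suminf) auto
      finally show ?thesis .
    qed auto
  qed
  also have "\<dots> = (\<Sum>j. \<integral>\<^sup>+x. f x * indicator (S j) x \<partial>M)"
    by (rule nn_integral_suminf) simp
  also have "\<dots> \<le> (\<Sum>j. ennreal (c * q ^ j))"
    by (intro suminf_le bound) auto
  also have "\<dots> = ennreal (\<Sum>j. c * q ^ j)"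
    using c by (intro suminf_ennreal2 summable_mult summable_geometric) auto
  also have "(\<Sum>j. c * q ^ j) = c / (1 - q)"
    using c by (subst suminf_mult) (auto intro: summable_geometric simp: suminf_geometric)
  finally show ?thesis .
qed

lemma powr_minus_nat_mult: "(2::real) powr (real j * a) = (2 powr a) ^ j"
  by (simp add: powr_realpow[symmetric] powr_powr mult.commute)

text \<open>Mass of order r^a in small balls makes |x|^(-\<gamma>) integrable against f as long as
  \<gamma> < a: on the j-th dyadic shell the bound is geometric with ratio 2^(\<gamma>-a). It is
  applied with f = 1, and with f = |v . x|^(p-2), where the singularity on a hyperplane lowers a to
  n + p - 2.\<close>

lemma nn_integral_ball_powr:
  fixes f :: "'a::euclidean_space \<Rightarrow> ennreal"
  assumes [measurable]: "f \<in> borel_measurable borel" and "\<gamma> < a" "0 \<le> c"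
    and bound: "\<And>r. 0 < r \<Longrightarrow> r \<le> 1 \<Longrightarrow> (\<integral>\<^sup>+x. f x * indicator (ball 0 r) x \<partial>lborel) \<le> ennreal (c * r powr a)"
  shows "(\<integral>\<^sup>+x. (f x * ennreal (norm x powr (- \<gamma>))) * indicator (ball 0 1) x \<partial>lborel)
       \<le> ennreal (c * 2 powr \<bar>\<gamma>\<bar> / (1 - 2 powr (\<gamma> - a)))"
proof (rule nn_integral_shells[where S = "\<lambda>j. {x. 2 powr (- real j - 1) \<le> norm x \<and> norm x < 2 powr (- real j)}"])
  fix x :: 'a assume x: "f x * ennreal (norm x powr (- \<gamma>)) \<noteq> 0" "x \<in> ball 0 1"
  then have "x \<noteq> 0" by auto
  \<comment> \<open>Ceiling minus one, not a floor: the outer inequality of the shell must be strict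
    and the inner one weak.\<close>
  define j where "j = nat \<lceil>- log 2 (norm x)\<rceil> - 1"
  have l: "- log 2 (norm x) > 0" using x \<open>x \<noteq> 0\<close> by (simp add: log_less_zero_cancel_iff)
  have "real j < - log 2 (norm x)" "- log 2 (norm x) \<le> real j + 1"
    using l unfolding j_def by linarith+
  then have "log 2 (norm x) < - real j" "- real j - 1 \<le> log 2 (norm x)" by auto
  then have "norm x < 2 powr (- real j)" "2 powr (- real j - 1) \<le> norm x"
    using \<open>x \<noteq> 0\<close> by (simp_all add: log_less_iff le_log_iff)
  then show "x \<in> (\<Union>j. {x. 2 powr (- real j - 1) \<le> norm x \<and> norm x < 2 powr (- real j)})" by auto
next
  fix j :: nat
  let ?S = "{x::'a. 2 powr (- real j - 1) \<le> norm x \<and> norm x < 2 powr (- real j)}"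
  have "(\<integral>\<^sup>+x. f x * ennreal (norm x powr - \<gamma>) * indicator ?S x \<partial>lborel)
      \<le> (\<integral>\<^sup>+x. ennreal (2 powr (real j * \<gamma> + \<bar>\<gamma>\<bar>)) * (f x * indicator (ball 0 (2 powr (- real j))) x) \<partial>lborel)"
  proof (rule nn_integral_mono)
    fix x :: 'a
    show "f x * ennreal (norm x powr - \<gamma>) * indicator ?S x
       \<le> ennreal (2 powr (real j * \<gamma> + \<bar>\<gamma>\<bar>)) * (f x * indicator (ball 0 (2 powr (- real j))) x)"
    proof (cases "x \<in> ?S")
      case True
      have p0: "norm x > 0" using True by (metis (mono_tags) mem_Collect_eq order_less_le_trans powr_gt_zero zero_neq_numeral)
      have "norm x powr - \<gamma> \<le> 2 powr (real j * \<gamma> + \<bar>\<gamma>\<bar>)"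
      proof (cases "\<gamma> \<ge> 0")
        case g: True
        have "norm x powr - \<gamma> \<le> (2 powr (- real j - 1)) powr - \<gamma>"
          using True g by (intro powr_mono2') auto
        also have "\<dots> = 2 powr (real j * \<gamma> + \<bar>\<gamma>\<bar>)" using g by (simp add: powr_powr algebra_simps)
        finally show ?thesis .
      next
        case g: False
        have "norm x powr - \<gamma> \<le> (2 powr (- real j)) powr - \<gamma>"
          using True g p0 by (intro powr_mono2) auto
        also have "\<dots> = 2 powr (real j * \<gamma>)" by (simp add: powr_powr)
        also have "\<dots> \<le> 2 powr (real j * \<gamma> + \<bar>\<gamma>\<bar>)" by (intro powr_mono) auto
        finally show ?thesis .
      qed
      then have "f x * ennreal (norm x powr - \<gamma>) \<le> f x * ennreal (2 powr (real j * \<gamma> + \<bar>\<gamma>\<bar>))"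
        by (intro mult_left_mono ennreal_leI) auto
      then show ?thesis using True by (simp add: mult.commute)
    qed simp
  qed
  also have "\<dots> = ennreal (2 powr (real j * \<gamma> + \<bar>\<gamma>\<bar>)) * (\<integral>\<^sup>+x. f x * indicator (ball 0 (2 powr (- real j))) x \<partial>lborel)"
    by (rule nn_integral_cmult) (intro borel_measurable_times_ennreal assms(1) borel_measurable_indicator; simp)
  also have "\<dots> \<le> ennreal (2 powr (real j * \<gamma> + \<bar>\<gamma>\<bar>)) * ennreal (c * (2 powr (- real j)) powr a)"
    by (intro mult_left_mono bound) (use powr_mono[of "- real j" 0 2] in auto)
  also have "\<dots> = ennreal (2 powr (real j * \<gamma> + \<bar>\<gamma>\<bar>) * (c * (2 powr (- real j)) powr a))"
    by (rule ennreal_mult[symmetric]) (use assms in auto)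
  also have "2 powr (real j * \<gamma> + \<bar>\<gamma>\<bar>) * (c * (2 powr (- real j)) powr a) = c * 2 powr \<bar>\<gamma>\<bar> * (2 powr (\<gamma> - a)) ^ j"
  proof -
    have "(2::real) powr (real j * \<gamma> + \<bar>\<gamma>\<bar>) * (2 powr (- real j)) powr a = 2 powr \<bar>\<gamma>\<bar> * 2 powr (real j * (\<gamma> - a))"
      by (simp only: powr_powr powr_add[symmetric]) (simp add: algebra_simps)
    then show ?thesis by (simp only: powr_minus_nat_mult) (simp add: mult_ac)
  qed
  finally show "(\<integral>\<^sup>+x. f x * ennreal (norm x powr - \<gamma>) * indicator ?S x \<partial>lborel)
      \<le> ennreal (c * 2 powr \<bar>\<gamma>\<bar> * (2 powr (\<gamma> - a)) ^ j)" .
next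
  show "2 powr (\<gamma> - a) < 1" using assms powr_less_mono[of "\<gamma> - a" 0 2] by simp
qed (use assms in auto)

lemma nn_integral_norm_powr_outside:
  assumes "real DIM('a::euclidean_space) < N"
  shows "(\<integral>\<^sup>+x. ennreal (norm x powr (- N)) * indicator {x::'a. 1 \<le> norm x} x \<partial>lborel) < \<infinity>"
proof -
  define \<omega> where "\<omega> = measure lborel (ball (0::'a) 1)"
  have "(\<integral>\<^sup>+x. ennreal (norm x powr (- N)) * indicator {x::'a. 1 \<le> norm x} x \<partial>lborel)
     \<le> ennreal (\<omega> * 2 powr real DIM('a) / (1 - 2 powr (real DIM('a) - N)))"
  proof (rule nn_integral_shells[where S = "\<lambda>j. {x. 2 ^ j \<le> norm x \<and> norm x < 2 ^ (j + 1)}"])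
    fix x :: 'a assume "x \<in> {x. 1 \<le> norm x}"
    then have x: "1 \<le> norm x" by simp
    define j where "j = nat \<lfloor>log 2 (norm x)\<rfloor>"
    have "log 2 (norm x) \<ge> 0" using x by (subst zero_le_log_cancel_iff) auto
    then have "real j \<le> log 2 (norm x)" "log 2 (norm x) < real j + 1" unfolding j_def by linarith+
    moreover have "0 < norm x" using x by linarith
    ultimately have "2 powr (real j) \<le> norm x" "norm x < 2 powr (real j + 1)"
      using le_log_iff[of 2 "norm x" "real j"] log_less_iff[of 2 "norm x" "real j + 1"] by auto
    then have "2 ^ j \<le> norm x" "norm x < 2 ^ (j + 1)"
      by (simp_all add: powr_realpow powr_add)
    then show "x \<in> (\<Union>j. {x. 2 ^ j \<le> norm x \<and> norm x < 2 ^ (j + 1)})" by auto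
  next
    fix j :: nat
    let ?S = "{x::'a. 2 ^ j \<le> norm x \<and> norm x < 2 ^ (j + 1)}"
    have "(\<integral>\<^sup>+x. ennreal (norm x powr - N) * indicator ?S x \<partial>lborel)
      \<le> (\<integral>\<^sup>+x. ennreal ((2 ^ j) powr - N) * indicator (ball 0 (2 ^ (j + 1))) (x::'a) \<partial>lborel)"
    proof (rule nn_integral_mono)
      fix x :: 'a
      show "ennreal (norm x powr - N) * indicator ?S x \<le> ennreal ((2 ^ j) powr - N) * indicator (ball 0 (2 ^ (j + 1))) x"
      proof (cases "x \<in> ?S")
        case True
        then have "norm x powr - N \<le> (2 ^ j) powr - N"
          using assms by (intro powr_mono2') auto
        then show ?thesis using True by (auto intro: ennreal_leI)
      qed simp
    qed
    also have "\<dots> = ennreal ((2 ^ j) powr - N) * emeasure lborel (ball (0::'a) (2 ^ (j + 1)))"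
      by (rule nn_integral_cmult_indicator) simp
    also have "emeasure lborel (ball (0::'a) (2 ^ (j + 1))) = ennreal (measure lborel (ball (0::'a) (2 ^ (j + 1))))"
      by (rule emeasure_eq_ennreal_measure) (use emeasure_lborel_ball_finite[of "0::'a"] in \<open>simp add: top.not_eq_extremum\<close>)
    also have "measure lborel (ball (0::'a) (2 ^ (j + 1))) = (2 ^ (j + 1)) ^ DIM('a) * \<omega>"
      using content_ball_conv_unit_ball[of "2 ^ (j + 1)" "0::'a"] by (simp add: \<omega>_def)
    also have "ennreal ((2 ^ j) powr - N) * ennreal ((2 ^ (j + 1)) ^ DIM('a) * \<omega>) = ennreal ((2 ^ j) powr - N * ((2 ^ (j + 1)) ^ DIM('a) * \<omega>))"
      by (rule ennreal_mult[symmetric]) (auto simp: \<omega>_def)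
    also have "(2 ^ j) powr - N * ((2 ^ (j + 1)) ^ DIM('a) * \<omega>) = \<omega> * 2 powr real DIM('a) * (2 powr (real DIM('a) - N)) ^ j"
    proof -
      have "((2::real) ^ j) powr - N * (2 ^ (j + 1)) ^ DIM('a) = 2 powr (real j * (- N)) * 2 powr (real (j + 1) * real DIM('a))"
      proof -
        have "(2::real) ^ j = 2 powr real j" by (rule powr_realpow[symmetric]) simp
        then have "((2::real) ^ j) powr - N = 2 powr (real j * (- N))" by (simp only: powr_powr)
        moreover have "((2::real) ^ (j + 1)) ^ DIM('a) = 2 powr (real ((j + 1) * DIM('a)))"
          by (subst powr_realpow) (simp_all only: power_mult zero_less_numeral)
        ultimately show ?thesis by (simp only: of_nat_mult)
      qed
      also have "\<dots> = 2 powr real DIM('a) * 2 powr (real j * (real DIM('a) - N))"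
        by (simp only: powr_add[symmetric]) (simp add: algebra_simps)
      finally show ?thesis by (simp only: powr_minus_nat_mult) (simp add: mult_ac)
    qed
    finally show "(\<integral>\<^sup>+x. ennreal (norm x powr - N) * indicator ?S x \<partial>lborel)
      \<le> ennreal (\<omega> * 2 powr real DIM('a) * (2 powr (real DIM('a) - N)) ^ j)" .
  next
    show "2 powr (real DIM('a) - N) < 1" using assms powr_less_mono[of "real DIM('a) - N" 0 2] by simp
  qed (auto simp: \<omega>_def)
  also have "\<dots> < \<infinity>" by simp
  finally show ?thesis .
qed

section \<open>Smooth kernels\<close>

definition ker :: "real \<Rightarrow> real \<Rightarrow> 'a::euclidean_space \<Rightarrow> real" where
  "ker N \<epsilon> x = ((norm x)\<^sup>2 + \<epsilon>\<^sup>2) powr (- (N / 2))"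

lemma sq_pos: "0 < \<epsilon> \<Longrightarrow> 0 < a\<^sup>2 + (\<epsilon>::real)\<^sup>2"
  by (simp add: sum_power2_gt_zero_iff)

lemma ker_pos: "0 < \<epsilon> \<Longrightarrow> 0 < ker N \<epsilon> x"
  by (simp add: ker_def)

lemma ker_minus [simp]: "ker N \<epsilon> (- x) = ker N \<epsilon> x"
  by (simp add: ker_def)

lemma ker_cong_norm: "norm x = norm y \<Longrightarrow> ker N \<epsilon> x = ker N \<epsilon> y"
  by (simp add: ker_def)

lemma ker_commute: "ker N \<epsilon> (x - y) = ker N \<epsilon> (y - x)"
  by (rule ker_cong_norm) (rule norm_minus_commute)

lemma ker_measurable [measurable]: "ker N \<epsilon> \<in> borel_measurable borel"
  unfolding ker_def[abs_def] by measurable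

lemma ker_mono:
  assumes "0 < \<epsilon>" "0 \<le> N" "norm x \<le> norm y" shows "ker N \<epsilon> y \<le> ker N \<epsilon> x"
  unfolding ker_def
  using assms sq_pos[of \<epsilon> "norm x"] by (intro powr_mono2') (auto intro!: power_mono)

lemma ker_le_powr:
  assumes "0 < \<epsilon>" "0 \<le> N" "x \<noteq> 0" shows "ker N \<epsilon> x \<le> norm x powr (- N)"
proof -
  have "ker N \<epsilon> x \<le> ((norm x)\<^sup>2) powr (- (N / 2))"
    unfolding ker_def using assms by (intro powr_mono2') auto
  also have "((norm x)\<^sup>2) powr (- (N / 2)) = norm x powr (- N)"
  proof -
    have "(norm x)\<^sup>2 = norm x powr 2" using assms by simp
    then show ?thesis by (simp only: powr_powr) simp
  qed
  finally show ?thesis .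
qed

lemma ker_le_eps:
  assumes "0 < \<epsilon>" "0 \<le> N" shows "ker N \<epsilon> x \<le> \<epsilon> powr (- N)"
proof -
  have "ker N \<epsilon> x \<le> (\<epsilon>\<^sup>2) powr (- (N / 2))"
    unfolding ker_def using assms by (intro powr_mono2') auto
  also have "((\<epsilon>)\<^sup>2) powr (- (N / 2)) = \<epsilon> powr (- N)"
  proof -
    have "(\<epsilon>)\<^sup>2 = \<epsilon> powr 2" using assms by simp
    then show ?thesis by (simp only: powr_powr) simp
  qed
  finally show ?thesis .
qed

text \<open>Mean value theorem in the norm; dropping \<epsilon> from the derivative makes the bound
  uniform in \<epsilon>.\<close>

lemma ker_diff_upper:
  fixes x y :: "'a::euclidean_space"
  assumes "0 < \<epsilon>" "0 \<le> N" "x \<noteq> 0" "norm x \<le> norm y"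
  shows "ker N \<epsilon> x - ker N \<epsilon> y \<le> N * (norm y - norm x) * norm x powr (- N - 1)"
proof -
  let ?f = "\<lambda>r::real. (r\<^sup>2 + \<epsilon>\<^sup>2) powr (- (N / 2))"
  let ?f' = "\<lambda>r::real. - N * r * (r\<^sup>2 + \<epsilon>\<^sup>2) powr (- (N / 2) - 1)"
  have d: "(?f has_real_derivative ?f' r) (at r)" for r
  proof -
    have "((\<lambda>r. r\<^sup>2 + \<epsilon>\<^sup>2) has_real_derivative 2 * r) (at r)"
      by (auto intro!: derivative_eq_intros)
    from DERIV_fun_powr[OF this sq_pos[OF assms(1)], of "- (N / 2)"] show ?thesis by (simp add: mult_ac)
  qed
  have b: "- ?f' r \<le> N * norm x powr (- N - 1)" if "norm x \<le> r" for r
  proof -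
    have r: "0 < r" using that assms(3) zero_less_norm_iff[of x] by linarith
    have "r * (r\<^sup>2 + \<epsilon>\<^sup>2) powr (- (N / 2) - 1) \<le> r * (r\<^sup>2) powr (- (N / 2) - 1)"
      using r assms by (intro mult_left_mono powr_mono2') auto
    also have "(r\<^sup>2) powr (- (N / 2) - 1) = r powr (- N - 2)"
    proof -
      have "r\<^sup>2 = r powr 2" using r by simp
      then show ?thesis by (simp only: powr_powr) (simp add: algebra_simps)
    qed
    also have "r * r powr (- N - 2) = r powr (- N - 1)"
    proof -
      have "1 + (- N - 2) = - N - 1" by simp
      then show ?thesis using powr_mult_base[of r "- N - 2"] r by (simp only:)
    qed
    also have "\<dots> \<le> norm x powr (- N - 1)"
      using that assms by (intro powr_mono2') auto
    finally show ?thesis using assms by (simp add: mult_left_mono mult.assoc)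
  qed
  have "?f (norm x) - ?f (norm y) \<le> N * norm x powr (- N - 1) * (norm y - norm x)"
  proof (cases "norm x = norm y")
    case False
    then have "norm x < norm y" using assms by simp
    from MVT2[OF this, of ?f ?f'] d obtain z where z: "norm x < z" "z < norm y"
      "?f (norm y) - ?f (norm x) = (norm y - norm x) * ?f' z" by blast
    have "?f (norm x) - ?f (norm y) = (norm y - norm x) * (- ?f' z)" using z(3) by linarith
    also have "\<dots> \<le> (norm y - norm x) * (N * norm x powr (- N - 1))"
      using b[of z] z assms by (intro mult_left_mono) auto
    finally show ?thesis by (simp add: mult.commute)
  qed simp
  then show ?thesis by (simp add: ker_def mult_ac)
qed

text \<open>Here the mean value theorem is applied in the squared norm, because a reflection changes
  the squared distance by an explicit product (\<open>norm_refl_at_sq\<close>). The constant is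
  uniform in \<epsilon> up to 1.\<close>

lemma ker_diff_lower:
  fixes x y :: "'a::euclidean_space"
  assumes "0 < \<epsilon>" "\<epsilon> \<le> 1" "0 \<le> N" "norm x \<le> norm y" "norm y \<le> R"
  shows "N / 2 * (R\<^sup>2 + 1) powr (- (N / 2) - 1) * ((norm y)\<^sup>2 - (norm x)\<^sup>2) \<le> ker N \<epsilon> x - ker N \<epsilon> y"
proof -
  let ?f = "\<lambda>r::real. (r + \<epsilon>\<^sup>2) powr (- (N / 2))"
  let ?f' = "\<lambda>r::real. - (N / 2) * (r + \<epsilon>\<^sup>2) powr (- (N / 2) - 1)"
  have d: "(?f has_real_derivative ?f' r) (at r)" if "0 \<le> r" for r
  proof -
    have "((\<lambda>r. r + \<epsilon>\<^sup>2) has_real_derivative 1) (at r)"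
      by (auto intro!: derivative_eq_intros)
    moreover have "0 < r + \<epsilon>\<^sup>2" using that assms(1) zero_less_power[of \<epsilon> 2] by linarith
    ultimately show ?thesis using DERIV_fun_powr[of "\<lambda>r. r + \<epsilon>\<^sup>2" 1 r "- (N / 2)"] by simp
  qed
  show ?thesis
  proof (cases "norm x = norm y")
    case False
    then have "(norm x)\<^sup>2 < (norm y)\<^sup>2" using assms by (simp add: power_strict_mono)
    moreover have "(?f has_real_derivative ?f' r) (at r)" if "(norm x)\<^sup>2 \<le> r" for r
      using that order_trans[OF zero_le_power2[of "norm x"] that] by (intro d) auto
    ultimately obtain z where z: "(norm x)\<^sup>2 < z" "z < (norm y)\<^sup>2"
      "?f ((norm y)\<^sup>2) - ?f ((norm x)\<^sup>2) = ((norm y)\<^sup>2 - (norm x)\<^sup>2) * ?f' z"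
      using MVT2[of "(norm x)\<^sup>2" "(norm y)\<^sup>2" ?f ?f'] by blast
    have z0: "0 < z + \<epsilon>\<^sup>2" using z(1) zero_le_power2[of "norm x"] zero_less_power[OF assms(1), of 2] by linarith
    have "z + \<epsilon>\<^sup>2 \<le> R\<^sup>2 + 1"
    proof -
      have "(norm y)\<^sup>2 \<le> R\<^sup>2" using assms by (intro power_mono) auto
      moreover have "\<epsilon>\<^sup>2 \<le> 1" using assms by (simp add: power_le_one)
      ultimately show ?thesis using z(2) by linarith
    qed
    then have "(R\<^sup>2 + 1) powr (- (N / 2) - 1) \<le> (z + \<epsilon>\<^sup>2) powr (- (N / 2) - 1)"
      using z0 assms by (intro powr_mono2') auto
    then have "N / 2 * (R\<^sup>2 + 1) powr (- (N / 2) - 1) * ((norm y)\<^sup>2 - (norm x)\<^sup>2) \<le>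
        N / 2 * (z + \<epsilon>\<^sup>2) powr (- (N / 2) - 1) * ((norm y)\<^sup>2 - (norm x)\<^sup>2)"
      using z assms by (intro mult_right_mono mult_left_mono) auto
    also have "\<dots> = ?f ((norm x)\<^sup>2) - ?f ((norm y)\<^sup>2)" using z(3) by (simp add: algebra_simps)
    finally show ?thesis by (simp add: ker_def)
  qed (simp add: ker_def)
qed

lemma integrable_ker:
  assumes "0 < \<epsilon>" "real DIM('a::euclidean_space) < N"
  shows "integrable lborel (ker N \<epsilon> :: 'a \<Rightarrow> real)"
proof (rule integrableI_bounded)
  have N: "0 \<le> N" using assms by linarith
  let ?A = "\<lambda>x::'a. ennreal (\<epsilon> powr - N) * indicator (ball 0 1) x"
  let ?B = "\<lambda>x::'a. ennreal (norm x powr (- N)) * indicator {x. 1 \<le> norm x} x"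
  have A: "(\<integral>\<^sup>+x. ?A x \<partial>lborel) < \<infinity>"
  proof -
    have "(\<integral>\<^sup>+x. ?A x \<partial>lborel) = ennreal (\<epsilon> powr - N) * emeasure lborel (ball (0::'a) 1)"
      by (rule nn_integral_cmult_indicator) simp
    also have "\<dots> < \<infinity>"
      using emeasure_lborel_ball_finite[of "0::'a" 1] by (simp add: ennreal_mult_less_top)
    finally show ?thesis .
  qed
  have "(\<integral>\<^sup>+x. ennreal (norm (ker N \<epsilon> (x::'a))) \<partial>lborel) \<le> (\<integral>\<^sup>+x. ?A x + ?B x \<partial>lborel)"
  proof (rule nn_integral_mono)
    fix x :: 'a
    show "ennreal (norm (ker N \<epsilon> x)) \<le> ?A x + ?B x"
    proof (cases "norm x < 1")
      case True
      have "ennreal (norm (ker N \<epsilon> x)) \<le> ennreal (\<epsilon> powr - N)"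
        using ker_le_eps[OF assms(1) N, of x] ker_pos[OF assms(1), of N x] by (intro ennreal_leI) auto
      then show ?thesis using True by (simp add: indicator_def)
    next
      case False
      then have "x \<noteq> 0" by auto
      have "ennreal (norm (ker N \<epsilon> x)) \<le> ennreal (norm x powr - N)"
        using ker_le_powr[OF assms(1) N \<open>x \<noteq> 0\<close>] ker_pos[OF assms(1), of N x] by (intro ennreal_leI) auto
      then show ?thesis using False by (simp add: indicator_def)
    qed
  qed
  also have "\<dots> = (\<integral>\<^sup>+x. ?A x \<partial>lborel) + (\<integral>\<^sup>+x. ?B x \<partial>lborel)"
    by (rule nn_integral_add) measurable
  also have "\<dots> < \<infinity>"
  proof -
    have B: "(\<integral>\<^sup>+x. ?B x \<partial>lborel) < \<infinity>"
      using assms(2) nn_integral_norm_powr_outside[where 'a='a and N=N] by blast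
    show ?thesis using A B by simp
  qed
  finally show "(\<integral>\<^sup>+x. ennreal (norm (ker N \<epsilon> (x::'a))) \<partial>lborel) < \<infinity>" .
qed measurable

text \<open>The derivative of \<open>ker N \<epsilon>\<close> along e. What matters later is that it
  is odd and, for fixed \<epsilon>, bounded and integrable.\<close>

definition dker :: "real \<Rightarrow> real \<Rightarrow> 'a::euclidean_space \<Rightarrow> 'a \<Rightarrow> real" where
  "dker N \<epsilon> e x = - N * (x \<bullet> e) * ((norm x)\<^sup>2 + \<epsilon>\<^sup>2) powr (- (N / 2) - 1)"

lemma dker_minus [simp]: "dker N \<epsilon> e (- x) = - dker N \<epsilon> e x"
  by (simp add: dker_def)

lemma dker_measurable [measurable]: "dker N \<epsilon> e \<in> borel_measurable borel"
  unfolding dker_def[abs_def] by measurable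

lemma continuous_dker: "0 < \<epsilon> \<Longrightarrow> continuous_on A (dker N \<epsilon> e)"
  unfolding dker_def[abs_def]
  by (intro continuous_intros ballI) (simp add: sq_pos less_imp_neq[symmetric])

lemma ker_has_derivative_line:
  fixes x e :: "'a::euclidean_space"
  assumes "0 < \<epsilon>" "norm e = 1"
  shows "((\<lambda>s. ker N \<epsilon> (x + s *\<^sub>R e)) has_real_derivative dker N \<epsilon> e (x + s *\<^sub>R e)) (at s within S)"
proof -
  have ee: "e \<bullet> e = 1" using assms(2) by (simp add: dot_square_norm)
  have "((\<lambda>s. x \<bullet> x + 2 * s * (x \<bullet> e) + s\<^sup>2 + \<epsilon>\<^sup>2) has_real_derivative 2 * ((x + s *\<^sub>R e) \<bullet> e)) (at s within S)"
    using ee by (auto intro!: derivative_eq_intros simp: inner_add_left)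
  moreover have "x \<bullet> x + 2 * s * (x \<bullet> e) + s\<^sup>2 = (norm (x + s *\<^sub>R e))\<^sup>2" for s
    using ee unfolding power2_norm_eq_inner
    by (simp add: inner_add_left inner_add_right inner_commute power2_eq_square algebra_simps)
  ultimately have "((\<lambda>s. (norm (x + s *\<^sub>R e))\<^sup>2 + \<epsilon>\<^sup>2) has_real_derivative 2 * ((x + s *\<^sub>R e) \<bullet> e)) (at s within S)"
    by simp
  moreover have "((\<lambda>z. z powr (- (N / 2))) has_real_derivative (- (N / 2)) * ((norm (x + s *\<^sub>R e))\<^sup>2 + \<epsilon>\<^sup>2) powr (- (N / 2) - 1))
      (at ((norm (x + s *\<^sub>R e))\<^sup>2 + \<epsilon>\<^sup>2))"
    using has_real_derivative_powr[OF sq_pos[OF assms(1), of "norm (x + s *\<^sub>R e)"], of "- (N / 2)"] by simp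
  ultimately have "((\<lambda>s. ((norm (x + s *\<^sub>R e))\<^sup>2 + \<epsilon>\<^sup>2) powr (- (N / 2))) has_real_derivative
      (- (N / 2)) * ((norm (x + s *\<^sub>R e))\<^sup>2 + \<epsilon>\<^sup>2) powr (- (N / 2) - 1) * (2 * ((x + s *\<^sub>R e) \<bullet> e))) (at s within S)"
    by (rule DERIV_chain2[rotated])
  then show ?thesis by (simp add: ker_def dker_def mult_ac)
qed

lemma abs_dker_le:
  assumes "0 < \<epsilon>" "norm e = 1" "0 \<le> N"
  shows "\<bar>dker N \<epsilon> e x\<bar> \<le> N * ker (N + 1) \<epsilon> x"
proof -
  let ?z = "(norm x)\<^sup>2 + \<epsilon>\<^sup>2"
  have z: "0 < ?z" by (rule sq_pos[OF assms(1)])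
  have "\<bar>x \<bullet> e\<bar> \<le> norm x" using Cauchy_Schwarz_ineq2[of x e] assms by simp
  also have "\<dots> \<le> sqrt ?z" by (rule real_le_rsqrt) simp
  also have "sqrt ?z = ?z powr (1 / 2)" using z by (simp add: powr_half_sqrt)
  finally have "\<bar>dker N \<epsilon> e x\<bar> \<le> N * (?z powr (1 / 2)) * ?z powr (- (N / 2) - 1)"
    unfolding dker_def abs_mult using assms by (intro mult_mono) auto
  also have "\<dots> = N * ker (N + 1) \<epsilon> x"
  proof -
    have "1 / 2 + (- (N / 2) - 1) = - ((N + 1) / 2)" by (simp add: field_simps)
    then have "?z powr (1 / 2) * ?z powr (- (N / 2) - 1) = ?z powr (- ((N + 1) / 2))"
      by (simp only: powr_add[symmetric])
    then show ?thesis by (simp only: ker_def mult.assoc)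
  qed
  finally show ?thesis .
qed

lemma integrable_dker:
  assumes "0 < \<epsilon>" "norm e = 1" "real DIM('a::euclidean_space) < N"
  shows "integrable lborel (dker N \<epsilon> e :: 'a \<Rightarrow> real)"
proof (rule Bochner_Integration.integrable_bound)
  show "integrable lborel (\<lambda>x::'a. N * ker (N + 1) \<epsilon> x)"
    using integrable_ker[of \<epsilon> "N + 1", where 'a = 'a] assms by auto
  show "AE x in lborel. norm (dker N \<epsilon> e x) \<le> norm (N * ker (N + 1) \<epsilon> x)"
    using abs_dker_le[of \<epsilon> e N] assms by (auto intro!: AE_I2 order_trans[OF _ abs_ge_self])
qed simp

text \<open>Writing the ratio of the two kernels as the integral over \<theta> in (0,1) of the
  indicator that \<theta> is below it shows that the smooth integral is an average of sharply
  truncated integrals at radii \<epsilon> * \<sigma> \<theta>. Convergence then follows by dominated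
  convergence from the existence of the principal value alone; no regularity of F is
  involved.\<close>

lemma tendsto_integral_ker:
  fixes F :: "'a::euclidean_space \<Rightarrow> real"
  assumes N: "0 < N" and [measurable]: "F \<in> borel_measurable borel"
    and int: "\<And>\<epsilon>. 0 < \<epsilon> \<Longrightarrow> set_integrable lborel {y. \<epsilon> \<le> dist x y} (\<lambda>y. F y / norm (x - y) powr N)"
    and lim: "((\<lambda>\<epsilon>. LINT y:{y. \<epsilon> \<le> dist x y}|lborel. F y / norm (x - y) powr N) \<longlongrightarrow> L) (at_right 0)"
    and kint: "\<And>\<epsilon>. 0 < \<epsilon> \<Longrightarrow> integrable lborel (\<lambda>y. F y * ker N \<epsilon> (x - y))"
    and e: "\<And>n. 0 < e n" "e \<longlonglongrightarrow> 0"
  shows "(\<lambda>n. \<integral>y. F y * ker N (e n) (x - y) \<partial>lborel) \<longlonglongrightarrow> L"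
proof -
  \<comment> \<open>Solves (r^2 / (r^2 + 1))^(N/2) = \<theta> for r, the case \<epsilon> = 1 of the
    level radius.\<close>
  define \<sigma> where "\<sigma> \<theta> = sqrt (\<theta> powr (2 / N) / (1 - \<theta> powr (2 / N)))" for \<theta> :: real
  define \<Psi> where "\<Psi> \<epsilon> = (LINT y:{y. \<epsilon> \<le> dist x y}|lborel. F y / norm (x - y) powr N)" for \<epsilon>
  have [measurable]: "\<sigma> \<in> borel_measurable borel" unfolding \<sigma>_def by measurable
  have \<sigma>: "0 < \<sigma> \<theta>" if "0 < \<theta>" "\<theta> < 1" for \<theta>
    using that N powr_less_mono2[of "2 / N" \<theta> 1] by (simp add: \<sigma>_def)
  \<comment> \<open>The ratio of the smooth kernel to the singular one is a radially increasing function with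
     values in (0,1); the sharp cutoffs at radius \<open>\<epsilon> * \<sigma> \<theta>\<close> are its superlevel sets.\<close>
  have level: "\<theta> \<le> ker N \<epsilon> (x - y) * norm (x - y) powr N \<longleftrightarrow> \<epsilon> * \<sigma> \<theta> \<le> dist x y"
    if "0 < \<theta>" "\<theta> < 1" "x \<noteq> y" "0 < \<epsilon>" for \<theta> \<epsilon> y
  proof -
    let ?r = "norm (x - y)" and ?q = "\<theta> powr (2 / N)"
    have r: "0 < ?r" using that by simp
    have q: "0 < ?q" "?q < 1" using that N powr_less_mono2[of "2 / N" \<theta> 1] by auto
    have z: "0 < ?r\<^sup>2 + \<epsilon>\<^sup>2" by (rule sq_pos) fact
    let ?w = "?r\<^sup>2 / (?r\<^sup>2 + \<epsilon>\<^sup>2)"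
    have w: "0 < ?w" using r z by simp
    have "?r powr N = (?r powr 2) powr (N / 2)" by (simp only: powr_powr) simp
    also have "?r powr 2 = ?r\<^sup>2" using r by simp
    finally have "ker N \<epsilon> (x - y) * ?r powr N = ?w powr (N / 2)"
      using r z by (simp add: ker_def powr_divide powr_minus field_simps)
    moreover have "\<theta> = ?q powr (N / 2)" using that N by (simp add: powr_powr)
    moreover have "?q powr (N / 2) \<le> ?w powr (N / 2) \<longleftrightarrow> ?q \<le> ?w"
      using powr_mono2[of "N / 2" ?q ?w] powr_less_mono2[of "N / 2" ?w ?q] q w N by (cases "?q \<le> ?w") auto
    ultimately have "\<theta> \<le> ker N \<epsilon> (x - y) * ?r powr N \<longleftrightarrow> ?q \<le> ?w"
      by simp
    also have "\<dots> \<longleftrightarrow> ?q * \<epsilon>\<^sup>2 \<le> (1 - ?q) * ?r\<^sup>2"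
      using z by (simp add: pos_le_divide_eq algebra_simps)
    also have "\<dots> \<longleftrightarrow> \<epsilon>\<^sup>2 * (?q / (1 - ?q)) \<le> ?r\<^sup>2"
      using q by (simp add: field_simps)
    also have "\<dots> \<longleftrightarrow> (\<epsilon> * \<sigma> \<theta>)\<^sup>2 \<le> ?r\<^sup>2"
      using q by (simp add: \<sigma>_def power_mult_distrib)
    also have "\<dots> \<longleftrightarrow> \<epsilon> * \<sigma> \<theta> \<le> ?r"
      using r that \<sigma>[of \<theta>] by (simp add: power2_le_iff_abs_le abs_mult)
    finally show ?thesis by (simp add: dist_norm)
  qed
  have kr: "0 \<le> ker N \<epsilon> (x - y) * norm (x - y) powr N \<and> ker N \<epsilon> (x - y) * norm (x - y) powr N \<le> 1" if "0 < \<epsilon>" for \<epsilon> y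
  proof (cases "x = y")
    case False
    have "ker N \<epsilon> (x - y) * norm (x - y) powr N \<le> norm (x - y) powr (- N) * norm (x - y) powr N"
      using ker_le_powr[of \<epsilon> N "x - y"] that N False by (intro mult_right_mono) auto
    also have "\<dots> = 1" using False by (simp flip: powr_add)
    finally show ?thesis using ker_pos[OF that, of N "x - y"] by auto
  qed simp
  have rep: "(\<integral>y. F y * ker N \<epsilon> (x - y) \<partial>lborel) = (LINT \<theta>:{0<..<1}|lborel. \<Psi> (\<epsilon> * \<sigma> \<theta>))" if \<epsilon>: "0 < \<epsilon>" for \<epsilon>
  proof -
    let ?H = "\<lambda>(\<theta>, y). indicator {0<..<1::real} \<theta> * (indicator {y. \<epsilon> * \<sigma> \<theta> \<le> dist x y} y * (F y / norm (x - y) powr N))"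
    have eqy: "indicator {0<..<1} \<theta> * (indicator {y. \<epsilon> * \<sigma> \<theta> \<le> dist x y} y * (F y / norm (x - y) powr N))
        = indicator ({0<..<1} \<inter> {..ker N \<epsilon> (x - y) * norm (x - y) powr N}) \<theta> * (F y / norm (x - y) powr N)" if "x \<noteq> y" for \<theta> y
      using level[of \<theta> y \<epsilon>] \<epsilon> that by (auto simp: indicator_def)
    have meas: "measure lborel ({0<..<1} \<inter> {..m}) = m" "emeasure lborel ({0<..<1} \<inter> {..m}) = ennreal m" if "0 \<le> m" "m \<le> 1" for m :: real
    proof -
      have "({0<..<1} \<inter> {..m}) = (if m < 1 then {0<..m} else {0<..<1})" using that by auto
      then show "measure lborel ({0<..<1} \<inter> {..m}) = m" "emeasure lborel ({0<..<1} \<inter> {..m}) = ennreal m"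
        using that by auto
    qed
    have "integrable (lborel \<Otimes>\<^sub>M lborel) (\<lambda>(y, \<theta>). indicator {0<..<1::real} \<theta> * (indicator {y. \<epsilon> * \<sigma> \<theta> \<le> dist x y} y * (F y / norm (x - y) powr N)))"
    proof (rule lborel_pair.Fubini_integrable)
      have ne: "AE y in lborel. x \<noteq> y" using AE_lborel_singleton[of x] by auto
      show "integrable lborel (\<lambda>y. \<integral>\<theta>. norm (case (y, \<theta>) of (y, \<theta>) \<Rightarrow> indicator {0<..<1} \<theta> * (indicator {y. \<epsilon> * \<sigma> \<theta> \<le> dist x y} y * (F y / norm (x - y) powr N))) \<partial>lborel)"
      proof (rule integrable_cong_AE_imp)
        show "integrable lborel (\<lambda>y. \<bar>F y * ker N \<epsilon> (x - y)\<bar>)" using kint[OF \<epsilon>] by simp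
        show "AE y in lborel. \<bar>F y * ker N \<epsilon> (x - y)\<bar> = (\<integral>\<theta>. norm (case (y, \<theta>) of (y, \<theta>) \<Rightarrow> indicator {0<..<1} \<theta> * (indicator {y. \<epsilon> * \<sigma> \<theta> \<le> dist x y} y * (F y / norm (x - y) powr N))) \<partial>lborel)"
          using ne
        proof eventually_elim
          case (elim y)
          let ?S = "{0<..<1} \<inter> {..ker N \<epsilon> (x - y) * norm (x - y) powr N}"
          have "(\<integral>\<theta>. norm (case (y, \<theta>) of (y, \<theta>) \<Rightarrow> indicator {0<..<1} \<theta> * (indicator {y. \<epsilon> * \<sigma> \<theta> \<le> dist x y} y * (F y / norm (x - y) powr N))) \<partial>lborel)
             = (\<integral>\<theta>. indicator ?S \<theta> * \<bar>F y / norm (x - y) powr N\<bar> \<partial>lborel)"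
            by (rule Bochner_Integration.integral_cong) (simp_all only: eqy[OF elim] prod.case real_norm_def abs_mult abs_indicator)
          also have "\<dots> = ker N \<epsilon> (x - y) * norm (x - y) powr N * \<bar>F y / norm (x - y) powr N\<bar>"
            using meas[of "ker N \<epsilon> (x - y) * norm (x - y) powr N"] kr[OF \<epsilon>, of y] by simp
          also have "\<dots> = \<bar>F y * ker N \<epsilon> (x - y)\<bar>"
            using elim ker_pos[OF \<epsilon>, of N "x - y"] by (simp add: abs_mult)
          finally show ?case by simp
        qed
      qed measurable
      show "AE y in lborel. integrable lborel (\<lambda>\<theta>. case (y, \<theta>) of (y, \<theta>) \<Rightarrow> indicator {0<..<1} \<theta> * (indicator {y. \<epsilon> * \<sigma> \<theta> \<le> dist x y} y * (F y / norm (x - y) powr N)))"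
        using ne
      proof eventually_elim
        case (elim y)
        have "emeasure lborel ({0<..<1} \<inter> {..ker N \<epsilon> (x - y) * norm (x - y) powr N}) < \<infinity>"
          using meas(2)[of "ker N \<epsilon> (x - y) * norm (x - y) powr N"] kr[OF \<epsilon>, of y] by simp
        then show ?case unfolding prod.case eqy[OF elim]
          by (intro integrable_mult_left integrable_real_indicator) simp_all
      qed
    qed measurable
    then have "(\<integral>\<theta>. (\<integral>y. indicator {0<..<1} \<theta> * (indicator {y. \<epsilon> * \<sigma> \<theta> \<le> dist x y} y * (F y / norm (x - y) powr N)) \<partial>lborel) \<partial>lborel)
      = (\<integral>y. (\<integral>\<theta>. indicator {0<..<1} \<theta> * (indicator {y. \<epsilon> * \<sigma> \<theta> \<le> dist x y} y * (F y / norm (x - y) powr N)) \<partial>lborel) \<partial>lborel)"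
      by (rule lborel_pair.Fubini_integral)
    also have "\<dots> = (\<integral>y. F y * ker N \<epsilon> (x - y) \<partial>lborel)"
    proof (rule integral_cong_AE)
      have ne: "AE y in lborel. x \<noteq> y" using AE_lborel_singleton[of x] by auto
      then show "AE y in lborel. (\<integral>\<theta>. indicator {0<..<1} \<theta> * (indicator {y. \<epsilon> * \<sigma> \<theta> \<le> dist x y} y * (F y / norm (x - y) powr N)) \<partial>lborel) = F y * ker N \<epsilon> (x - y)"
      proof eventually_elim
        case (elim y)
        show ?case unfolding eqy[OF elim]
          using meas[of "ker N \<epsilon> (x - y) * norm (x - y) powr N"] kr[OF \<epsilon>, of y] elim by simp
      qed
    qed measurable
    finally show ?thesis
      unfolding set_lebesgue_integral_def \<Psi>_def real_scaleR_def by (simp only: integral_mult_right_zero)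
  qed
  have "(\<Psi> \<longlongrightarrow> L) (at_right 0)" using lim by (simp add: \<Psi>_def[abs_def])
  have [measurable]: "\<Psi> \<in> borel_measurable borel" unfolding \<Psi>_def[abs_def] set_lebesgue_integral_def by measurable
  \<comment> \<open>The dominating constant: near 0 the truncated integrals are close to their
    limit, and for larger radii they are bounded by the absolute integral outside one fixed
    radius.\<close>
  obtain B where B: "\<And>\<rho>. 0 < \<rho> \<Longrightarrow> \<bar>\<Psi> \<rho>\<bar> \<le> B"
  proof -
    have "eventually (\<lambda>\<rho>. dist (\<Psi> \<rho>) L < 1) (at_right 0)"
      using \<open>(\<Psi> \<longlongrightarrow> L) (at_right 0)\<close> by (rule tendstoD) simp
    then obtain \<rho>0 where \<rho>0: "0 < \<rho>0" "\<And>\<rho>. 0 < \<rho> \<Longrightarrow> \<rho> < \<rho>0 \<Longrightarrow> dist (\<Psi> \<rho>) L < 1"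
      by (auto simp: eventually_at_right_field)
    define B1 where "B1 = (LINT y:{y. \<rho>0 \<le> dist x y}|lborel. \<bar>F y / norm (x - y) powr N\<bar>)"
    have "\<bar>\<Psi> \<rho>\<bar> \<le> max B1 (\<bar>L\<bar> + 1)" if "0 < \<rho>" for \<rho>
    proof (cases "\<rho> < \<rho>0")
      case True
      then show ?thesis using \<rho>0(2)[of \<rho>] that by (auto simp: dist_real_def)
    next
      case False
      have "\<bar>\<Psi> \<rho>\<bar> \<le> (LINT y:{y. \<rho> \<le> dist x y}|lborel. \<bar>F y / norm (x - y) powr N\<bar>)"
        unfolding \<Psi>_def set_lebesgue_integral_def by (rule order_trans[OF integral_abs_bound]) (simp add: abs_mult)
      also have "\<dots> \<le> B1" unfolding B1_def set_lebesgue_integral_def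
      proof (rule integral_mono)
        have abs: "integrable lborel (\<lambda>y. indicator {y. \<rho> \<le> dist x y} y *\<^sub>R \<bar>F y / norm (x - y) powr N\<bar>)" if "0 < \<rho>" for \<rho>
          using integrable_abs[OF int[OF that, unfolded set_integrable_def]] by (simp add: abs_mult)
        show "integrable lborel (\<lambda>y. indicator {y. \<rho> \<le> dist x y} y *\<^sub>R \<bar>F y / norm (x - y) powr N\<bar>)"
          "integrable lborel (\<lambda>y. indicator {y. \<rho>0 \<le> dist x y} y *\<^sub>R \<bar>F y / norm (x - y) powr N\<bar>)"
          using abs[OF that] abs[OF \<rho>0(1)] by auto
      qed (use False in \<open>auto simp: indicator_def\<close>)
      finally show ?thesis by simp
    qed
    then show ?thesis using that by blast
  qed
  have "(\<lambda>n. LINT \<theta>:{0<..<1}|lborel. \<Psi> (e n * \<sigma> \<theta>)) \<longlonglongrightarrow> (LINT \<theta>:{0<..<1::real}|lborel. L)"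
    unfolding set_lebesgue_integral_def
  proof (rule integral_dominated_convergence)
    show "integrable lborel (\<lambda>\<theta>::real. indicator {0<..<1} \<theta> * B)" by simp
    show "AE \<theta> in lborel. (\<lambda>n. indicator {0<..<1} \<theta> *\<^sub>R \<Psi> (e n * \<sigma> \<theta>)) \<longlonglongrightarrow> indicator {0<..<1} \<theta> *\<^sub>R L"
    proof (rule AE_I2)
      fix \<theta> :: real
      show "(\<lambda>n. indicator {0<..<1} \<theta> *\<^sub>R \<Psi> (e n * \<sigma> \<theta>)) \<longlonglongrightarrow> indicator {0<..<1} \<theta> *\<^sub>R L"
      proof (cases "\<theta> \<in> {0<..<1}")
        case True
        have "(\<lambda>n. e n * \<sigma> \<theta>) \<longlonglongrightarrow> 0" using e(2) by (rule tendsto_mult_left_zero)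
        then have "filterlim (\<lambda>n. e n * \<sigma> \<theta>) (at_right 0) sequentially"
          using e(1) e(1)[THEN less_imp_neq, symmetric] \<sigma>[of \<theta>] True
          by (auto simp: filterlim_at intro!: always_eventually)
        from filterlim_compose[OF \<open>(\<Psi> \<longlongrightarrow> L) (at_right 0)\<close> this] show ?thesis
          using True by simp
      qed simp
    qed
    show "AE \<theta> in lborel. norm (indicator {0<..<1} \<theta> *\<^sub>R \<Psi> (e n * \<sigma> \<theta>)) \<le> indicator {0<..<1} \<theta> * B" for n
      using B e(1)[of n] \<sigma> by (intro AE_I2) (auto simp: indicator_def)
  qed measurable
  moreover have "(LINT \<theta>:{0<..<1::real}|lborel. L) = L" by (simp add: set_lebesgue_integral_def)
  ultimately show ?thesis by (simp only: rep[OF e(1)])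
qed

section \<open>Solutions and maximum principles\<close>

lemma integral_pos_of_open:
  fixes f :: "'a::euclidean_space \<Rightarrow> real"
  assumes f: "integrable lborel f" "\<And>x. 0 \<le> f x" and A: "open A" "a \<in> A" "\<And>x. x \<in> A \<Longrightarrow> 0 < f x"
  shows "0 < (\<integral>x. f x \<partial>lborel)"
proof (rule ccontr)
  assume "\<not> ?thesis"
  moreover have "0 \<le> (\<integral>x. f x \<partial>lborel)" using f(2) by simp
  ultimately have "(\<integral>x. f x \<partial>lborel) = 0" by linarith
  then have "AE x in lborel. f x = 0"
    using integral_nonneg_eq_0_iff_AE[OF f(1)] f(2) by simp
  then have "AE x in lborel. x \<notin> A"
    by eventually_elim (use A(3) in fastforce)
  moreover have "A \<in> sets lborel" using A(1) by simp
  ultimately have "A \<in> null_sets lborel" by (simp add: AE_iff_null_sets)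
  then have "negligible A" by (metis negligible_iff_null_sets null_sets_completionI)
  then show False using open_not_negligible[OF A(1)] A(2) by blast
qed

text \<open>The boundary hyperplane is null. Pairing each point with its mirror image allows signs
  to be compared pointwise on one side of the plane.\<close>

lemma integral_fold_halfspace:
  fixes f :: "'a::euclidean_space \<Rightarrow> real"
  assumes e: "norm e = 1" and f: "integrable lborel f"
  shows "integrable lborel (\<lambda>y. indicator {y. y \<bullet> e < c} y * (f y + f (refl_at e c y)))"
    and "(\<integral>y. f y \<partial>lborel) = (\<integral>y. indicator {y. y \<bullet> e < c} y * (f y + f (refl_at e c y)) \<partial>lborel)"
proof -
  have [measurable]: "f \<in> borel_measurable borel" using f by (simp add: borel_measurable_integrable)
  let ?S = "{y. y \<bullet> e < c}" and ?T = "{y. c < y \<bullet> e}"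
  have S: "integrable lborel (\<lambda>y. indicator ?S y * f y)" "integrable lborel (\<lambda>y. indicator ?T y * f y)"
    using f by (auto intro!: integrable_mult_indicator[where 'b = real, simplified real_scaleR_def])
  have R: "indicator ?T (refl_at e c y) = (indicator ?S y :: real)" for y
    using e by (auto simp: indicator_def refl_at_inner)
  have T: "integrable lborel (\<lambda>y. indicator ?S y * f (refl_at e c y))"
    "(\<integral>y. indicator ?S y * f (refl_at e c y) \<partial>lborel) = (\<integral>y. indicator ?T y * f y \<partial>lborel)"
    using integrable_refl_at[OF e S(2), of c] integral_refl_at[OF e, of "\<lambda>y. indicator ?T y * f y" c]
    by (simp_all add: R)
  show "integrable lborel (\<lambda>y. indicator ?S y * (f y + f (refl_at e c y)))"
    unfolding distrib_left by (intro Bochner_Integration.integrable_add S T)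
  have "AE y in lborel. y \<bullet> e \<noteq> c"
  proof -
    have "e \<noteq> 0" using e by auto
    then have "negligible {y. e \<bullet> y = c}" by (rule negligible_hyperplane[OF disjI1])
    then have "{y. y \<bullet> e = c} \<in> null_sets lebesgue"
      by (simp add: inner_commute negligible_iff_null_sets)
    moreover have "{y. y \<bullet> e = c} \<in> sets borel" by measurable
    ultimately have "{y. y \<bullet> e = c} \<in> null_sets lborel"
      by (simp add: null_sets_def)
    then show ?thesis by (rule AE_not_in[THEN AE_mp]) auto
  qed
  then have "(\<integral>y. f y \<partial>lborel) = (\<integral>y. indicator ?S y * f y + indicator ?T y * f y \<partial>lborel)"
    by (intro integral_cong_AE) (auto simp: indicator_def elim!: eventually_mono)
  also have "\<dots> = (\<integral>y. indicator ?S y * (f y + f (refl_at e c y)) \<partial>lborel)"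
    unfolding distrib_left by (simp add: Bochner_Integration.integral_add S T)
  finally show "(\<integral>y. f y \<partial>lborel) = (\<integral>y. indicator ?S y * (f y + f (refl_at e c y)) \<partial>lborel)" .
qed

text \<open>The product is positive for two points strictly on the same side. It yields both the
  order of the two kernel values and, with \<open>ker_diff_lower\<close>, a quantitative gap between
  them.\<close>

lemma norm_refl_at_sq:
  assumes "norm e = 1"
  shows "(norm (x - refl_at e c y))\<^sup>2 = (norm (x - y))\<^sup>2 + 4 * (c - x \<bullet> e) * (c - y \<bullet> e)"
proof -
  have ee: "e \<bullet> e = 1" using assms by (simp add: dot_square_norm)
  have eq: "(norm (v - k *\<^sub>R e))\<^sup>2 = (norm v)\<^sup>2 - 2 * k * (v \<bullet> e) + k\<^sup>2" for v k
    using ee unfolding power2_norm_eq_inner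
    by (simp add: inner_diff_left inner_diff_right inner_commute power2_eq_square algebra_simps)
  have "x - refl_at e c y = (x - y) - (2 * (c - y \<bullet> e)) *\<^sub>R e" by (simp add: refl_at_def)
  then have "(norm (x - refl_at e c y))\<^sup>2
      = (norm (x - y))\<^sup>2 - 2 * (2 * (c - y \<bullet> e)) * ((x - y) \<bullet> e) + (2 * (c - y \<bullet> e))\<^sup>2"
    by (simp only: eq)
  also have "\<dots> = (norm (x - y))\<^sup>2 + 4 * (c - x \<bullet> e) * (c - y \<bullet> e)"
    by (simp add: inner_diff_left power2_eq_square algebra_simps)
  finally show ?thesis .
qed

lemma norm_refl_at_le:
  assumes "norm e = 1" "x \<bullet> e \<le> c" "y \<bullet> e \<le> c"
  shows "norm (x - y) \<le> norm (x - refl_at e c y)"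
proof -
  have "(norm (x - y))\<^sup>2 \<le> (norm (x - refl_at e c y))\<^sup>2"
    unfolding norm_refl_at_sq[OF assms(1)] using assms by simp
  then show ?thesis by (simp add: power2_le_iff_abs_le)
qed

lemma integrable_mult_ker:
  fixes \<Omega> :: "'a::euclidean_space \<Rightarrow> real"
  assumes "0 < \<epsilon>" "real DIM('a) < N" and [measurable]: "\<Omega> \<in> borel_measurable borel" and "\<And>y. \<bar>\<Omega> y\<bar> \<le> B"
  shows "integrable lborel (\<lambda>y. \<Omega> y * ker N \<epsilon> (x - y))"
proof (rule Bochner_Integration.integrable_bound)
  have "integrable lborel (\<lambda>y::'a. ker N \<epsilon> (- y + x))"
    using integrable_lborel_uminus[OF integrable_lborel_translate[OF integrable_ker[OF assms(1,2)], of x]] .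
  then show "integrable lborel (\<lambda>y. B * ker N \<epsilon> (x - y))" by (simp add: add.commute)
  show "AE y in lborel. norm (\<Omega> y * ker N \<epsilon> (x - y)) \<le> norm (B * ker N \<epsilon> (x - y))"
    using assms(4) ker_pos[OF assms(1)]
    by (auto intro!: AE_I2 mult_right_mono order_trans[OF assms(4) abs_ge_self] simp: abs_mult less_imp_le)
qed measurable

section \<open>The solution, its regularized operators and the maximum principles\<close>

locale frac_p_solution =
  fixes u :: "'a::euclidean_space \<Rightarrow> real" and g :: "real \<Rightarrow> real" and s p C s0 :: real
  assumes s_pos: "0 < s" and s_less_1: "s < 1" and p_gt_1: "1 < p" and C_pos: "0 < C"
    and s0_pos: "0 < s0"
    and g_deriv: "\<And>t. 0 < t \<Longrightarrow> t < s0 \<Longrightarrow> \<exists>d. (g has_real_derivative d) (at t) \<and> d \<le> 0"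
    and u_C11: "u \<in> C11_loc"
    and u_pos: "\<And>x. 0 < u x"
    and u_eq: "\<And>x. frac_p_laplacian_eq C s p u x (g (u x))"
    and u_lim: "(u \<longlongrightarrow> 0) at_infinity"
begin

definition N :: real where "N = real DIM('a) + s * p"

lemma N_gt: "real DIM('a) < N" using s_pos p_gt_1 by (simp add: N_def)

lemma N_pos: "0 < N" using N_gt by (meson of_nat_0_le_iff order_le_less_trans)

lemma u_cont: "continuous_on A u"
proof -
  obtain Du where "\<And>x. (u has_derivative (\<lambda>h. Du x \<bullet> h)) (at x)"
    using u_C11 by (auto simp: C11_loc_def)
  from has_derivative_continuous[OF this] show ?thesis
    by (intro continuous_at_imp_continuous_on) auto
qed

lemma u_measurable [measurable]: "u \<in> borel_measurable borel"
  by (rule borel_measurable_continuous_onI) (rule u_cont)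

lemma u_small_outside:
  assumes "0 < t" obtains R where "0 < R" "\<And>x. R < norm x \<Longrightarrow> u x < t"
proof -
  have "eventually (\<lambda>x. dist (u x) 0 < t) at_infinity" using u_lim assms by (rule tendstoD)
  then obtain b where b: "\<And>x. b \<le> norm x \<Longrightarrow> dist (u x) 0 < t" unfolding eventually_at_infinity by blast
  show ?thesis
  proof (rule that[of "max b 1"])
    fix x :: 'a assume "max b 1 < norm x"
    then show "u x < t" using b[of x] by (auto simp: dist_real_def)
  qed simp
qed

definition umax :: real where "umax = (SUP x. u x)"

lemma u_bdd: "bdd_above (range u)"
proof -
  obtain R where R: "0 < R" "\<And>x. R < norm x \<Longrightarrow> u x < 1" using u_small_outside[of 1] by auto
  obtain z where "\<forall>y\<in>cball 0 R. u y \<le> u z"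
    using continuous_attains_sup[OF compact_cball _ u_cont, of 0 R] R(1) by auto
  then have B: "\<And>x. norm x \<le> R \<Longrightarrow> u x \<le> u z" by simp
  have "u x \<le> max (u z) 1" for x
    using R(2)[of x] B[of x] by (cases "norm x \<le> R") auto
  then show ?thesis by (auto simp: bdd_above_def)
qed

lemma u_le: "u x \<le> umax"
  unfolding umax_def using u_bdd by (rule cSUP_upper[rotated]) simp

lemma umax_pos: "0 < umax"
  using u_le[of 0] u_pos[of 0] by linarith

lemma abs_u_diff_le: "\<bar>u x - u y\<bar> \<le> umax"
  using u_le[of x] u_le[of y] u_pos[of x] u_pos[of y] by (auto simp: abs_if)

definition h :: "real \<Rightarrow> 'a \<Rightarrow> real" where
  "h \<epsilon> x = (\<integral>y. Gp p (u x - u y) * ker N \<epsilon> (x - y) \<partial>lborel)"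

lemma abs_Gp_u_le: "\<bar>a\<bar> \<le> umax \<Longrightarrow> \<bar>Gp p a\<bar> \<le> umax powr (p - 1)"
  unfolding abs_Gp using p_gt_1 by (intro powr_mono2) auto

lemma h_integrable:
  assumes "0 < \<epsilon>" shows "integrable lborel (\<lambda>y. Gp p (u x - u y) * ker N \<epsilon> (x - y))"
  using abs_Gp_u_le[OF abs_u_diff_le]
  by (intro integrable_mult_ker[OF assms N_gt, where B = "umax powr (p - 1)"]) auto

definition eps :: "nat \<Rightarrow> real" where "eps n = inverse (real (Suc n))"

lemma eps_pos: "0 < eps n" and eps_le_1: "eps n \<le> 1" and eps_lim: "eps \<longlonglongrightarrow> 0"
  using LIMSEQ_inverse_real_of_nat by (auto simp: eps_def[abs_def] field_simps)

text \<open>The quotient by \<open>C\<close> appears because \<open>h\<close> carries no normalizing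
  constant.\<close>

lemma h_lim: "(\<lambda>n. h (eps n) x) \<longlonglongrightarrow> g (u x) / C"
  unfolding h_def
proof (rule tendsto_integral_ker)
  have fk: "frac_kernel s p u x = (\<lambda>y. Gp p (u x - u y) / norm (x - y) powr N)"
    by (simp add: frac_kernel_def Gp_def N_def fun_eq_iff)
  note eq = u_eq[of x, unfolded frac_p_laplacian_eq_def]
  show "set_integrable lborel {y. \<epsilon> \<le> dist x y} (\<lambda>y. Gp p (u x - u y) / norm (x - y) powr N)" if "0 < \<epsilon>" for \<epsilon>
    using eq that by (simp add: fk)
  have "((\<lambda>\<epsilon>. C * (LINT y:{y. \<epsilon> \<le> dist x y}|lborel. Gp p (u x - u y) / norm (x - y) powr N) / C) \<longlongrightarrow> g (u x) / C) (at_right 0)"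
    using eq C_pos by (intro tendsto_divide tendsto_const) (auto simp: fk)
  then show "((\<lambda>\<epsilon>. LINT y:{y. \<epsilon> \<le> dist x y}|lborel. Gp p (u x - u y) / norm (x - y) powr N) \<longlongrightarrow> g (u x) / C) (at_right 0)"
    using C_pos by simp
qed (use N_pos eps_pos eps_lim h_integrable in auto)

lemma g_noninc:
  assumes "0 < a" "a \<le> b" "b < s0" shows "g b \<le> g a"
proof (rule DERIV_nonpos_imp_nonincreasing[OF assms(2)])
  fix t assume "a \<le> t" "t \<le> b"
  then show "\<exists>y. DERIV g t :> y \<and> y \<le> 0" using assms g_deriv[of t] by auto
qed

text \<open>Folding gives \<open>a y\<close> times the near kernel plus \<open>b y\<close> times the
  far kernel, and \<open>b\<close> alone has no sign. Regrouped, \<open>a\<close> multiplies a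
  nonnegative kernel difference, and \<open>a + b\<close> is a sum of two differences of
  \<open>Gp\<close> in each of which the same value u(y) or u(R y) is subtracted; hence its sign is
  that of u(R x) - u(x).\<close>

lemma h_refl_diff:
  fixes c \<epsilon> :: real and e x :: 'a
  assumes e: "norm e = 1" and \<epsilon>: "0 < \<epsilon>"
  defines "R \<equiv> refl_at e c"
  defines "a \<equiv> \<lambda>y. Gp p (u (R x) - u (R y)) - Gp p (u x - u y)"
    and "b \<equiv> \<lambda>y. Gp p (u (R x) - u y) - Gp p (u x - u (R y))"
  shows "integrable lborel (\<lambda>y. indicator {y. y \<bullet> e < c} y * (a y * (ker N \<epsilon> (x - y) - ker N \<epsilon> (x - R y)) + (a y + b y) * ker N \<epsilon> (x - R y)))"
    "h \<epsilon> (R x) - h \<epsilon> x = (\<integral>y. indicator {y. y \<bullet> e < c} y * (a y * (ker N \<epsilon> (x - y) - ker N \<epsilon> (x - R y)) + (a y + b y) * ker N \<epsilon> (x - R y)) \<partial>lborel)"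
proof -
  let ?f = "\<lambda>y. a y * ker N \<epsilon> (x - y)"
  have [measurable]: "R \<in> borel_measurable borel" by (simp add: R_def)
  have RR: "R (R y) = y" for y using e by (simp add: R_def)
  have i1: "integrable lborel (\<lambda>y. Gp p (u (R x) - u (R y)) * ker N \<epsilon> (x - y))"
    using abs_Gp_u_le[OF abs_u_diff_le]
    by (intro integrable_mult_ker[OF \<epsilon> N_gt, where B = "umax powr (p - 1)"]) auto
  have fi: "integrable lborel ?f"
    unfolding a_def left_diff_distrib by (intro Bochner_Integration.integrable_diff i1 h_integrable[OF \<epsilon>])
  have k: "ker N \<epsilon> (R x - R y) = ker N \<epsilon> (x - y)" for y
    by (rule ker_cong_norm) (simp add: R_def norm_refl_at_diff[OF e])
  have "h \<epsilon> (R x) = (\<integral>y. Gp p (u (R x) - u (R y)) * ker N \<epsilon> (R x - R y) \<partial>lborel)"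
    unfolding h_def R_def by (subst integral_refl_at[OF e, symmetric, where c = c]) auto
  then have "h \<epsilon> (R x) - h \<epsilon> x = (\<integral>y. ?f y \<partial>lborel)"
    unfolding h_def a_def left_diff_distrib k
    by (subst Bochner_Integration.integral_diff) (use i1 h_integrable[OF \<epsilon>] in auto)
  note diff = this
  have eq: "?f y + ?f (R y) = a y * (ker N \<epsilon> (x - y) - ker N \<epsilon> (x - R y)) + (a y + b y) * ker N \<epsilon> (x - R y)" for y
    by (simp add: a_def b_def RR algebra_simps)
  show "integrable lborel (\<lambda>y. indicator {y. y \<bullet> e < c} y * (a y * (ker N \<epsilon> (x - y) - ker N \<epsilon> (x - R y)) + (a y + b y) * ker N \<epsilon> (x - R y)))"
    using integral_fold_halfspace(1)[OF e fi, of c, folded R_def] by (simp only: eq)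
  show "h \<epsilon> (R x) - h \<epsilon> x = (\<integral>y. indicator {y. y \<bullet> e < c} y * (a y * (ker N \<epsilon> (x - y) - ker N \<epsilon> (x - R y)) + (a y + b y) * ker N \<epsilon> (x - R y)) \<partial>lborel)"
    using integral_fold_halfspace(2)[OF e fi, of c, folded R_def] diff by (simp only: eq)
qed

text \<open>The gap \<kappa> must not depend on \<epsilon>; only then does the strict inequality
  survive the limit.\<close>

lemma g_refl_less:
  assumes e: "norm e = 1" and \<kappa>: "0 < \<kappa>"
    and "\<And>\<epsilon>. 0 < \<epsilon> \<Longrightarrow> \<epsilon> \<le> 1 \<Longrightarrow> h \<epsilon> x' - h \<epsilon> x \<le> - \<kappa>"
  shows "g (u x') < g (u x)"
proof -
  have "(\<lambda>n. h (eps n) x' - h (eps n) x) \<longlonglongrightarrow> g (u x') / C - g (u x) / C"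
    by (intro tendsto_diff h_lim)
  then have "g (u x') / C - g (u x) / C \<le> - \<kappa>"
    by (rule LIMSEQ_le_const2) (use assms eps_pos eps_le_1 in auto)
  then have "g (u x') / C < g (u x) / C" using \<kappa> by linarith
  then show ?thesis using C_pos by (simp add: divide_strict_right_mono divide_less_cancel)
qed

lemma ker_ge_1:
  assumes "0 < \<epsilon>" "\<epsilon> \<le> 1" shows "ker N 1 x \<le> ker N \<epsilon> x"
proof -
  have "\<epsilon>\<^sup>2 \<le> 1" using assms by (simp add: power_le_one)
  then show ?thesis
    unfolding ker_def using N_pos sq_pos[OF assms(1), of "norm x"] by (intro powr_mono2') auto
qed

text \<open>In the decomposition of \<open>h_refl_diff\<close>, minimality makes \<open>a\<close>
  nonpositive, and the drop from u(x) to u(R x) makes \<open>a + b\<close> at most -2 g0 for every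
  y. The second term therefore supplies the strict inequality, without any condition on g.\<close>

lemma max_principle:
  assumes e: "norm e = 1" and x: "x \<bullet> e < c" "u (refl_at e c x) < u x"
    and min: "\<And>y. y \<bullet> e < c \<Longrightarrow> u (refl_at e c x) - u x \<le> u (refl_at e c y) - u y"
  shows "g (u (refl_at e c x)) < g (u x)"
proof -
  let ?R = "refl_at e c"
  have "0 < u x - u (?R x)" using x by simp
  from Gp_gap[OF p_gt_1 this, of umax] obtain g0 where g0: "0 < g0"
    "\<And>a b. \<bar>a\<bar> \<le> umax \<Longrightarrow> a + (u x - u (?R x)) \<le> b \<Longrightarrow> g0 \<le> Gp p b - Gp p a" by blast
  have gap: "g0 \<le> Gp p (u x - v) - Gp p (u (?R x) - v)" if "v = u z" for v z
    by (rule g0(2)) (use abs_u_diff_le[of "?R x" z] that in auto)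
  \<comment> \<open>The kernel with \<epsilon> = 1 lies below all kernels with smaller \<epsilon>,
    so this minorant of the drop is independent of \<epsilon>.\<close>
  let ?k = "\<lambda>y. indicator {y. y \<bullet> e < c} y * (2 * g0 * ker N 1 (x - ?R y))"
  have ki: "integrable lborel ?k"
  proof -
    have "integrable lborel (\<lambda>y. 2 * g0 * ker N 1 (?R x - y))"
      by (intro integrable_mult_ker[OF _ N_gt, where B = "\<bar>2 * g0\<bar>"]) auto
    moreover have "ker N 1 (?R x - y) = ker N 1 (x - ?R y)" for y
      by (rule ker_cong_norm) (rule norm_refl_at_swap[OF e])
    ultimately show ?thesis
      by (intro integrable_mult_indicator[where 'b = real, simplified real_scaleR_def]) auto
  qed
  show ?thesis
  proof (rule g_refl_less[OF e])
    show "0 < (\<integral>y. ?k y \<partial>lborel)"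
    proof (rule integral_pos_of_open[OF ki, of "{y. y \<bullet> e < c}" x])
      have kp: "0 < ker N 1 z" for z :: 'a by (rule ker_pos) simp
      show "0 \<le> ?k y" for y using g0(1) kp by (simp add: less_imp_le)
      show "0 < ?k y" if "y \<in> {y. y \<bullet> e < c}" for y using that g0(1) kp by simp
    qed (use x(1) in \<open>auto simp: inner_commute[of _ e] open_halfspace_lt\<close>)
    fix \<epsilon> :: real assume \<epsilon>: "0 < \<epsilon>" "\<epsilon> \<le> 1"
    have "h \<epsilon> (?R x) - h \<epsilon> x \<le> (\<integral>y. - ?k y \<partial>lborel)"
      unfolding h_refl_diff(2)[OF e \<epsilon>(1)]
    proof (rule integral_mono[OF h_refl_diff(1)[OF e \<epsilon>(1)]])
      show "integrable lborel (\<lambda>y. - ?k y)" using ki by simp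
      fix y
      let ?a = "Gp p (u (?R x) - u (?R y)) - Gp p (u x - u y)"
      let ?b = "Gp p (u (?R x) - u y) - Gp p (u x - u (?R y))"
      show "indicator {y. y \<bullet> e < c} y * (?a * (ker N \<epsilon> (x - y) - ker N \<epsilon> (x - ?R y)) + (?a + ?b) * ker N \<epsilon> (x - ?R y)) \<le> - ?k y"
      proof (cases "y \<bullet> e < c")
        case True
        have a: "?a \<le> 0" using Gp_mono[OF p_gt_1, of "u (?R x) - u (?R y)" "u x - u y"] min[OF True] by simp
        have "ker N \<epsilon> (x - ?R y) \<le> ker N \<epsilon> (x - y)"
          using norm_refl_at_le[OF e, of x c y] x True N_pos by (intro ker_mono \<epsilon>) auto
        then have "?a * (ker N \<epsilon> (x - y) - ker N \<epsilon> (x - ?R y)) \<le> 0"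
          using a by (intro mult_nonpos_nonneg) auto
        moreover have "(?a + ?b) * ker N \<epsilon> (x - ?R y) \<le> - (2 * g0) * ker N 1 (x - ?R y)"
        proof -
          have "?a + ?b \<le> - (2 * g0)" using gap[OF refl, of y] gap[OF refl, of "?R y"] by simp
          then have "(?a + ?b) * ker N \<epsilon> (x - ?R y) \<le> - (2 * g0) * ker N \<epsilon> (x - ?R y)"
            using ker_pos[OF \<epsilon>(1), of N "x - ?R y"] by (intro mult_right_mono) auto
          also have "\<dots> \<le> - (2 * g0) * ker N 1 (x - ?R y)"
            using ker_ge_1[OF \<epsilon>] g0(1) by (intro mult_left_mono_neg) auto
          finally show ?thesis .
        qed
        ultimately show ?thesis using True by simp
      qed simp
    qed
    then show "h \<epsilon> (?R x) - h \<epsilon> x \<le> - (\<integral>y. ?k y \<partial>lborel)" by simp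
  qed
qed

text \<open>At a contact point \<open>a + b\<close> vanishes, so everything comes from the kernel
  difference. If the reflection strictly increased u near some y0, this would force g(u(R x)) <
  g(u(x)) although both arguments are equal; hence g may be arbitrary.\<close>

lemma strong_max_principle:
  assumes e: "norm e = 1" and x: "x \<bullet> e < c" "u (refl_at e c x) = u x"
    and nonneg: "\<And>y. y \<bullet> e < c \<Longrightarrow> u y \<le> u (refl_at e c y)" and y0: "y0 \<bullet> e < c"
  shows "u (refl_at e c y0) = u y0"
proof (rule ccontr)
  let ?R = "refl_at e c"
  assume "u (?R y0) \<noteq> u y0"
  then have "u y0 < u (?R y0)" using nonneg[OF y0] by simp
  define d where "d = (u (?R y0) - u y0) / 2"
  have d: "0 < d" using \<open>u y0 < u (?R y0)\<close> by (simp add: d_def)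
  from Gp_gap[OF p_gt_1 this, of umax] obtain g0 where g0: "0 < g0"
    "\<And>a b. \<bar>a\<bar> \<le> umax \<Longrightarrow> a + d \<le> b \<Longrightarrow> g0 \<le> Gp p b - Gp p a" by blast
  \<comment> \<open>The unit ball keeps all distances to the reflected point below
    \<open>Rb\<close>, as the lower kernel bound requires a bounded range.\<close>
  define A where "A = {y. y \<bullet> e < c} \<inter> {y. d < u (?R y) - u y} \<inter> ball y0 1"
  have "continuous_on UNIV (\<lambda>y. u (?R y) - u y)"
    by (intro continuous_on_diff u_cont continuous_on_compose2[OF u_cont continuous_on_refl_at]) auto
  then have "open {y. d < u (?R y) - u y}"
    using open_Collect_less[of "\<lambda>_. d" "\<lambda>y. u (?R y) - u y"] by auto
  moreover have "open {y. y \<bullet> e < c}" by (simp add: inner_commute[of _ e] open_halfspace_lt)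
  ultimately have A: "open A" "y0 \<in> A"
    using y0 d by (auto simp: A_def d_def)
  define Rb where "Rb = norm (?R x - y0) + 1"
  define K where "K = N / 2 * (Rb\<^sup>2 + 1) powr (- (N / 2) - 1) * (4 * (c - x \<bullet> e))"
  have K: "0 < K" using N_pos x(1) unfolding K_def
    using sq_pos[of 1 Rb] by (intro mult_pos_pos) auto
  let ?k = "\<lambda>y. indicator A y * (g0 * (K * (c - y \<bullet> e)))"
  have ki: "integrable lborel ?k"
  proof (rule Bochner_Integration.integrable_bound)
    show "integrable lborel (\<lambda>y. indicator (ball y0 1) y * (g0 * (K * (\<bar>c - y0 \<bullet> e\<bar> + 1))))"
      by (intro integrable_mult_left) (use emeasure_lborel_ball_finite[of y0 1] in \<open>simp add: integrable_indicator_iff\<close>)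
    show "AE y in lborel. norm (?k y) \<le> norm (indicator (ball y0 1) y * (g0 * (K * (\<bar>c - y0 \<bullet> e\<bar> + 1))))"
    proof (rule AE_I2)
      fix y
      show "norm (?k y) \<le> norm (indicator (ball y0 1) y * (g0 * (K * (\<bar>c - y0 \<bullet> e\<bar> + 1))))"
      proof (cases "y \<in> A")
        case True
        then have "norm (y0 - y) < 1" by (auto simp: A_def dist_norm)
        then have "\<bar>(y0 - y) \<bullet> e\<bar> \<le> 1" using Cauchy_Schwarz_ineq2[of "y0 - y" e] e by simp
        then have "\<bar>c - y \<bullet> e\<bar> \<le> \<bar>c - y0 \<bullet> e\<bar> + 1" by (simp add: inner_diff_left)
        then show ?thesis using True g0 K by (auto simp: A_def abs_mult)
      qed simp
    qed
    have [measurable]: "A \<in> sets borel" using A(1) by simp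
    show "?k \<in> borel_measurable lborel" by measurable
  qed
  have "g (u (?R x)) < g (u x)"
  proof (rule g_refl_less[OF e])
    show "0 < (\<integral>y. ?k y \<partial>lborel)"
      using A K g0(1) by (intro integral_pos_of_open[OF ki, of A y0]) (auto simp: A_def indicator_def)
    fix \<epsilon> :: real assume \<epsilon>: "0 < \<epsilon>" "\<epsilon> \<le> 1"
    have "h \<epsilon> (?R x) - h \<epsilon> x \<le> (\<integral>y. - ?k y \<partial>lborel)"
      unfolding h_refl_diff(2)[OF e \<epsilon>(1)]
    proof (rule integral_mono[OF h_refl_diff(1)[OF e \<epsilon>(1)]])
      show "integrable lborel (\<lambda>y. - ?k y)" using ki by simp
      fix y
      let ?a = "Gp p (u (?R x) - u (?R y)) - Gp p (u x - u y)"
      let ?b = "Gp p (u (?R x) - u y) - Gp p (u x - u (?R y))"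
      show "indicator {y. y \<bullet> e < c} y * (?a * (ker N \<epsilon> (x - y) - ker N \<epsilon> (x - ?R y)) + (?a + ?b) * ker N \<epsilon> (x - ?R y)) \<le> - ?k y"
      proof (cases "y \<bullet> e < c")
        case True
        have a: "?a \<le> 0" using Gp_mono[OF p_gt_1, of "u (?R x) - u (?R y)" "u x - u y"] nonneg[OF True] x(2) by simp
        have ab: "?a + ?b = 0" using x(2) by simp
        have le: "norm (x - y) \<le> norm (x - ?R y)" using norm_refl_at_le[OF e, of x c y] x True by auto
        show ?thesis
        proof (cases "y \<in> A")
          case yA: True
          have ga: "?a \<le> - g0"
            using g0(2)[of "u (?R x) - u (?R y)" "u x - u y"] abs_u_diff_le[of "?R x" "?R y"] yA x(2) by (auto simp: A_def)
          have "norm (x - ?R y) \<le> Rb"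
          proof -
            have "norm (x - ?R y) = norm (?R x - y)" by (rule norm_refl_at_swap[OF e, symmetric])
            also have "\<dots> \<le> norm (?R x - y0) + norm (y0 - y)" using norm_triangle_ineq[of "?R x - y0" "y0 - y"] by simp
            finally show ?thesis using yA by (auto simp: A_def Rb_def dist_norm)
          qed
          from ker_diff_lower[OF \<epsilon> _ le this, of N]
          have "K * (c - y \<bullet> e) \<le> ker N \<epsilon> (x - y) - ker N \<epsilon> (x - ?R y)"
            unfolding norm_refl_at_sq[OF e] K_def using N_pos by (simp add: mult_ac)
          then have "g0 * (K * (c - y \<bullet> e)) \<le> (- ?a) * (ker N \<epsilon> (x - y) - ker N \<epsilon> (x - ?R y))"
            using ga g0(1) K True by (intro mult_mono) auto
          then have "?a * (ker N \<epsilon> (x - y) - ker N \<epsilon> (x - ?R y)) \<le> - (g0 * (K * (c - y \<bullet> e)))"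
            by (simp only: mult_minus_left)
          then show ?thesis using True yA ab by simp
        next
          case False
          have "ker N \<epsilon> (x - ?R y) \<le> ker N \<epsilon> (x - y)"
            using le N_pos by (intro ker_mono \<epsilon>) auto
          then have "?a * (ker N \<epsilon> (x - y) - ker N \<epsilon> (x - ?R y)) \<le> 0"
            using a by (intro mult_nonpos_nonneg) auto
          then show ?thesis using True False ab by simp
        qed
      qed (simp add: A_def)
    qed
    then show "h \<epsilon> (?R x) - h \<epsilon> x \<le> - (\<integral>y. ?k y \<partial>lborel)" by simp
  qed
  then show False using x(2) by simp
qed

end

section \<open>Moving planes\<close>

context frac_p_solution begin

lemma continuous_u_refl: "continuous_on A (\<lambda>x. u (refl_at e c x))"
  by (rule continuous_on_compose2[OF u_cont[of UNIV] continuous_on_refl_at]) simp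

text \<open>The minimum over the unbounded half-space is attained because u decays: far away the
  difference exceeds -u(y), which is above the given negative value. At such a minimum below
  \<open>s0\<close>, \<open>max_principle\<close> would contradict the monotonicity of g.\<close>

lemma negative_min:
  assumes e: "norm e = 1" and neg: "z \<bullet> e < c" "u (refl_at e c z) < u z"
  obtains x where "x \<bullet> e < c" "u (refl_at e c x) < u x" "s0 \<le> u x"
    "\<And>y. y \<bullet> e < c \<Longrightarrow> u (refl_at e c x) - u x \<le> u (refl_at e c y) - u y"
proof -
  let ?R = "refl_at e c"
  let ?w = "\<lambda>y. u (?R y) - u y"
  obtain R where R: "0 < R" "\<And>x. R < norm x \<Longrightarrow> u x < u z - u (?R z)"
    using u_small_outside[of "u z - u (?R z)"] neg by auto
  have zR: "norm z \<le> R"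
    using R(2)[of z] u_pos[of "?R z"] by fastforce
  define K where "K = cball 0 R \<inter> {y. y \<bullet> e \<le> c}"
  have "compact K" unfolding K_def
    by (intro compact_Int_closed compact_cball) (simp add: inner_commute[of _ e] closed_halfspace_le)
  moreover have "K \<noteq> {}" using zR neg(1) by (auto simp: K_def intro: exI[of _ z])
  ultimately obtain x where x: "x \<in> K" "\<And>y. y \<in> K \<Longrightarrow> ?w x \<le> ?w y"
    using continuous_attains_inf[of K ?w] continuous_on_diff[OF continuous_u_refl u_cont] by blast
  have "z \<in> K" using zR neg(1) by (auto simp: K_def)
  then have wx: "?w x \<le> ?w z" using x(2) by blast
  have min: "?w x \<le> ?w y" if "y \<bullet> e < c" for y
  proof (cases "norm y \<le> R")
    case True
    then show ?thesis using x(2)[of y] that by (auto simp: K_def)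
  next
    case False
    then show ?thesis using R(2)[of y] wx u_pos[of "?R y"] by auto
  qed
  have xc: "x \<bullet> e < c"
  proof (rule ccontr)
    assume "\<not> ?thesis"
    then have "x \<bullet> e = c" using x(1) by (auto simp: K_def)
    then have "?R x = x" by (simp add: refl_at_def)
    then show False using wx neg(2) by simp
  qed
  have wneg: "u (?R x) < u x" using wx neg(2) by simp
  have "s0 \<le> u x"
  proof (rule ccontr)
    assume "\<not> ?thesis"
    then have "g (u x) \<le> g (u (?R x))" using g_noninc[of "u (?R x)" "u x"] u_pos wneg by auto
    then show False using max_principle[OF e xc wneg min] by simp
  qed
  then show ?thesis using that[OF xc wneg _ min] by blast
qed

definition good :: "'a \<Rightarrow> real \<Rightarrow> bool" where
  "good e c \<longleftrightarrow> (\<forall>x. x \<bullet> e < c \<longrightarrow> u x \<le> u (refl_at e c x))"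

definition lam :: "'a \<Rightarrow> real" where
  "lam e = Sup {l. \<forall>c\<le>l. good e c}"

text \<open>A failing plane yields a minimum point with u at least \<open>s0\<close>, hence in a
  fixed ball that the half-space of a plane far to the left does not meet.\<close>

lemma good_start:
  assumes e: "norm e = 1" shows "\<exists>l. \<forall>c\<le>l. good e c"
proof -
  obtain R where R: "\<And>x. R < norm x \<Longrightarrow> u x < s0" using u_small_outside[OF s0_pos] by blast
  have "good e c" if "c \<le> - R" for c
  proof (rule ccontr)
    assume "\<not> good e c"
    then obtain z where "z \<bullet> e < c" "u (refl_at e c z) < u z" by (auto simp: good_def)
    then obtain x where x: "x \<bullet> e < c" "s0 \<le> u x" using negative_min[OF e] by blast
    have "\<bar>x \<bullet> e\<bar> \<le> norm x" using Cauchy_Schwarz_ineq2[of x e] e by simp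
    then show False using R[of x] x that by linarith
  qed
  then show ?thesis by blast
qed

lemma refl_line_tendsto:
  assumes e: "norm e = 1" and "0 < (t::real)" obtains c where "0 < c" "\<And>b. c \<le> b \<Longrightarrow> u (refl_at e b 0) < t"
proof -
  obtain R where R: "0 < R" "\<And>x. R < norm x \<Longrightarrow> u x < t" using u_small_outside[OF assms(2)] by blast
  show ?thesis
  proof (rule that[of R])
    fix b assume "R \<le> b"
    then have "R < norm (refl_at e b 0)" using e R(1) by (simp add: refl_at_def)
    then show "u (refl_at e b 0) < t" by (rule R(2))
  qed (rule R(1))
qed

text \<open>Planes far to the right send the origin so far away that u falls below u(0).\<close>

lemma lam_bdd:
  assumes e: "norm e = 1" shows "bdd_above {l. \<forall>c\<le>l. good e c}"
proof -
  obtain b where b: "0 < b" "\<And>c. b \<le> c \<Longrightarrow> u (refl_at e c 0) < u 0" using refl_line_tendsto[OF e u_pos[of 0]] by blast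
  have "l \<le> b" if "\<forall>c\<le>l. good e c" for l
  proof (rule ccontr)
    assume "\<not> l \<le> b"
    then have "good e b" using that by simp
    then have "u 0 \<le> u (refl_at e b 0)" using b(1) by (simp add: good_def)
    then show False using b(2)[of b] by simp
  qed
  then show ?thesis by (auto simp: bdd_above_def)
qed

lemma good_closed:
  assumes e: "norm e = 1" and lt: "\<And>b. b < c \<Longrightarrow> good e b" shows "good e c"
  unfolding good_def
proof (intro allI impI)
  fix x assume x: "x \<bullet> e < c"
  have "((\<lambda>b. u (refl_at e b x)) \<longlongrightarrow> u (refl_at e c x)) (at_left c)"
  proof -
    have "continuous_on UNIV (\<lambda>b. u (refl_at e b x))"
      by (rule continuous_on_compose2[OF u_cont[of UNIV], where f = "\<lambda>b. refl_at e b x"])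
         (auto simp: refl_at_def intro!: continuous_intros)
    then have "isCont (\<lambda>b. u (refl_at e b x)) c" by (simp add: continuous_on_eq_continuous_at)
    then show ?thesis by (simp add: isCont_def filterlim_at_split)
  qed
  moreover have "eventually (\<lambda>b. u x \<le> u (refl_at e b x)) (at_left c)"
    unfolding eventually_at_left_field
    using lt x by (intro exI[of _ "x \<bullet> e"]) (auto simp: good_def)
  ultimately show "u x \<le> u (refl_at e c x)"
    by (intro tendsto_lowerbound[of _ _ "at_left c"]) auto
qed

lemma good_le_lam:
  assumes e: "norm e = 1" and c: "c \<le> lam e" shows "good e c"
proof -
  have lt: "good e b" if b: "b < lam e" for b
  proof -
    have "{l. \<forall>c\<le>l. good e c} \<noteq> {}" using good_start[OF e] by auto
    then obtain l where "\<forall>c\<le>l. good e c" "b < l"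
      using b less_cSup_iff[OF _ lam_bdd[OF e], of b] unfolding lam_def by auto
    then show ?thesis by simp
  qed
  show ?thesis by (rule good_closed[OF e]) (use lt c in auto)
qed

lemma not_good_above_lam:
  assumes e: "norm e = 1" and l: "lam e < l" obtains c where "lam e < c" "c \<le> l" "\<not> good e c"
proof -
  have "\<not> (\<forall>c\<le>l. good e c)"
  proof
    assume "\<forall>c\<le>l. good e c"
    then have "l \<le> lam e" unfolding lam_def by (intro cSup_upper lam_bdd[OF e]) auto
    then show False using l by simp
  qed
  then obtain c where "c \<le> l" "\<not> good e c" by blast
  then show ?thesis using that good_le_lam[OF e, of c] by force
qed

lemma good_strict_or_symmetric:
  assumes e: "norm e = 1" and "good e c"
  shows "(\<forall>x. x \<bullet> e < c \<longrightarrow> u x < u (refl_at e c x)) \<or> (\<forall>x. u (refl_at e c x) = u x)"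
proof (cases "\<exists>x. x \<bullet> e < c \<and> u (refl_at e c x) = u x")
  case True
  then obtain x where x: "x \<bullet> e < c" "u (refl_at e c x) = u x" by blast
  have lt: "u (refl_at e c y) = u y" if "y \<bullet> e < c" for y
    using strong_max_principle[OF e x _ that] assms(2) by (auto simp: good_def)
  have "u (refl_at e c y) = u y" for y
  proof (cases "y \<bullet> e" c rule: linorder_cases)
    case greater
    then have "refl_at e c y \<bullet> e < c" using e by (simp add: refl_at_inner)
    from lt[OF this] show ?thesis using e by simp
  qed (use lt in \<open>auto simp: refl_at_def\<close>)
  then show ?thesis by blast
next
  case False
  then show ?thesis using assms(2) by (force simp: good_def)
qed

text \<open>A second symmetry hyperplane below the critical one would make the solution
  monotone along a translation, contradicting the decay at infinity.\<close>

lemma strict_below_lam: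
  assumes e: "norm e = 1" and c: "c < lam e" and x: "x \<bullet> e < c"
  shows "u x < u (refl_at e c x)"
proof (rule ccontr)
  assume "\<not> ?thesis"
  then have sym: "u (refl_at e c y) = u y" for y
    using good_strict_or_symmetric[OF e good_le_lam[OF e less_imp_le[OF c]]] x by blast
  define b where "b = (c + lam e) / 2"
  have b: "c < b" "b \<le> lam e" using c by (auto simp: b_def)
  define d where "d = 2 * (b - c)"
  have d: "0 < d" using b by (simp add: d_def)
  \<comment> \<open>Two reflections in parallel planes compose to a translation; the one at c
    preserves u and the one at b does not decrease it.\<close>
  have shift: "u y \<le> u (y - d *\<^sub>R e)" if "y \<bullet> e < b" for y
  proof -
    have "refl_at e c (refl_at e b y) = refl_at e b y + (2 * (c - (2 * b - y \<bullet> e))) *\<^sub>R e"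
      using e by (simp add: refl_at_def[of e c] refl_at_inner)
    also have "\<dots> = y + (2 * (b - y \<bullet> e) + 2 * (c - (2 * b - y \<bullet> e))) *\<^sub>R e"
      by (simp only: refl_at_def scaleR_add_left add.assoc)
    also have "2 * (b - y \<bullet> e) + 2 * (c - (2 * b - y \<bullet> e)) = - d" by (simp add: d_def)
    finally have "refl_at e c (refl_at e b y) = y - d *\<^sub>R e" by simp
    moreover have "u y \<le> u (refl_at e b y)" using good_le_lam[OF e b(2)] that by (simp add: good_def)
    ultimately show ?thesis using sym[of "refl_at e b y"] by simp
  qed
  define y where "y = (c - 1) *\<^sub>R e"
  have ee: "e \<bullet> e = 1" using e by (simp add: dot_square_norm)
  have iter: "u y \<le> u (y - (real n * d) *\<^sub>R e)" for n
  proof (induction n)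
    case (Suc n)
    have "(y - (real n * d) *\<^sub>R e) \<bullet> e < b"
    proof -
      have "(y - (real n * d) *\<^sub>R e) \<bullet> e = c - 1 - real n * d" using ee by (simp add: y_def inner_diff_left)
      moreover have "0 \<le> real n * d" using d by simp
      ultimately show ?thesis using b(1) by linarith
    qed
    from shift[OF this] Suc.IH show ?case by (simp add: algebra_simps)
  qed simp
  obtain R where R: "0 < R" "\<And>x. R < norm x \<Longrightarrow> u x < u y" using u_small_outside[OF u_pos] by blast
  obtain n where "R + norm y < real n * d" using reals_Archimedean3[OF d] by blast
  moreover have "real n * d - norm y \<le> norm (y - (real n * d) *\<^sub>R e)"
    using norm_triangle_ineq2[of "(real n * d) *\<^sub>R e" y] e d by (simp add: norm_minus_commute)
  ultimately have "u (y - (real n * d) *\<^sub>R e) < u y" by (intro R(2)) linarith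
  then show False using iter[of n] by simp
qed

text \<open>Every critical plane passes through a maximum point x0: neither x0 nor its mirror image,
  also a maximum point, can lie strictly left of the plane. Two points at equal distance from x0 are
  exchanged by the symmetry whose normal is their difference. For monotonicity, y is reflected
  towards x0 onto the sphere through x, in a plane strictly below the critical one.\<close>

lemma radial:
  assumes sym: "\<And>e x. norm e = 1 \<Longrightarrow> u (refl_at e (lam e) x) = u x"
  shows "\<exists>x0. (\<forall>x y. dist x x0 = dist y x0 \<longrightarrow> u x = u y) \<and> (\<forall>x y. dist x x0 < dist y x0 \<longrightarrow> u y < u x)"
proof -
  obtain R where R: "0 < R" "\<And>x. R < norm x \<Longrightarrow> u x < u 0" using u_small_outside[OF u_pos] by blast
  obtain x0 where "\<forall>y\<in>cball 0 R. u y \<le> u x0"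
    using continuous_attains_sup[OF compact_cball _ u_cont, of 0 R] R(1) by auto
  then have x0: "\<And>y. norm y \<le> R \<Longrightarrow> u y \<le> u x0" by simp
  have max: "u y \<le> u x0" for y
    using x0[of y] x0[of 0] R(1) R(2)[of y] by (cases "norm y \<le> R") auto
  \<comment> \<open>Reflection in the plane halfway to the critical one would strictly raise the
    maximum.\<close>
  have not_below: "\<not> z \<bullet> e < lam e" if e: "norm e = 1" and "u z = u x0" for e z
  proof
    assume z: "z \<bullet> e < lam e"
    have "u z < u (refl_at e ((z \<bullet> e + lam e) / 2) z)"
      by (rule strict_below_lam[OF e]) (use z in auto)
    then show False using max[of "refl_at e ((z \<bullet> e + lam e) / 2) z"] that by simp
  qed
  have center: "lam e = x0 \<bullet> e" if e: "norm e = 1" for e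
  proof -
    have "\<not> refl_at e (lam e) x0 \<bullet> e < lam e" by (rule not_below[OF e sym[OF e]])
    then show ?thesis using not_below[OF e refl] e by (simp add: refl_at_inner)
  qed
  have eq: "u x = u y" if d: "dist x x0 = dist y x0" for x y
  proof (cases "x = y")
    case False
    define e where "e = (y - x) /\<^sub>R norm (y - x)"
    have n: "norm (y - x) > 0" using False by simp
    have e: "norm e = 1" using n by (simp add: e_def)
    have "(norm (x - x0))\<^sup>2 = (norm (y - x0))\<^sup>2" using d by (simp add: dist_norm)
    then have "2 * ((x0 - x) \<bullet> (y - x)) = (y - x) \<bullet> (y - x)"
      unfolding power2_norm_eq_inner by (simp add: inner_diff_left inner_diff_right inner_commute)
    moreover have "((x0 - x) \<bullet> e) * norm (y - x) = (x0 - x) \<bullet> (y - x)"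
      using n by (simp add: e_def)
    ultimately have "2 * ((x0 - x) \<bullet> e) * norm (y - x) = (norm (y - x))\<^sup>2"
      unfolding power2_norm_eq_inner by linarith
    then have "2 * ((x0 - x) \<bullet> e) = norm (y - x)" using n by (simp add: power2_eq_square)
    then have "refl_at e (lam e) x = x + norm (y - x) *\<^sub>R e"
      by (simp add: refl_at_def center[OF e] inner_diff_left)
    also have "\<dots> = y" using n by (simp add: e_def)
    finally show ?thesis using sym[OF e, of x] by simp
  qed simp
  have "u y < u x" if d: "dist x x0 < dist y x0" for x y
  proof -
    define r where "r = norm (y - x0)"
    have r: "0 < r" unfolding r_def dist_norm[symmetric] using d zero_le_dist[of x x0] by linarith
    define e where "e = (x0 - y) /\<^sub>R r"
    have e: "norm e = 1" using r by (simp add: e_def r_def norm_minus_commute)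
    define k where "k = r - dist x x0"
    have k: "0 < k" "k \<le> r" using d by (auto simp: k_def r_def dist_norm)
    define z where "z = y + k *\<^sub>R e"
    have ye: "y = x0 - r *\<^sub>R e" using r by (simp add: e_def)
    have "z - x0 = (k - r) *\<^sub>R e" by (simp add: z_def ye scaleR_diff_left)
    then have "dist z x0 = dist x x0" using e k by (simp add: dist_norm k_def)
    then have uz: "u z = u x" by (rule eq)
    define c where "c = y \<bullet> e + k / 2"
    have ee: "e \<bullet> e = 1" using e by (simp add: dot_square_norm)
    have "u y < u (refl_at e c y)"
    proof (rule strict_below_lam[OF e])
      show "c < lam e" using ee k r by (simp add: c_def center[OF e] ye inner_diff_left)
      show "y \<bullet> e < c" using k by (simp add: c_def)
    qed
    moreover have "refl_at e c y = z" by (simp add: refl_at_def c_def z_def)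
    ultimately show ?thesis using uz by simp
  qed
  then show ?thesis using eq by blast
qed

end

section \<open>Components of superlevel sets on lines\<close>

context frac_p_solution begin

text \<open>Distance to the end of the component of a superlevel set of $u$ in the direction $v$ (only meaningful for
  positive $t$, where the set is nonempty).\<close>

definition ret :: "'a \<Rightarrow> real \<Rightarrow> 'a \<Rightarrow> real" where
  "ret v t x = Inf {r. 0 \<le> r \<and> u (x + r *\<^sub>R v) \<le> t}"

lemma u_line_cont: "continuous_on A (\<lambda>r. u (x + r *\<^sub>R v))"
  by (rule continuous_on_compose2[OF u_cont[of UNIV], where f = "\<lambda>r. x + r *\<^sub>R v"])
     (auto intro!: continuous_intros)

lemma ret_set:
  assumes v: "norm v = 1" and t: "0 < t"
  shows "ret v t x \<in> {r. 0 \<le> r \<and> u (x + r *\<^sub>R v) \<le> t}"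
proof -
  let ?S = "{r. 0 \<le> r \<and> u (x + r *\<^sub>R v) \<le> t}"
  obtain R where R: "0 < R" "\<And>x. R < norm x \<Longrightarrow> u x < t" using u_small_outside[OF t] by blast
  have "norm ((R + norm x + 1) *\<^sub>R v) - norm x \<le> norm (x + (R + norm x + 1) *\<^sub>R v)"
    using norm_diff_ineq[of "(R + norm x + 1) *\<^sub>R v" x] by (simp add: add.commute)
  then have "R < norm (x + (R + norm x + 1) *\<^sub>R v)" using v R(1) by simp
  then have "R + norm x + 1 \<in> ?S" using R by (auto intro: less_imp_le)
  then have ne: "?S \<noteq> {}" by blast
  have "closed ?S"
    unfolding Collect_conj_eq
    by (intro closed_Int closed_Collect_le continuous_intros u_line_cont)
  moreover have "bdd_below ?S" by (rule bdd_belowI[of _ 0]) simp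
  ultimately show ?thesis using closed_contains_Inf[OF ne] by (simp add: ret_def)
qed

lemma ret_nonneg: "norm v = 1 \<Longrightarrow> 0 < t \<Longrightarrow> 0 \<le> ret v t x"
  and ret_le: "norm v = 1 \<Longrightarrow> 0 < t \<Longrightarrow> u (x + ret v t x *\<^sub>R v) \<le> t"
  using ret_set by auto

lemma before_ret:
  assumes "0 \<le> r" "r < ret v t x" shows "t < u (x + r *\<^sub>R v)"
proof (rule ccontr)
  assume "\<not> ?thesis"
  then have "ret v t x \<le> r" unfolding ret_def
    using assms(1) by (intro cInf_lower bdd_belowI[of _ 0]) auto
  then show False using assms(2) by simp
qed

lemma ret_lowerI:
  assumes "norm v = 1" "0 < t" "\<And>\<sigma>. 0 \<le> \<sigma> \<Longrightarrow> \<sigma> \<le> r \<Longrightarrow> t < u (x + \<sigma> *\<^sub>R v)"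
  shows "r < ret v t x"
  using assms(3)[of "ret v t x"] ret_le[OF assms(1,2), of x] ret_nonneg[OF assms(1,2), of x] by force

lemma ret_upperI: "0 \<le> r \<Longrightarrow> u (x + r *\<^sub>R v) \<le> t \<Longrightarrow> ret v t x \<le> r"
  using before_ret[of r v t x] by force

lemma ret_pos: "norm v = 1 \<Longrightarrow> 0 < t \<Longrightarrow> t < u x \<Longrightarrow> 0 < ret v t x"
  by (rule ret_lowerI) auto

lemma ret_eq:
  assumes v: "norm v = 1" "0 < t" "t < u x" shows "u (x + ret v t x *\<^sub>R v) = t"
proof (rule antisym)
  let ?f = "\<lambda>r. u (x + r *\<^sub>R v)"
  have pos: "0 < ret v t x" by (rule ret_pos[OF v])
  have "isCont ?f (ret v t x)" using u_line_cont[of UNIV] by (simp add: continuous_on_eq_continuous_at)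
  then have "(?f \<longlongrightarrow> ?f (ret v t x)) (at_left (ret v t x))"
    by (simp add: isCont_def filterlim_at_split)
  moreover have "eventually (\<lambda>r. t \<le> ?f r) (at_left (ret v t x))"
    unfolding eventually_at_left_field using pos before_ret by (auto intro!: exI[of _ 0] less_imp_le)
  ultimately show "t \<le> ?f (ret v t x)"
    by (intro tendsto_lowerbound[of _ _ "at_left (ret v t x)"]) auto
qed (rule ret_le[OF v(1,2)])

lemma ret_shift:
  assumes v: "norm v = 1" "0 < t" and r: "0 \<le> r" "\<And>\<sigma>. 0 \<le> \<sigma> \<Longrightarrow> \<sigma> \<le> r \<Longrightarrow> t < u (x + \<sigma> *\<^sub>R v)"
  shows "ret v t (x + r *\<^sub>R v) = ret v t x - r" "ret (- v) t (x + r *\<^sub>R v) = ret (- v) t x + r"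
proof -
  have add: "x + r *\<^sub>R v + \<sigma> *\<^sub>R v = x + (r + \<sigma>) *\<^sub>R v" for \<sigma> by (simp add: scaleR_add_left)
  have lt: "r < ret v t x" by (rule ret_lowerI[OF v r(2)])
  have v': "norm (- v) = 1" using v by simp
  show "ret v t (x + r *\<^sub>R v) = ret v t x - r"
  proof (rule antisym)
    show "ret v t (x + r *\<^sub>R v) \<le> ret v t x - r"
      using lt ret_le[OF v, of x] by (intro ret_upperI) (auto simp: add)
    show "ret v t x - r \<le> ret v t (x + r *\<^sub>R v)"
      using ret_le[OF v, of "x + r *\<^sub>R v"] ret_nonneg[OF v, of "x + r *\<^sub>R v"] r(1)
        ret_upperI[of "r + ret v t (x + r *\<^sub>R v)" x v t] by (simp add: add)
  qed
  have sub: "x + r *\<^sub>R v + \<sigma> *\<^sub>R (- v) = x + (r - \<sigma>) *\<^sub>R v" for \<sigma> by (simp add: scaleR_diff_left)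
  have sub': "x + \<sigma> *\<^sub>R (- v) = x + (- \<sigma>) *\<^sub>R v" for \<sigma> by simp
  show "ret (- v) t (x + r *\<^sub>R v) = ret (- v) t x + r"
  proof (rule antisym)
    show "ret (- v) t (x + r *\<^sub>R v) \<le> ret (- v) t x + r"
      using ret_le[OF v', of t x] v(2) r(1) ret_nonneg[OF v', of t x]
      by (intro ret_upperI) (auto simp: sub simp del: scaleR_minus_right scaleR_minus_left, simp)
    have "r < ret (- v) t (x + r *\<^sub>R v)"
    proof (rule ret_lowerI[OF v' v(2)])
      fix \<sigma> assume "0 \<le> \<sigma>" "\<sigma> \<le> r"
      then show "t < u (x + r *\<^sub>R v + \<sigma> *\<^sub>R (- v))" unfolding sub by (intro r(2)) auto
    qed
    then have "ret (- v) t x \<le> ret (- v) t (x + r *\<^sub>R v) - r"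
      using ret_le[OF v' v(2), of "x + r *\<^sub>R v"] unfolding sub
      by (intro ret_upperI) (simp_all add: scaleR_diff_left)
    then show "ret (- v) t x + r \<le> ret (- v) t (x + r *\<^sub>R v)" by simp
  qed
qed

text \<open>For t > 0, ret exceeds r exactly if no \<sigma> in [0,r] brings u down to t; the
  exceptional set is the projection of a closed set along a compact interval, hence closed.\<close>

lemma ret_measurable [measurable]:
  assumes v: "norm v = 1" shows "(\<lambda>(x, t). ret v t x) \<in> borel_measurable borel"
proof (rule borel_measurableI_greater)
  fix r :: real
  have c: "continuous_on UNIV (\<lambda>z::real \<times> 'a \<times> real. u (fst (snd z) + fst z *\<^sub>R v))"
    by (rule continuous_on_compose2[OF u_cont[of UNIV], where f = "\<lambda>z. fst (snd z) + fst z *\<^sub>R v"])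
       (auto intro!: continuous_intros)
  have "closed {z::real \<times> 'a \<times> real. u (fst (snd z) + fst z *\<^sub>R v) \<le> snd (snd z)}"
    by (intro closed_Collect_le c continuous_intros)
  from closed_compact_projection[OF compact_Icc[of 0 r] this]
  have cl: "closed {y::'a \<times> real. \<exists>\<sigma>. \<sigma> \<in> {0..r} \<and> u (fst y + \<sigma> *\<^sub>R v) \<le> snd y}" by simp
  \<comment> \<open>For t at most 0 the defining set is empty and \<open>ret\<close> is the
    unspecified constant \<open>Inf {}\<close>, so that half-space is split off.\<close>
  have eq: "{z::'a \<times> real. r < (case z of (x, t) \<Rightarrow> ret v t x)}
     = ({z. 0 < snd z} \<inter> (if r < 0 then UNIV else - {y. \<exists>\<sigma>. \<sigma> \<in> {0..r} \<and> u (fst y + \<sigma> *\<^sub>R v) \<le> snd y}))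
       \<union> ({z. snd z \<le> 0} \<inter> (if r < Inf {} then UNIV else {}))" (is "?L = ?R")
  proof (rule set_eqI)
    fix z :: "'a \<times> real"
    obtain x t where z: "z = (x, t)" by fastforce
    show "z \<in> ?L \<longleftrightarrow> z \<in> ?R"
    proof (cases "0 < t")
      case True
      have "r < ret v t x \<longleftrightarrow> (r < 0 \<or> (\<forall>\<sigma>\<in>{0..r}. t < u (x + \<sigma> *\<^sub>R v)))"
      proof
        assume "r < ret v t x"
        then have "\<forall>\<sigma>\<in>{0..r}. t < u (x + \<sigma> *\<^sub>R v)" using before_ret[of _ v t x] by auto
        then show "r < 0 \<or> (\<forall>\<sigma>\<in>{0..r}. t < u (x + \<sigma> *\<^sub>R v))" ..
      next
        assume "r < 0 \<or> (\<forall>\<sigma>\<in>{0..r}. t < u (x + \<sigma> *\<^sub>R v))"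
        then show "r < ret v t x"
        proof
          assume "r < 0" then show ?thesis using ret_nonneg[OF v True, of x] by linarith
        qed (rule ret_lowerI[OF v True], simp)
      qed
      then have "r < ret v t x \<longleftrightarrow> (r < 0 \<or> \<not> (\<exists>\<sigma>. \<sigma> \<in> {0..r} \<and> u (x + \<sigma> *\<^sub>R v) \<le> t))"
        by (simp only: Ball_def not_le[symmetric]) blast
      then show ?thesis using True by (cases "r < 0") (simp_all add: z)
    next
      case False
      have "t < u (x + r *\<^sub>R v)" for r using False u_pos[of "x + r *\<^sub>R v"] by linarith
      then have "{r. 0 \<le> r \<and> u (x + r *\<^sub>R v) \<le> t} = {}" by (auto simp: not_le)
      then have "ret v t x = Inf {}" by (simp only: ret_def)
      then show ?thesis using False by (auto simp: z)
    qed
  qed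
  show "{z \<in> space borel. r < (case z of (x, t) \<Rightarrow> ret v t x)} \<in> sets borel"
  proof -
    have s: "{z::'a \<times> real. 0 < snd z} \<in> sets borel" "{z::'a \<times> real. snd z \<le> 0} \<in> sets borel"
      by (intro borel_open open_Collect_less borel_closed closed_Collect_le continuous_intros)+
    have "?R \<in> sets borel"
      using borel_comp[OF borel_closed[OF cl]] by (intro sets.Un sets.Int s) auto
    then show ?thesis by (simp only: eq space_borel UNIV_I simp_thms)
  qed
qed

end

section \<open>Components on lines in one fixed direction: length, centre, ends and averages\<close>

locale frac_p_direction = frac_p_solution +
  fixes e :: 'a
  assumes norm_e: "norm e = 1"
begin

lemma norm_me: "norm (- e) = 1" using norm_e by simp
lemma inner_ee: "e \<bullet> e = 1" using norm_e by (simp add: dot_square_norm)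

text \<open>With \<open>ll\<close>, the two one-sided distances from x to the ends of its component
  of {u > t} on the line through x in direction e; \<open>len\<close> and \<open>cen\<close> depend
  only on that component.\<close>

definition rr where "rr t x = ret e t x"
definition ll where "ll t x = ret (- e) t x"
definition len where "len t x = rr t x + ll t x"
definition cen where "cen t x = x \<bullet> e + (rr t x - ll t x) / 2"
text \<open>The relation that x and x + r e lie in one component; min and max cover both signs of
  r.\<close>

definition conn where "conn t x r \<longleftrightarrow> (\<forall>\<sigma>. min 0 r \<le> \<sigma> \<and> \<sigma> \<le> max 0 r \<longrightarrow> t < u (x + \<sigma> *\<^sub>R e))"

lemma rr_measurable [measurable]: "(\<lambda>(x, t). rr t x) \<in> borel_measurable borel"
  and ll_measurable [measurable]: "(\<lambda>(x, t). ll t x) \<in> borel_measurable borel"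
  using ret_measurable[OF norm_e] ret_measurable[OF norm_me] by (simp_all add: rr_def ll_def)

lemma rr_measurable' [measurable (raw)]:
  assumes [measurable]: "f \<in> borel_measurable M" "k \<in> borel_measurable M"
  shows "(\<lambda>z. rr (k z) (f z)) \<in> borel_measurable M"
  using measurable_compose[OF borel_measurable_Pair[OF assms] rr_measurable] by simp

lemma ll_measurable' [measurable (raw)]:
  assumes [measurable]: "f \<in> borel_measurable M" "k \<in> borel_measurable M"
  shows "(\<lambda>z. ll (k z) (f z)) \<in> borel_measurable M"
  using measurable_compose[OF borel_measurable_Pair[OF assms] ll_measurable] by simp

lemma len_measurable [measurable (raw)]:
  assumes [measurable]: "f \<in> borel_measurable M" "k \<in> borel_measurable M"
  shows "(\<lambda>z. len (k z) (f z)) \<in> borel_measurable M"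
  unfolding len_def by measurable

lemma cen_measurable [measurable (raw)]:
  assumes [measurable]: "f \<in> borel_measurable M" "k \<in> borel_measurable M"
  shows "(\<lambda>z. cen (k z) (f z)) \<in> borel_measurable M"
  unfolding cen_def by measurable

lemma conn_0: "conn t x r \<Longrightarrow> t < u x"
  by (auto simp: conn_def dest!: spec[of _ 0])

lemma conn_sym: "conn t (x + r *\<^sub>R e) (- r) \<longleftrightarrow> conn t x r"
proof -
  have *: "conn t (x + r *\<^sub>R e) (- r)" if c: "conn t x r" for x r
    unfolding conn_def
  proof (intro allI impI)
    fix \<sigma> assume "min 0 (- r) \<le> \<sigma> \<and> \<sigma> \<le> max 0 (- r)"
    then have "t < u (x + (r + \<sigma>) *\<^sub>R e)" using c unfolding conn_def by (auto simp: min_def max_def split: if_splits)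
    then show "t < u (x + r *\<^sub>R e + \<sigma> *\<^sub>R e)" by (simp add: scaleR_add_left add.assoc)
  qed
  show ?thesis using *[of x r] *[of "x + r *\<^sub>R e" "- r"] by auto
qed

lemma conn_iff:
  assumes "0 < t" "t < u x" shows "conn t x r \<longleftrightarrow> - ll t x < r \<and> r < rr t x"
proof (cases "0 \<le> r")
  case True
  have "conn t x r \<longleftrightarrow> (\<forall>\<sigma>. 0 \<le> \<sigma> \<and> \<sigma> \<le> r \<longrightarrow> t < u (x + \<sigma> *\<^sub>R e))"
    using True by (simp add: conn_def)
  also have "\<dots> \<longleftrightarrow> r < rr t x"
  proof
    assume "\<forall>\<sigma>. 0 \<le> \<sigma> \<and> \<sigma> \<le> r \<longrightarrow> t < u (x + \<sigma> *\<^sub>R e)"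
    then show "r < rr t x" unfolding rr_def by (intro ret_lowerI norm_e assms) auto
  next
    assume "r < rr t x"
    then show "\<forall>\<sigma>. 0 \<le> \<sigma> \<and> \<sigma> \<le> r \<longrightarrow> t < u (x + \<sigma> *\<^sub>R e)"
      using before_ret[of _ e t x] unfolding rr_def by auto
  qed
  finally show ?thesis using ret_pos[OF norm_me assms] True by (auto simp: ll_def)
next
  case False
  have "conn t x r \<longleftrightarrow> (\<forall>\<sigma>. r \<le> \<sigma> \<and> \<sigma> \<le> 0 \<longrightarrow> t < u (x + \<sigma> *\<^sub>R e))"
    using False by (simp add: conn_def)
  also have "\<dots> \<longleftrightarrow> - r < ll t x"
  proof
    assume *: "\<forall>\<sigma>. r \<le> \<sigma> \<and> \<sigma> \<le> 0 \<longrightarrow> t < u (x + \<sigma> *\<^sub>R e)"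
    have "t < u (x + \<sigma> *\<^sub>R (- e))" if "0 \<le> \<sigma>" "\<sigma> \<le> - r" for \<sigma>
      using *[rule_format, of "- \<sigma>"] that by simp
    then show "- r < ll t x" unfolding ll_def by (intro ret_lowerI norm_me assms)
  next
    assume *: "- r < ll t x"
    show "\<forall>\<sigma>. r \<le> \<sigma> \<and> \<sigma> \<le> 0 \<longrightarrow> t < u (x + \<sigma> *\<^sub>R e)"
    proof (intro allI impI)
      fix \<sigma> assume "r \<le> \<sigma> \<and> \<sigma> \<le> 0"
      then show "t < u (x + \<sigma> *\<^sub>R e)" using before_ret[of "- \<sigma>" "- e" t x] * unfolding ll_def by simp
    qed
  qed
  finally show ?thesis using ret_pos[OF norm_e assms] False by (auto simp: rr_def)
qed

lemma conn_shift:
  assumes t: "0 < t" and c: "conn t x r"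
  shows "rr t (x + r *\<^sub>R e) = rr t x - r" "ll t (x + r *\<^sub>R e) = ll t x + r"
proof -
  have "rr t (x + r *\<^sub>R e) = rr t x - r \<and> ll t (x + r *\<^sub>R e) = ll t x + r"
  proof (cases "0 \<le> r")
    case True
    then show ?thesis
      using ret_shift[OF norm_e t True, of x] c by (auto simp: conn_def rr_def ll_def)
  next
    case False
    let ?y = "x + r *\<^sub>R e"
    have "conn t ?y (- r)" using c by (simp add: conn_sym)
    then have "rr t (?y + (- r) *\<^sub>R e) = rr t ?y - (- r) \<and> ll t (?y + (- r) *\<^sub>R e) = ll t ?y + (- r)"
      using ret_shift[OF norm_e t, of "- r" ?y] False by (auto simp: conn_def rr_def ll_def)
    then show ?thesis by simp
  qed
  then show "rr t (x + r *\<^sub>R e) = rr t x - r" "ll t (x + r *\<^sub>R e) = ll t x + r" by auto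
qed

lemma len_shift: "0 < t \<Longrightarrow> conn t x r \<Longrightarrow> len t (x + r *\<^sub>R e) = len t x"
  and cen_shift: "0 < t \<Longrightarrow> conn t x r \<Longrightarrow> cen t (x + r *\<^sub>R e) = cen t x"
  using inner_ee by (simp_all add: len_def cen_def conn_shift inner_add_left field_simps)

lemma len_pos: "0 < t \<Longrightarrow> t < u x \<Longrightarrow> 0 < len t x"
  using ret_pos[OF norm_e, of t x] ret_pos[OF norm_me, of t x] by (simp add: len_def rr_def ll_def)

definition lend where "lend t x = x - ll t x *\<^sub>R e"
definition rend where "rend t x = x + rr t x *\<^sub>R e"

lemma lend_measurable [measurable (raw)]:
  assumes [measurable]: "f \<in> borel_measurable M" "k \<in> borel_measurable M"
  shows "(\<lambda>z. lend (k z) (f z)) \<in> borel_measurable M"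
  unfolding lend_def by measurable

lemma rend_measurable [measurable (raw)]:
  assumes [measurable]: "f \<in> borel_measurable M" "k \<in> borel_measurable M"
  shows "(\<lambda>z. rend (k z) (f z)) \<in> borel_measurable M"
  unfolding rend_def by measurable

lemma u_lend: "0 < t \<Longrightarrow> t < u x \<Longrightarrow> u (lend t x) = t"
  and u_rend: "0 < t \<Longrightarrow> t < u x \<Longrightarrow> u (rend t x) = t"
  using ret_eq[OF norm_me, of t x] ret_eq[OF norm_e, of t x] by (simp_all add: lend_def rend_def ll_def rr_def)

lemma lend_inner: "lend t x \<bullet> e = cen t x - len t x / 2"
  by (simp add: lend_def cen_def len_def inner_diff_left inner_ee field_simps)

lemma rend_eq_refl: "rend t x = refl_at e (cen t x) (lend t x)"
proof -
  have "refl_at e (cen t x) (lend t x) = lend t x + len t x *\<^sub>R e"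
    by (simp add: refl_at_def lend_inner)
  also have "\<dots> = rend t x" by (simp add: lend_def rend_def len_def scaleR_add_left)
  finally show ?thesis by simp
qed

text \<open>A weight V that is constant along components cannot distinguish \<phi> from its
  component means. Instead of splitting the space into lines, the proof spreads the mass V(x)
  uniformly over the component of x: with the kernel \<open>W\<close>, Fubini and a translation of x
  for each fixed shift r exchange the two descriptions.\<close>

lemma average_nn:
  fixes V \<phi> :: "'a \<Rightarrow> ennreal"
  assumes t: "0 < t" and [measurable]: "V \<in> borel_measurable borel" "\<phi> \<in> borel_measurable borel"
    and V: "\<And>x r. conn t x r \<Longrightarrow> V (x + r *\<^sub>R e) = V x"
  shows "(\<integral>\<^sup>+x. indicator {x. t < u x} x * (V x * \<phi> x) \<partial>lborel)
    = (\<integral>\<^sup>+x. indicator {x. t < u x} x * (V x * (ennreal (1 / len t x)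
        * (\<integral>\<^sup>+r. indicator {- ll t x<..<rr t x} r * \<phi> (x + r *\<^sub>R e) \<partial>lborel))) \<partial>lborel)"
proof -
  define W where "W x r = (if t < u x \<and> - ll t x < r \<and> r < rr t x then V x * ennreal (1 / len t x) else 0)" for x r
  have [measurable]: "(\<lambda>(x, r). W x r) \<in> borel_measurable (borel \<Otimes>\<^sub>M borel)" unfolding W_def by measurable
  have Weq: "W x r = (if conn t x r then V x * ennreal (1 / len t x) else 0)" for x r
    using conn_iff[OF t, of x r] conn_0[of t x r] by (auto simp: W_def indicator_def)
  \<comment> \<open>The symmetry of being in one component: moving back by r turns the shift r into
    -r, with V and \<open>len\<close> unchanged.\<close>
  have sh: "W (x + (- r) *\<^sub>R e) r = W x (- r)" for x r
  proof -
    have "conn t (x + (- r) *\<^sub>R e) r \<longleftrightarrow> conn t x (- r)" using conn_sym[of t x "- r"] by simp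
    then show ?thesis using V[of x "- r"] len_shift[OF t, of x "- r"] by (auto simp: Weq)
  qed
  have "(\<integral>\<^sup>+x. indicator {x. t < u x} x * (V x * (ennreal (1 / len t x)
        * (\<integral>\<^sup>+r. indicator {- ll t x<..<rr t x} r * \<phi> (x + r *\<^sub>R e) \<partial>lborel))) \<partial>lborel)
    = (\<integral>\<^sup>+x. (\<integral>\<^sup>+r. W x r * \<phi> (x + r *\<^sub>R e) \<partial>lborel) \<partial>lborel)"
  proof (rule nn_integral_cong)
    fix x
    have "(\<integral>\<^sup>+r. W x r * \<phi> (x + r *\<^sub>R e) \<partial>lborel) = (\<integral>\<^sup>+r. (indicator {x. t < u x} x * V x * ennreal (1 / len t x)) * (indicator {- ll t x<..<rr t x} r * \<phi> (x + r *\<^sub>R e)) \<partial>lborel)"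
      by (intro nn_integral_cong) (auto simp: W_def indicator_def)
    also have "\<dots> = (indicator {x. t < u x} x * V x * ennreal (1 / len t x)) * (\<integral>\<^sup>+r. indicator {- ll t x<..<rr t x} r * \<phi> (x + r *\<^sub>R e) \<partial>lborel)"
      by (rule nn_integral_cmult) measurable
    finally show "indicator {x. t < u x} x * (V x * (ennreal (1 / len t x)
        * (\<integral>\<^sup>+r. indicator {- ll t x<..<rr t x} r * \<phi> (x + r *\<^sub>R e) \<partial>lborel))) = (\<integral>\<^sup>+r. W x r * \<phi> (x + r *\<^sub>R e) \<partial>lborel)"
      by (simp add: mult.assoc)
  qed
  also have "\<dots> = (\<integral>\<^sup>+r. (\<integral>\<^sup>+x. W x r * \<phi> (x + r *\<^sub>R e) \<partial>lborel) \<partial>lborel)"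
    by (rule lborel_pair.Fubini'[symmetric]) measurable
  also have "\<dots> = (\<integral>\<^sup>+r. (\<integral>\<^sup>+x. W x (- r) * \<phi> x \<partial>lborel) \<partial>lborel)"
  proof (rule nn_integral_cong)
    fix r :: real
    have "(\<integral>\<^sup>+x. W x r * \<phi> (x + r *\<^sub>R e) \<partial>lborel) = (\<integral>\<^sup>+x. W (x + (- r) *\<^sub>R e) r * \<phi> (x + (- r) *\<^sub>R e + r *\<^sub>R e) \<partial>lborel)"
      by (rule nn_integral_lborel_translate[symmetric]) measurable
    then show "(\<integral>\<^sup>+x. W x r * \<phi> (x + r *\<^sub>R e) \<partial>lborel) = (\<integral>\<^sup>+x. W x (- r) * \<phi> x \<partial>lborel)"
      by (simp only: sh) simp
  qed
  also have "\<dots> = (\<integral>\<^sup>+x. (\<integral>\<^sup>+r. W x (- r) * \<phi> x \<partial>lborel) \<partial>lborel)"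
    by (rule lborel_pair.Fubini') measurable
  also have "\<dots> = (\<integral>\<^sup>+x. indicator {x. t < u x} x * (V x * \<phi> x) \<partial>lborel)"
  proof (rule nn_integral_cong)
    fix x
    show "(\<integral>\<^sup>+r. W x (- r) * \<phi> x \<partial>lborel) = indicator {x. t < u x} x * (V x * \<phi> x)"
    proof (cases "t < u x")
      case True
      have "(\<integral>\<^sup>+r. W x (- r) * \<phi> x \<partial>lborel) = (\<integral>\<^sup>+r. (V x * ennreal (1 / len t x) * \<phi> x) * indicator {- rr t x<..<ll t x} r \<partial>lborel)"
        using True by (intro nn_integral_cong) (auto simp: W_def indicator_def)
      also have "\<dots> = (V x * ennreal (1 / len t x) * \<phi> x) * emeasure lborel {- rr t x<..<ll t x}"
        by (rule nn_integral_cmult_indicator) simp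
      also have "emeasure lborel {- rr t x<..<ll t x} = ennreal (len t x)"
        using len_pos[OF t True] by (simp add: len_def add.commute)
      also have "V x * ennreal (1 / len t x) * \<phi> x * ennreal (len t x) = V x * \<phi> x * ennreal (1 / len t x * len t x)"
        using len_pos[OF t True] by (subst ennreal_mult) (auto simp: mult_ac)
      also have "1 / len t x * len t x = 1" using len_pos[OF t True] by simp
      finally show ?thesis using True by simp
    qed (simp add: W_def)
  qed
  finally show ?thesis by simp
qed

end

section \<open>Local estimates\<close>

lemma onorm_inner_le:
  fixes v :: "'a::euclidean_space"
  assumes "norm v \<le> L" shows "onorm (\<lambda>h. v \<bullet> h) \<le> L"
proof (rule onorm_bound)
  show "0 \<le> L" using assms norm_ge_zero[of v] by linarith
  show "norm (v \<bullet> x) \<le> L * norm x" for x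
    using Cauchy_Schwarz_ineq2[of v x] mult_right_mono[OF assms norm_ge_zero[of x]] by simp
qed

context frac_p_solution begin

definition Du :: "'a \<Rightarrow> 'a" where
  "Du = (SOME D. (\<forall>x. (u has_derivative (\<lambda>h. D x \<bullet> h)) (at x)) \<and>
      (\<forall>K. compact K \<longrightarrow> (\<exists>L. \<forall>x\<in>K. \<forall>y\<in>K. dist (D x) (D y) \<le> L * dist x y)))"

lemma Du_spec: "(\<forall>x. (u has_derivative (\<lambda>h. Du x \<bullet> h)) (at x)) \<and>
      (\<forall>K. compact K \<longrightarrow> (\<exists>L. \<forall>x\<in>K. \<forall>y\<in>K. dist (Du x) (Du y) \<le> L * dist x y))"
  unfolding Du_def using u_C11 unfolding C11_loc_def mem_Collect_eq by (rule someI_ex)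

lemma u_deriv: "(u has_derivative (\<lambda>h. Du x \<bullet> h)) (at x within S)"
  using Du_spec has_derivative_at_withinI by blast

lemma local_lipschitz:
  obtains L where "1 \<le> L" "\<And>x y. norm x \<le> R \<Longrightarrow> norm y \<le> R \<Longrightarrow> norm (Du x - Du y) \<le> L * norm (x - y)"
    "\<And>x. norm x \<le> R \<Longrightarrow> norm (Du x) \<le> L"
    "\<And>x y. norm x \<le> R \<Longrightarrow> norm y \<le> R \<Longrightarrow> \<bar>u x - u y\<bar> \<le> L * norm (x - y)"
proof -
  obtain L0 where L0: "\<And>x y. norm x \<le> R \<Longrightarrow> norm y \<le> R \<Longrightarrow> dist (Du x) (Du y) \<le> L0 * dist x y"
    using Du_spec compact_cball[of "0::'a" R] by (metis mem_cball_0)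
  define L where "L = max 1 (max L0 (norm (Du 0) + \<bar>L0\<bar> * \<bar>R\<bar>))"
  have L: "1 \<le> L" "L0 \<le> L" "norm (Du 0) + \<bar>L0\<bar> * \<bar>R\<bar> \<le> L" by (auto simp: L_def)
  have D: "norm (Du x) \<le> L" if "norm x \<le> R" for x
  proof -
    have "norm 0 \<le> R" using that norm_ge_zero[of x] by (simp only: norm_zero)
    then have "norm (Du x - Du 0) \<le> L0 * norm x" using L0[OF that, of 0] by (simp add: dist_norm)
    also have "\<dots> \<le> \<bar>L0\<bar> * \<bar>R\<bar>" using that by (intro mult_mono) auto
    finally show ?thesis using norm_triangle_ineq[of "Du x - Du 0" "Du 0"] L(3) by simp
  qed
  show ?thesis
  proof (rule that[OF L(1) _ D])
    show "norm (Du x - Du y) \<le> L * norm (x - y)" if "norm x \<le> R" "norm y \<le> R" for x y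
      using L0[OF that] mult_right_mono[OF L(2), of "norm (x - y)"] by (simp add: dist_norm)
    show "\<bar>u x - u y\<bar> \<le> L * norm (x - y)" if "norm x \<le> R" "norm y \<le> R" for x y
    proof -
      have "norm (u x - u y) \<le> L * norm (x - y)"
      proof (rule differentiable_bound[of "cball 0 R" u "\<lambda>x h. Du x \<bullet> h"])
        show "onorm (\<lambda>h. Du z \<bullet> h) \<le> L" if "z \<in> cball 0 R" for z
          using D[of z] that by (intro onorm_inner_le) simp
      qed (use that u_deriv in auto)
      then show ?thesis by simp
    qed
  qed
qed

end

context frac_p_direction begin

text \<open>The set that is moved: points on level $t$ whose component on the line in direction $e$ has its
  centre to the left of the plane at height $l$.\<close>

definition inA :: "real \<Rightarrow> real \<Rightarrow> 'a \<Rightarrow> bool" where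
  "inA l t x \<longleftrightarrow> t < u x \<and> cen t x < l"

lemma inA_conn: "0 < t \<Longrightarrow> conn t x r \<Longrightarrow> inA l t (x + r *\<^sub>R e) \<longleftrightarrow> inA l t x"
  using conn_0[of t x r] conn_0[of t "x + r *\<^sub>R e" "- r"] cen_shift[of t x r] by (simp add: inA_def conn_sym)

text \<open>If the centre is to the right of c, the distance from y to the right end exceeds twice
  the distance from y to the plane, so the mirror image lies in the same component.\<close>

lemma refl_stays:
  assumes t: "0 < t" "t < u y" and c: "y \<bullet> e < c" "c \<le> cen t y"
  shows "t < u (refl_at e c y)" "cen t (refl_at e c y) = cen t y"
proof -
  let ?r = "2 * (c - y \<bullet> e)"
  have l: "0 < ll t y" using ret_pos[OF norm_me t] by (simp add: ll_def)
  then have cn: "conn t y ?r" using c ret_pos[OF norm_e t] by (simp add: conn_iff[OF t] cen_def field_simps rr_def)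
  then have "conn t (refl_at e c y) (- ?r)" unfolding refl_at_def by (simp only: conn_sym)
  then show "t < u (refl_at e c y)" by (rule conn_0)
  show "cen t (refl_at e c y) = cen t y"
    unfolding refl_at_def by (rule cen_shift[OF t(1) cn])
qed

text \<open>The difference W(y) = u(R y) - u(y) vanishes at a, and its gradient there is only of
  order \<delta> = c - a . e. For the components orthogonal to e this is the Lipschitz bound for the
  gradient; for the component along e, where the reflection turns a difference into a sum, equality
  of u at both ends gives a nearby zero of the slope. Hence the quadratic bound in place of a linear
  one.\<close>

lemma reflection_difference_le:
  assumes L: "0 \<le> L" "\<And>x y. norm x \<le> R + 1 \<Longrightarrow> norm y \<le> R + 1 \<Longrightarrow> norm (Du x - Du y) \<le> L * norm (x - y)"
    and a: "norm a \<le> R" "norm (refl_at e c a) \<le> R" "a \<bullet> e < c" "u (refl_at e c a) = u a"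
    and y: "norm (y - a) \<le> 1"
  shows "\<bar>u (refl_at e c y) - u y\<bar> \<le> 6 * L * ((c - a \<bullet> e) + norm (y - a)) * norm (y - a)"
proof -
  let ?R = "refl_at e c"
  define \<delta> where "\<delta> = c - a \<bullet> e"
  have \<delta>: "0 < \<delta>" using a by (simp add: \<delta>_def)
  have Ra: "?R a = a + (2 * \<delta>) *\<^sub>R e" by (simp add: refl_at_def \<delta>_def)
  have seg: "norm (a + s *\<^sub>R e) \<le> R" if "0 \<le> s" "s \<le> 2 * \<delta>" for s
  proof -
    have "a + s *\<^sub>R e = (1 - s / (2 * \<delta>)) *\<^sub>R a + (s / (2 * \<delta>)) *\<^sub>R ?R a"
      using \<delta> by (simp add: Ra algebra_simps)
    moreover have "\<dots> \<in> cball 0 R"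
      using a that \<delta> by (intro convexD[OF convex_cball]) auto
    ultimately show ?thesis by simp
  qed
  \<comment> \<open>Rolle's theorem between a and its mirror image.\<close>
  obtain \<zeta> where \<zeta>: "0 < \<zeta>" "\<zeta> < 2 * \<delta>" "Du (a + \<zeta> *\<^sub>R e) \<bullet> e = 0"
  proof -
    have d: "((\<lambda>s. u (a + s *\<^sub>R e)) has_real_derivative Du (a + s *\<^sub>R e) \<bullet> e) (at s)" for s
    proof -
      have "((\<lambda>s. a + s *\<^sub>R e) has_derivative (\<lambda>h. h *\<^sub>R e)) (at s)"
        by (auto intro!: derivative_eq_intros)
      from has_derivative_compose[OF this u_deriv[where S = UNIV]]
      show ?thesis by (simp add: has_field_derivative_def mult_commute_abs)
    qed
    have "\<exists>z>0. z < 2 * \<delta> \<and> DERIV (\<lambda>s. u (a + s *\<^sub>R e)) z :> 0"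
    proof (rule Rolle)
      show "u (a + 0 *\<^sub>R e) = u (a + (2 * \<delta>) *\<^sub>R e)" using a(4) by (simp add: Ra)
      show "continuous_on {0..2 * \<delta>} (\<lambda>s. u (a + s *\<^sub>R e))" by (rule u_line_cont)
      show "(\<lambda>s. u (a + s *\<^sub>R e)) differentiable (at x)" for x
        using d[of x] by (auto simp: has_field_derivative_def intro: differentiableI)
    qed (use \<delta> in auto)
    then show ?thesis using that d DERIV_unique by blast
  qed
  let ?W = "\<lambda>y. u (?R y) - u y"
  let ?DW = "\<lambda>y. refl_at e 0 (Du (?R y)) - Du y"
  have lin: "refl_at e 0 v \<bullet> h = v \<bullet> refl_at e 0 h" for v h
    by (simp add: refl_at_def inner_add_left inner_add_right inner_diff_left inner_diff_right inner_commute)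
  have dW: "(?W has_derivative (\<lambda>h. ?DW z \<bullet> h)) (at z within S)" for z S
  proof -
    have "?R = (\<lambda>y. refl_at e 0 y + (2 * c) *\<^sub>R e)" by (simp add: refl_at_def fun_eq_iff algebra_simps)
    moreover have "linear (refl_at e 0)" by (rule linearI) (simp_all add: refl_at_def algebra_simps)
    ultimately have "(?R has_derivative refl_at e 0) (at z within S)"
      by (auto intro!: derivative_eq_intros linear_imp_has_derivative)
    from has_derivative_compose[OF this u_deriv[where S = UNIV]]
    have "((\<lambda>y. u (?R y)) has_derivative (\<lambda>h. Du (?R z) \<bullet> refl_at e 0 h)) (at z within S)" .
    from has_derivative_diff[OF this u_deriv] show ?thesis by (simp add: inner_diff_left lin)
  qed
  let ?d = "norm (y - a)"
  have bound: "norm (?DW z) \<le> 6 * L * (\<delta> + ?d)" if z: "norm (z - a) \<le> ?d" for z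
  proof -
    have za: "norm (?R z - ?R a) = norm (z - a)" by (rule norm_refl_at_diff[OF norm_e])
    have nz: "norm z \<le> R + 1" using norm_triangle_sub[of z a] z y a(1) by linarith
    have nRz: "norm (?R z) \<le> R + 1" using norm_triangle_sub[of "?R z" "?R a"] z y a(2) za by linarith
    have n\<zeta>: "norm (a + \<zeta> *\<^sub>R e) \<le> R + 1" using seg[of \<zeta>] \<zeta> by simp
    have ie: "\<bar>(z - a) \<bullet> e\<bar> \<le> ?d" using Cauchy_Schwarz_ineq2[of "z - a" e] z norm_e by simp
    have "norm (?R z - z) = 2 * \<bar>c - z \<bullet> e\<bar>" using norm_e by (simp add: refl_at_def abs_if)
    also have "\<dots> \<le> 2 * (\<delta> + ?d)" 
    proof -
      have "\<bar>c - z \<bullet> e\<bar> \<le> \<bar>c - a \<bullet> e\<bar> + \<bar>(z - a) \<bullet> e\<bar>"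
        using abs_triangle_ineq4[of "c - a \<bullet> e" "(z - a) \<bullet> e"] by (simp add: inner_diff_left)
      then show ?thesis using ie \<delta> by (simp add: \<delta>_def)
    qed
    finally have d1: "norm (?R z - z) \<le> 2 * (\<delta> + ?d)" .
    have "norm (?R a - (a + \<zeta> *\<^sub>R e)) = \<bar>2 * \<delta> - \<zeta>\<bar>"
      unfolding Ra using norm_e by (simp add: scaleR_diff_left[symmetric])
    moreover have "norm (?R z - (a + \<zeta> *\<^sub>R e)) \<le> norm (?R z - ?R a) + norm (?R a - (a + \<zeta> *\<^sub>R e))"
      using dist_triangle[of "?R z" "a + \<zeta> *\<^sub>R e" "?R a"] by (simp only: dist_norm)
    ultimately have d2: "norm (?R z - (a + \<zeta> *\<^sub>R e)) \<le> ?d + 2 * \<delta>"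
      using za z \<zeta> by linarith
    have "\<bar>Du (?R z) \<bullet> e\<bar> = \<bar>(Du (?R z) - Du (a + \<zeta> *\<^sub>R e)) \<bullet> e\<bar>" using \<zeta>(3) by (simp add: inner_diff_left)
    also have "\<dots> \<le> norm (Du (?R z) - Du (a + \<zeta> *\<^sub>R e))"
      using Cauchy_Schwarz_ineq2[of "Du (?R z) - Du (a + \<zeta> *\<^sub>R e)" e] norm_e by simp
    also have "\<dots> \<le> L * (?d + 2 * \<delta>)" using L(2)[OF nRz n\<zeta>] mult_left_mono[OF d2 L(1)] by linarith
    finally have d3: "\<bar>Du (?R z) \<bullet> e\<bar> \<le> L * (?d + 2 * \<delta>)" .
    have d4: "norm (Du (?R z) - Du z) \<le> L * (2 * (\<delta> + ?d))"
      using L(2)[OF nRz nz] mult_left_mono[OF d1 L(1)] by linarith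
    \<comment> \<open>Separates the harmless gradient difference from the part along e, which only
      the zero of the slope at \<zeta> makes small.\<close>
    have eq: "?DW z = (Du (?R z) - Du z) - (2 * (Du (?R z) \<bullet> e)) *\<^sub>R e" by (simp add: refl_at_def)
    have "norm (?DW z) \<le> norm (Du (?R z) - Du z) + norm ((2 * (Du (?R z) \<bullet> e)) *\<^sub>R e)"
      unfolding eq by (rule norm_triangle_ineq4)
    also have "norm ((2 * (Du (?R z) \<bullet> e)) *\<^sub>R e) = 2 * \<bar>Du (?R z) \<bullet> e\<bar>"
      using norm_e by (simp add: abs_mult)
    also have "norm (Du (?R z) - Du z) + 2 * \<bar>Du (?R z) \<bullet> e\<bar> \<le> L * (2 * (\<delta> + ?d)) + 2 * (L * (?d + 2 * \<delta>))" using d3 d4 by linarith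
    also have "\<dots> \<le> 6 * L * (\<delta> + ?d)" using L(1) by (simp add: algebra_simps)
    finally show ?thesis .
  qed
  have "norm (?W y - ?W a) \<le> 6 * L * (\<delta> + ?d) * norm (y - a)"
  proof (rule differentiable_bound[of "cball a ?d" ?W "\<lambda>z h. ?DW z \<bullet> h"])
    show "onorm (\<lambda>h. ?DW z \<bullet> h) \<le> 6 * L * (\<delta> + ?d)" if "z \<in> cball a ?d" for z
      using bound[of z] that by (intro onorm_inner_le) (simp add: dist_norm norm_minus_commute)
  qed (use dW in \<open>auto simp: dist_norm norm_minus_commute\<close>)
  then show ?thesis using a(4) by (simp add: \<delta>_def)
qed

end

section \<open>Interpolation between the kernel difference and the violation of monotonicity\<close>

definition K0 :: "real \<Rightarrow> real \<Rightarrow> 'a::euclidean_space \<Rightarrow> real" where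
  "K0 \<alpha> N z = (if norm z < 1 then norm z powr (- \<alpha>) else norm z powr (- N))"

lemma K0_measurable [measurable]: "K0 \<alpha> N \<in> borel_measurable borel"
  unfolding K0_def[abs_def] by measurable

lemma nn_integral_ball_le:
  assumes "0 < r"
  shows "(\<integral>\<^sup>+x. 1 * indicator (ball (0::'a::euclidean_space) r) x \<partial>lborel) \<le> ennreal (measure lborel (ball (0::'a) 1) * r powr DIM('a))"
proof -
  have "(\<integral>\<^sup>+x. 1 * indicator (ball (0::'a) r) x \<partial>lborel) = emeasure lborel (ball (0::'a) r)" by simp
  also have "\<dots> = ennreal (measure lborel (ball (0::'a) r))"
    by (rule emeasure_eq_ennreal_measure) (use emeasure_lborel_ball_finite[of "0::'a"] in \<open>simp add: top.not_eq_extremum\<close>)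
  also have "measure lborel (ball (0::'a) r) = measure lborel (ball (0::'a) 1) * r powr DIM('a)"
    using content_ball_conv_unit_ball[of r "0::'a"] assms by (simp add: powr_realpow)
  finally show ?thesis by simp
qed

lemma integrable_K0:
  assumes "\<alpha> < real DIM('a)" "real DIM('a) < N"
  shows "integrable lborel (K0 \<alpha> N :: 'a::euclidean_space \<Rightarrow> real)"
proof (rule integrableI_bounded)
  let ?A = "\<lambda>x::'a. (1 * ennreal (norm x powr (- \<alpha>))) * indicator (ball 0 1) x"
  let ?B = "\<lambda>x::'a. ennreal (norm x powr (- N)) * indicator {x. 1 \<le> norm x} x"
  have "(\<integral>\<^sup>+x. ?A x \<partial>lborel) \<le> ennreal (measure lborel (ball (0::'a) 1) * 2 powr \<bar>\<alpha>\<bar> / (1 - 2 powr (\<alpha> - real DIM('a))))"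
    by (rule nn_integral_ball_powr) (use assms nn_integral_ball_le in auto)
  then have A: "(\<integral>\<^sup>+x. ?A x \<partial>lborel) < \<infinity>" by (rule le_less_trans) simp
  have B: "(\<integral>\<^sup>+x. ?B x \<partial>lborel) < \<infinity>"
    using assms(2) nn_integral_norm_powr_outside[where 'a='a and N=N] by blast
  have "(\<integral>\<^sup>+x. ennreal (norm (K0 \<alpha> N (x::'a))) \<partial>lborel) = (\<integral>\<^sup>+x. ?A x + ?B x \<partial>lborel)"
    by (intro nn_integral_cong) (auto simp: K0_def indicator_def)
  also have "\<dots> = (\<integral>\<^sup>+x. ?A x \<partial>lborel) + (\<integral>\<^sup>+x. ?B x \<partial>lborel)"
    by (rule nn_integral_add) measurable
  also have "\<dots> < \<infinity>" using A B by simp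
  finally show "(\<integral>\<^sup>+x. ennreal (norm (K0 \<alpha> N (x::'a))) \<partial>lborel) < \<infinity>" .
qed measurable

text \<open>Here q stands for the kernel difference across a component of half-length \<delta>, d
  for the distance to its left end, and w for the violation at that distance. Two factors are wanted
  at once: \<delta>, to be cancelled by the division by the length, and a power of M. The price for
  M^\<theta> is 2\<theta> in the exponent of d.\<close>

lemma kernel_times_negative_part_le:
  fixes d \<delta> q w M L N \<theta> :: real
  assumes d: "0 < d" "d < 1" and \<delta>: "0 < \<delta>" and \<theta>: "0 < \<theta>" "\<theta> < 1" and L: "1 \<le> L" and N: "1 \<le> N"
    and q: "0 \<le> q" "q \<le> d powr (- N)" "q \<le> N * (2 * \<delta>) * d powr (- N - 1)"
    and w: "0 \<le> w" "w \<le> M" "w \<le> 6 * L * (\<delta> + d) * d"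
  shows "q * w \<le> 24 * N * L * \<delta> * M powr \<theta> * d powr (1 - 2 * \<theta> - N)"
proof -
  have M: "0 \<le> M" using w by linarith
  \<comment> \<open>Geometric interpolation of the two bounds for w: the exponent \<theta> goes to M
    and 1 - \<theta> to the quadratic bound.\<close>
  have w1: "w \<le> M powr \<theta> * (12 * L * (max \<delta> d * d)) powr (1 - \<theta>)"
  proof (cases "w = 0")
    case False
    have "w = w powr \<theta> * w powr (1 - \<theta>)" using w(1) False by (simp add: powr_add[symmetric])
    also have "\<dots> \<le> M powr \<theta> * (12 * L * (max \<delta> d * d)) powr (1 - \<theta>)"
    proof (intro mult_mono powr_mono2)
      have "(\<delta> + d) * d \<le> 2 * (max \<delta> d * d)"
        using mult_right_mono[of "\<delta> + d" "2 * max \<delta> d" d] d by (simp add: mult.assoc)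
      from mult_left_mono[OF this, of "6 * L"] have "6 * L * (\<delta> + d) * d \<le> 12 * L * (max \<delta> d * d)"
        using L by (simp add: mult.assoc)
      with w(3) show "w \<le> 12 * L * (max \<delta> d * d)" by (rule order_trans)
    qed (use w \<theta> in auto)
    finally show ?thesis .
  qed (use M in simp)
  have "(12 * L * (max \<delta> d * d)) powr (1 - \<theta>) = (12 * L) powr (1 - \<theta>) * ((max \<delta> d) powr (1 - \<theta>) * d powr (1 - \<theta>))"
    using L d \<delta> by (simp add: powr_mult)
  also have "\<dots> \<le> (12 * L) * ((max \<delta> d) powr (1 - \<theta>) * d powr (1 - \<theta>))"
    using powr_mono[of "1 - \<theta>" 1 "12 * L"] L \<theta> by (intro mult_right_mono) auto
  finally have w2: "w \<le> M powr \<theta> * (12 * L * ((max \<delta> d) powr (1 - \<theta>) * d powr (1 - \<theta>)))"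
    by (intro order_trans[OF w1] mult_left_mono) auto
  \<comment> \<open>For d below \<delta> the plain size d^(-N) of the kernel is used, and \<delta>
    comes from w; for larger d the gradient bound for the kernel supplies \<delta>.\<close>
  have key: "q * ((max \<delta> d) powr (1 - \<theta>) * d powr (1 - \<theta>)) \<le> 2 * N * \<delta> * d powr (1 - 2 * \<theta> - N)"
  proof (cases "d \<le> \<delta>")
    case True
    have "\<delta> powr (1 - \<theta>) = \<delta> * \<delta> powr (- \<theta>)" using \<delta> powr_add[of \<delta> 1 "- \<theta>"] by simp
    also have "\<dots> \<le> \<delta> * d powr (- \<theta>)" using \<delta> d True \<theta> by (intro mult_left_mono powr_mono2') auto
    finally have "q * (\<delta> powr (1 - \<theta>) * d powr (1 - \<theta>)) \<le> d powr (- N) * ((\<delta> * d powr (- \<theta>)) * d powr (1 - \<theta>))"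
      using q \<delta> by (intro mult_mono) auto
    also have "\<dots> = \<delta> * d powr (- N + - \<theta> + (1 - \<theta>))" by (simp only: powr_add mult_ac)
    also have "- N + - \<theta> + (1 - \<theta>) = 1 - 2 * \<theta> - N" by simp
    also have "\<delta> * d powr (1 - 2 * \<theta> - N) \<le> 2 * N * (\<delta> * d powr (1 - 2 * \<theta> - N))"
      using mult_right_mono[of 1 "2 * N" "\<delta> * d powr (1 - 2 * \<theta> - N)"] N \<delta> by simp
    finally show ?thesis using True by (simp add: max_def mult.assoc split: if_splits)
  next
    case False
    have "q * (d powr (1 - \<theta>) * d powr (1 - \<theta>)) \<le> (N * (2 * \<delta>) * d powr (- N - 1)) * (d powr (1 - \<theta>) * d powr (1 - \<theta>))"
      using q by (intro mult_right_mono) auto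
    also have "\<dots> = 2 * N * \<delta> * d powr ((- N - 1) + ((1 - \<theta>) + (1 - \<theta>)))" by (simp only: powr_add mult_ac)
    also have "(- N - 1) + ((1 - \<theta>) + (1 - \<theta>)) = 1 - 2 * \<theta> - N" by simp
    finally show ?thesis using False by (simp add: max_def)
  qed
  have "q * w \<le> q * (M powr \<theta> * (12 * L * ((max \<delta> d) powr (1 - \<theta>) * d powr (1 - \<theta>))))"
    by (intro mult_left_mono w2 q)
  also have "\<dots> = (12 * L * M powr \<theta>) * (q * ((max \<delta> d) powr (1 - \<theta>) * d powr (1 - \<theta>)))" by (simp only: mult_ac)
  also have "\<dots> \<le> (12 * L * M powr \<theta>) * (2 * N * \<delta> * d powr (1 - 2 * \<theta> - N))"
    using key L by (intro mult_left_mono) auto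
  also have "\<dots> = 24 * N * L * \<delta> * M powr \<theta> * d powr (1 - 2 * \<theta> - N)" by simp
  finally show ?thesis .
qed

section \<open>The symmetrization weight\<close>

context frac_p_direction begin

text \<open>The integral over $r$ of the layer-cake weight of the nonlinearity against the difference between
  the cut-off superlevel set and its part that is moved by the symmetrization. The subtracted
  term is symmetric in the two levels, so its total contribution vanishes against the odd
  kernel; what is left has a sign up to an error of the size of the violation of monotonicity.\<close>

definition Om :: "real \<Rightarrow> (real \<Rightarrow> real) \<Rightarrow> real \<Rightarrow> 'a \<Rightarrow> real" where
  "Om l \<tau> t y = (LINT r:{0<..umax}|lborel. (p - 1) * \<bar>t - r\<bar> powr (p - 2) *
     ((if r < u y then \<tau> t else 0) - (if inA l r y then min (\<tau> t) (\<tau> r) else 0)))"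

lemma inA_measurable [measurable (raw)]:
  assumes [measurable]: "f \<in> borel_measurable M" "k \<in> borel_measurable M"
  shows "Measurable.pred M (\<lambda>z. inA l (k z) (f z))"
  unfolding inA_def by measurable

lemma beta_integrable:
  "integrable lborel (\<lambda>r. indicator {0<..umax} r * ((p - 1) * \<bar>t - r\<bar> powr (p - 2)))"
proof -
  have "set_integrable lborel {0<..umax} (\<lambda>r. (p - 1) * \<bar>t - r\<bar> powr (p - 2))"
    by (rule set_integrable_subset[OF Gp_layer_integral(1)[OF p_gt_1, of 0 umax t]]) (use umax_pos in auto)
  then show ?thesis unfolding set_integrable_def real_scaleR_def .
qed

lemma weight_bounds:
  fixes \<tau> :: "real \<Rightarrow> real"
  assumes "\<And>t. 0 \<le> \<tau> t"
  shows "0 \<le> (if r < u y then \<tau> t else 0) - (if inA l r y then min (\<tau> t) (\<tau> r) else 0)"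
    "(if r < u y then \<tau> t else 0) - (if inA l r y then min (\<tau> t) (\<tau> r) else 0) \<le> \<tau> t"
  using assms[of t] assms[of r] by (auto simp: inA_def)

lemma Om_integrand_integrable:
  fixes \<tau> :: "real \<Rightarrow> real"
  assumes [measurable]: "\<tau> \<in> borel_measurable borel" and \<tau>: "\<And>t. 0 \<le> \<tau> t"
  shows "integrable lborel (\<lambda>r. indicator {0<..umax} r * ((p - 1) * \<bar>t - r\<bar> powr (p - 2) *
     ((if r < u y then \<tau> t else 0) - (if inA l r y then min (\<tau> t) (\<tau> r) else 0))))"
proof (rule Bochner_Integration.integrable_bound)
  show "integrable lborel (\<lambda>r. \<tau> t * (indicator {0<..umax} r * ((p - 1) * \<bar>t - r\<bar> powr (p - 2))))"
    using beta_integrable by simp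
  show "AE r in lborel. norm (indicator {0<..umax} r * ((p - 1) * \<bar>t - r\<bar> powr (p - 2) *
     ((if r < u y then \<tau> t else 0) - (if inA l r y then min (\<tau> t) (\<tau> r) else 0))))
     \<le> norm (\<tau> t * (indicator {0<..umax} r * ((p - 1) * \<bar>t - r\<bar> powr (p - 2))))"
  proof (rule AE_I2)
    fix r
    define w where "w = (if r < u y then \<tau> t else 0) - (if inA l r y then min (\<tau> t) (\<tau> r) else 0)"
    have w: "0 \<le> w" "w \<le> \<tau> t" using weight_bounds[of \<tau>, OF \<tau>] by (simp_all add: w_def)
    have "\<bar>indicator {0<..umax} r * ((p - 1) * \<bar>t - r\<bar> powr (p - 2) * w)\<bar> \<le> \<tau> t * (indicator {0<..umax} r * ((p - 1) * \<bar>t - r\<bar> powr (p - 2)))"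
      using w p_gt_1 mult_right_mono[OF w(2), of "(p - 1) * \<bar>t - r\<bar> powr (p - 2)"]
      by (auto simp: indicator_def abs_mult mult_ac)
    then show "norm (indicator {0<..umax} r * ((p - 1) * \<bar>t - r\<bar> powr (p - 2) *
     ((if r < u y then \<tau> t else 0) - (if inA l r y then min (\<tau> t) (\<tau> r) else 0))))
     \<le> norm (\<tau> t * (indicator {0<..umax} r * ((p - 1) * \<bar>t - r\<bar> powr (p - 2))))"
      unfolding w_def[symmetric] real_norm_def by (rule order_trans[OF _ abs_ge_self])
  qed
qed measurable

lemma Om_bounds:
  fixes \<tau> :: "real \<Rightarrow> real"
  assumes [measurable]: "\<tau> \<in> borel_measurable borel" and \<tau>: "\<And>t. 0 \<le> \<tau> t"
  shows "0 \<le> Om l \<tau> t y" "Om l \<tau> t y \<le> \<tau> t * (\<integral>r. indicator {0<..umax} r * ((p - 1) * \<bar>t - r\<bar> powr (p - 2)) \<partial>lborel)"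
proof -
  show "0 \<le> Om l \<tau> t y"
    unfolding Om_def set_lebesgue_integral_def using weight_bounds(1)[of \<tau>, OF \<tau>] p_gt_1
    by (intro Bochner_Integration.integral_nonneg) (simp add: zero_le_mult_iff)
  have "Om l \<tau> t y \<le> (\<integral>r. \<tau> t * (indicator {0<..umax} r * ((p - 1) * \<bar>t - r\<bar> powr (p - 2))) \<partial>lborel)"
    unfolding Om_def set_lebesgue_integral_def real_scaleR_def
  proof (rule integral_mono[OF Om_integrand_integrable[OF assms]])
    show "integrable lborel (\<lambda>r. \<tau> t * (indicator {0<..umax} r * ((p - 1) * \<bar>t - r\<bar> powr (p - 2))))"
      using beta_integrable by simp
    fix r
    show "indicator {0<..umax} r * ((p - 1) * \<bar>t - r\<bar> powr (p - 2) *
     ((if r < u y then \<tau> t else 0) - (if inA l r y then min (\<tau> t) (\<tau> r) else 0)))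
      \<le> \<tau> t * (indicator {0<..umax} r * ((p - 1) * \<bar>t - r\<bar> powr (p - 2)))"
      using mult_left_mono[OF weight_bounds(2)[of \<tau> r y t l, OF \<tau>], of "(p - 1) * \<bar>t - r\<bar> powr (p - 2)"] p_gt_1
      by (auto simp: indicator_def mult_ac)
  qed
  then show "Om l \<tau> t y \<le> \<tau> t * (\<integral>r. indicator {0<..umax} r * ((p - 1) * \<bar>t - r\<bar> powr (p - 2)) \<partial>lborel)" by simp
qed

lemma Om_measurable [measurable]:
  assumes [measurable]: "\<tau> \<in> borel_measurable borel"
  shows "(\<lambda>(t, y). Om l \<tau> t y) \<in> borel_measurable (borel \<Otimes>\<^sub>M borel)"
  unfolding Om_def set_lebesgue_integral_def by measurable

text \<open>The factor t - r produced by \<tau>(t) - \<tau>(r) turns the exponent p - 2, singular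
  for p < 2, into the positive exponent p - 1.\<close>

lemma beta_times_le:
  assumes "v \<le> r" "v < t"
  shows "(p - 1) * \<bar>t - r\<bar> powr (p - 2) * max 0 (t - r) \<le> (p - 1) * (t - v) powr (p - 1)"
proof (cases "r < t")
  case True
  then have "\<bar>t - r\<bar> powr (p - 2) * max 0 (t - r) = (t - r) powr (p - 1)"
    using powr_mult_base[of "t - r" "p - 2"] by (simp add: mult.commute)
  also have "\<dots> \<le> (t - v) powr (p - 1)" using True assms p_gt_1 by (intro powr_mono2) auto
  finally show ?thesis using p_gt_1 by (simp add: mult.assoc mult_left_mono)
qed (use p_gt_1 in \<open>simp add: max_def\<close>)

text \<open>The two values of \<open>Om\<close> are compared level by level. Gain: for y in E and r
  between u(y) + \<eta> and u(R y), the mirror image carries the full weight \<tau>(t), since its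
  component is centred beyond l and is not moved, while y carries none. Loss: only where u(R y) is
  at most r and r < u(y). There y belongs to the moved part, so just \<tau>(t) - min(\<tau>(t),
  \<tau>(r)) is lost, which is bounded by the slope times the positive part of t - r.\<close>

lemma Om_reflection_lower:
  fixes \<tau> d\<tau> :: "real \<Rightarrow> real"
  assumes [measurable]: "\<tau> \<in> borel_measurable borel" and \<tau>: "\<And>t. 0 \<le> \<tau> t" "\<And>r. r \<le> t \<Longrightarrow> \<tau> t - \<tau> r \<le> d\<tau> t * (t - r)"
    "mono \<tau>" "0 \<le> d\<tau> t"
    and c: "c < l" "y \<bullet> e < c"
    and E: "\<And>r. y \<in> E \<Longrightarrow> u y + \<eta> < r \<Longrightarrow> r < u (refl_at e c y) \<Longrightarrow> l \<le> cen r (refl_at e c y)"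
    and \<eta>: "0 < \<eta>" "y \<in> E \<Longrightarrow> u y + \<eta> \<le> u (refl_at e c y)"
  defines "v \<equiv> u (refl_at e c y)"
  shows "\<tau> t * indicator E y * (Gp p (t - u y - \<eta>) - Gp p (t - v))
      - d\<tau> t * ((p - 1) * max 0 (t - v) powr (p - 1) * max 0 (u y - v)) \<le> Om l \<tau> t (refl_at e c y) - Om l \<tau> t y"
proof -
  let ?R = "refl_at e c"
  let ?\<beta> = "\<lambda>r. (p - 1) * \<bar>t - r\<bar> powr (p - 2)"
  let ?w = "\<lambda>y r. (if r < u y then \<tau> t else 0) - (if inA l r y then min (\<tau> t) (\<tau> r) else 0)"
  let ?X = "(p - 1) * max 0 (t - v) powr (p - 1)"
  let ?lo = "\<lambda>r. \<tau> t * indicator E y * (indicator {u y + \<eta>..v} r * ?\<beta> r) - d\<tau> t * (?X * indicator {v..<u y} r)"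
  have vpos: "0 < v" "v \<le> umax" "0 < u y" "u y \<le> umax" using u_pos u_le by (auto simp: v_def)
  have \<beta>0: "0 \<le> ?\<beta> r" for r using p_gt_1 by simp
  have i1: "integrable lborel (\<lambda>r. \<tau> t * indicator E y * (indicator {u y + \<eta>..v} r * ?\<beta> r))"
    "(\<integral>r. \<tau> t * indicator E y * (indicator {u y + \<eta>..v} r * ?\<beta> r) \<partial>lborel) = \<tau> t * indicator E y * (Gp p (t - u y - \<eta>) - Gp p (t - v))"
  proof -
    show "integrable lborel (\<lambda>r. \<tau> t * indicator E y * (indicator {u y + \<eta>..v} r * ?\<beta> r))"
      using Gp_layer_integral(1)[OF p_gt_1, of "u y + \<eta>" v t] \<eta>(2)
      by (cases "y \<in> E") (auto simp: set_integrable_def v_def)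
    show "(\<integral>r. \<tau> t * indicator E y * (indicator {u y + \<eta>..v} r * ?\<beta> r) \<partial>lborel) = \<tau> t * indicator E y * (Gp p (t - u y - \<eta>) - Gp p (t - v))"
    proof (cases "y \<in> E")
      case True
      have "(\<integral>r. indicator {u y + \<eta>..v} r * ?\<beta> r \<partial>lborel) = Gp p (t - (u y + \<eta>)) - Gp p (t - v)"
        using Gp_layer_integral(2)[OF p_gt_1, of "u y + \<eta>" v t] \<eta>(2)[OF True]
        unfolding set_lebesgue_integral_def real_scaleR_def v_def by blast
      then show ?thesis using True by (simp add: diff_diff_eq)
    qed simp
  qed
  have i2: "integrable lborel (\<lambda>r. d\<tau> t * (?X * indicator {v..<u y} r))"
    "(\<integral>r. d\<tau> t * (?X * indicator {v..<u y} r) \<partial>lborel) = d\<tau> t * (?X * max 0 (u y - v))"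
    by (cases "v \<le> u y", auto simp: max_def)+
  have "(\<integral>r. ?lo r \<partial>lborel) = \<tau> t * indicator E y * (Gp p (t - u y - \<eta>) - Gp p (t - v)) - d\<tau> t * (?X * max 0 (u y - v))"
    by (subst Bochner_Integration.integral_diff[OF i1(1) i2(1)]) (simp only: i1(2) i2(2))
  moreover have "(\<integral>r. ?lo r \<partial>lborel) \<le> (\<integral>r. indicator {0<..umax} r * (?\<beta> r * ?w (?R y) r) - indicator {0<..umax} r * (?\<beta> r * ?w y r) \<partial>lborel)"
  proof (rule integral_mono_AE)
    show "integrable lborel ?lo" by (rule Bochner_Integration.integrable_diff[OF i1(1) i2(1)])
    show "integrable lborel (\<lambda>r. indicator {0<..umax} r * (?\<beta> r * ?w (?R y) r) - indicator {0<..umax} r * (?\<beta> r * ?w y r))"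
      by (intro Bochner_Integration.integrable_diff Om_integrand_integrable assms(1) \<tau>)
    have "AE r in lborel. r \<noteq> u y + \<eta>" "AE r in lborel. r \<noteq> v"
      using AE_lborel_singleton[of "u y + \<eta>"] AE_lborel_singleton[of v] by auto
    then show "AE r in lborel. ?lo r \<le> indicator {0<..umax} r * (?\<beta> r * ?w (?R y) r) - indicator {0<..umax} r * (?\<beta> r * ?w y r)"
    proof eventually_elim
      case (elim r)
      show ?case
      proof (cases "0 < r \<and> r \<le> umax")
        case False
        then have "\<not> (u y + \<eta> \<le> r \<and> r \<le> v)" "\<not> (v \<le> r \<and> r < u y)" using vpos \<eta>(1) by auto
        then show ?thesis using False by (auto simp: indicator_def)
      next
        case True
        \<comment> \<open>A component that is not moved has its centre beyond l > c, so
          \<open>refl_stays\<close> puts the mirror image into the same component.\<close>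
        have stays: "\<not> inA l r y \<Longrightarrow> r < u y \<Longrightarrow> r < v \<and> \<not> inA l r (?R y)"
          using refl_stays[of r y c] True c by (auto simp: inA_def v_def)
        define b where "b = ?\<beta> r"
        define X where "X = ?X"
        define wR where "wR = ?w (?R y) r"
        define wy where "wy = ?w y r"
        have b0: "0 \<le> b" unfolding b_def by (rule \<beta>0)
        have X0: "0 \<le> X" using p_gt_1 by (simp add: X_def)
        have wR0: "0 \<le> wR" unfolding wR_def by (rule weight_bounds(1)[of \<tau>, OF \<tau>(1)])
        have "\<tau> t * indicator E y * (indicator {u y + \<eta>..v} r * b) - d\<tau> t * (X * indicator {v..<u y} r) \<le> b * (wR - wy)"
        proof (cases "r < u y")
          case ry: False
          have w0: "wy = 0" using ry by (simp add: inA_def wy_def)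
          have i0: "indicator {v..<u y} r = (0::real)" using ry by simp
          show ?thesis
          proof (cases "y \<in> E \<and> u y + \<eta> \<le> r \<and> r \<le> v")
            case yes: True
            then have "u y + \<eta> < r" "r < v" using elim by auto
            then have "\<not> inA l r (?R y)" using E[of r] yes by (auto simp: inA_def v_def)
            then have "wR = \<tau> t" using \<open>r < v\<close> by (simp add: v_def wR_def)
            moreover have "indicator E y = (1::real)" "indicator {u y + \<eta>..v} r = (1::real)" using yes by auto
            ultimately show ?thesis unfolding w0 i0 by simp
          next
            case False
            then have "indicator E y = (0::real) \<or> indicator {u y + \<eta>..v} r = (0::real)" by auto
            then show ?thesis unfolding w0 i0 using b0 wR0 by auto
          qed
        next
          case ry: True
          have E0: "indicator {u y + \<eta>..v} r = (0::real)" using ry \<eta>(1) by auto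
          show ?thesis
          proof (cases "r < v")
            case rv: True
            have "wy \<le> wR"
              using stays ry rv \<tau>(1)[of t] \<tau>(1)[of r] unfolding wR_def wy_def v_def by (auto simp: min_def)
            moreover have "indicator {v..<u y} r = (0::real)" using rv by simp
            ultimately show ?thesis unfolding E0 using b0 by simp
          next
            case rv: False
            then have A: "inA l r y" using stays ry by auto
            have wR: "wR = 0" using rv by (simp add: inA_def v_def wR_def)
            \<comment> \<open>If r > t, monotonicity of \<tau> makes the minimum equal to \<tau>(t)
              and nothing is lost.\<close>
            have "wy \<le> d\<tau> t * max 0 (t - r)"
            proof (cases "r \<le> t")
              case True
              then show ?thesis using A ry \<tau>(2)[OF True] monoD[OF \<tau>(3) True] by (simp add: wy_def)
            next
              case False
              then have "\<tau> t \<le> \<tau> r" using monoD[OF \<tau>(3), of t r] by simp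
              then show ?thesis using A ry \<tau>(4) False by (simp add: wy_def)
            qed
            then have 1: "b * wy \<le> b * (d\<tau> t * max 0 (t - r))" using b0 by (rule mult_left_mono)
            have "b * max 0 (t - r) \<le> X"
            proof (cases "v < t")
              case True then show ?thesis using beta_times_le[of v r t] rv by (simp add: max_def b_def X_def)
            next
              case False
              then have "max 0 (t - r) = 0" using rv by simp
              then show ?thesis using X0 by simp
            qed
            then have "d\<tau> t * (b * max 0 (t - r)) \<le> d\<tau> t * X" using \<tau>(4) by (rule mult_left_mono)
            then have 2: "b * wy \<le> d\<tau> t * X" using 1 by (simp add: mult.left_commute)
            have "indicator {v..<u y} r = (1::real)" using ry rv by simp
            then show ?thesis unfolding E0 wR using 2 by simp
          qed
        qed
        then have "?lo r \<le> ?\<beta> r * (?w (?R y) r - ?w y r)" by (simp only: b_def X_def wR_def wy_def)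
        moreover have "indicator {0<..umax} r = (1::real)" using True by simp
        ultimately show ?thesis by (simp only: right_diff_distrib mult_1)
      qed
    qed
  qed
  moreover have "(\<integral>r. indicator {0<..umax} r * (?\<beta> r * ?w (?R y) r) - indicator {0<..umax} r * (?\<beta> r * ?w y r) \<partial>lborel) = Om l \<tau> t (?R y) - Om l \<tau> t y"
    unfolding Om_def set_lebesgue_integral_def real_scaleR_def
    by (rule Bochner_Integration.integral_diff) (intro Om_integrand_integrable assms(1) \<tau>)+
  ultimately show ?thesis by simp
qed

end

section \<open>The case without symmetry at the critical plane\<close>

locale frac_p_nonsym = frac_p_direction +
  assumes strict: "\<And>c x. c \<le> lam e \<Longrightarrow> x \<bullet> e < c \<Longrightarrow> u x < u (refl_at e c x)"
begin

text \<open>Both ends have the value t, whereas reflection in any plane up to the critical one would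
  strictly increase u from the left end to the right end.\<close>

lemma cen_gt_lam:
  assumes t: "0 < t" "t < u x" shows "lam e < cen t x"
proof (rule ccontr)
  assume "\<not> ?thesis"
  moreover have "lend t x \<bullet> e < cen t x" using len_pos[OF t] by (simp add: lend_inner)
  ultimately have "u (lend t x) < u (rend t x)" unfolding rend_eq_refl by (intro strict) auto
  then show False using u_lend[OF t] u_rend[OF t] by simp
qed

text \<open>Strict asymmetry at one point left of the critical plane persists, with a margin, on a
  small ball and for all planes slightly beyond. The last property says that at a level above u(y) +
  \<eta> the component of R y cannot reach back to y, so its centre is pushed to the right of c by a
  fixed amount; it is therefore not moved in the test.\<close>

lemma gain_region:
  obtains y0 \<rho>0 \<eta> \<epsilon>0 where "0 < \<rho>0" "0 < \<eta>" "0 < \<epsilon>0" "\<epsilon>0 \<le> 1"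
    "\<And>y. y \<in> ball y0 \<rho>0 \<Longrightarrow> y \<bullet> e \<le> lam e - 1 / 2"
    "\<And>c y. y \<in> ball y0 \<rho>0 \<Longrightarrow> lam e \<le> c \<Longrightarrow> c < lam e + \<epsilon>0 \<Longrightarrow> u y + 2 * \<eta> \<le> u (refl_at e c y)"
    "\<And>c y r. y \<in> ball y0 \<rho>0 \<Longrightarrow> lam e \<le> c \<Longrightarrow> c < lam e + \<epsilon>0 \<Longrightarrow> u y + \<eta> < r \<Longrightarrow> r < u (refl_at e c y)
      \<Longrightarrow> lam e + \<epsilon>0 \<le> cen r (refl_at e c y)"
proof -
  define y0 where "y0 = (lam e - 1) *\<^sub>R e"
  have y0e: "y0 \<bullet> e = lam e - 1" by (simp add: y0_def inner_ee)
  define \<eta> where "\<eta> = (u (refl_at e (lam e) y0) - u y0) / 4"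
  have \<eta>: "0 < \<eta>" using strict[of "lam e" y0] y0e by (simp add: \<eta>_def)
  define R where "R = norm y0 + 2 + 2 * (\<bar>lam e\<bar> + norm y0 + 2)"
  have R: "norm y0 + 2 \<le> R" "norm y0 + 1 + 2 * (\<bar>lam e\<bar> + norm y0 + 2) \<le> R"
    using norm_ge_zero[of y0] abs_ge_zero[of "lam e"] by (simp_all add: R_def)
  obtain L where L: "1 \<le> L" "\<And>x y. norm x \<le> R \<Longrightarrow> norm y \<le> R \<Longrightarrow> \<bar>u x - u y\<bar> \<le> L * norm (x - y)"
    by (rule local_lipschitz[of R]) (rule that)
  \<comment> \<open>A distance over which u varies by at most \<eta>; a quarter of it serves both as
    the ball radius and as the range of planes.\<close>
  define s' where "s' = min 1 (\<eta> / L)"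
  have s': "0 < s'" "s' \<le> 1" "L * s' \<le> \<eta>" 
  proof -
    have "s' \<le> \<eta> / L" by (simp add: s'_def)
    then have "s' * L \<le> \<eta>" using L(1) by (subst (asm) pos_le_divide_eq) auto
    then show "L * s' \<le> \<eta>" by (simp only: mult.commute)
    show "0 < s'" "s' \<le> 1" using \<eta> L(1) by (simp_all add: s'_def)
  qed
  define \<rho>0 where "\<rho>0 = s' / 4"
  have \<rho>0: "0 < \<rho>0" "\<rho>0 \<le> 1 / 4" "L * (4 * \<rho>0) \<le> \<eta>" using s' 
  proof -
    show "0 < \<rho>0" "\<rho>0 \<le> 1 / 4" using s' unfolding \<rho>0_def by linarith+
    have "4 * \<rho>0 = s'" by (simp add: \<rho>0_def)
    then show "L * (4 * \<rho>0) \<le> \<eta>" using s' by simp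
  qed
  have yn: "norm y \<le> norm y0 + 1" "\<bar>y \<bullet> e - y0 \<bullet> e\<bar> \<le> \<rho>0" "norm (y - y0) \<le> \<rho>0" if "y \<in> ball y0 \<rho>0" for y
  proof -
    show d: "norm (y - y0) \<le> \<rho>0" using that by (simp add: dist_norm norm_minus_commute)
    show "norm y \<le> norm y0 + 1" using norm_triangle_sub[of y y0] d \<rho>0 by linarith
    show "\<bar>y \<bullet> e - y0 \<bullet> e\<bar> \<le> \<rho>0" using Cauchy_Schwarz_ineq2[of "y - y0" e] norm_e d by (simp add: inner_diff_left)
  qed
  have rn: "norm (refl_at e c y) \<le> R" if "norm y \<le> norm y0 + 1" "lam e \<le> c" "c < lam e + \<rho>0" for c y
  proof -
    have "\<bar>y \<bullet> e\<bar> \<le> norm y" using Cauchy_Schwarz_ineq2[of y e] norm_e by simp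
    moreover have "\<bar>c\<bar> \<le> \<bar>lam e\<bar> + 1" using that(2,3) \<rho>0(2) by linarith
    ultimately have b: "\<bar>c - y \<bullet> e\<bar> \<le> \<bar>lam e\<bar> + norm y0 + 2"
      using that(1) abs_triangle_ineq4[of c "y \<bullet> e"] by linarith
    have "norm (refl_at e c y) \<le> norm y + 2 * \<bar>c - y \<bullet> e\<bar>"
      unfolding refl_at_def using norm_triangle_ineq[of y "(2 * (c - y \<bullet> e)) *\<^sub>R e"] norm_e
      by (simp only: norm_scaleR abs_mult abs_numeral mult_1_right)
    also have "\<dots> \<le> (norm y0 + 1) + 2 * (\<bar>lam e\<bar> + norm y0 + 2)"
      using that(1) b by (intro add_mono mult_left_mono) auto
    also note R(2)
    finally show ?thesis .
  qed
  show ?thesis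
  proof (rule that[of \<rho>0 \<eta> \<rho>0 y0])
    show "y \<bullet> e \<le> lam e - 1 / 2" if "y \<in> ball y0 \<rho>0" for y
      using abs_le_D1[OF yn(2)[OF that]] \<rho>0 y0e by linarith
    show "u y + 2 * \<eta> \<le> u (refl_at e c y)" if y: "y \<in> ball y0 \<rho>0" and c: "lam e \<le> c" "c < lam e + \<rho>0" for c y
    proof -
      have "\<bar>u y - u y0\<bar> \<le> L * norm (y - y0)"
        using yn(1)[OF y] R(1) norm_ge_zero[of y0] by (intro L(2)) linarith+
      then have 1: "u y \<le> u y0 + L * \<rho>0" using mult_left_mono[OF yn(3)[OF y], of L] L(1) by linarith
      have "refl_at e c y - refl_at e (lam e) y0 = (refl_at e c y - refl_at e c y0) + (2 * (c - lam e)) *\<^sub>R e"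
        by (simp add: refl_at_def algebra_simps)
      then have "norm (refl_at e c y - refl_at e (lam e) y0) \<le> norm (refl_at e c y - refl_at e c y0) + norm ((2 * (c - lam e)) *\<^sub>R e)"
        by (simp only: norm_triangle_ineq)
      also have "\<dots> \<le> \<rho>0 + 2 * \<rho>0"
        using yn(3)[OF y] norm_refl_at_diff[OF norm_e, of c y y0] c norm_e by simp
      finally have "norm (refl_at e c y - refl_at e (lam e) y0) \<le> 3 * \<rho>0" by simp
      moreover have "\<bar>u (refl_at e c y) - u (refl_at e (lam e) y0)\<bar> \<le> L * norm (refl_at e c y - refl_at e (lam e) y0)"
        using rn[OF yn(1)[OF y] c] rn[of y0 "lam e"] \<rho>0(1) by (intro L(2)) simp_all
      ultimately have "u (refl_at e (lam e) y0) - L * (3 * \<rho>0) \<le> u (refl_at e c y)"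
        using mult_left_mono[of "norm (refl_at e c y - refl_at e (lam e) y0)" "3 * \<rho>0" L] L(1) by linarith
      moreover have "u (refl_at e (lam e) y0) = u y0 + 4 * \<eta>" by (simp add: \<eta>_def field_simps)
      ultimately show ?thesis using 1 \<rho>0(3) \<eta> by linarith
    qed
    show "lam e + \<rho>0 \<le> cen r (refl_at e c y)"
      if y: "y \<in> ball y0 \<rho>0" and c: "lam e \<le> c" "c < lam e + \<rho>0" and r: "u y + \<eta> < r" "r < u (refl_at e c y)" for c y r
    proof -
      let ?z = "refl_at e c y" and ?k = "c - y \<bullet> e"
      have r0: "0 < r" using r(1) u_pos[of y] \<eta> by linarith
      have k: "1 / 2 \<le> ?k" using abs_le_D1[OF yn(2)[OF y]] \<rho>0 y0e c by linarith
      \<comment> \<open>Going left from the mirror image, the point s' to the right of y has u at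
        most u(y) + \<eta>, so the component ends before it; this shifts the centre to at least c +
        s'/2.\<close>
      have eq: "?z + (2 * ?k - s') *\<^sub>R (- e) = y + s' *\<^sub>R e" by (simp add: refl_at_def algebra_simps)
      have "\<bar>u (y + s' *\<^sub>R e) - u y\<bar> \<le> L * norm (s' *\<^sub>R e)"
      proof -
        have "norm (s' *\<^sub>R e) \<le> 1" using s' norm_e by simp
        then have "norm (y + s' *\<^sub>R e) \<le> R" "norm y \<le> R"
          using yn(1)[OF y] R(1) norm_triangle_ineq[of y "s' *\<^sub>R e"] by linarith+
        from L(2)[OF this] show ?thesis by simp
      qed
      moreover have "L * norm (s' *\<^sub>R e) \<le> \<eta>" using s' norm_e by simp
      ultimately have "u (?z + (2 * ?k - s') *\<^sub>R (- e)) \<le> r" unfolding eq using r(1) by linarith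
      moreover have "0 \<le> 2 * ?k - s'" using order_trans[OF s'(2), of "2 * ?k"] mult_left_mono[OF k, of 2] by simp
      ultimately have "ll r ?z \<le> 2 * ?k - s'" unfolding ll_def by (intro ret_upperI)
      moreover have "0 \<le> rr r ?z" unfolding rr_def by (rule ret_nonneg[OF norm_e r0])
      moreover have "?z \<bullet> e = 2 * c - y \<bullet> e" by (rule refl_at_inner[OF norm_e])
      ultimately have "c + s' / 2 \<le> cen r ?z" by (simp add: cen_def field_simps)
      then show ?thesis using c(1) s'(1) by (simp add: \<rho>0_def)
    qed
  qed (use \<rho>0 \<eta> in auto)
qed

end

section \<open>Bounds at critical points\<close>

lemma Gp_shift_le:
  assumes "1 < p" "p < 2" "0 < r" shows "Gp p t - Gp p (t - r) \<le> 2 * r powr (p - 1)"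
proof -
  have sub: "b powr (p - 1) \<le> a powr (p - 1) + (b - a) powr (p - 1)" if "0 \<le> a" "a \<le> b" for a b :: real
  proof (cases "b = 0")
    case False
    have b: "0 < b" using False that by linarith
    have x: "x * b powr (p - 2) \<le> x powr (p - 1)" if "0 \<le> x" "x \<le> b" for x
    proof (cases "x = 0")
      case False
      have "x * b powr (p - 2) \<le> x * x powr (p - 2)"
        using that False assms by (intro mult_left_mono powr_mono2') auto
      also have "\<dots> = x powr (p - 1)" using powr_mult_base[of x "p - 2"] that by simp
      finally show ?thesis .
    qed simp
    have "b powr (p - 1) = a * b powr (p - 2) + (b - a) * b powr (p - 2)"
      using powr_mult_base[of b "p - 2"] b by (simp add: algebra_simps)
    then show ?thesis using x[of a] x[of "b - a"] that by simp
  qed (use that in simp)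
  have r0: "0 \<le> r powr (p - 1)" by simp
  consider "r \<le> t" | "t \<le> 0" | "0 < t" "t < r" by linarith
  then show ?thesis
  proof cases
    case 1
    then have eq: "Gp p t = t powr (p - 1)" "Gp p (t - r) = (t - r) powr (p - 1)"
      using assms by (simp_all add: Gp_nonneg_eq)
    have "t powr (p - 1) \<le> (t - r) powr (p - 1) + r powr (p - 1)" using sub[of "t - r" t] 1 assms by simp
    then show ?thesis unfolding eq using r0 by linarith
  next
    case 2
    have "Gp p t = - ((- t) powr (p - 1))" and "Gp p (t - r) = - ((r - t) powr (p - 1))"
      using Gp_nonneg_eq[of "- t" p] Gp_nonneg_eq[of "r - t" p] Gp_minus[of p "- t"] Gp_minus[of p "r - t"] 2 assms by auto
    moreover have "(r - t) powr (p - 1) \<le> (- t) powr (p - 1) + r powr (p - 1)"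
      using sub[of "- t" "r - t"] 2 assms by simp
    ultimately show ?thesis using r0 by linarith
  next
    case 3
    have "Gp p (t - r) = - ((r - t) powr (p - 1))"
      using Gp_nonneg_eq[of "r - t" p] Gp_minus[of p "r - t"] 3 by auto
    moreover have "t powr (p - 1) \<le> r powr (p - 1)" "(r - t) powr (p - 1) \<le> r powr (p - 1)"
      using 3 assms by (auto intro!: powr_mono2)
    ultimately show ?thesis using 3 by (simp add: Gp_nonneg_eq)
  qed
qed

text \<open>The bound is uniform in b, that is, in the position of the singularity on the
  line.\<close>

lemma nn_integral_line_powr_le:
  assumes "1 < p" "p < 2" "0 < r" "k \<noteq> 0"
  shows "(\<integral>\<^sup>+s. indicator {0..r} s * ennreal (\<bar>b + s * k\<bar> powr (p - 2)) \<partial>lborel)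
    \<le> ennreal (\<bar>k\<bar> powr (p - 2) * (2 / (p - 1) * r powr (p - 1)))"
proof -
  define c where "c = \<bar>k\<bar> powr (p - 2) / (p - 1)"
  have c: "0 \<le> c" using assms by (simp add: c_def)
  let ?f = "\<lambda>s. (p - 1) * \<bar>- (b / k) - s\<bar> powr (p - 2)"
  have eq: "\<bar>b + s * k\<bar> powr (p - 2) = c * ?f s" for s
  proof -
    have "\<bar>b + s * k\<bar> = \<bar>k\<bar> * \<bar>- (b / k) - s\<bar>"
      using assms(4) by (simp add: abs_mult[symmetric] field_simps)
    then have "\<bar>b + s * k\<bar> powr (p - 2) = \<bar>k\<bar> powr (p - 2) * \<bar>- (b / k) - s\<bar> powr (p - 2)"
      using assms(4) by (simp add: powr_mult)
    then show ?thesis using assms(1) by (simp add: c_def)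
  qed
  note I = Gp_layer_integral[OF assms(1), of 0 r "- (b / k)", unfolded set_integrable_def set_lebesgue_integral_def real_scaleR_def]
  have "(\<integral>\<^sup>+s. indicator {0..r} s * ennreal (\<bar>b + s * k\<bar> powr (p - 2)) \<partial>lborel) = (\<integral>\<^sup>+s. ennreal (c * (indicator {0..r} s * ?f s)) \<partial>lborel)"
    unfolding eq by (intro nn_integral_cong) (auto simp: indicator_def)
  also have "\<dots> = ennreal (\<integral>s. c * (indicator {0..r} s * ?f s) \<partial>lborel)"
    using I(1) assms c by (intro nn_integral_eq_integral) auto
  also have "(\<integral>s. c * (indicator {0..r} s * ?f s) \<partial>lborel) = c * (Gp p (- (b / k) - 0) - Gp p (- (b / k) - r))"
    using I(2) assms(3) by simp
  also have "ennreal \<dots> \<le> ennreal (c * (2 * r powr (p - 1)))"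
    using Gp_shift_le[OF assms(1-3), of "- (b / k)"] c by (intro ennreal_leI mult_left_mono) auto
  finally show ?thesis by (simp add: c_def mult_ac)
qed

text \<open>The integrand is singular on a hyperplane transversal to e. Averaging over translations
  by s in [0,r] along e enlarges the ball only to radius 2r and reduces the singularity to a
  one-dimensional integral, so no rotated coordinates are needed. The dependence on v is only
  through its component along e.\<close>

lemma nn_integral_ball_inner_powr:
  fixes e v :: "'a::euclidean_space"
  assumes p: "1 < p" "p < 2" and e: "norm e = 1" and v: "v \<bullet> e \<noteq> 0" and r: "0 < r"
  shows "(\<integral>\<^sup>+y. ennreal (\<bar>v \<bullet> y\<bar> powr (p - 2)) * indicator (ball 0 r) y \<partial>lborel)
    \<le> ennreal (2 / (p - 1) * (measure lborel (ball (0::'a) 1) * 2 ^ DIM('a)) * \<bar>v \<bullet> e\<bar> powr (p - 2) * r powr (real DIM('a) + p - 2))"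
proof -
  let ?F = "\<lambda>y. ennreal (\<bar>v \<bullet> y\<bar> powr (p - 2))"
  define I where "I = (\<integral>\<^sup>+y. ?F y * indicator (ball 0 r) y \<partial>lborel)"
  define k where "k = \<bar>v \<bullet> e\<bar> powr (p - 2) * (2 / (p - 1) * r powr (p - 1))"
  have k0: "0 \<le> k" using p by (simp add: k_def)
  have le: "I \<le> (\<integral>\<^sup>+y. ?F (y + s *\<^sub>R e) * indicator (ball 0 (2 * r)) y \<partial>lborel)" if s: "s \<in> {0..r}" for s
  proof -
    have "I = (\<integral>\<^sup>+y. ?F (y + s *\<^sub>R e) * indicator (ball 0 r) (y + s *\<^sub>R e) \<partial>lborel)"
      unfolding I_def by (rule nn_integral_lborel_translate[symmetric]) measurable
    also have "\<dots> \<le> (\<integral>\<^sup>+y. ?F (y + s *\<^sub>R e) * indicator (ball 0 (2 * r)) y \<partial>lborel)"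
    proof (intro nn_integral_mono mult_left_mono)
      fix y
      have "norm y \<le> norm (y + s *\<^sub>R e) + s" using norm_triangle_ineq4[of "y + s *\<^sub>R e" "s *\<^sub>R e"] e s by simp
      then show "(indicator (ball 0 r) (y + s *\<^sub>R e) :: ennreal) \<le> indicator (ball 0 (2 * r)) y"
        using s by (auto simp: indicator_def)
    qed simp
    finally show ?thesis .
  qed
  have "ennreal r * I = (\<integral>\<^sup>+s. I * indicator {0..r} s \<partial>lborel)"
    using r by (subst nn_integral_cmult_indicator) (auto simp: mult.commute)
  also have "\<dots> \<le> (\<integral>\<^sup>+s. (\<integral>\<^sup>+y. indicator {0..r} s * (?F (y + s *\<^sub>R e) * indicator (ball 0 (2 * r)) y) \<partial>lborel) \<partial>lborel)"
  proof (rule nn_integral_mono)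
    fix s :: real
    have "I * indicator {0..r} s \<le> indicator {0..r} s * (\<integral>\<^sup>+y. ?F (y + s *\<^sub>R e) * indicator (ball 0 (2 * r)) y \<partial>lborel)"
      using le[of s] by (auto simp: indicator_def)
    also have "\<dots> = (\<integral>\<^sup>+y. indicator {0..r} s * (?F (y + s *\<^sub>R e) * indicator (ball 0 (2 * r)) y) \<partial>lborel)"
      by (rule nn_integral_cmult[symmetric]) measurable
    finally show "I * indicator {0..r} s \<le> (\<integral>\<^sup>+y. indicator {0..r} s * (?F (y + s *\<^sub>R e) * indicator (ball 0 (2 * r)) y) \<partial>lborel)" .
  qed
  also have "\<dots> = (\<integral>\<^sup>+y. (\<integral>\<^sup>+s. indicator {0..r} s * (?F (y + s *\<^sub>R e) * indicator (ball 0 (2 * r)) y) \<partial>lborel) \<partial>lborel)"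
    by (rule lborel_pair.Fubini') measurable
  also have "\<dots> \<le> (\<integral>\<^sup>+y. ennreal k * indicator (ball (0::'a) (2 * r)) y \<partial>lborel)"
  proof (rule nn_integral_mono)
    fix y
    have "(\<integral>\<^sup>+s. indicator {0..r} s * (?F (y + s *\<^sub>R e) * indicator (ball 0 (2 * r)) y) \<partial>lborel)
        = (\<integral>\<^sup>+s. (indicator {0..r} s * ennreal (\<bar>v \<bullet> y + s * (v \<bullet> e)\<bar> powr (p - 2))) * indicator (ball 0 (2 * r)) y \<partial>lborel)"
      by (simp add: inner_add_right mult.assoc)
    also have "\<dots> = (\<integral>\<^sup>+s. indicator {0..r} s * ennreal (\<bar>v \<bullet> y + s * (v \<bullet> e)\<bar> powr (p - 2)) \<partial>lborel) * indicator (ball 0 (2 * r)) y"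
      by (rule nn_integral_multc) measurable
    also have "\<dots> \<le> ennreal k * indicator (ball 0 (2 * r)) y"
      unfolding k_def by (intro mult_right_mono nn_integral_line_powr_le p r v) simp
    finally show "(\<integral>\<^sup>+s. indicator {0..r} s * (?F (y + s *\<^sub>R e) * indicator (ball 0 (2 * r)) y) \<partial>lborel) \<le> ennreal k * indicator (ball 0 (2 * r)) y" .
  qed
  also have "\<dots> = ennreal k * (\<integral>\<^sup>+y. 1 * indicator (ball (0::'a) (2 * r)) y \<partial>lborel)"
    by (subst nn_integral_cmult) auto
  also have "\<dots> \<le> ennreal k * ennreal (measure lborel (ball (0::'a) 1) * (2 * r) powr DIM('a))"
    using r by (intro mult_left_mono nn_integral_ball_le) auto
  also have "\<dots> = ennreal (k * (measure lborel (ball (0::'a) 1) * (2 * r) powr DIM('a)))"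
    using k0 by (simp add: ennreal_mult'[symmetric])
  finally have 1: "ennreal r * I \<le> ennreal (k * (measure lborel (ball (0::'a) 1) * (2 * r) powr DIM('a)))" .
  have "I = ennreal (1 / r) * (ennreal r * I)"
    using r by (simp add: mult.assoc[symmetric] ennreal_mult''[symmetric])
  also have "\<dots> \<le> ennreal (1 / r) * ennreal (k * (measure lborel (ball (0::'a) 1) * (2 * r) powr DIM('a)))"
    by (rule mult_left_mono[OF 1]) simp
  also have "\<dots> = ennreal (1 / r * (k * (measure lborel (ball (0::'a) 1) * (2 * r) powr DIM('a))))"
    using k0 r by (intro ennreal_mult[symmetric] mult_nonneg_nonneg) auto
  also have "1 / r * (k * (measure lborel (ball (0::'a) 1) * (2 * r) powr DIM('a))) =
     2 / (p - 1) * (measure lborel (ball (0::'a) 1) * 2 ^ DIM('a)) * \<bar>v \<bullet> e\<bar> powr (p - 2) * (r powr (p - 1) * r powr DIM('a) * r powr (- 1))"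
    using r by (simp add: k_def powr_mult powr_realpow powr_minus_divide mult_ac)
  also have "r powr (p - 1) * r powr DIM('a) * r powr (- 1) = r powr (real DIM('a) + p - 2)"
    by (simp only: powr_add[symmetric]) (simp add: algebra_simps)
  finally show ?thesis by (simp add: I_def)
qed

lemma AE_inner_nonzero:
  fixes v :: "'a::euclidean_space"
  assumes "v \<noteq> 0" shows "AE z in lborel. v \<bullet> z \<noteq> 0"
proof -
  have "negligible {z. v \<bullet> z = 0}" by (rule negligible_hyperplane) (use assms in simp)
  then have "{z. v \<bullet> z = 0} \<in> null_sets lebesgue" by (simp add: negligible_iff_null_sets)
  then have "{z. v \<bullet> z = 0} \<in> null_sets lborel"
    by (subst (asm) null_sets_completion_iff) auto
  then show ?thesis by (rule AE_I') auto
qed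

context frac_p_solution begin

text \<open>Averaging z with -z removes the first-order Taylor term, which cannot be bounded
  absolutely uniformly in \<epsilon>. The gained factor 1/2 is given away.\<close>

lemma abs_h_le:
  assumes \<epsilon>: "0 < \<epsilon>"
  shows "ennreal \<bar>h \<epsilon> x\<bar> \<le> (\<integral>\<^sup>+z. ennreal (\<bar>Gp p (u x - u (x + z)) - Gp p (u (x - z) - u x)\<bar> * ker N \<epsilon> z) \<partial>lborel)"
proof -
  let ?a = "\<lambda>z. Gp p (u x - u (x + z)) * ker N \<epsilon> z"
  let ?b = "\<lambda>z. Gp p (u (x - z) - u x) * ker N \<epsilon> z"
  let ?f = "\<lambda>y. Gp p (u x - u y) * ker N \<epsilon> (x - y)"
  have i1: "integrable lborel ?a" and e1: "(\<integral>z. ?a z \<partial>lborel) = h \<epsilon> x"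
    using integrable_lborel_translate[OF h_integrable[OF \<epsilon>, of x], of x] integral_lborel_translate[of ?f x]
    by (simp_all add: add.commute h_def)
  have m: "- ?a (- z) = ?b z" for z
  proof -
    have "Gp p (u (x - z) - u x) = - Gp p (u x - u (x - z))" using Gp_minus[of p "u x - u (x - z)"] by simp
    then show ?thesis by simp
  qed
  have i2: "integrable lborel ?b" and e2: "(\<integral>z. ?b z \<partial>lborel) = - h \<epsilon> x"
    using Bochner_Integration.integrable_minus[OF integrable_lborel_uminus[OF i1]] integral_lborel_uminus[of ?a] e1
    unfolding m[symmetric] by simp_all
  have "2 * h \<epsilon> x = (\<integral>z. ?a z - ?b z \<partial>lborel)"
    by (subst Bochner_Integration.integral_diff[OF i1 i2]) (simp add: e1 e2)
  then have "\<bar>2 * h \<epsilon> x\<bar> \<le> (\<integral>z. \<bar>?a z - ?b z\<bar> \<partial>lborel)" by simp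
  moreover have "\<bar>h \<epsilon> x\<bar> \<le> \<bar>2 * h \<epsilon> x\<bar>" by simp
  ultimately have "ennreal \<bar>h \<epsilon> x\<bar> \<le> ennreal (\<integral>z. \<bar>?a z - ?b z\<bar> \<partial>lborel)" by (intro ennreal_leI) linarith
  also have "\<dots> = (\<integral>\<^sup>+z. ennreal \<bar>?a z - ?b z\<bar> \<partial>lborel)"
    using Bochner_Integration.integrable_diff[OF i1 i2] by (intro nn_integral_eq_integral[symmetric]) auto
  also have "\<dots> = (\<integral>\<^sup>+z. ennreal (\<bar>Gp p (u x - u (x + z)) - Gp p (u (x - z) - u x)\<bar> * ker N \<epsilon> z) \<partial>lborel)"
  proof -
    have "\<bar>ker N \<epsilon> z\<bar> = ker N \<epsilon> z" for z :: 'a using ker_pos[OF \<epsilon>, of N z] by simp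
    then show ?thesis by (simp only: left_diff_distrib[symmetric] abs_mult)
  qed
  finally show ?thesis .
qed

lemma taylor:
  assumes L: "0 \<le> L" "\<And>x y. norm x \<le> R + 1 \<Longrightarrow> norm y \<le> R + 1 \<Longrightarrow> norm (Du x - Du y) \<le> L * norm (x - y)"
    and x: "norm x \<le> R" and z: "norm z \<le> 1"
  shows "\<bar>u (x + z) - u x - Du x \<bullet> z\<bar> \<le> L * (norm z)\<^sup>2"
proof -
  have "norm ((\<lambda>y. u y - Du x \<bullet> y) (x + z) - (\<lambda>y. u y - Du x \<bullet> y) x) \<le> L * norm z * norm (x + z - x)"
  proof (rule differentiable_bound[of "cball x (norm z)" _ "\<lambda>y h. (Du y - Du x) \<bullet> h"])
    show "((\<lambda>y. u y - Du x \<bullet> y) has_derivative (\<lambda>h. (Du y - Du x) \<bullet> h)) (at y within cball x (norm z))" for y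
      unfolding inner_diff_left by (intro has_derivative_diff u_deriv) (auto intro!: derivative_eq_intros)
    show "onorm (\<lambda>h. (Du y - Du x) \<bullet> h) \<le> L * norm z" if "y \<in> cball x (norm z)" for y
    proof (rule onorm_inner_le)
      have d: "norm (y - x) \<le> norm z" using that by (simp add: dist_norm norm_minus_commute)
      have "norm y \<le> R + 1" using norm_triangle_sub[of y x] d x z by linarith
      then have "norm (Du y - Du x) \<le> L * norm (y - x)" using x by (intro L(2)) auto
      then show "norm (Du y - Du x) \<le> L * norm z" using mult_left_mono[OF d L(1)] by linarith
    qed
  qed (auto simp: dist_norm)
  then show ?thesis by (simp add: inner_add_right power2_eq_square mult.assoc algebra_simps)
qed

text \<open>For p at least 2 the second-order cancellation bounds \<open>h\<close> itself. For p < 2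
  the bound for \<open>h\<close> contains |Du x . e|^(p-2), unbounded at critical points;
  multiplying by the slope leaves the positive power p - 1. Only the slope along e occurs, because
  it is the one whose inverse is integrable at the ends of components.\<close>

lemma h_times_slope_bounded:
  assumes e: "norm e = 1"
  obtains CH where "0 \<le> CH" "\<And>\<epsilon> x. 0 < \<epsilon> \<Longrightarrow> norm x \<le> R \<Longrightarrow> \<bar>h \<epsilon> x\<bar> * \<bar>Du x \<bullet> e\<bar> \<le> CH"
proof -
  obtain L where L: "1 \<le> L" "\<And>x y. norm x \<le> R + 1 \<Longrightarrow> norm y \<le> R + 1 \<Longrightarrow> norm (Du x - Du y) \<le> L * norm (x - y)"
    "\<And>x. norm x \<le> R + 1 \<Longrightarrow> norm (Du x) \<le> L"
    "\<And>x y. norm x \<le> R + 1 \<Longrightarrow> norm y \<le> R + 1 \<Longrightarrow> \<bar>u x - u y\<bar> \<le> L * norm (x - y)"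
    using local_lipschitz[of "R + 1"] by blast
  have slope: "\<bar>Du x \<bullet> e\<bar> \<le> L" if "norm x \<le> R" for x
    using Cauchy_Schwarz_ineq2[of "Du x" e] L(3)[of x] that e by simp
  define U where "U = 2 * umax powr (p - 1)"
  have U0: "0 \<le> U" by (simp add: U_def)
  let ?X = "\<lambda>x z. \<bar>Gp p (u x - u (x + z)) - Gp p (u (x - z) - u x)\<bar>"
  have X_U: "?X x z \<le> U" for x z
    using abs_Gp_u_le[OF abs_u_diff_le[of x "x + z"]] abs_Gp_u_le[OF abs_u_diff_le[of "x - z" x]]
      abs_triangle_ineq4[of "Gp p (u x - u (x + z))" "Gp p (u (x - z) - u x)"] by (simp add: U_def)
  have far: "?X x z * ker N \<epsilon> z \<le> U * norm z powr (- N)" if "1 \<le> norm z" "0 < \<epsilon>" for x z \<epsilon>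
  proof -
    have "z \<noteq> 0" using that by auto
    then show ?thesis
      using X_U[of x z] ker_le_powr[of \<epsilon> N z] N_pos that ker_pos[of \<epsilon> N z] U0 by (intro mult_mono) auto
  qed
  have near: "\<bar>(u x - u (x + z)) - (- (Du x \<bullet> z))\<bar> \<le> L * (norm z)\<^sup>2" "\<bar>(u (x - z) - u x) - (- (Du x \<bullet> z))\<bar> \<le> L * (norm z)\<^sup>2"
    if "norm x \<le> R" "norm z \<le> 1" for x z
    using taylor[OF _ L(2) that(1), of z] taylor[OF _ L(2) that(1), of "- z"] that L(1) by (auto simp: abs_minus_commute algebra_simps)
  have close: "norm (x + z) \<le> R + 1" "norm (x - z) \<le> R + 1" "norm x \<le> R + 1" if "norm x \<le> R" "norm z \<le> 1" for x z
    using norm_triangle_ineq[of x z] norm_triangle_ineq4[of x z] that by linarith+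
  show ?thesis
  proof (cases "2 \<le> p")
    case True
    define B where "B = U + (p - 1) * L powr (p - 2) * (2 * L)"
    have B: "0 \<le> (p - 1) * L powr (p - 2) * (2 * L)" "U \<le> B" "0 \<le> B" using L(1) p_gt_1 U0 by (auto simp: B_def)
    \<comment> \<open>This is sp < p, and the first place where s < 1 gives integrability at the
      origin.\<close>
    have sp: "N - p < real DIM('a)" using s_less_1 p_gt_1 by (simp add: N_def algebra_simps)
    have iK: "integrable lborel (K0 (N - p) N :: 'a \<Rightarrow> real)" by (rule integrable_K0[OF sp N_gt])
    have ptw: "?X x z * ker N \<epsilon> z \<le> B * K0 (N - p) N z" if "norm x \<le> R" "0 < \<epsilon>" for x z \<epsilon>
    proof (cases "norm z < 1")
      case False
      have "U * norm z powr (- N) \<le> B * norm z powr (- N)" using B by (intro mult_right_mono) auto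
      then show ?thesis using far[of z \<epsilon> x] that False by (simp add: K0_def)
    next
      case z: True
      show ?thesis
      proof (cases "z = 0")
        case False
        have nz: "0 < norm z" using False by simp
        have "?X x z \<le> (p - 1) * (L * norm z) powr (p - 2) * \<bar>(u x - u (x + z)) - (u (x - z) - u x)\<bar>"
          using L(4)[of x "x + z"] L(4)[of "x - z" x] close[OF that(1), of z] z by (intro Gp_diff_le_ge2[OF True]) auto
        also have "\<dots> \<le> (p - 1) * (L * norm z) powr (p - 2) * (2 * L * (norm z)\<^sup>2)"
          using near[OF that(1), of z] z p_gt_1 by (intro mult_left_mono) (auto simp: abs_le_iff)
        also have "\<dots> = (p - 1) * L powr (p - 2) * (2 * L) * (norm z powr (p - 2) * norm z powr 2)"
          using L(1) nz by (simp add: powr_mult powr_numeral)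
        also have "norm z powr (p - 2) * norm z powr 2 = norm z powr p" by (simp only: powr_add[symmetric]) simp
        finally have "?X x z * ker N \<epsilon> z \<le> ((p - 1) * L powr (p - 2) * (2 * L) * norm z powr p) * norm z powr (- N)"
          using ker_le_powr[of \<epsilon> N z] N_pos that ker_pos[of \<epsilon> N z] False B(1) by (intro mult_mono) auto
        also have "\<dots> = ((p - 1) * L powr (p - 2) * (2 * L)) * norm z powr (- (N - p))"
          by (simp only: powr_add[symmetric] mult.assoc) simp
        also have "\<dots> \<le> B * norm z powr (- (N - p))" using U0 by (intro mult_right_mono) (auto simp: B_def)
        finally show ?thesis using z by (simp add: K0_def)
      qed (simp add: K0_def B)
    qed
    have hb: "\<bar>h \<epsilon> x\<bar> \<le> B * (\<integral>z. K0 (N - p) N (z::'a) \<partial>lborel)" if "norm x \<le> R" "0 < \<epsilon>" for x \<epsilon>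
    proof -
      have K0nn: "0 \<le> K0 (N - p) N z" for z :: 'a by (simp add: K0_def)
      have "ennreal \<bar>h \<epsilon> x\<bar> \<le> (\<integral>\<^sup>+z. ennreal (B * K0 (N - p) N (z::'a)) \<partial>lborel)"
        using ptw[OF that] by (intro order_trans[OF abs_h_le[OF that(2)]] nn_integral_mono ennreal_leI)
      also have "\<dots> = ennreal (B * (\<integral>z. K0 (N - p) N (z::'a) \<partial>lborel))"
        using iK B K0nn by (subst nn_integral_eq_integral) auto
      finally show ?thesis using B K0nn by (subst (asm) ennreal_le_iff) (auto intro!: mult_nonneg_nonneg Bochner_Integration.integral_nonneg)
    qed
    show ?thesis
    proof (rule that[of "\<bar>B * (\<integral>z. K0 (N - p) N (z::'a) \<partial>lborel)\<bar> * L"])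
      show "\<bar>h \<epsilon> x\<bar> * \<bar>Du x \<bullet> e\<bar> \<le> \<bar>B * (\<integral>z. K0 (N - p) N (z::'a) \<partial>lborel)\<bar> * L" if "0 < \<epsilon>" "norm x \<le> R" for \<epsilon> x
        using hb[OF that(2,1)] slope[OF that(2)] by (intro mult_mono order_trans[OF hb[OF that(2,1)] abs_ge_self]) auto
    qed (use L in auto)
  next
    case False
    then have p2: "p < 2" by simp
    \<comment> \<open>The growth exponent from \<open>nn_integral_ball_inner_powr\<close>; against
      |z|^(-(N-2)), left over from the kernel and the quadratic Taylor remainder, the requirement N
      - 2 < a is again s < 1.\<close>
    define a where "a = real DIM('a) + p - 2"
    define c where "c = 2 / (p - 1) * (measure lborel (ball (0::'a) 1) * 2 ^ DIM('a))"
    have c0: "0 \<le> c" using p_gt_1 by (simp add: c_def)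
    have ga: "N - 2 < a" using s_less_1 p_gt_1 by (simp add: N_def a_def algebra_simps)
    define k where "k = 12 * L * (c * 2 powr \<bar>N - 2\<bar> / (1 - 2 powr (N - 2 - a)))"
    have den: "0 < 1 - 2 powr (N - 2 - a)" using ga powr_less_mono[of "N - 2 - a" 0 "2::real"] by simp
    have k0: "0 \<le> k" using L(1) c0 den unfolding k_def by (intro mult_nonneg_nonneg divide_nonneg_pos) auto
    obtain Y where Y: "0 \<le> Y" "(\<integral>\<^sup>+x. ennreal (norm x powr (- N)) * indicator {x::'a. 1 \<le> norm x} x \<partial>lborel) = ennreal Y"
    proof
      show "(\<integral>\<^sup>+x. ennreal (norm x powr (- N)) * indicator {x::'a. 1 \<le> norm x} x \<partial>lborel) =
          ennreal (enn2real (\<integral>\<^sup>+x. ennreal (norm x powr (- N)) * indicator {x::'a. 1 \<le> norm x} x \<partial>lborel))"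
        by (rule ennreal_enn2real[symmetric]) (use nn_integral_norm_powr_outside[OF N_gt] in \<open>simp only: infinity_ennreal_def\<close>)
    qed simp
    have hb: "ennreal \<bar>h \<epsilon> x\<bar> \<le> ennreal (k * \<bar>Du x \<bullet> e\<bar> powr (p - 2) + U * Y)"
      if x: "norm x \<le> R" and \<epsilon>: "0 < \<epsilon>" and ne: "Du x \<bullet> e \<noteq> 0" for x \<epsilon>
    proof -
      define v where "v = Du x"
      have v0: "v \<noteq> 0" using ne by (auto simp: v_def)
      let ?F = "\<lambda>z. (ennreal (\<bar>v \<bullet> z\<bar> powr (p - 2)) * ennreal (norm z powr (- (N - 2)))) * indicator (ball 0 1) z"
      let ?G = "\<lambda>z::'a. ennreal (norm z powr (- N)) * indicator {x. 1 \<le> norm x} z"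
      have F: "(\<integral>\<^sup>+z. ?F z \<partial>lborel) \<le> ennreal ((c * \<bar>v \<bullet> e\<bar> powr (p - 2)) * 2 powr \<bar>N - 2\<bar> / (1 - 2 powr (N - 2 - a)))"
      proof (rule nn_integral_ball_powr[OF _ ga])
        fix r :: real assume "0 < r" "r \<le> 1"
        show "(\<integral>\<^sup>+z. ennreal (\<bar>v \<bullet> z\<bar> powr (p - 2)) * indicator (ball 0 r) z \<partial>lborel) \<le> ennreal ((c * \<bar>v \<bullet> e\<bar> powr (p - 2)) * r powr a)"
          using nn_integral_ball_inner_powr[OF p_gt_1 p2 e, of v r] ne \<open>0 < r\<close> unfolding c_def a_def v_def by simp
      qed (use c0 in auto)
      have "ennreal \<bar>h \<epsilon> x\<bar> \<le> (\<integral>\<^sup>+z. ennreal (12 * L) * ?F z + ennreal U * ?G z \<partial>lborel)"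
      proof (rule order_trans[OF abs_h_le[OF \<epsilon>] nn_integral_mono_AE])
        show "AE z in lborel. ennreal (?X x z * ker N \<epsilon> z) \<le> ennreal (12 * L) * ?F z + ennreal U * ?G z"
          using AE_inner_nonzero[OF v0]
        proof eventually_elim
          case (elim z)
          show ?case
          proof (cases "norm z < 1")
            case False
            then show ?thesis using far[of z \<epsilon> x] \<epsilon> U0 by (auto simp: ennreal_mult''[symmetric] intro!: ennreal_leI)
          next
            case True
            have nz: "0 < norm z" using elim by auto
            \<comment> \<open>Both increments differ from -(Du x . z) by at most L|z|^2, which are
              the \<alpha> and E of \<open>Gp_diff_le_lt2\<close>.\<close>
            have "?X x z \<le> 12 * (L * (norm z)\<^sup>2) * \<bar>- (v \<bullet> z)\<bar> powr (p - 2)"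
              using near[OF x, of z] True elim by (intro Gp_diff_le_lt2[OF p_gt_1 p2]) (auto simp: v_def)
            then have "?X x z * ker N \<epsilon> z \<le> (12 * (L * (norm z)\<^sup>2) * \<bar>v \<bullet> z\<bar> powr (p - 2)) * norm z powr (- N)"
              using ker_le_powr[of \<epsilon> N z] N_pos \<epsilon> ker_pos[of \<epsilon> N z] nz L(1) by (intro mult_mono) auto
            also have "\<dots> = (12 * L) * (\<bar>v \<bullet> z\<bar> powr (p - 2) * (norm z powr 2 * norm z powr (- N)))"
              using nz by (simp add: powr_numeral)
            also have "norm z powr 2 * norm z powr (- N) = norm z powr (- (N - 2))" by (simp only: powr_add[symmetric]) simp
            finally have "ennreal (?X x z * ker N \<epsilon> z) \<le> ennreal ((12 * L) * (\<bar>v \<bullet> z\<bar> powr (p - 2) * norm z powr (- (N - 2))))"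
              by (rule ennreal_leI)
            then show ?thesis using True L(1) by (simp add: ennreal_mult' del: minus_diff_eq)
          qed
        qed
      qed
      also have "\<dots> = ennreal (12 * L) * (\<integral>\<^sup>+z. ?F z \<partial>lborel) + ennreal U * (\<integral>\<^sup>+z. ?G z \<partial>lborel)"
        by (subst nn_integral_add) (auto simp: nn_integral_cmult)
      also have "\<dots> \<le> ennreal (12 * L) * ennreal ((c * \<bar>v \<bullet> e\<bar> powr (p - 2)) * 2 powr \<bar>N - 2\<bar> / (1 - 2 powr (N - 2 - a))) + ennreal U * ennreal Y"
        unfolding Y(2) by (intro add_mono mult_left_mono F) auto
      also have "\<dots> = ennreal ((12 * L) * ((c * \<bar>v \<bullet> e\<bar> powr (p - 2)) * 2 powr \<bar>N - 2\<bar> / (1 - 2 powr (N - 2 - a))) + U * Y)"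
        using L(1) U0 Y(1) c0 den by (simp add: ennreal_mult'[symmetric] ennreal_plus[symmetric] del: ennreal_plus)
      also have "(12 * L) * ((c * \<bar>v \<bullet> e\<bar> powr (p - 2)) * 2 powr \<bar>N - 2\<bar> / (1 - 2 powr (N - 2 - a))) = k * \<bar>Du x \<bullet> e\<bar> powr (p - 2)"
        by (simp add: k_def v_def)
      finally show ?thesis .
    qed
    show ?thesis
    proof (rule that[of "k * L powr (p - 1) + U * Y * L"])
      show "\<bar>h \<epsilon> x\<bar> * \<bar>Du x \<bullet> e\<bar> \<le> k * L powr (p - 1) + U * Y * L" if "0 < \<epsilon>" "norm x \<le> R" for \<epsilon> x
      proof (cases "Du x \<bullet> e = 0")
        case False
        let ?d = "\<bar>Du x \<bullet> e\<bar>"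
        have d: "0 < ?d" "?d \<le> L" using False slope[OF that(2)] by auto
        have "\<bar>h \<epsilon> x\<bar> \<le> k * ?d powr (p - 2) + U * Y"
          using hb[OF that(2,1) False] k0 U0 Y(1) by (subst (asm) ennreal_le_iff) auto
        then have "\<bar>h \<epsilon> x\<bar> * ?d \<le> (k * ?d powr (p - 2) + U * Y) * ?d" by (rule mult_right_mono) simp
        also have "\<dots> = k * ?d powr (p - 1) + U * Y * ?d"
          using powr_mult_base[of ?d "p - 2"] by (simp add: algebra_simps)
        also have "\<dots> \<le> k * L powr (p - 1) + U * Y * L"
          using d k0 U0 Y(1) p_gt_1 by (intro add_mono mult_left_mono powr_mono2) auto
        finally show ?thesis .
      qed (use k0 U0 Y L in simp)
    qed (use k0 U0 Y L in simp)
  qed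
qed

end

section \<open>Coarea-type integrability of the inverse slope at the ends of components\<close>

context frac_p_solution begin

lemma ret_antimono:
  assumes "norm v = 1" "0 < t" "t \<le> t'" shows "ret v t' x \<le> ret v t x"
  using ret_nonneg[OF assms(1,2)] ret_le[OF assms(1,2), of x] assms(3) by (intro ret_upperI) auto

lemma ret_measurable_t [measurable (raw)]:
  assumes "norm v = 1" and [measurable]: "f \<in> borel_measurable M" "k \<in> borel_measurable M"
  shows "(\<lambda>z. ret v (k z) (f z)) \<in> borel_measurable M"
  using measurable_compose[OF borel_measurable_Pair[OF assms(2,3)] ret_measurable[OF assms(1)]] by simp

lemma Du_measurable [measurable]: "Du \<in> borel_measurable borel"
proof (rule borel_measurable_continuous_onI)
  have "isCont Du x" for x
  proof -
    obtain L where L: "1 \<le> L" "\<And>y z. norm y \<le> norm x + 1 \<Longrightarrow> norm z \<le> norm x + 1 \<Longrightarrow> norm (Du y - Du z) \<le> L * norm (y - z)"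
      by (rule local_lipschitz[of "norm x + 1"]) (rule that)
    have "L-lipschitz_on (ball x 1) Du"
    proof (rule lipschitz_onI)
      fix y z assume "y \<in> ball x 1" "z \<in> ball x 1"
      then have "norm y \<le> norm x + 1" "norm z \<le> norm x + 1"
        using norm_triangle_sub[of y x] norm_triangle_sub[of z x] by (auto simp: dist_norm norm_minus_commute)
      then show "dist (Du y) (Du z) \<le> L * dist y z" using L(2) by (simp add: dist_norm)
    qed (use L in simp)
    from lipschitz_on_continuous_on[OF this] show ?thesis by (simp add: continuous_on_eq_continuous_at)
  qed
  then show "continuous_on UNIV Du" by (simp add: continuous_on_eq_continuous_at)
qed

lemma ret_right_continuous:
  assumes v: "norm v = 1" and t: "0 < t"
  shows "(\<lambda>n. ret v (t + inverse (real (Suc n))) x) \<longlonglongrightarrow> ret v t x"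
proof -
  let ?t = "\<lambda>n. t + inverse (real (Suc n))"
  let ?r = "\<lambda>n. ret v (?t n) x"
  have t0: "0 < ?t n" for n using t by (simp add: add_pos_pos)
  have inc: "incseq ?r"
  proof (rule incseq_SucI)
    fix n show "?r n \<le> ?r (Suc n)"
      using le_imp_inverse_le[of "real (Suc n)" "real (Suc (Suc n))"] by (intro ret_antimono[OF v t0]) simp
  qed
  have le: "?r n \<le> ret v t x" for n by (rule ret_antimono[OF v t]) simp
  obtain m where m: "?r \<longlonglongrightarrow> m" using incseq_convergent[OF inc, of "ret v t x"] le by blast
  have m0: "0 \<le> m" using ret_nonneg[OF v t0] by (intro tendsto_lowerbound[OF m]) auto
  have "(\<lambda>n. u (x + ?r n *\<^sub>R v)) \<longlonglongrightarrow> u (x + m *\<^sub>R v)"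
    using continuous_on_tendsto_compose[OF u_line_cont[of UNIV x v] m] by simp
  moreover have "?t \<longlonglongrightarrow> t" using tendsto_add[OF tendsto_const LIMSEQ_inverse_real_of_nat, of t] by simp
  ultimately have "u (x + m *\<^sub>R v) \<le> t"
    using ret_le[OF v t0] by (intro LIMSEQ_le[of "\<lambda>n. u (x + ?r n *\<^sub>R v)" _ ?t]) auto
  then have "ret v t x \<le> m" by (rule ret_upperI[OF m0])
  moreover have "m \<le> ret v t x" using le by (intro tendsto_upperbound[OF m]) auto
  ultimately show ?thesis using m by simp
qed

lemma u_line_deriv: "((\<lambda>r. u (x + r *\<^sub>R v)) has_real_derivative Du (x + r *\<^sub>R v) \<bullet> v) (at r)"
proof -
  have "((\<lambda>s. x + s *\<^sub>R v) has_derivative (\<lambda>h. h *\<^sub>R v)) (at r)" by (auto intro!: derivative_eq_intros)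
  from has_derivative_compose[OF this u_deriv[where S = UNIV]]
  show ?thesis by (simp add: has_field_derivative_def mult_commute_abs)
qed

text \<open>As a function of the level, \<open>ret\<close> inverts u along the line, so its
  derivative is minus the inverse slope at the end. The inverse in \<open>ennreal\<close> is
  infinite at a critical end, and the limit holds there as well.\<close>

lemma ret_difference_quotient:
  assumes v: "norm v = 1" and t: "0 < t" "t < u x"
  shows "(\<lambda>n. ennreal (real (Suc n) * (ret v t x - ret v (t + inverse (real (Suc n))) x)))
    \<longlonglongrightarrow> inverse (ennreal \<bar>Du (x + ret v t x *\<^sub>R v) \<bullet> v\<bar>)"
proof -
  let ?t = "\<lambda>n. t + inverse (real (Suc n))"
  define l where "l = ret v t x"
  define d where "d n = l - ret v (?t n) x" for n
  have t0: "0 < ?t n" for n using t by (simp add: add_pos_pos)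
  have lim: "(\<lambda>n. ret v (?t n) x) \<longlonglongrightarrow> l" unfolding l_def by (rule ret_right_continuous[OF v t(1)])
  have "?t \<longlonglongrightarrow> t" using tendsto_add[OF tendsto_const LIMSEQ_inverse_real_of_nat, of t] by simp
  then have ev: "eventually (\<lambda>n. ?t n < u x) sequentially" using t(2) by (rule order_tendstoD)
  have ul: "u (x + l *\<^sub>R v) = t" unfolding l_def by (rule ret_eq[OF v t])
  have un: "u (x + ret v (?t n) x *\<^sub>R v) = ?t n" if "?t n < u x" for n by (rule ret_eq[OF v t0 that])
  have dpos: "0 < d n" if "?t n < u x" for n
  proof -
    have "ret v (?t n) x \<le> l" unfolding l_def by (rule ret_antimono[OF v t(1)]) simp
    moreover have "ret v (?t n) x \<noteq> l"
    proof
      assume "ret v (?t n) x = l"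
      then have "?t n = t" using ul un[OF that] by simp
      then show False by simp
    qed
    ultimately show ?thesis by (simp add: d_def)
  qed
  have "((\<lambda>r. (u (x + r *\<^sub>R v) - u (x + l *\<^sub>R v)) / (r - l)) \<longlongrightarrow> Du (x + l *\<^sub>R v) \<bullet> v) (at l)"
    using u_line_deriv[of x v l] by (simp add: has_field_derivative_iff)
  moreover have "filterlim (\<lambda>n. ret v (?t n) x) (at l) sequentially"
    unfolding filterlim_at
  proof (rule conjI[OF _ lim])
    show "\<forall>\<^sub>F n in sequentially. ret v (?t n) x \<in> UNIV \<and> ret v (?t n) x \<noteq> l"
      using ev by eventually_elim (use dpos d_def in force)
  qed
  ultimately have "(\<lambda>n. (u (x + ret v (?t n) x *\<^sub>R v) - u (x + l *\<^sub>R v)) / (ret v (?t n) x - l)) \<longlonglongrightarrow> Du (x + l *\<^sub>R v) \<bullet> v"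
    by (rule filterlim_compose)
  then have "(\<lambda>n. ennreal \<bar>(u (x + ret v (?t n) x *\<^sub>R v) - u (x + l *\<^sub>R v)) / (ret v (?t n) x - l)\<bar>) \<longlonglongrightarrow> ennreal \<bar>Du (x + l *\<^sub>R v) \<bullet> v\<bar>"
    by (intro tendsto_ennrealI tendsto_rabs)
  then have "(\<lambda>n. inverse (ennreal \<bar>(u (x + ret v (?t n) x *\<^sub>R v) - u (x + l *\<^sub>R v)) / (ret v (?t n) x - l)\<bar>)) \<longlonglongrightarrow> inverse (ennreal \<bar>Du (x + l *\<^sub>R v) \<bullet> v\<bar>)"
    by (rule continuous_on_tendsto_compose[where f = inverse, OF continuous_on_inverse_ennreal[OF continuous_on_id[of UNIV]]]) simp_all
  moreover have "\<forall>\<^sub>F n in sequentially. inverse (ennreal \<bar>(u (x + ret v (?t n) x *\<^sub>R v) - u (x + l *\<^sub>R v)) / (ret v (?t n) x - l)\<bar>)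
     = ennreal (real (Suc n) * d n)"
    using ev
  proof eventually_elim
    case (elim n)
    have d: "0 < d n" by (rule dpos[OF elim])
    have "(u (x + ret v (?t n) x *\<^sub>R v) - u (x + l *\<^sub>R v)) / (ret v (?t n) x - l) = inverse (real (Suc n)) / (- d n)"
      unfolding ul un[OF elim] d_def by simp
    then have "\<bar>(u (x + ret v (?t n) x *\<^sub>R v) - u (x + l *\<^sub>R v)) / (ret v (?t n) x - l)\<bar> = inverse (real (Suc n) * d n)"
      using d by (simp add: abs_mult divide_inverse)
    moreover have "0 < real (Suc n) * d n" using d by simp
    ultimately show ?case using inverse_ennreal[of "inverse (real (Suc n) * d n)"]
      by (simp only: inverse_inverse_eq inverse_positive_iff_positive)
  qed
  ultimately show ?thesis unfolding d_def l_def by (rule Lim_transform_eventually)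
qed

text \<open>Telescoping in $t$: this bounds the integral of the inverse slope at the endpoints by the coarea idea,
  without the coarea formula.\<close>

lemma ret_increment_integral_le:
  assumes v: "norm v = 1" and t1: "0 < t1" and k: "0 < k" and \<eta>: "0 < \<eta>"
  shows "(\<integral>\<^sup>+t. indicator {t. t1 < t \<and> t < u x \<and> ret v t x < k} t * ennreal (ret v t x - ret v (t + \<eta>) x) \<partial>lborel) \<le> ennreal (k * \<eta>)"
proof -
  define S where "S = {t. t1 < t \<and> ret v t x < k}"
  define Q where "Q t = indicator S t * ret v t x" for t
  have [measurable]: "S \<in> sets borel" unfolding S_def using v by measurable
  have [measurable]: "Q \<in> borel_measurable borel" unfolding Q_def[abs_def] using v by measurable
  \<comment> \<open>\<open>ret\<close> decreases in the level, so S is closed upwards.\<close>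
  have up: "t' \<in> S" if "t \<in> S" "t \<le> t'" for t t'
    using that ret_antimono[OF v _ that(2), of x] t1 by (auto simp: S_def)
  have z: "ret v t x = 0" if "u x \<le> t" "0 < t" for t
    using ret_nonneg[OF v that(2), of x] ret_upperI[of 0 x v t] that by simp
  have Qb: "0 \<le> Q t" "Q t \<le> k" for t
    using ret_nonneg[OF v, of t x] t1 k by (auto simp: Q_def S_def indicator_def)
  have Qs: "t \<in> S \<inter> {t1..u x}" if "Q t \<noteq> 0" for t
  proof -
    have "t \<in> S" "ret v t x \<noteq> 0" using that by (auto simp: Q_def indicator_def split: if_splits)
    then show ?thesis using z[of t] t1 by (cases "u x \<le> t") (auto simp: S_def)
  qed
  have Qi: "integrable lborel Q"
  proof (rule Bochner_Integration.integrable_bound)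
    have "integrable lborel (indicat_real {t1..u x})" by (rule integrable_real_indicator) (auto simp: emeasure_lborel_Icc_eq)
    then show "integrable lborel (\<lambda>t. k * indicator {t1..u x} t)" by simp
    show "AE t in lborel. norm (Q t) \<le> norm (k * indicator {t1..u x} t)"
    proof (rule AE_I2)
      fix t show "norm (Q t) \<le> norm (k * indicator {t1..u x} t)"
        using Qb[of t] Qs[of t] k by (cases "Q t = 0") auto
    qed
  qed measurable
  have iS: "integrable lborel (\<lambda>t. indicator S (t - \<eta>) * Q t)"
    by (rule Bochner_Integration.integrable_bound[OF Qi]) (auto simp: indicator_def)
  have iS': "integrable lborel (\<lambda>t. indicator S t * Q (t + \<eta>))" and eS: "(\<integral>t. indicator S t * Q (t + \<eta>) \<partial>lborel) = (\<integral>t. indicator S (t - \<eta>) * Q t \<partial>lborel)"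
    using integrable_lborel_translate[OF iS, of \<eta>] integral_lborel_translate[of "\<lambda>t. indicator S (t - \<eta>) * Q t" \<eta>] by simp_all
  have eq: "indicator S t * (ret v t x - ret v (t + \<eta>) x) = Q t - indicator S t * Q (t + \<eta>)" for t
    using up[of t "t + \<eta>"] \<eta> by (auto simp: Q_def indicator_def)
  have pos: "0 \<le> indicator S t * (ret v t x - ret v (t + \<eta>) x)" for t
    using ret_antimono[OF v, of t "t + \<eta>" x] t1 \<eta> by (auto simp: indicator_def S_def)
  have "(\<integral>\<^sup>+t. indicator {t. t1 < t \<and> t < u x \<and> ret v t x < k} t * ennreal (ret v t x - ret v (t + \<eta>) x) \<partial>lborel)
    \<le> (\<integral>\<^sup>+t. ennreal (indicator S t * (ret v t x - ret v (t + \<eta>) x)) \<partial>lborel)"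
    by (intro nn_integral_mono) (auto simp: indicator_def S_def)
  also have "\<dots> = ennreal (\<integral>t. indicator S t * (ret v t x - ret v (t + \<eta>) x) \<partial>lborel)"
    using Bochner_Integration.integrable_diff[OF Qi iS'] pos by (intro nn_integral_eq_integral) (auto simp: eq)
  also have "(\<integral>t. indicator S t * (ret v t x - ret v (t + \<eta>) x) \<partial>lborel) = (\<integral>t. Q t - indicator S (t - \<eta>) * Q t \<partial>lborel)"
    by (simp only: eq Bochner_Integration.integral_diff[OF Qi iS'] Bochner_Integration.integral_diff[OF Qi iS] eS)
  also have "\<dots> \<le> (\<integral>t. k * indicator {Inf S..Inf S + \<eta>} t \<partial>lborel)"
  proof (rule integral_mono)
    \<comment> \<open>After the translation only levels t in S with t - \<eta> outside S remain;
      they lie in a window of length \<eta> above the infimum of S, where Q is at most k.\<close>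
    show "Q t - indicator S (t - \<eta>) * Q t \<le> k * indicator {Inf S..Inf S + \<eta>} t" for t
    proof (cases "t \<in> S \<and> t - \<eta> \<notin> S")
      case True
      have bd: "bdd_below S" by (rule bdd_belowI[of _ t1]) (auto simp: S_def)
      have "Inf S \<le> t" using True bd by (auto intro: cInf_lower)
      moreover have "t - \<eta> \<le> Inf S"
      proof (rule cInf_greatest)
        show "S \<noteq> {}" using True by auto
        fix w assume "w \<in> S" then show "t - \<eta> \<le> w" using up[of w "t - \<eta>"] True by fastforce
      qed
      ultimately show ?thesis using Qb[of t] by (auto simp: indicator_def)
    next
      case False
      then show ?thesis using Qb[of t] Qs[of t] k by (cases "Q t = 0") (auto simp: indicator_def)
    qed
    have "integrable lborel (indicat_real {Inf S..Inf S + \<eta>})"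
      by (rule integrable_real_indicator) (auto simp: emeasure_lborel_Icc_eq)
    then show "integrable lborel (\<lambda>t. k * indicator {Inf S..Inf S + \<eta>} t)" by simp
  qed (use Qi iS in auto)
  also have "\<dots> = k * \<eta>" using \<eta> by simp
  finally show ?thesis using k \<eta> by (simp add: ennreal_leI)
qed

text \<open>Fatou's lemma for the difference quotients in the level, whose integrals are all bounded
  by k by telescoping.\<close>

lemma nn_integral_inverse_slope_le:
  assumes v: "norm v = 1" and t1: "0 < t1" and k: "0 < k"
  shows "(\<integral>\<^sup>+t. indicator {t. t1 < t \<and> t < u x \<and> ret v t x < k} t * inverse (ennreal \<bar>Du (x + ret v t x *\<^sub>R v) \<bullet> v\<bar>) \<partial>lborel) \<le> ennreal k"
proof -
  let ?S = "{t. t1 < t \<and> t < u x \<and> ret v t x < k}"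
  let ?X = "\<lambda>n t. ennreal (real (Suc n) * (ret v t x - ret v (t + inverse (real (Suc n))) x))"
  have [measurable]: "(\<lambda>t. ret v t x) \<in> borel_measurable borel" "(\<lambda>t. ret v (t + r) x) \<in> borel_measurable borel" for r
    using v by measurable
  have "(\<integral>\<^sup>+t. indicator ?S t * inverse (ennreal \<bar>Du (x + ret v t x *\<^sub>R v) \<bullet> v\<bar>) \<partial>lborel) \<le> (\<integral>\<^sup>+t. liminf (\<lambda>n. indicator ?S t * ?X n t) \<partial>lborel)"
  proof (rule nn_integral_mono)
    fix t
    show "indicator ?S t * inverse (ennreal \<bar>Du (x + ret v t x *\<^sub>R v) \<bullet> v\<bar>) \<le> liminf (\<lambda>n. indicator ?S t * ?X n t)"
    proof (cases "t \<in> ?S")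
      case True
      then have "(\<lambda>n. ?X n t) \<longlonglongrightarrow> inverse (ennreal \<bar>Du (x + ret v t x *\<^sub>R v) \<bullet> v\<bar>)"
        using t1 by (intro ret_difference_quotient[OF v]) auto
      then show ?thesis using True lim_imp_Liminf[of sequentially "\<lambda>n. ?X n t"] by simp
    qed simp
  qed
  also have "\<dots> \<le> liminf (\<lambda>n. \<integral>\<^sup>+t. indicator ?S t * ?X n t \<partial>lborel)"
    by (rule nn_integral_liminf) measurable
  also have "\<dots> \<le> ennreal k"
  proof (rule Liminf_le)
    show "\<forall>\<^sub>F n in sequentially. (\<integral>\<^sup>+t. indicator ?S t * ?X n t \<partial>lborel) \<le> ennreal k"
    proof (rule always_eventually, rule allI)
      fix n
      have "(\<integral>\<^sup>+t. indicator ?S t * ?X n t \<partial>lborel)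
        = (\<integral>\<^sup>+t. ennreal (real (Suc n)) * (indicator ?S t * ennreal (ret v t x - ret v (t + inverse (real (Suc n))) x)) \<partial>lborel)"
        by (intro nn_integral_cong) (simp add: ennreal_mult' mult_ac del: of_nat_Suc)
      also have "\<dots> = ennreal (real (Suc n)) * (\<integral>\<^sup>+t. indicator ?S t * ennreal (ret v t x - ret v (t + inverse (real (Suc n))) x) \<partial>lborel)"
        by (rule nn_integral_cmult) measurable
      also have "\<dots> \<le> ennreal (real (Suc n)) * ennreal (k * inverse (real (Suc n)))"
        using ret_increment_integral_le[OF v t1 k, of "inverse (real (Suc n))"] by (intro mult_left_mono) auto
      also have "\<dots> = ennreal k" using k by (simp add: ennreal_mult''[symmetric] del: of_nat_Suc)
      finally show "(\<integral>\<^sup>+t. indicator ?S t * ?X n t \<partial>lborel) \<le> ennreal k" .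
    qed
  qed simp
  finally show ?thesis .
qed

end

context frac_p_direction begin

lemma lend_conn: "0 < t \<Longrightarrow> conn t x r \<Longrightarrow> lend t (x + r *\<^sub>R e) = lend t x"
  by (simp add: lend_def conn_shift scaleR_add_left)

text \<open>An integrable majorant for the symmetrization test, since $h$ times the slope is bounded. The value is
  infinite at a critical endpoint, so that integrability also excludes those for almost every level.\<close>

definition Wl :: "real \<Rightarrow> real \<Rightarrow> 'a \<Rightarrow> ennreal" where
  "Wl t1 t x = indicator {t1<..} t * (indicator {x. t < u x} x * (inverse (ennreal \<bar>Du (lend t x) \<bullet> e\<bar>) * ennreal (1 / len t x)))"

lemma Wl_measurable [measurable (raw)]:
  assumes [measurable]: "f \<in> borel_measurable M" "k \<in> borel_measurable M"
  shows "(\<lambda>z. Wl t1 (k z) (f z)) \<in> borel_measurable M"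
  unfolding Wl_def by measurable

lemma superlevel_finite:
  assumes "0 < t" shows "emeasure lborel {x. t < u x} < \<infinity>"
proof -
  obtain R where R: "0 < R" "\<And>x. R < norm x \<Longrightarrow> u x < t" using u_small_outside[OF assms] by blast
  have "{x. t < u x} \<subseteq> cball 0 R" using R(2) by (force simp: not_less[symmetric])
  then have "emeasure lborel {x. t < u x} \<le> emeasure lborel (cball (0::'a) R)" by (rule emeasure_mono) simp
  also have "\<dots> < \<infinity>" by (rule emeasure_lborel_cball_finite)
  finally show ?thesis .
qed

text \<open>The functions \<phi> concentrate near the left end and have component mean 1/len once
  the component is long enough. By \<open>average_nn\<close>, 1/len may thus be replaced by \<phi>.
  With x fixed, integration over the levels first then gives (n+1) times the integral of the inverse
  slope over levels whose left end is within 1/(n+1) of x, which is at most 1. Fatou's lemma removes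
  n.\<close>

lemma inverse_len_slope_finite:
  assumes t1: "0 < t1"
  shows "(\<integral>\<^sup>+t. (\<integral>\<^sup>+x. Wl t1 t x \<partial>lborel) \<partial>lborel) < \<infinity>"
proof -
  define V where "V t x = inverse (ennreal \<bar>Du (lend t x) \<bullet> e\<bar>)" for t x
  \<comment> \<open>Unit mass on the piece of length 1/(n+1) next to the left end.\<close>
  define \<phi> where "\<phi> n t x = ennreal (real (Suc n)) * indicator {x. ll t x < inverse (real (Suc n))} x" for n t x
  define F where "F n t x = indicator {t1<..} t * (indicator {x. t < u x} x * (V t x * \<phi> n t x))" for n t x
  have [measurable]: "(\<lambda>(t, x). V t x) \<in> borel_measurable (borel \<Otimes>\<^sub>M borel)" unfolding V_def by measurable
  have [measurable]: "(\<lambda>(t, x). \<phi> n t x) \<in> borel_measurable (borel \<Otimes>\<^sub>M borel)" for n unfolding \<phi>_def by measurable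
  have [measurable]: "(\<lambda>(t, x). F n t x) \<in> borel_measurable (borel \<Otimes>\<^sub>M borel)" for n unfolding F_def by measurable
  define G where "G n t x = indicator {t1<..} t * (indicator {x. t < u x} x * (V t x * (ennreal (1 / len t x)
        * (\<integral>\<^sup>+r. indicator {- ll t x<..<rr t x} r * \<phi> n t (x + r *\<^sub>R e) \<partial>lborel))))" for n t x
  have [measurable]: "(\<lambda>(t, x). G n t x) \<in> borel_measurable (borel \<Otimes>\<^sub>M borel)" for n
    unfolding G_def \<phi>_def indicator_def of_bool_def greaterThanLessThan_iff greaterThan_iff mem_Collect_eq by measurable
  have GF: "(\<integral>\<^sup>+x. G n t x \<partial>lborel) = (\<integral>\<^sup>+x. F n t x \<partial>lborel)" for n t
  proof (cases "t1 < t")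
    case True
    then have t: "0 < t" using t1 by simp
    have "V t (x + r *\<^sub>R e) = V t x" if "conn t x r" for x r using lend_conn[OF t that] by (simp add: V_def)
    moreover have "V t \<in> borel_measurable borel" "\<phi> n t \<in> borel_measurable borel" unfolding V_def \<phi>_def by measurable
    ultimately have "(\<integral>\<^sup>+x. indicator {x. t < u x} x * (V t x * \<phi> n t x) \<partial>lborel)
      = (\<integral>\<^sup>+x. indicator {x. t < u x} x * (V t x * (ennreal (1 / len t x)
        * (\<integral>\<^sup>+r. indicator {- ll t x<..<rr t x} r * \<phi> n t (x + r *\<^sub>R e) \<partial>lborel))) \<partial>lborel)"
      by (intro average_nn[OF t]) auto
    then show ?thesis using True by (simp add: F_def G_def)
  qed (simp add: F_def G_def)
  have lim: "Wl t1 t x \<le> liminf (\<lambda>n. G n t x)" for t x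
  proof (cases "t1 < t \<and> t < u x")
    case True
    then have t: "0 < t" "t < u x" using t1 by auto
    have len: "0 < len t x" by (rule len_pos[OF t])
    have "eventually (\<lambda>n. inverse (real (Suc n)) < len t x) sequentially"
      using LIMSEQ_inverse_real_of_nat len by (rule order_tendstoD)
    then have "eventually (\<lambda>n. G n t x = Wl t1 t x) sequentially"
    proof eventually_elim
      case (elim n)
      have "(\<integral>\<^sup>+r. indicator {- ll t x<..<rr t x} r * \<phi> n t (x + r *\<^sub>R e) \<partial>lborel)
        = (\<integral>\<^sup>+r. ennreal (real (Suc n)) * indicator {- ll t x<..<- ll t x + inverse (real (Suc n))} r \<partial>lborel)"
      proof (rule nn_integral_cong)
        fix r
        show "indicator {- ll t x<..<rr t x} r * \<phi> n t (x + r *\<^sub>R e) = ennreal (real (Suc n)) * indicator {- ll t x<..<- ll t x + inverse (real (Suc n))} r"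
          using elim conn_shift(2)[OF t(1), of x r] conn_iff[OF t, of r]
          by (auto simp: \<phi>_def indicator_def len_def simp del: of_nat_Suc)
      qed
      also have "\<dots> = ennreal (real (Suc n)) * ennreal (inverse (real (Suc n)))"
        by (subst nn_integral_cmult_indicator) (auto simp del: of_nat_Suc)
      also have "\<dots> = 1" by (simp add: ennreal_mult''[symmetric] del: of_nat_Suc)
      finally show ?case by (simp add: G_def Wl_def V_def)
    qed
    then have "(\<lambda>n. G n t x) \<longlonglongrightarrow> Wl t1 t x" by (rule tendsto_eventually)
    then show ?thesis using lim_imp_Liminf[of sequentially "\<lambda>n. G n t x"] by simp
  qed (auto simp: Wl_def)
  have bound: "(\<integral>\<^sup>+t. (\<integral>\<^sup>+x. F n t x \<partial>lborel) \<partial>lborel) \<le> emeasure lborel {x. t1 < u x}" for n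
  proof -
    have "(\<integral>\<^sup>+t. (\<integral>\<^sup>+x. F n t x \<partial>lborel) \<partial>lborel) = (\<integral>\<^sup>+x. (\<integral>\<^sup>+t. F n t x \<partial>lborel) \<partial>lborel)"
      by (rule lborel_pair.Fubini') measurable
    also have "\<dots> \<le> (\<integral>\<^sup>+x. indicator {x. t1 < u x} x \<partial>lborel)"
    proof (rule nn_integral_mono)
      fix x
      have [measurable]: "(\<lambda>t. ret (- e) t x) \<in> borel_measurable borel" using ret_measurable_t[OF norm_me] by measurable
      let ?S = "{t. t1 < t \<and> t < u x \<and> ret (- e) t x < inverse (real (Suc n))}"
      let ?I = "\<lambda>t. indicator ?S t * inverse (ennreal \<bar>Du (x + ret (- e) t x *\<^sub>R (- e)) \<bullet> (- e)\<bar>)"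
      have "(\<integral>\<^sup>+t. F n t x \<partial>lborel) = (\<integral>\<^sup>+t. ennreal (real (Suc n)) * ?I t \<partial>lborel)"
        by (intro nn_integral_cong) (auto simp: F_def V_def \<phi>_def lend_def ll_def indicator_def mult_ac simp del: of_nat_Suc)
      also have "\<dots> = ennreal (real (Suc n)) * (\<integral>\<^sup>+t. ?I t \<partial>lborel)" by (rule nn_integral_cmult) measurable
      also have "\<dots> \<le> ennreal (real (Suc n)) * ennreal (inverse (real (Suc n)))"
        by (intro mult_left_mono nn_integral_inverse_slope_le norm_me t1) auto
      also have "\<dots> = 1" by (simp add: ennreal_mult''[symmetric] del: of_nat_Suc)
      finally have 1: "(\<integral>\<^sup>+t. F n t x \<partial>lborel) \<le> 1" .
      show "(\<integral>\<^sup>+t. F n t x \<partial>lborel) \<le> indicator {x. t1 < u x} x"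
      proof (cases "t1 < u x")
        case False
        then have "F n t x = 0" for t by (auto simp: F_def indicator_def)
        then show ?thesis by simp
      qed (use 1 in simp)
    qed
    also have "\<dots> = emeasure lborel {x. t1 < u x}" by simp
    finally show ?thesis .
  qed
  have "(\<integral>\<^sup>+t. (\<integral>\<^sup>+x. Wl t1 t x \<partial>lborel) \<partial>lborel) \<le> (\<integral>\<^sup>+t. (\<integral>\<^sup>+x. liminf (\<lambda>n. G n t x) \<partial>lborel) \<partial>lborel)"
    by (intro nn_integral_mono lim)
  also have "\<dots> \<le> (\<integral>\<^sup>+t. liminf (\<lambda>n. \<integral>\<^sup>+x. G n t x \<partial>lborel) \<partial>lborel)"
    by (intro nn_integral_mono nn_integral_liminf) measurable
  also have "\<dots> \<le> liminf (\<lambda>n. \<integral>\<^sup>+t. (\<integral>\<^sup>+x. G n t x \<partial>lborel) \<partial>lborel)"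
    by (rule nn_integral_liminf) measurable
  also have "\<dots> \<le> emeasure lborel {x. t1 < u x}"
    unfolding GF using bound by (intro Liminf_le) auto
  also have "\<dots> < \<infinity>" by (rule superlevel_finite[OF t1])
  finally show ?thesis .
qed

definition Wr :: "real \<Rightarrow> real \<Rightarrow> 'a \<Rightarrow> ennreal" where
  "Wr t1 t x = indicator {t1<..} t * (indicator {x. t < u x} x * (inverse (ennreal \<bar>Du (rend t x) \<bullet> e\<bar>) * ennreal (1 / len t x)))"

lemma Wr_measurable [measurable (raw)]:
  assumes [measurable]: "f \<in> borel_measurable M" "k \<in> borel_measurable M"
  shows "(\<lambda>z. Wr t1 (k z) (f z)) \<in> borel_measurable M"
  unfolding Wr_def by measurable

lemma inverse_len_slope_finite':
  assumes t1: "0 < t1"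
  shows "(\<integral>\<^sup>+t. (\<integral>\<^sup>+x. Wr t1 t x \<partial>lborel) \<partial>lborel) < \<infinity>"
proof -
  \<comment> \<open>Reversing the direction exchanges the ends, so the right end needs no separate
    proof.\<close>
  interpret neg: frac_p_direction u g s p C s0 "- e"
    by unfold_locales (simp add: norm_e)
  have "neg.ll t x = rr t x" "neg.rr t x = ll t x" for t x
    by (simp_all add: neg.ll_def neg.rr_def ll_def rr_def)
  then have "neg.Wl t1 t x = Wr t1 t x" for t x
    by (simp add: neg.Wl_def Wr_def neg.lend_def rend_def neg.len_def len_def add.commute)
  then show ?thesis using neg.inverse_len_slope_finite[OF t1] by simp
qed

lemma h_measurable [measurable]: "h \<epsilon> \<in> borel_measurable borel"
  unfolding h_def by measurable

text \<open>The part of the test that contains the operator. The value of u is t at both ends, so in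
  the limit it becomes a multiple of g(t) - g(t).\<close>

definition FF :: "real \<Rightarrow> (real \<Rightarrow> real) \<Rightarrow> real \<Rightarrow> real \<times> 'a \<Rightarrow> real" where
  "FF l \<tau> \<epsilon> z = (if inA l (fst z) (snd z) then \<tau> (fst z) * (h \<epsilon> (lend (fst z) (snd z)) - h \<epsilon> (rend (fst z) (snd z))) / len (fst z) (snd z) else 0)"

lemma fst_borel: "(fst :: real \<times> 'a \<Rightarrow> real) \<in> borel_measurable borel"
  and snd_borel: "(snd :: real \<times> 'a \<Rightarrow> 'a) \<in> borel_measurable borel"
  by (auto intro!: borel_measurable_continuous_onI continuous_intros)

lemma FF_measurable [measurable]:
  assumes [measurable]: "\<tau> \<in> borel_measurable borel" shows "FF l \<tau> \<epsilon> \<in> borel_measurable borel"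
proof -
  note [measurable] = fst_borel snd_borel
  show ?thesis unfolding FF_def by measurable
qed

text \<open>Dominated convergence: the pointwise limit is 0 for any g, and
  \<open>h_times_slope_bounded\<close> makes a multiple of \<open>Wl\<close> + \<open>Wr\<close> a
  majorant. Levels up to \<open>t1\<close> drop out through \<tau>, so all ends stay in a fixed
  ball.\<close>

lemma FF_integral_tendsto_0:
  assumes t1: "0 < t1" and [measurable]: "\<tau> \<in> borel_measurable borel" and \<tau>: "\<And>t. 0 \<le> \<tau> t" "\<And>t. t \<le> umax \<Longrightarrow> \<tau> t \<le> T" "\<And>t. t \<le> t1 \<Longrightarrow> \<tau> t = 0"
  shows "integrable lborel (FF l \<tau> (eps n))" "(\<lambda>n. \<integral>z. FF l \<tau> (eps n) z \<partial>lborel) \<longlonglongrightarrow> 0"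
proof -
  obtain R where R: "0 < R" "\<And>x. R < norm x \<Longrightarrow> u x < t1" using u_small_outside[OF t1] by blast
  obtain CH where CH: "0 \<le> CH" "\<And>\<epsilon> x. 0 < \<epsilon> \<Longrightarrow> norm x \<le> R \<Longrightarrow> \<bar>h \<epsilon> x\<bar> * \<bar>Du x \<bullet> e\<bar> \<le> CH"
    using h_times_slope_bounded[OF norm_e, of R] by blast
  have T: "0 \<le> T" using \<tau>(1,2)[of umax] by linarith
  define W where "W z = Wl t1 (fst z) (snd z) + Wr t1 (fst z) (snd z)" for z
  have [measurable]: "W \<in> borel_measurable borel"
  proof -
    note [measurable] = fst_borel snd_borel
    show ?thesis unfolding W_def[abs_def] by measurable
  qed
  have Wfin: "(\<integral>\<^sup>+z. W z \<partial>lborel) < \<infinity>"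
  proof -
    have "(\<integral>\<^sup>+z. W z \<partial>lborel) = (\<integral>\<^sup>+z. W z \<partial>(lborel \<Otimes>\<^sub>M lborel))" by (simp only: lborel_prod)
    also have "\<dots> = (\<integral>\<^sup>+t. (\<integral>\<^sup>+x. W (t, x) \<partial>lborel) \<partial>lborel)"
      by (rule lborel.nn_integral_fst[symmetric]) (simp add: lborel_prod)
    also have "\<dots> = (\<integral>\<^sup>+t. (\<integral>\<^sup>+x. Wl t1 t x \<partial>lborel) \<partial>lborel) + (\<integral>\<^sup>+t. (\<integral>\<^sup>+x. Wr t1 t x \<partial>lborel) \<partial>lborel)"
      unfolding W_def fst_conv snd_conv by (subst nn_integral_add[symmetric]) (auto intro!: nn_integral_cong nn_integral_add)
    also have "\<dots> < \<infinity>"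
      using inverse_len_slope_finite[OF t1] inverse_len_slope_finite'[OF t1] by simp
    finally show ?thesis .
  qed
  define w where "w z = T * CH * enn2real (W z)" for z
  have wi: "integrable lborel w"
  proof (rule integrableI_bounded)
    have "(\<integral>\<^sup>+z. ennreal (norm (w z)) \<partial>lborel) \<le> (\<integral>\<^sup>+z. ennreal (T * CH) * W z \<partial>lborel)"
      using T CH(1) by (intro nn_integral_mono) (auto simp: w_def abs_mult ennreal_mult'' ennreal_enn2real_if intro!: mult_left_mono)
    also have "\<dots> = ennreal (T * CH) * (\<integral>\<^sup>+z. W z \<partial>lborel)" by (rule nn_integral_cmult) measurable
    also have "\<dots> < \<infinity>" using Wfin by (simp add: ennreal_mult_less_top)
    finally show "(\<integral>\<^sup>+z. ennreal (norm (w z)) \<partial>lborel) < \<infinity>" .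
  qed (simp add: w_def[abs_def])
  \<comment> \<open>Infinite values mean critical ends; they occur only on a null set, so the slopes
    may be divided by below.\<close>
  have "AE z in lborel. W z \<noteq> \<infinity>"
    by (rule nn_integral_noteq_infinite) (use Wfin in auto)
  then have dom: "AE z in lborel. norm (FF l \<tau> (eps n) z) \<le> w z" for n
  proof eventually_elim
    case (elim z)
    obtain t x where z: "z = (t, x)" by fastforce
    show ?case
    proof (cases "inA l t x \<and> t1 < t")
      case True
      then have t: "0 < t" "t < u x" "t1 < t" using t1 by (auto simp: inA_def)
      have len: "0 < len t x" by (rule len_pos[OF t(1,2)])
      have fin: "Wl t1 t x \<noteq> top" "Wr t1 t x \<noteq> top" using elim by (auto simp: W_def z)
      have sl: "Du (lend t x) \<bullet> e \<noteq> 0" "Du (rend t x) \<bullet> e \<noteq> 0"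
        using fin t len by (auto simp: Wl_def Wr_def ennreal_top_mult)
      have hb: "\<bar>h (eps n) y\<bar> \<le> CH * (1 / \<bar>Du y \<bullet> e\<bar>)" if "u y = t" "Du y \<bullet> e \<noteq> 0" for y
      proof -
        have "norm y \<le> R" using R(2)[of y] that t(3) by (force simp: not_less[symmetric])
        from CH(2)[OF eps_pos this, of n] show ?thesis using that by (simp add: field_simps)
      qed
      have e1: "enn2real (Wl t1 t x) = 1 / \<bar>Du (lend t x) \<bullet> e\<bar> * (1 / len t x)" "enn2real (Wr t1 t x) = 1 / \<bar>Du (rend t x) \<bullet> e\<bar> * (1 / len t x)"
        using t sl len by (simp_all add: Wl_def Wr_def inverse_ennreal ennreal_mult''[symmetric] divide_inverse)
      have "enn2real (W z) = enn2real (Wl t1 t x) + enn2real (Wr t1 t x)"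
        using fin by (simp add: W_def z enn2real_plus less_top)
      then have w: "w z = T * ((CH * (1 / \<bar>Du (lend t x) \<bullet> e\<bar>) + CH * (1 / \<bar>Du (rend t x) \<bullet> e\<bar>)) / len t x)"
        by (simp add: w_def e1 add_divide_distrib distrib_left)
      have "\<bar>h (eps n) (lend t x) - h (eps n) (rend t x)\<bar> \<le> CH * (1 / \<bar>Du (lend t x) \<bullet> e\<bar>) + CH * (1 / \<bar>Du (rend t x) \<bullet> e\<bar>)"
        using hb[OF u_lend[OF t(1,2)] sl(1)] hb[OF u_rend[OF t(1,2)] sl(2)] abs_triangle_ineq4[of "h (eps n) (lend t x)" "h (eps n) (rend t x)"] by linarith
      then have "\<tau> t * (\<bar>h (eps n) (lend t x) - h (eps n) (rend t x)\<bar> / len t x) \<le> w z"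
        unfolding w using \<tau>(1)[of t] \<tau>(2)[of t] len t u_le[of x] T by (intro mult_mono divide_right_mono) auto
      then show ?thesis using True \<tau>(1)[of t] len by (simp add: FF_def z abs_mult)
    next
      case False
      then have "FF l \<tau> (eps n) z = 0" using \<tau>(3)[of t] by (auto simp: FF_def z not_less)
      then show ?thesis using T CH(1) by (simp add: w_def)
    qed
  qed
  show "integrable lborel (FF l \<tau> (eps n))"
    by (rule Bochner_Integration.integrable_bound[OF wi]) (use dom[of n] in \<open>auto elim!: eventually_mono simp: order_trans[OF _ abs_ge_self]\<close>)
  have "(\<lambda>n. \<integral>z. FF l \<tau> (eps n) z \<partial>lborel) \<longlonglongrightarrow> (\<integral>z. 0 \<partial>(lborel :: (real \<times> 'a) measure))"
  proof (rule integral_dominated_convergence[OF _ _ wi _ dom])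
    show "AE z in lborel. (\<lambda>n. FF l \<tau> (eps n) z) \<longlonglongrightarrow> 0"
    proof (rule AE_I2)
      fix z :: "real \<times> 'a"
      obtain t x where z: "z = (t, x)" by fastforce
      show "(\<lambda>n. FF l \<tau> (eps n) z) \<longlonglongrightarrow> 0"
      proof (cases "inA l t x \<and> t1 < t")
        case True
        then have t: "0 < t" "t < u x" using t1 by (auto simp: inA_def)
        have "(\<lambda>n. h (eps n) (lend t x) - h (eps n) (rend t x)) \<longlonglongrightarrow> g (u (lend t x)) / C - g (u (rend t x)) / C"
          by (intro tendsto_diff h_lim)
        then have "(\<lambda>n. h (eps n) (lend t x) - h (eps n) (rend t x)) \<longlonglongrightarrow> 0" by (simp add: u_lend[OF t] u_rend[OF t])
        from tendsto_mult_left[OF this, of "\<tau> t / len t x"] show ?thesis using True by (simp add: FF_def z)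
      next
        case False
        then have "FF l \<tau> (eps n) z = 0" for n using \<tau>(3)[of t] by (auto simp: FF_def z not_less)
        then show ?thesis by simp
      qed
    qed
  qed simp_all
  then show "(\<lambda>n. \<integral>z. FF l \<tau> (eps n) z \<partial>lborel) \<longlonglongrightarrow> 0" by simp
qed

end

section \<open>The lower bound for the symmetrization test\<close>

text \<open>The factor v^(p-1), at most (L d)^(p-1) near the end, lifts the exponent from the
  interpolation to -(N - p + 2\<theta>), which is integrable at 0. For d at least 1 the factor
  M^\<theta> comes directly from M being at most M^\<theta>.\<close>

lemma max_powr_mult_le:
  fixes d \<delta> q w v M L N \<theta> p U :: real
  assumes d: "0 < d" and \<delta>: "0 < \<delta>" and \<theta>: "0 < \<theta>" "\<theta> < 1" and L: "1 \<le> L" and N: "1 \<le> N" and M: "0 < M" "M \<le> 1" and p: "1 < p" and U: "0 \<le> U"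
    and q: "0 \<le> q" "q \<le> d powr (- N)" "q \<le> N * (2 * \<delta>) * d powr (- N - 1)"
    and w: "0 \<le> w" "w \<le> M" "d < 1 \<Longrightarrow> w \<le> 6 * L * (\<delta> + d) * d"
    and v: "0 \<le> v" "v \<le> U" "d < 1 \<Longrightarrow> v \<le> L * d"
  shows "q * (v powr (p - 1) * w) \<le> 24 * N * L * (L powr (p - 1) + U powr (p - 1)) * \<delta> * M powr \<theta> * (if d < 1 then d powr (- (N - p + 2 * \<theta>)) else d powr (- N))"
proof (cases "d < 1")
  case True
  have qw: "q * w \<le> 24 * N * L * \<delta> * M powr \<theta> * d powr (1 - 2 * \<theta> - N)"
    by (rule kernel_times_negative_part_le[OF d True \<delta> \<theta> L N q w(1,2) w(3)[OF True]])
  have vp: "v powr (p - 1) \<le> L powr (p - 1) * d powr (p - 1)"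
  proof -
    have "v powr (p - 1) \<le> (L * d) powr (p - 1)" using v True p by (intro powr_mono2) auto
    then show ?thesis using L d by (simp add: powr_mult)
  qed
  have "v powr (p - 1) * (q * w) \<le> (L powr (p - 1) * d powr (p - 1)) * (24 * N * L * \<delta> * M powr \<theta> * d powr (1 - 2 * \<theta> - N))"
    by (rule mult_mono[OF vp qw]) (use q(1) w(1) in auto)
  also have "\<dots> = 24 * N * L * L powr (p - 1) * \<delta> * M powr \<theta> * (d powr (p - 1) * d powr (1 - 2 * \<theta> - N))" by (simp only: mult_ac)
  also have "d powr (p - 1) * d powr (1 - 2 * \<theta> - N) = d powr (- (N - p + 2 * \<theta>))"
    by (simp only: powr_add[symmetric]) (simp add: algebra_simps)
  also have "24 * N * L * L powr (p - 1) * \<delta> * M powr \<theta> * d powr (- (N - p + 2 * \<theta>)) \<le> 24 * N * L * (L powr (p - 1) + U powr (p - 1)) * \<delta> * M powr \<theta> * d powr (- (N - p + 2 * \<theta>))"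
    using N L \<delta> by (intro mult_right_mono mult_left_mono) auto
  finally show ?thesis using True by (simp add: mult_ac)
next
  case False
  have "q \<le> N * (2 * \<delta>) * d powr (- N)"
  proof -
    have "d powr (- N - 1) \<le> d powr (- N)" using False by (intro powr_mono) auto
    then have "N * (2 * \<delta>) * d powr (- N - 1) \<le> N * (2 * \<delta>) * d powr (- N)" using N \<delta> by (intro mult_left_mono) auto
    then show ?thesis using q(3) by (rule order_trans[rotated])
  qed
  moreover have "w \<le> M powr \<theta>"
  proof -
    have "M powr 1 \<le> M powr \<theta>" using M \<theta> by (intro powr_mono') auto
    then show ?thesis using w(2) M by simp
  qed
  moreover have "v powr (p - 1) \<le> U powr (p - 1)" using v p by (intro powr_mono2) auto
  ultimately have "q * (v powr (p - 1) * w) \<le> (N * (2 * \<delta>) * d powr (- N)) * (U powr (p - 1) * M powr \<theta>)"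
    using q(1) w(1) N \<delta> by (intro mult_mono[OF _ mult_mono]) auto
  also have "\<dots> = 2 * N * U powr (p - 1) * \<delta> * M powr \<theta> * d powr (- N)" by (simp only: mult_ac)
  also have "\<dots> \<le> 24 * N * L * (L powr (p - 1) + U powr (p - 1)) * \<delta> * M powr \<theta> * d powr (- N)"
  proof (intro mult_right_mono)
    have "2 * N * U powr (p - 1) \<le> (24 * N * L) * U powr (p - 1)"
      using N L mult_mono[of 2 "24 * L" N N] by (intro mult_right_mono) (auto simp: mult_ac)
    also have "\<dots> \<le> 24 * N * L * (L powr (p - 1) + U powr (p - 1))" using N L by (intro mult_left_mono) auto
    finally show "2 * N * U powr (p - 1) \<le> 24 * N * L * (L powr (p - 1) + U powr (p - 1))" .
  qed (use \<delta> in auto)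
  finally show ?thesis using False by simp
qed

context frac_p_nonsym begin

text \<open>The integral is folded at the centre of the component itself, which exchanges its two
  ends and leaves a nonnegative kernel difference times the change of \<open>Om\<close> under
  reflection. The far ball of \<open>gain_region\<close> contributes at least a constant times
  \<tau>(t) and the length; violations cost at most a constant times M^\<theta>, the slope of \<tau>
  and the length. No constant depends on the plane, the weight, the level or \<epsilon>.\<close>

lemma steiner_lower:
  assumes t1: "0 < t1"
  obtains \<epsilon>0 \<kappa>1 \<kappa>2 \<theta> where "0 < \<epsilon>0" "0 < \<kappa>1" "0 < \<kappa>2" "0 < \<theta>"
    "\<And>l M \<tau> d\<tau> \<epsilon> t x. lam e < l \<Longrightarrow> l \<le> lam e + \<epsilon>0 \<Longrightarrow> 0 < M \<Longrightarrow> M \<le> 1 \<Longrightarrow>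
      (\<And>c y. c < l \<Longrightarrow> y \<bullet> e < c \<Longrightarrow> u y - u (refl_at e c y) \<le> M) \<Longrightarrow>
      \<tau> \<in> borel_measurable borel \<Longrightarrow> (\<And>t. 0 \<le> \<tau> t) \<Longrightarrow> (\<And>r t. r \<le> t \<Longrightarrow> \<tau> t - \<tau> r \<le> d\<tau> t * (t - r)) \<Longrightarrow>
      mono \<tau> \<Longrightarrow> (\<And>t. 0 \<le> d\<tau> t) \<Longrightarrow> 0 < \<epsilon> \<Longrightarrow> \<epsilon> \<le> 1 \<Longrightarrow> t1 \<le> t \<Longrightarrow> inA l t x \<Longrightarrow>
      (\<kappa>1 * \<tau> t - \<kappa>2 * M powr \<theta> * d\<tau> t) * len t x
        \<le> (\<integral>y. Om l \<tau> t y * (ker N \<epsilon> (rend t x - y) - ker N \<epsilon> (lend t x - y)) \<partial>lborel)"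
proof -
  obtain R where R: "0 < R" "\<And>x. R < norm x \<Longrightarrow> u x < t1" using u_small_outside[OF t1] by blast
  obtain y0 \<rho>0 \<eta> \<epsilon>0 where gr: "0 < \<rho>0" "0 < \<eta>" "0 < \<epsilon>0" "\<epsilon>0 \<le> 1"
    "\<And>y. y \<in> ball y0 \<rho>0 \<Longrightarrow> y \<bullet> e \<le> lam e - 1 / 2"
    "\<And>c y. y \<in> ball y0 \<rho>0 \<Longrightarrow> lam e \<le> c \<Longrightarrow> c < lam e + \<epsilon>0 \<Longrightarrow> u y + 2 * \<eta> \<le> u (refl_at e c y)"
    "\<And>c y r. y \<in> ball y0 \<rho>0 \<Longrightarrow> lam e \<le> c \<Longrightarrow> c < lam e + \<epsilon>0 \<Longrightarrow> u y + \<eta> < r \<Longrightarrow> r < u (refl_at e c y)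
      \<Longrightarrow> lam e + \<epsilon>0 \<le> cen r (refl_at e c y)"
    by (rule gain_region) (rule that)
  obtain L where L: "1 \<le> L" "\<And>x y. norm x \<le> R + 1 \<Longrightarrow> norm y \<le> R + 1 \<Longrightarrow> norm (Du x - Du y) \<le> L * norm (x - y)"
    "\<And>x y. norm x \<le> R + 1 \<Longrightarrow> norm y \<le> R + 1 \<Longrightarrow> \<bar>u x - u y\<bar> \<le> L * norm (x - y)"
    by (rule local_lipschitz[of "R + 1"]) (rule that)
  obtain g0 where g0: "0 < g0" "\<And>a b. \<bar>a\<bar> \<le> umax \<Longrightarrow> a + \<eta> \<le> b \<Longrightarrow> g0 \<le> Gp p b - Gp p a"
    by (rule Gp_gap[OF p_gt_1 gr(2), of umax]) (rule that)
  have N1: "1 \<le> N" using N_gt DIM_positive[where 'a='a] by linarith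
  \<comment> \<open>Any \<theta> in (0,1) with 2\<theta> < p(1 - s) would do; this inequality says
    exactly that \<alpha> < n below.\<close>
  define \<theta> where "\<theta> = min (1 / 2) (p * (1 - s) / 4)"
  have \<theta>: "0 < \<theta>" "\<theta> < 1" "2 * \<theta> < p * (1 - s)"
  proof -
    have ps: "0 < p * (1 - s)" using p_gt_1 s_less_1 by simp
    then show "0 < \<theta>" by (simp add: \<theta>_def)
    show "\<theta> < 1" by (simp add: \<theta>_def min_def)
    have "\<theta> \<le> p * (1 - s) / 4" by (simp add: \<theta>_def)
    then show "2 * \<theta> < p * (1 - s)" using ps by linarith
  qed
  define \<alpha> where "\<alpha> = N - p + 2 * \<theta>"
  have \<alpha>: "\<alpha> < real DIM('a)" using \<theta>(3) by (simp add: \<alpha>_def N_def algebra_simps)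
  define Rb where "Rb = R + norm y0 + \<rho>0"
  define E where "E = ball y0 \<rho>0"
  have Em [measurable]: "E \<in> sets borel" by (simp add: E_def)
  define mE where "mE = measure lborel E"
  have mE: "0 < mE" using content_ball_pos[OF gr(1), of y0] by (simp add: mE_def E_def)
  define \<kappa>a where "\<kappa>a = g0 * (N / 2 * (Rb\<^sup>2 + 1) powr (- (N / 2) - 1))"
  have Rb1: "0 < Rb\<^sup>2 + 1" by (simp add: add_nonneg_pos)
  have \<kappa>a: "0 < \<kappa>a" using g0(1) N1 Rb1 by (simp add: \<kappa>a_def)
  \<comment> \<open>12 instead of the 24 of \<open>max_powr_mult_le\<close>, since \<delta> is half
    the length.\<close>
  define \<kappa>b where "\<kappa>b = (p - 1) * (12 * N * L * (L powr (p - 1) + umax powr (p - 1)))"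
  have \<kappa>b: "0 \<le> \<kappa>b" using p_gt_1 N1 L(1) by (simp add: \<kappa>b_def)
  define I0 where "I0 = (\<integral>z. K0 \<alpha> N (z::'a) \<partial>lborel)"
  have K0nn: "0 \<le> K0 \<alpha> N z" for z :: 'a by (simp add: K0_def)
  have I0: "0 \<le> I0" unfolding I0_def using K0nn by (rule Bochner_Integration.integral_nonneg)
  have iK: "integrable lborel (K0 \<alpha> N :: 'a \<Rightarrow> real)" by (rule integrable_K0[OF \<alpha> N_gt])
  show ?thesis
  proof (rule that[of \<epsilon>0 "\<kappa>a * mE" "\<kappa>b * I0 + 1" \<theta>])
    show "0 < \<epsilon>0" "0 < \<theta>" "0 < \<kappa>a * mE" using gr \<theta> \<kappa>a mE by auto
    show "0 < \<kappa>b * I0 + 1" using \<kappa>b I0 by (simp add: add_nonneg_pos)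
    fix l M :: real and \<tau> d\<tau> :: "real \<Rightarrow> real" and \<epsilon> t :: real and x :: 'a
    assume l: "lam e < l" "l \<le> lam e + \<epsilon>0" and M: "0 < M" "M \<le> 1"
      and wM: "\<And>c y. c < l \<Longrightarrow> y \<bullet> e < c \<Longrightarrow> u y - u (refl_at e c y) \<le> M"
      and \<tau>m [measurable]: "\<tau> \<in> borel_measurable borel" and \<tau>: "\<And>t. 0 \<le> \<tau> t" "\<And>r t. r \<le> t \<Longrightarrow> \<tau> t - \<tau> r \<le> d\<tau> t * (t - r)" "mono \<tau>" "\<And>t. 0 \<le> d\<tau> t"
      and \<epsilon>: "0 < \<epsilon>" "\<epsilon> \<le> 1" and t: "t1 \<le> t" and A: "inA l t x"
    define c where "c = cen t x"
    define a where "a = lend t x"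
    define b where "b = rend t x"
    define \<delta> where "\<delta> = len t x / 2"
    have tu: "0 < t" "t < u x" using A t t1 by (auto simp: inA_def)
    have c: "lam e < c" "c < l" using cen_gt_lam[OF tu] A by (auto simp: c_def inA_def)
    have c\<epsilon>: "lam e \<le> c" "c < lam e + \<epsilon>0" using c l by linarith+
    have \<delta>: "0 < \<delta>" using len_pos[OF tu] by (simp add: \<delta>_def)
    have ae: "c - a \<bullet> e = \<delta>" by (simp add: a_def c_def lend_inner \<delta>_def)
    have ba: "b = refl_at e c a" unfolding a_def b_def c_def by (rule rend_eq_refl)
    have ub: "u a = t" "u b = t" by (simp_all add: a_def b_def u_lend[OF tu] u_rend[OF tu])
    have na: "norm a \<le> R" "norm b \<le> R" using R(2)[of a] R(2)[of b] ub t by (force simp: not_less[symmetric])+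
    have tmax: "t \<le> umax" using tu(2) u_le[of x] by linarith
    let ?R = "refl_at e c"
    define q where "q y = ker N \<epsilon> (a - y) - ker N \<epsilon> (b - y)" for y
    define B where "B = \<tau> t * (\<integral>r. indicator {0<..umax} r * ((p - 1) * \<bar>t - r\<bar> powr (p - 2)) \<partial>lborel)"
    have Omb: "\<bar>Om l \<tau> t y\<bar> \<le> B" for y
      using Om_bounds[of \<tau>, OF \<tau>m \<tau>(1), of l t y] by (simp add: B_def)
    have Omm [measurable]: "Om l \<tau> t \<in> borel_measurable borel"
      using measurable_compose[OF measurable_Pair1'[of t borel borel] Om_measurable[OF \<tau>m, of l]] by simp
    let ?f = "\<lambda>y. Om l \<tau> t y * (ker N \<epsilon> (b - y) - ker N \<epsilon> (a - y))"
    have fi: "integrable lborel ?f"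
      unfolding right_diff_distrib
      by (intro Bochner_Integration.integrable_diff integrable_mult_ker[OF \<epsilon>(1) N_gt Omm Omb])
    have rb: "norm (b - ?R y) = norm (a - y)" "norm (a - ?R y) = norm (b - y)" for y
    proof -
      show "norm (b - ?R y) = norm (a - y)" unfolding ba by (rule norm_refl_at_diff[OF norm_e])
      have "norm (b - y) = norm (?R b - ?R y)" by (rule norm_refl_at_diff[OF norm_e, symmetric])
      then show "norm (a - ?R y) = norm (b - y)" by (simp add: ba refl_at_refl_at[OF norm_e])
    qed
    have fold: "?f y + ?f (?R y) = q y * (Om l \<tau> t (?R y) - Om l \<tau> t y)" for y
      using ker_cong_norm[OF rb(1)[of y], of N \<epsilon>] ker_cong_norm[OF rb(2)[of y], of N \<epsilon>] by (simp add: q_def algebra_simps)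
    define lower where "lower y = \<kappa>a * len t x * \<tau> t * indicator E y - d\<tau> t * (\<kappa>b * len t x * M powr \<theta> * K0 \<alpha> N (y - a))" for y
    have iE: "integrable lborel (indicator E :: 'a \<Rightarrow> real)"
      by (rule integrable_real_indicator) (use emeasure_lborel_ball_finite[of y0 \<rho>0] in \<open>auto simp: E_def\<close>)
    have iKa: "integrable lborel (\<lambda>y. K0 \<alpha> N (y - a))" "(\<integral>y. K0 \<alpha> N (y - a) \<partial>lborel) = I0"
      using integrable_lborel_translate[OF iK, of "- a"] integral_lborel_translate[of "K0 \<alpha> N :: 'a \<Rightarrow> real" "- a"] by (simp_all add: I0_def)
    have il: "integrable lborel lower"
      unfolding lower_def using iE iKa(1) by simp
    have "(\<integral>y. lower y \<partial>lborel) = \<kappa>a * len t x * \<tau> t * mE - d\<tau> t * (\<kappa>b * len t x * M powr \<theta> * I0)"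
      unfolding lower_def using iE iKa by (subst Bochner_Integration.integral_diff) (auto simp: mE_def)
    moreover have "(\<integral>y. lower y \<partial>lborel) \<le> (\<integral>y. indicator {y. y \<bullet> e < c} y * (?f y + ?f (?R y)) \<partial>lborel)"
    proof (rule integral_mono[OF il integral_fold_halfspace(1)[OF norm_e fi, of c]])
      fix y
      have low_neg: "0 \<le> d\<tau> t * (\<kappa>b * len t x * M powr \<theta> * K0 \<alpha> N (y - a))"
        using \<tau>(4) \<kappa>b len_pos[OF tu] K0nn[of "y - a"] by simp
      show "lower y \<le> indicator {y. y \<bullet> e < c} y * (?f y + ?f (?R y))"
      proof (cases "y \<bullet> e < c")
        case False
        \<comment> \<open>The gain region lies left of all centres, so outside the half-space the
          minorant contains only the nonpositive loss term.\<close>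
        then have "y \<notin> E" using gr(5)[of y] c by (auto simp: E_def)
        then show ?thesis using False low_neg by (simp add: lower_def)
      next
        case yc: True
        define v where "v = u (?R y)"
        define d where "d = norm (y - a)"
        have nle: "norm (a - y) \<le> norm (b - y)"
          using norm_refl_at_le[OF norm_e, of a c y] ae \<delta> yc rb(2)[of y] by simp
        have q0: "0 \<le> q y" unfolding q_def using ker_mono[OF \<epsilon>(1) _ nle, of N] N_pos by simp
        have base: "\<tau> t * indicator E y * (Gp p (t - u y - \<eta>) - Gp p (t - v))
            - d\<tau> t * ((p - 1) * max 0 (t - v) powr (p - 1) * max 0 (u y - v)) \<le> Om l \<tau> t (?R y) - Om l \<tau> t y"
          unfolding v_def
        proof (rule Om_reflection_lower[OF \<tau>m \<tau>(1,2,3,4) c(2) yc])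
          show "l \<le> cen r (?R y)" if "y \<in> E" "u y + \<eta> < r" "r < u (?R y)" for r
            using gr(7)[of y c r] that c\<epsilon> l by (simp add: E_def)
          show "u y + \<eta> \<le> u (?R y)" if "y \<in> E" using gr(6)[of y c] that c\<epsilon> gr(2) by (simp add: E_def)
        qed (use gr in auto)
        have gain: "\<kappa>a * len t x * \<tau> t * indicator E y \<le> q y * (\<tau> t * indicator E y * (Gp p (t - u y - \<eta>) - Gp p (t - v)))"
        proof (cases "y \<in> E")
          case yE: True
          have gap: "g0 \<le> Gp p (t - u y - \<eta>) - Gp p (t - v)"
          proof (rule g0(2))
            show "\<bar>t - v\<bar> \<le> umax" using tu tmax u_pos[of "?R y"] u_le[of "?R y"] by (simp add: v_def abs_le_iff)
            show "t - v + \<eta> \<le> t - u y - \<eta>" using gr(6)[of y c] yE c\<epsilon> by (simp add: v_def E_def)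
          qed
          have ny: "norm y \<le> norm y0 + \<rho>0"
            using yE norm_triangle_sub[of y y0] by (simp add: E_def dist_norm norm_minus_commute)
          have nb: "norm (b - y) \<le> Rb" using norm_triangle_ineq4[of b y] ny na by (simp add: Rb_def)
          have sq: "(norm (b - y))\<^sup>2 - (norm (a - y))\<^sup>2 = 4 * \<delta> * (c - y \<bullet> e)"
            using norm_refl_at_sq[OF norm_e, of y c a] by (simp add: ba[symmetric] ae norm_minus_commute mult_ac)
          \<comment> \<open>The distance 1/2 to the critical plane turns 4\<delta>(c - y . e) into
            at least the full length.\<close>
          have "1 / 2 \<le> c - y \<bullet> e" using gr(5)[of y] yE c by (simp add: E_def)
          then have "4 * \<delta> * (1 / 2) \<le> 4 * \<delta> * (c - y \<bullet> e)" using \<delta> by (intro mult_left_mono) auto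
          then have "len t x \<le> (norm (b - y))\<^sup>2 - (norm (a - y))\<^sup>2" unfolding sq by (simp add: \<delta>_def)
          then have "N / 2 * (Rb\<^sup>2 + 1) powr (- (N / 2) - 1) * len t x \<le> N / 2 * (Rb\<^sup>2 + 1) powr (- (N / 2) - 1) * ((norm (b - y))\<^sup>2 - (norm (a - y))\<^sup>2)"
            using N1 by (intro mult_left_mono) auto
          also have "\<dots> \<le> q y" unfolding q_def using N_pos by (intro ker_diff_lower \<epsilon> nle nb) auto
          finally have ql: "N / 2 * (Rb\<^sup>2 + 1) powr (- (N / 2) - 1) * len t x \<le> q y" .
          have "g0 * (N / 2 * (Rb\<^sup>2 + 1) powr (- (N / 2) - 1) * len t x) \<le> (Gp p (t - u y - \<eta>) - Gp p (t - v)) * q y"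
            using gap ql g0(1) len_pos[OF tu] N1 by (intro mult_mono) auto
          then have "\<tau> t * (\<kappa>a * len t x) \<le> \<tau> t * (q y * (Gp p (t - u y - \<eta>) - Gp p (t - v)))"
            using \<tau>(1) by (intro mult_left_mono) (auto simp: \<kappa>a_def mult_ac)
          then show ?thesis using yE by (simp add: mult_ac)
        qed simp
        have loss: "q y * ((p - 1) * max 0 (t - v) powr (p - 1) * max 0 (u y - v)) \<le> \<kappa>b * len t x * M powr \<theta> * K0 \<alpha> N (y - a)"
        proof (cases "y = a \<or> u y \<le> v")
          case True
          then have "max 0 (u y - v) = 0" using ub ba by (auto simp: v_def)
          then show ?thesis using \<kappa>b len_pos[OF tu] K0nn[of "y - a"] by simp
        next
          case False
          have d0: "0 < d" using False by (simp add: d_def)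
          have dn: "norm (a - y) = d" by (simp add: d_def norm_minus_commute)
          have ne: "a - y \<noteq> 0" using False by auto
          have ba2: "norm (b - y) - norm (a - y) \<le> 2 * \<delta>"
          proof -
            have "norm (b - y) - norm (a - y) \<le> norm ((b - y) - (a - y))" by (rule norm_triangle_ineq2)
            also have "(b - y) - (a - y) = (2 * \<delta>) *\<^sub>R e" by (simp add: ba refl_at_def ae)
            finally show ?thesis using \<delta> norm_e by simp
          qed
          have q1: "q y \<le> d powr (- N)"
            using ker_le_powr[OF \<epsilon>(1) _ ne, of N] N_pos ker_pos[OF \<epsilon>(1), of N "b - y"] by (simp add: q_def dn)
          have q2: "q y \<le> N * (2 * \<delta>) * d powr (- N - 1)"
          proof -
            have "q y \<le> N * (norm (b - y) - norm (a - y)) * norm (a - y) powr (- N - 1)"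
              unfolding q_def using N_pos by (intro ker_diff_upper \<epsilon> ne nle) auto
            also have "\<dots> \<le> N * (2 * \<delta>) * norm (a - y) powr (- N - 1)"
              using ba2 N_pos by (intro mult_right_mono mult_left_mono) auto
            finally show ?thesis by (simp add: dn)
          qed
          have w1: "max 0 (u y - v) \<le> M" using wM[OF c(2) yc] M by (simp add: v_def)
          have w2: "max 0 (u y - v) \<le> 6 * L * (\<delta> + d) * d" if "d < 1"
          proof -
            have L0: "0 \<le> L" using L(1) by simp
            have "\<bar>u (?R y) - u y\<bar> \<le> 6 * L * ((c - a \<bullet> e) + norm (y - a)) * norm (y - a)"
              using ae \<delta> na ub that by (intro reflection_difference_le[OF L0 L(2)]) (auto simp: ba d_def)
            then have "\<bar>v - u y\<bar> \<le> 6 * L * (\<delta> + d) * d" by (simp add: v_def d_def ae)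
            then show ?thesis using abs_ge_zero[of "v - u y"] abs_ge_minus_self[of "v - u y"]
              by (intro max.boundedI) linarith+
          qed
          have v1: "max 0 (t - v) \<le> umax" using tmax u_pos[of "?R y"] umax_pos by (simp add: v_def)
          have v2: "max 0 (t - v) \<le> L * d" if "d < 1"
          proof -
            have nd: "norm (b - ?R y) = d" by (simp add: rb(1) dn)
            have "norm (?R y) \<le> norm b + norm (b - ?R y)" using norm_triangle_ineq4[of b "b - ?R y"] by simp
            then have "norm (?R y) \<le> R + 1" "norm b \<le> R + 1" using nd that na by linarith+
            then have "\<bar>u b - u (?R y)\<bar> \<le> L * norm (b - ?R y)" by (intro L(3))
            then have "\<bar>t - v\<bar> \<le> L * d" by (simp add: nd ub v_def)
            then show ?thesis using abs_ge_zero[of "t - v"] abs_ge_self[of "t - v"]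
              by (intro max.boundedI) linarith+
          qed
          have "q y * (max 0 (t - v) powr (p - 1) * max 0 (u y - v))
            \<le> 24 * N * L * (L powr (p - 1) + umax powr (p - 1)) * \<delta> * M powr \<theta> * (if d < 1 then d powr (- (N - p + 2 * \<theta>)) else d powr (- N))"
            by (rule max_powr_mult_le[OF d0 \<delta> \<theta>(1,2) L(1) N1 M p_gt_1 _ q0 q1 q2 _ w1 w2 _ v1 v2]) (use umax_pos in auto)
          also have "(if d < 1 then d powr (- (N - p + 2 * \<theta>)) else d powr (- N)) = K0 \<alpha> N (y - a)"
            by (simp add: K0_def d_def \<alpha>_def)
          finally have "(p - 1) * (q y * (max 0 (t - v) powr (p - 1) * max 0 (u y - v)))
            \<le> (p - 1) * (24 * N * L * (L powr (p - 1) + umax powr (p - 1)) * \<delta> * M powr \<theta> * K0 \<alpha> N (y - a))"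
            using p_gt_1 by (intro mult_left_mono) auto
          also have "\<dots> = \<kappa>b * len t x * M powr \<theta> * K0 \<alpha> N (y - a)" by (simp add: \<kappa>b_def \<delta>_def mult_ac)
          finally show ?thesis by (simp only: mult_ac)
        qed
        have "lower y \<le> q y * (\<tau> t * indicator E y * (Gp p (t - u y - \<eta>) - Gp p (t - v)))
            - d\<tau> t * (q y * ((p - 1) * max 0 (t - v) powr (p - 1) * max 0 (u y - v)))"
          unfolding lower_def using gain mult_left_mono[OF loss \<tau>(4)[of t]] by linarith
        also have "\<dots> = q y * (\<tau> t * indicator E y * (Gp p (t - u y - \<eta>) - Gp p (t - v))
            - d\<tau> t * ((p - 1) * max 0 (t - v) powr (p - 1) * max 0 (u y - v)))"
          by (simp only: right_diff_distrib mult.left_commute)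
        also have "\<dots> \<le> q y * (Om l \<tau> t (?R y) - Om l \<tau> t y)" by (rule mult_left_mono[OF base q0])
        finally show ?thesis using yc by (simp add: fold)
      qed
    qed
    moreover have "(\<kappa>a * mE * \<tau> t - (\<kappa>b * I0 + 1) * M powr \<theta> * d\<tau> t) * len t x \<le> \<kappa>a * len t x * \<tau> t * mE - d\<tau> t * (\<kappa>b * len t x * M powr \<theta> * I0)"
    proof -
      have "0 \<le> M powr \<theta> * d\<tau> t * len t x" using \<tau>(4)[of t] len_pos[OF tu] by simp
      then show ?thesis by (simp add: algebra_simps)
    qed
    moreover note integral_fold_halfspace(2)[OF norm_e fi, of c]
    ultimately show "(\<kappa>a * mE * \<tau> t - (\<kappa>b * I0 + 1) * M powr \<theta> * d\<tau> t) * len t x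
        \<le> (\<integral>y. Om l \<tau> t y * (ker N \<epsilon> (rend t x - y) - ker N \<epsilon> (lend t x - y)) \<partial>lborel)"
      unfolding a_def b_def by linarith
  qed
qed

end

section \<open>Averaging over components\<close>

lemma integral_dker_line:
  fixes z e :: "'a::euclidean_space"
  assumes "0 < \<epsilon>" "norm e = 1" "a \<le> b"
  shows "integrable lborel (\<lambda>r. indicator {a<..<b} r * dker N \<epsilon> e (z + r *\<^sub>R e))"
    "(\<integral>r. indicator {a<..<b} r * dker N \<epsilon> e (z + r *\<^sub>R e) \<partial>lborel) = ker N \<epsilon> (z + b *\<^sub>R e) - ker N \<epsilon> (z + a *\<^sub>R e)"
proof -
  have c: "continuous_on {a..b} (\<lambda>r. dker N \<epsilon> e (z + r *\<^sub>R e))"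
    by (rule continuous_on_compose2[OF continuous_dker[OF assms(1), of UNIV], where f = "\<lambda>r. z + r *\<^sub>R e"]) (auto intro!: continuous_intros)
  have ii: "integrable lborel (\<lambda>r. indicator {a..b} r *\<^sub>R dker N \<epsilon> e (z + r *\<^sub>R e))"
    using borel_integrable_atLeastAtMost'[OF c] by (simp add: set_integrable_def)
  have fi: "(\<integral>r. indicator {a..b} r *\<^sub>R dker N \<epsilon> e (z + r *\<^sub>R e) \<partial>lborel) = ker N \<epsilon> (z + b *\<^sub>R e) - ker N \<epsilon> (z + a *\<^sub>R e)"
    using c ker_has_derivative_line[OF assms(1,2)] assms(3)
    by (intro integral_FTC_Icc) (auto simp: has_real_derivative_iff_has_vector_derivative)
  have ae: "AE r in lborel. indicator {a<..<b} r * dker N \<epsilon> e (z + r *\<^sub>R e) = indicator {a..b} r *\<^sub>R dker N \<epsilon> e (z + r *\<^sub>R e)"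
    using AE_lborel_singleton[of a] AE_lborel_singleton[of b] by eventually_elim (auto simp: indicator_def)
  show "integrable lborel (\<lambda>r. indicator {a<..<b} r * dker N \<epsilon> e (z + r *\<^sub>R e))"
    by (subst integrable_cong_AE[OF _ _ ae]) (use ii in auto)
  show "(\<integral>r. indicator {a<..<b} r * dker N \<epsilon> e (z + r *\<^sub>R e) \<partial>lborel) = ker N \<epsilon> (z + b *\<^sub>R e) - ker N \<epsilon> (z + a *\<^sub>R e)"
    by (subst integral_cong_AE[OF _ _ ae]) (use fi in auto)
qed

text \<open>Fubini and the fundamental theorem along the line. A difference of kernels at the two
  ends of a component becomes the integral over that component of a function of the point alone,
  which is the form needed for averaging.\<close>

lemma integral_line_convolution:
  fixes \<Omega> :: "'a::euclidean_space \<Rightarrow> real"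
  assumes \<epsilon>: "0 < \<epsilon>" and e: "norm e = 1" and ab: "a \<le> b" and N: "real DIM('a) < N"
    and [measurable]: "\<Omega> \<in> borel_measurable borel" and B: "\<And>y. \<bar>\<Omega> y\<bar> \<le> B"
  shows "(\<integral>r. indicator {a<..<b} r * (\<integral>y. \<Omega> y * dker N \<epsilon> e (x + r *\<^sub>R e - y) \<partial>lborel) \<partial>lborel)
    = (\<integral>y. \<Omega> y * (ker N \<epsilon> (x + b *\<^sub>R e - y) - ker N \<epsilon> (x + a *\<^sub>R e - y)) \<partial>lborel)"
proof -
  let ?f = "\<lambda>r y. indicator {a<..<b} r * (\<Omega> y * dker N \<epsilon> e (x + r *\<^sub>R e - y))"
  have N0: "0 \<le> N" using N by linarith
  have B0: "0 \<le> B" using B[of 0] by linarith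
  define K where "K = (\<integral>z. ker (N + 1) \<epsilon> (z::'a) \<partial>lborel)"
  have Ki: "integrable lborel (ker (N + 1) \<epsilon> :: 'a \<Rightarrow> real)" by (rule integrable_ker) (use \<epsilon> N in auto)
  have [measurable]: "(\<lambda>z. case z of (r, y) \<Rightarrow> ?f r y) \<in> borel_measurable (borel \<Otimes>\<^sub>M borel)" by measurable
  have int: "integrable (lborel \<Otimes>\<^sub>M lborel) (\<lambda>(r, y). ?f r y)"
  proof (rule integrableI_bounded)
    have "(\<integral>\<^sup>+z. ennreal (norm (case z of (r, y) \<Rightarrow> ?f r y)) \<partial>(lborel \<Otimes>\<^sub>M lborel)) = (\<integral>\<^sup>+r. (\<integral>\<^sup>+y. ennreal (norm (?f r y)) \<partial>lborel) \<partial>lborel)"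
      by (subst lborel.nn_integral_fst[symmetric]) auto
    also have "\<dots> \<le> (\<integral>\<^sup>+r. ennreal (B * N * K) * indicator {a<..<b} r \<partial>lborel)"
    proof (rule nn_integral_mono)
      fix r
      have "(\<integral>\<^sup>+y. ennreal (norm (?f r y)) \<partial>lborel) \<le> (\<integral>\<^sup>+y. ennreal (B * N * ker (N + 1) \<epsilon> (y + (- x - r *\<^sub>R e))) * indicator {a<..<b} r \<partial>lborel)"
      proof (rule nn_integral_mono)
        fix y
        have "\<bar>dker N \<epsilon> e (x + r *\<^sub>R e - y)\<bar> \<le> N * ker (N + 1) \<epsilon> (x + r *\<^sub>R e - y)" by (rule abs_dker_le[OF \<epsilon> e N0])
        also have "ker (N + 1) \<epsilon> (x + r *\<^sub>R e - y) = ker (N + 1) \<epsilon> (y + (- x - r *\<^sub>R e))"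
        proof -
          have "x + r *\<^sub>R e - y = - (y + (- x - r *\<^sub>R e))" by simp
          then show ?thesis by (simp only: ker_minus)
        qed
        finally have "\<bar>\<Omega> y\<bar> * \<bar>dker N \<epsilon> e (x + r *\<^sub>R e - y)\<bar> \<le> B * (N * ker (N + 1) \<epsilon> (y + (- x - r *\<^sub>R e)))"
          using B B0 by (intro mult_mono) auto
        then show "ennreal (norm (?f r y)) \<le> ennreal (B * N * ker (N + 1) \<epsilon> (y + (- x - r *\<^sub>R e))) * indicator {a<..<b} r"
          by (auto simp: abs_mult indicator_def mult.assoc intro!: ennreal_leI)
      qed
      also have "\<dots> = (\<integral>\<^sup>+y. ennreal (B * N * ker (N + 1) \<epsilon> (y + (- x - r *\<^sub>R e))) \<partial>lborel) * indicator {a<..<b} r"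
        by (rule nn_integral_multc) measurable
      also have "(\<integral>\<^sup>+y. ennreal (B * N * ker (N + 1) \<epsilon> (y + (- x - r *\<^sub>R e))) \<partial>lborel) = (\<integral>\<^sup>+y. ennreal (B * N * ker (N + 1) \<epsilon> (y::'a)) \<partial>lborel)"
        by (rule nn_integral_lborel_translate) measurable
      also have "\<dots> = ennreal (B * N * K)"
      proof -
        have "0 \<le> B * N * ker (N + 1) \<epsilon> y" for y :: 'a using B0 N0 ker_pos[OF \<epsilon>, of "N + 1" y] by simp
        then show ?thesis unfolding K_def using Ki by (subst nn_integral_eq_integral) auto
      qed
      finally show "(\<integral>\<^sup>+y. ennreal (norm (?f r y)) \<partial>lborel) \<le> ennreal (B * N * K) * indicator {a<..<b} r" .
    qed
    also have "\<dots> = ennreal (B * N * K) * ennreal (b - a)" using ab by (subst nn_integral_cmult_indicator) auto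
    also have "\<dots> < \<infinity>" by (simp add: ennreal_mult_less_top)
    finally show "(\<integral>\<^sup>+z. ennreal (norm (case z of (r, y) \<Rightarrow> ?f r y)) \<partial>(lborel \<Otimes>\<^sub>M lborel)) < \<infinity>" .
  qed simp
  have "(\<integral>r. indicator {a<..<b} r * (\<integral>y. \<Omega> y * dker N \<epsilon> e (x + r *\<^sub>R e - y) \<partial>lborel) \<partial>lborel) = (\<integral>r. (\<integral>y. ?f r y \<partial>lborel) \<partial>lborel)" by simp
  also have "\<dots> = (\<integral>y. (\<integral>r. ?f r y \<partial>lborel) \<partial>lborel)" by (rule lborel_pair.Fubini_integral[OF int, symmetric])
  also have "\<dots> = (\<integral>y. \<Omega> y * (ker N \<epsilon> (x + b *\<^sub>R e - y) - ker N \<epsilon> (x + a *\<^sub>R e - y)) \<partial>lborel)"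
  proof (rule Bochner_Integration.integral_cong[OF refl])
    fix y
    have s: "x + r *\<^sub>R e - y = (x - y) + r *\<^sub>R e" for r by simp
    have "(\<integral>r. ?f r y \<partial>lborel) = (\<integral>r. \<Omega> y * (indicator {a<..<b} r * dker N \<epsilon> e ((x - y) + r *\<^sub>R e)) \<partial>lborel)"
      unfolding s by (simp only: mult.left_commute)
    also have "\<dots> = \<Omega> y * (ker N \<epsilon> ((x - y) + b *\<^sub>R e) - ker N \<epsilon> ((x - y) + a *\<^sub>R e))"
      by (simp only: Bochner_Integration.integral_mult_right_zero integral_dker_line(2)[OF \<epsilon> e ab])
    finally show "(\<integral>r. ?f r y \<partial>lborel) = \<Omega> y * (ker N \<epsilon> (x + b *\<^sub>R e - y) - ker N \<epsilon> (x + a *\<^sub>R e - y))" unfolding s .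
  qed
  finally show ?thesis .
qed

context frac_p_direction begin

definition av :: "real \<Rightarrow> ('a \<Rightarrow> real) \<Rightarrow> 'a \<Rightarrow> real" where
  "av t \<Psi> x = (\<integral>r. indicator {- ll t x<..<rr t x} r * \<Psi> (x + r *\<^sub>R e) \<partial>lborel) / len t x"

lemma component_integrable:
  fixes \<Psi> :: "'a \<Rightarrow> real"
  assumes [measurable]: "\<Psi> \<in> borel_measurable borel" and B: "\<And>x. \<bar>\<Psi> x\<bar> \<le> B"
  shows "integrable lborel (\<lambda>r. indicator {- ll t x<..<rr t x} r * \<Psi> (x + r *\<^sub>R e))"
proof (rule Bochner_Integration.integrable_bound)
  have "integrable lborel (indicat_real {- ll t x<..<rr t x})"
    by (rule integrable_real_indicator) (simp, cases "- ll t x \<le> rr t x", auto)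
  then show "integrable lborel (\<lambda>r. B * indicat_real {- ll t x<..<rr t x} r)" by simp
  show "AE r in lborel. norm (indicator {- ll t x<..<rr t x} r * \<Psi> (x + r *\<^sub>R e)) \<le> norm (B * indicat_real {- ll t x<..<rr t x} r)"
    using B by (intro AE_I2) (auto simp: indicator_def intro: order_trans[OF B abs_ge_self])
qed measurable

lemma component_length:
  assumes "0 < t" "t < u x" shows "(\<integral>r. indicator {- ll t x<..<rr t x} r \<partial>lborel) = len t x"
  using len_pos[OF assms] by (simp add: len_def add.commute)

lemma av_add:
  assumes "0 < t" "t < u x" and \<Psi>: "\<Psi> \<in> borel_measurable borel" "\<And>x. \<bar>\<Psi> x\<bar> \<le> B"
  shows "av t (\<lambda>x. \<Psi> x + k) x = av t \<Psi> x + k"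
proof -
  have i: "integrable lborel (\<lambda>r. indicator {- ll t x<..<rr t x} r * k)"
    using component_integrable[of "\<lambda>x. k" "\<bar>k\<bar>"] by simp
  have "(\<integral>r. indicator {- ll t x<..<rr t x} r * (\<Psi> (x + r *\<^sub>R e) + k) \<partial>lborel)
    = (\<integral>r. indicator {- ll t x<..<rr t x} r * \<Psi> (x + r *\<^sub>R e) \<partial>lborel) + len t x * k"
    unfolding distrib_left
    by (subst Bochner_Integration.integral_add[OF component_integrable[OF \<Psi>] i])
      (simp only: Bochner_Integration.integral_mult_left_zero component_length[OF assms(1,2)])
  then show ?thesis using len_pos[OF assms(1,2)] by (simp add: av_def add_divide_distrib)
qed

lemma av_mono:
  assumes "0 < t" "t < u x" and \<Psi>: "\<Psi> \<in> borel_measurable borel" "\<And>x. \<bar>\<Psi> x\<bar> \<le> B" and nn: "\<And>x. 0 \<le> \<Psi> x"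
  shows "0 \<le> av t \<Psi> x"
  using len_pos[OF assms(1,2)] nn unfolding av_def by (intro divide_nonneg_pos Bochner_Integration.integral_nonneg) auto

lemma abs_av_le:
  assumes "0 < t" "t < u x" and \<Psi>: "\<Psi> \<in> borel_measurable borel" "\<And>x. \<bar>\<Psi> x\<bar> \<le> B"
  shows "\<bar>av t \<Psi> x\<bar> \<le> B"
proof -
  have "\<bar>\<integral>r. indicator {- ll t x<..<rr t x} r * \<Psi> (x + r *\<^sub>R e) \<partial>lborel\<bar> \<le> (\<integral>r. indicator {- ll t x<..<rr t x} r * B \<partial>lborel)"
  proof (rule integral_abs_bound[THEN order_trans], rule integral_mono)
    show "integrable lborel (\<lambda>r. \<bar>indicator {- ll t x<..<rr t x} r * \<Psi> (x + r *\<^sub>R e)\<bar>)"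
      using component_integrable[OF \<Psi>] by (rule Bochner_Integration.integrable_abs)
    have B0: "\<bar>B\<bar> \<le> B" using \<Psi>(2)[of 0] by linarith
    then show "integrable lborel (\<lambda>r. indicator {- ll t x<..<rr t x} r * B)"
      by (intro component_integrable[of "\<lambda>x. B"]) auto
  qed (use \<Psi>(2) in \<open>auto simp: indicator_def\<close>)
  also have "\<dots> = len t x * B"
    by (simp only: Bochner_Integration.integral_mult_left_zero component_length[OF assms(1,2)])
  finally have I: "\<bar>\<integral>r. indicator {- ll t x<..<rr t x} r * \<Psi> (x + r *\<^sub>R e) \<partial>lborel\<bar> \<le> len t x * B" .
  define J where "J = (\<integral>r. indicator {- ll t x<..<rr t x} r * \<Psi> (x + r *\<^sub>R e) \<partial>lborel)"
  have "\<bar>J\<bar> / len t x \<le> B"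
    using I len_pos[OF assms(1,2)] unfolding J_def[symmetric] by (simp only: pos_divide_le_eq mult.commute)
  then show ?thesis
    using len_pos[OF assms(1,2)] unfolding av_def J_def[symmetric] by (simp only: abs_divide abs_of_pos)
qed

lemma integrable_on_inA:
  fixes \<Phi> :: "'a \<Rightarrow> real"
  assumes t: "0 < t" and [measurable]: "\<Phi> \<in> borel_measurable borel" and B: "\<And>x. inA l t x \<Longrightarrow> \<bar>\<Phi> x\<bar> \<le> B"
  shows "integrable lborel (\<lambda>x. if inA l t x then \<Phi> x else 0)"
proof (rule Bochner_Integration.integrable_bound)
  have "integrable lborel (indicat_real {x. t < u x})"
    by (rule integrable_real_indicator) (use superlevel_finite[OF t] in auto)
  then show "integrable lborel (\<lambda>x. B * indicat_real {x. t < u x} x)" by simp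
  show "AE x in lborel. norm (if inA l t x then \<Phi> x else 0) \<le> norm (B * indicat_real {x. t < u x} x)"
  proof (rule AE_I2)
    fix x
    show "norm (if inA l t x then \<Phi> x else 0) \<le> norm (B * indicat_real {x. t < u x} x)"
    proof (cases "inA l t x")
      case True
      then show ?thesis using B[OF True] by (simp add: inA_def)
    qed simp
  qed
qed measurable

lemma av_measurable:
  assumes [measurable]: "(\<lambda>(t, x). \<Psi> t x) \<in> borel_measurable (borel \<Otimes>\<^sub>M borel)"
    and f [measurable]: "f \<in> borel_measurable M" and k [measurable]: "k \<in> borel_measurable M"
  shows "(\<lambda>z. av (k z) (\<Psi> (k z)) (f z)) \<in> borel_measurable M"
proof -
  have [measurable]: "(\<lambda>z. case z of (z, r) \<Rightarrow> \<Psi> (k z) (f z + r *\<^sub>R e)) \<in> borel_measurable (M \<Otimes>\<^sub>M borel)"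
  proof -
    have "(\<lambda>z. (k (fst z), f (fst z) + snd z *\<^sub>R e)) \<in> M \<Otimes>\<^sub>M borel \<rightarrow>\<^sub>M borel \<Otimes>\<^sub>M borel" by measurable
    from measurable_compose[OF this assms(1)] show ?thesis by (simp add: split_beta)
  qed
  show ?thesis
    unfolding av_def indicator_def of_bool_def greaterThanLessThan_iff by measurable
qed

lemma integral_average:
  assumes t: "0 < t" and [measurable]: "\<Psi> \<in> borel_measurable borel" and B: "\<And>x. \<bar>\<Psi> x\<bar> \<le> B"
  shows "(\<integral>x. (if inA l t x then \<Psi> x else 0) \<partial>lborel) = (\<integral>x. (if inA l t x then av t \<Psi> x else 0) \<partial>lborel)"
proof -
  have B0: "0 \<le> B" using B[of 0] by linarith
  \<comment> \<open>\<open>average_nn\<close> is for nonnegative functions; the bound B is added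
    and, averages being compatible with constants, removed again.\<close>
  let ?\<Phi> = "\<lambda>x. \<Psi> x + B"
  have \<Phi>: "0 \<le> ?\<Phi> x" "\<bar>?\<Phi> x\<bar> \<le> 2 * B" for x using B[of x] by (auto simp: abs_le_iff)
  have [measurable]: "av t f \<in> borel_measurable borel" if [measurable]: "f \<in> borel_measurable borel" for f
    unfolding av_def[abs_def] indicator_def of_bool_def greaterThanLessThan_iff by measurable
  have tu: "t < u x" if "inA l t x" for x using that by (simp add: inA_def)
  have i1: "integrable lborel (\<lambda>x. if inA l t x then \<Psi> x else 0)" by (rule integrable_on_inA[OF t]) (use B in auto)
  have i2: "integrable lborel (\<lambda>x. if inA l t x then av t \<Psi> x else 0)"
    by (rule integrable_on_inA[OF t _ abs_av_le[OF t tu _ B]]) auto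
  have i3: "integrable lborel (\<lambda>x. if inA l t x then B else 0)" by (rule integrable_on_inA[OF t]) auto
  have "(\<integral>\<^sup>+x. ennreal (if inA l t x then ?\<Phi> x else 0) \<partial>lborel) = (\<integral>\<^sup>+x. indicator {x. t < u x} x * (indicator {x. inA l t x} x * ennreal (?\<Phi> x)) \<partial>lborel)"
    by (intro nn_integral_cong) (auto simp: indicator_def inA_def)
  also have "\<dots> = (\<integral>\<^sup>+x. indicator {x. t < u x} x * (indicator {x. inA l t x} x * (ennreal (1 / len t x)
        * (\<integral>\<^sup>+r. indicator {- ll t x<..<rr t x} r * ennreal (?\<Phi> (x + r *\<^sub>R e)) \<partial>lborel))) \<partial>lborel)"
    by (rule average_nn[OF t]) (auto simp: inA_conn[OF t] indicator_def)
  also have "\<dots> = (\<integral>\<^sup>+x. ennreal (if inA l t x then av t ?\<Phi> x else 0) \<partial>lborel)"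
  proof (intro nn_integral_cong)
    fix x
    show "indicator {x. t < u x} x * (indicator {x. inA l t x} x * (ennreal (1 / len t x)
        * (\<integral>\<^sup>+r. indicator {- ll t x<..<rr t x} r * ennreal (?\<Phi> (x + r *\<^sub>R e)) \<partial>lborel))) = ennreal (if inA l t x then av t ?\<Phi> x else 0)"
    proof (cases "inA l t x")
      case True
      have "(\<integral>\<^sup>+r. indicator {- ll t x<..<rr t x} r * ennreal (?\<Phi> (x + r *\<^sub>R e)) \<partial>lborel) = (\<integral>\<^sup>+r. ennreal (indicator {- ll t x<..<rr t x} r * ?\<Phi> (x + r *\<^sub>R e)) \<partial>lborel)"
        by (intro nn_integral_cong) (auto simp: indicator_def)
      also have "\<dots> = ennreal (\<integral>r. indicator {- ll t x<..<rr t x} r * ?\<Phi> (x + r *\<^sub>R e) \<partial>lborel)"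
        by (rule nn_integral_eq_integral[OF component_integrable[OF _ \<Phi>(2)]]) (use \<Phi>(1) in \<open>auto simp del: distrib_left_numeral\<close>)
      finally have eq: "(\<integral>\<^sup>+r. indicator {- ll t x<..<rr t x} r * ennreal (?\<Phi> (x + r *\<^sub>R e)) \<partial>lborel) = ennreal (\<integral>r. indicator {- ll t x<..<rr t x} r * ?\<Phi> (x + r *\<^sub>R e) \<partial>lborel)" .
      have "0 \<le> (\<integral>r. indicator {- ll t x<..<rr t x} r * ?\<Phi> (x + r *\<^sub>R e) \<partial>lborel)"
        using \<Phi>(1) by (intro Bochner_Integration.integral_nonneg) auto
      then show ?thesis using True len_pos[OF t tu[OF True]] unfolding eq
        by (simp add: tu av_def ennreal_mult'[symmetric])
    qed simp
  qed
  finally have nn: "(\<integral>\<^sup>+x. ennreal (if inA l t x then ?\<Phi> x else 0) \<partial>lborel) = (\<integral>\<^sup>+x. ennreal (if inA l t x then av t ?\<Phi> x else 0) \<partial>lborel)" .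
  have avm: "0 \<le> av t ?\<Phi> x" if "inA l t x" for x by (rule av_mono[OF t tu[OF that] _ \<Phi>(2) \<Phi>(1)]) simp
  have "(\<integral>x. (if inA l t x then ?\<Phi> x else 0) \<partial>lborel) = enn2real (\<integral>\<^sup>+x. ennreal (if inA l t x then ?\<Phi> x else 0) \<partial>lborel)"
    using \<Phi>(1) by (intro integral_eq_nn_integral) auto
  also have "\<dots> = (\<integral>x. (if inA l t x then av t ?\<Phi> x else 0) \<partial>lborel)"
    unfolding nn using avm by (intro integral_eq_nn_integral[symmetric]) auto
  finally have \<Phi>eq: "(\<integral>x. (if inA l t x then ?\<Phi> x else 0) \<partial>lborel) = (\<integral>x. (if inA l t x then av t ?\<Phi> x else 0) \<partial>lborel)" .
  have "(\<integral>x. (if inA l t x then \<Psi> x else 0) + (if inA l t x then B else 0) \<partial>lborel) = (\<integral>x. (if inA l t x then ?\<Phi> x else 0) \<partial>lborel)"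
    by (intro Bochner_Integration.integral_cong) auto
  also note \<Phi>eq
  also have "(\<integral>x. (if inA l t x then av t ?\<Phi> x else 0) \<partial>lborel) = (\<integral>x. (if inA l t x then av t \<Psi> x else 0) + (if inA l t x then B else 0) \<partial>lborel)"
    using av_add[OF t tu _ B, where k = B] by (intro Bochner_Integration.integral_cong) auto
  finally show ?thesis
    by (simp only: Bochner_Integration.integral_add[OF i1 i3] Bochner_Integration.integral_add[OF i2 i3] add_right_cancel)
qed

end

section \<open>The antisymmetric part of the weight and the integral identity\<close>

context frac_p_direction begin

text \<open>The part subtracted in \<open>Om\<close>. Its weight is symmetric in t and r, which is
  why the minimum of the two weights is used rather than one of them.\<close>

definition Om2 :: "real \<Rightarrow> (real \<Rightarrow> real) \<Rightarrow> real \<Rightarrow> 'a \<Rightarrow> real" where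
  "Om2 l \<tau> t y = (\<integral>r. indicator {0<..umax} r * ((p - 1) * \<bar>t - r\<bar> powr (p - 2) * (if inA l r y then min (\<tau> t) (\<tau> r) else 0)) \<partial>lborel)"

lemma Om2_measurable [measurable (raw)]:
  assumes [measurable]: "\<tau> \<in> borel_measurable borel" "f \<in> borel_measurable M" "k \<in> borel_measurable M"
  shows "(\<lambda>z. Om2 l \<tau> (k z) (f z)) \<in> borel_measurable M"
  unfolding Om2_def by measurable

lemma beta_integral_le:
  assumes "0 < t" "t \<le> umax"
  shows "(\<integral>r. indicator {0<..umax} r * ((p - 1) * \<bar>t - r\<bar> powr (p - 2)) \<partial>lborel) \<le> 2 * umax powr (p - 1)"
proof -
  have "(\<integral>r. indicator {0<..umax} r * ((p - 1) * \<bar>t - r\<bar> powr (p - 2)) \<partial>lborel) = (\<integral>r. indicator {0..umax} r * ((p - 1) * \<bar>t - r\<bar> powr (p - 2)) \<partial>lborel)"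
  proof (rule integral_cong_AE)
    show "AE r in lborel. indicator {0<..umax} r * ((p - 1) * \<bar>t - r\<bar> powr (p - 2)) = indicator {0..umax} r * ((p - 1) * \<bar>t - r\<bar> powr (p - 2))"
      using AE_lborel_singleton[of "0::real"] by eventually_elim (auto simp: indicator_def)
  qed measurable
  also have "\<dots> = Gp p (t - 0) - Gp p (t - umax)"
    using Gp_layer_integral(2)[OF p_gt_1, of 0 umax t] umax_pos unfolding set_lebesgue_integral_def real_scaleR_def by simp
  also have "\<dots> \<le> 2 * umax powr (p - 1)"
    using abs_Gp_u_le[of "t - 0"] abs_Gp_u_le[of "t - umax"] assms by (simp add: abs_le_iff)
  finally show ?thesis .
qed

lemma Om2_integrand:
  fixes \<tau> :: "real \<Rightarrow> real"
  assumes [measurable]: "\<tau> \<in> borel_measurable borel" and \<tau>: "\<And>t. 0 \<le> \<tau> t"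
  shows "integrable lborel (\<lambda>r. indicator {0<..umax} r * ((p - 1) * \<bar>t - r\<bar> powr (p - 2) * (if inA l r y then min (\<tau> t) (\<tau> r) else 0)))"
    and "0 \<le> Om2 l \<tau> t y"
    and "Om2 l \<tau> t y \<le> \<tau> t * (\<integral>r. indicator {0<..umax} r * ((p - 1) * \<bar>t - r\<bar> powr (p - 2)) \<partial>lborel)"
proof -
  let ?b = "\<lambda>r. indicator {0<..umax} r * ((p - 1) * \<bar>t - r\<bar> powr (p - 2))"
  let ?m = "\<lambda>r. if inA l r y then min (\<tau> t) (\<tau> r) else 0"
  have b0: "0 \<le> ?b r" for r using p_gt_1 by simp
  have m: "0 \<le> ?m r" "?m r \<le> \<tau> t" for r using \<tau>[of t] \<tau>[of r] by auto
  have eq: "indicator {0<..umax} r * ((p - 1) * \<bar>t - r\<bar> powr (p - 2) * ?m r) = ?b r * ?m r" for r by simp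
  have le: "?b r * ?m r \<le> \<tau> t * ?b r" "0 \<le> ?b r * ?m r" for r
    using mult_left_mono[OF m(2) b0, of r r] b0[of r] m(1)[of r] by (simp_all only: mult.commute mult_nonneg_nonneg)
  have i: "integrable lborel (\<lambda>r. \<tau> t * ?b r)" using beta_integrable by simp
  have ii: "integrable lborel (\<lambda>r. ?b r * ?m r)"
  proof (rule Bochner_Integration.integrable_bound[OF i])
    show "AE r in lborel. norm (?b r * ?m r) \<le> norm (\<tau> t * ?b r)"
    proof (rule AE_I2)
      fix r show "norm (?b r * ?m r) \<le> norm (\<tau> t * ?b r)"
        unfolding real_norm_def abs_of_nonneg[OF le(2)] by (rule order_trans[OF le(1) abs_ge_self])
    qed
  qed measurable
  show "integrable lborel (\<lambda>r. indicator {0<..umax} r * ((p - 1) * \<bar>t - r\<bar> powr (p - 2) * ?m r))" unfolding eq by (rule ii)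
  show "0 \<le> Om2 l \<tau> t y" unfolding Om2_def eq by (rule Bochner_Integration.integral_nonneg) (rule le(2))
  have "Om2 l \<tau> t y \<le> (\<integral>r. \<tau> t * ?b r \<partial>lborel)" unfolding Om2_def eq by (rule integral_mono[OF ii i le(1)])
  then show "Om2 l \<tau> t y \<le> \<tau> t * (\<integral>r. ?b r \<partial>lborel)" by simp
qed

lemma Om2_le:
  fixes \<tau> :: "real \<Rightarrow> real"
  assumes \<tau>m: "\<tau> \<in> borel_measurable borel" and \<tau>: "\<And>t. 0 \<le> \<tau> t" "\<And>t. t \<le> umax \<Longrightarrow> \<tau> t \<le> T" and t: "0 < t" "t \<le> umax"
  shows "\<bar>Om2 l \<tau> t y\<bar> \<le> T * (2 * umax powr (p - 1))"
proof -
  have "Om2 l \<tau> t y \<le> \<tau> t * (2 * umax powr (p - 1))"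
    using Om2_integrand(3)[OF \<tau>m \<tau>(1), of l t y] mult_left_mono[OF beta_integral_le[OF t] \<tau>(1)[of t]] by linarith
  also have "\<dots> \<le> T * (2 * umax powr (p - 1))" using \<tau>(2)[OF t(2)] by (intro mult_right_mono) auto
  finally show ?thesis using Om2_integrand(2)[OF \<tau>m \<tau>(1), of l t y] by simp
qed

text \<open>The layer-cake formula turns the untruncated part into the nonlinearity at level t. The
  constant \<open>Gp p t\<close> will disappear, because the kernels at the two ends have the same
  total integral.\<close>

lemma Om_eq:
  fixes \<tau> :: "real \<Rightarrow> real"
  assumes [measurable]: "\<tau> \<in> borel_measurable borel" and \<tau>: "\<And>t. 0 \<le> \<tau> t"
  shows "Om l \<tau> t y = \<tau> t * (Gp p t - Gp p (t - u y)) - Om2 l \<tau> t y"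
proof -
  let ?\<beta> = "\<lambda>r. (p - 1) * \<bar>t - r\<bar> powr (p - 2)"
  let ?m = "\<lambda>r. if inA l r y then min (\<tau> t) (\<tau> r) else 0"
  let ?f = "\<lambda>r. indicator {0<..umax} r * (?\<beta> r * (if r < u y then \<tau> t else 0))"
  let ?g = "\<lambda>r. \<tau> t * (indicator {0..u y} r * ?\<beta> r)"
  have gi: "integrable lborel ?g" and gv: "(\<integral>r. ?g r \<partial>lborel) = \<tau> t * (Gp p t - Gp p (t - u y))"
    using Gp_layer_integral[OF p_gt_1, of 0 "u y" t] less_imp_le[OF u_pos[of y]]
    unfolding set_lebesgue_integral_def set_integrable_def real_scaleR_def by simp_all
  have ae: "AE r in lborel. ?f r = ?g r"
    using AE_lborel_singleton[of "0::real"] AE_lborel_singleton[of "u y"]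
    by eventually_elim (use u_le[of y] in \<open>auto simp: indicator_def\<close>)
  have fi: "integrable lborel ?f" by (subst integrable_cong_AE[OF _ _ ae]) (use gi in auto)
  have fv: "(\<integral>r. ?f r \<partial>lborel) = \<tau> t * (Gp p t - Gp p (t - u y))" unfolding gv[symmetric] by (rule integral_cong_AE[OF _ _ ae]) auto
  have "Om l \<tau> t y = (\<integral>r. ?f r - indicator {0<..umax} r * (?\<beta> r * ?m r) \<partial>lborel)"
    unfolding Om_def set_lebesgue_integral_def real_scaleR_def by (simp only: right_diff_distrib)
  also have "\<dots> = \<tau> t * (Gp p t - Gp p (t - u y)) - Om2 l \<tau> t y"
    unfolding Om2_def fv[symmetric] by (rule Bochner_Integration.integral_diff[OF fi Om2_integrand(1)[OF assms]])
  finally show ?thesis .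
qed

text \<open>The density whose integral over a component equals the contribution of
  \<open>Om2\<close> at its two ends, by \<open>integral_line_convolution\<close>.\<close>

definition Ps :: "real \<Rightarrow> (real \<Rightarrow> real) \<Rightarrow> real \<Rightarrow> real \<Rightarrow> 'a \<Rightarrow> real" where
  "Ps l \<tau> \<epsilon> t x = (\<integral>y. Om2 l \<tau> t y * dker N \<epsilon> e (x - y) \<partial>lborel)"

lemma Ps_measurable [measurable (raw)]:
  assumes [measurable]: "\<tau> \<in> borel_measurable borel" "f \<in> borel_measurable M" "k \<in> borel_measurable M"
  shows "(\<lambda>z. Ps l \<tau> \<epsilon> (k z) (f z)) \<in> borel_measurable M"
  unfolding Ps_def by measurable

lemma dker_translate:
  assumes "0 < \<epsilon>"
  shows "integrable lborel (\<lambda>y. \<bar>dker N \<epsilon> e (x - y)\<bar>)" "(\<integral>y. \<bar>dker N \<epsilon> e (x - y)\<bar> \<partial>lborel) = (\<integral>y. \<bar>dker N \<epsilon> e y\<bar> \<partial>lborel)"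
proof -
  have i: "integrable lborel (\<lambda>y::'a. \<bar>dker N \<epsilon> e y\<bar>)"
    using integrable_dker[OF assms norm_e N_gt] by (rule Bochner_Integration.integrable_abs)
  have eq: "\<bar>dker N \<epsilon> e (x - y)\<bar> = \<bar>dker N \<epsilon> e (y + (- x))\<bar>" for y
    using dker_minus[of N \<epsilon> e "y + (- x)"] by simp
  show "integrable lborel (\<lambda>y. \<bar>dker N \<epsilon> e (x - y)\<bar>)" unfolding eq by (rule integrable_lborel_translate[OF i])
  show "(\<integral>y. \<bar>dker N \<epsilon> e (x - y)\<bar> \<partial>lborel) = (\<integral>y. \<bar>dker N \<epsilon> e y\<bar> \<partial>lborel)"
    unfolding eq by (rule integral_lborel_translate) measurable
qed

lemma abs_Ps_le:
  fixes \<tau> :: "real \<Rightarrow> real"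
  assumes \<epsilon>: "0 < \<epsilon>" and \<tau>m [measurable]: "\<tau> \<in> borel_measurable borel" and \<tau>: "\<And>t. 0 \<le> \<tau> t" "\<And>t. t \<le> umax \<Longrightarrow> \<tau> t \<le> T" and t: "0 < t" "t \<le> umax"
  shows "\<bar>Ps l \<tau> \<epsilon> t x\<bar> \<le> T * (2 * umax powr (p - 1)) * (\<integral>y. \<bar>dker N \<epsilon> e y\<bar> \<partial>lborel)"
proof -
  let ?B = "T * (2 * umax powr (p - 1))"
  note b = Om2_le[OF \<tau>m \<tau> t]
  have bd: "\<bar>Om2 l \<tau> t y * dker N \<epsilon> e (x - y)\<bar> \<le> ?B * \<bar>dker N \<epsilon> e (x - y)\<bar>" for y
    using b[of l y] by (simp only: abs_mult) (rule mult_right_mono, auto)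
  have i: "integrable lborel (\<lambda>y. ?B * \<bar>dker N \<epsilon> e (x - y)\<bar>)" using dker_translate(1)[OF \<epsilon>] by (rule integrable_mult_right)
  have ii: "integrable lborel (\<lambda>y. Om2 l \<tau> t y * dker N \<epsilon> e (x - y))"
  proof (rule Bochner_Integration.integrable_bound[OF i])
    show "AE y in lborel. norm (Om2 l \<tau> t y * dker N \<epsilon> e (x - y)) \<le> norm (?B * \<bar>dker N \<epsilon> e (x - y)\<bar>)"
      using order_trans[OF bd abs_ge_self] by (intro AE_I2) (simp only: real_norm_def)
  qed measurable
  have "\<bar>Ps l \<tau> \<epsilon> t x\<bar> \<le> (\<integral>y. \<bar>Om2 l \<tau> t y * dker N \<epsilon> e (x - y)\<bar> \<partial>lborel)" unfolding Ps_def by (rule integral_abs_bound)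
  also have "\<dots> \<le> (\<integral>y. ?B * \<bar>dker N \<epsilon> e (x - y)\<bar> \<partial>lborel)"
    by (rule integral_mono[OF Bochner_Integration.integrable_abs[OF ii] i bd])
  also have "\<dots> = ?B * (\<integral>y. \<bar>dker N \<epsilon> e y\<bar> \<partial>lborel)"
    by (simp only: Bochner_Integration.integral_mult_right_zero dker_translate(2)[OF \<epsilon>])
  finally show ?thesis .
qed

text \<open>Written out, this is a double integral over pairs of moved points (t,x) and (r,y) of a
  factor symmetric in the levels times the odd kernel \<open>dker\<close> of x - y; exchanging the
  pairs changes its sign. The work is the absolute integrability that justifies the exchange, with
  \<epsilon> fixed.\<close>

lemma Ps_antisymmetry:
  fixes \<tau> :: "real \<Rightarrow> real"
  assumes \<epsilon>: "0 < \<epsilon>" and t1: "0 < t1" and \<tau>m [measurable]: "\<tau> \<in> borel_measurable borel" and \<tau>: "\<And>t. 0 \<le> \<tau> t" "\<And>t. t \<le> umax \<Longrightarrow> \<tau> t \<le> T" "\<And>t. t \<le> t1 \<Longrightarrow> \<tau> t = 0"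
  shows "(\<integral>z. (if inA l (fst z) (snd z) then Ps l \<tau> \<epsilon> (fst z) (snd z) else 0) \<partial>(lborel :: (real \<times> 'a) measure)) = 0"
proof -
  note [measurable] = fst_borel snd_borel
  define chi :: "real \<times> 'a \<Rightarrow> real" where "chi z = (if inA l (fst z) (snd z) \<and> 0 < fst z \<and> fst z \<le> umax then 1 else 0)" for z
  define kk where "kk t r = (p - 1) * \<bar>t - r\<bar> powr (p - 2) * min (\<tau> t) (\<tau> r)" for t r
  define H where "H z w = chi z * chi w * kk (fst z) (fst w) * dker N \<epsilon> e (snd z - snd w)" for z w :: "real \<times> 'a"
  \<comment> \<open>Majorant support: a pair with nonzero weight has both levels above
    \<open>t1\<close>, hence both points in the set {u > t1}, which has finite measure; only the
    integrable factor |t - r|^(p-2) remains.\<close>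
  define q :: "real \<times> 'a \<Rightarrow> real" where "q z = indicator {0<..umax} (fst z) * indicator {x. t1 < u x} (snd z)" for z
  define D where "D = N * \<epsilon> powr (- (N + 1)) * T"
  have [measurable]: "chi \<in> borel_measurable borel" unfolding chi_def[abs_def] by measurable
  have [measurable]: "q \<in> borel_measurable borel" unfolding q_def[abs_def] by measurable
  have [measurable]: "(\<lambda>(z, w). H z w) \<in> borel_measurable (borel \<Otimes>\<^sub>M borel)" unfolding H_def kk_def by measurable
  have T0: "0 \<le> T" using \<tau>(1,2)[of umax] by linarith
  have D0: "0 \<le> D" using N_pos T0 by (simp add: D_def)
  have q0: "0 \<le> q z" for z by (simp add: q_def)
  define m where "m = measure lborel {x. t1 < u x}"
  have em: "emeasure lborel {x. t1 < u x} = ennreal m"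
    unfolding m_def using superlevel_finite[OF t1] by (intro emeasure_eq_ennreal_measure) auto
  have m0: "0 \<le> m" by (simp add: m_def)
  have kernel: "\<bar>H z w\<bar> \<le> D * q z * (q w * ((p - 1) * \<bar>fst z - fst w\<bar> powr (p - 2)))" for z w
  proof (cases "chi z * chi w * min (\<tau> (fst z)) (\<tau> (fst w)) = 0")
    case True
    then have "H z w = 0" by (auto simp: H_def kk_def)
    then show ?thesis using D0 q0 p_gt_1 by simp
  next
    case False
    then have z: "inA l (fst z) (snd z)" "0 < fst z" "fst z \<le> umax" and w: "inA l (fst w) (snd w)" "0 < fst w" "fst w \<le> umax"
      and ne: "min (\<tau> (fst z)) (\<tau> (fst w)) \<noteq> 0" by (auto simp: chi_def split: if_splits)
    have gt: "t1 < fst z" "t1 < fst w"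
      using ne \<tau>(3)[of "fst z"] \<tau>(3)[of "fst w"] \<tau>(1)[of "fst z"] \<tau>(1)[of "fst w"] by (auto simp: not_less[symmetric] min_def split: if_splits)
    have qq: "q z = 1" "q w = 1" "chi z = 1" "chi w = 1" using z w gt by (auto simp: q_def chi_def inA_def)
    have "\<bar>dker N \<epsilon> e (snd z - snd w)\<bar> \<le> N * ker (N + 1) \<epsilon> (snd z - snd w)" by (rule abs_dker_le[OF \<epsilon> norm_e]) (use N_pos in simp)
    also have "\<dots> \<le> N * \<epsilon> powr (- (N + 1))" using ker_le_eps[OF \<epsilon>, of "N + 1" "snd z - snd w"] N_pos by (intro mult_left_mono) auto
    finally have dk: "\<bar>dker N \<epsilon> e (snd z - snd w)\<bar> \<le> N * \<epsilon> powr (- (N + 1))" .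
    have mn: "0 \<le> min (\<tau> (fst z)) (\<tau> (fst w))" "min (\<tau> (fst z)) (\<tau> (fst w)) \<le> T"
      using \<tau>(1)[of "fst z"] \<tau>(1)[of "fst w"] \<tau>(2)[OF z(3)] by auto
    have "\<bar>H z w\<bar> = (p - 1) * \<bar>fst z - fst w\<bar> powr (p - 2) * (min (\<tau> (fst z)) (\<tau> (fst w)) * \<bar>dker N \<epsilon> e (snd z - snd w)\<bar>)"
      using p_gt_1 mn(1) by (simp add: H_def kk_def qq abs_mult)
    also have "\<dots> \<le> (p - 1) * \<bar>fst z - fst w\<bar> powr (p - 2) * (T * (N * \<epsilon> powr (- (N + 1))))"
      using p_gt_1 mn T0 dk by (intro mult_left_mono mult_mono) auto
    also have "\<dots> = D * q z * (q w * ((p - 1) * \<bar>fst z - fst w\<bar> powr (p - 2)))" by (simp add: D_def qq)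
    finally show ?thesis .
  qed
  have inner: "(\<integral>\<^sup>+w. ennreal (q w * ((p - 1) * \<bar>t - fst w\<bar> powr (p - 2))) \<partial>lborel) \<le> ennreal (2 * umax powr (p - 1)) * ennreal m"
    if t: "0 < t" "t \<le> umax" for t
  proof -
    let ?b = "\<lambda>r. indicator {0<..umax} r * ((p - 1) * \<bar>t - r\<bar> powr (p - 2))"
    have b0: "0 \<le> ?b r" for r using p_gt_1 by simp
    have "(\<integral>\<^sup>+w. ennreal (q w * ((p - 1) * \<bar>t - fst w\<bar> powr (p - 2))) \<partial>lborel)
      = (\<integral>\<^sup>+w. ennreal (q w * ((p - 1) * \<bar>t - fst w\<bar> powr (p - 2))) \<partial>(lborel \<Otimes>\<^sub>M lborel))" by (simp only: lborel_prod)
    also have "\<dots> = (\<integral>\<^sup>+r. (\<integral>\<^sup>+y. ennreal (q (r, y) * ((p - 1) * \<bar>t - fst (r, y)\<bar> powr (p - 2))) \<partial>lborel) \<partial>lborel)"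
      by (rule lborel.nn_integral_fst[symmetric]) (simp add: lborel_prod)
    also have "\<dots> = (\<integral>\<^sup>+r. ennreal (?b r) * ennreal m \<partial>lborel)"
    proof (rule nn_integral_cong)
      fix r :: real
      have "(\<integral>\<^sup>+y. ennreal (q (r, y) * ((p - 1) * \<bar>t - fst (r, y)\<bar> powr (p - 2))) \<partial>lborel) = (\<integral>\<^sup>+y. ennreal (?b r) * indicator {x. t1 < u x} y \<partial>lborel)"
        by (intro nn_integral_cong) (auto simp: q_def indicator_def)
      also have "\<dots> = ennreal (?b r) * ennreal m" by (subst nn_integral_cmult_indicator) (auto simp: em)
      finally show "(\<integral>\<^sup>+y. ennreal (q (r, y) * ((p - 1) * \<bar>t - fst (r, y)\<bar> powr (p - 2))) \<partial>lborel) = ennreal (?b r) * ennreal m" .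
    qed
    also have "\<dots> = (\<integral>\<^sup>+r. ennreal (?b r) \<partial>lborel) * ennreal m" by (rule nn_integral_multc) measurable
    also have "(\<integral>\<^sup>+r. ennreal (?b r) \<partial>lborel) = ennreal (\<integral>r. ?b r \<partial>lborel)"
      using beta_integrable b0 by (intro nn_integral_eq_integral AE_I2)
    also have "ennreal (\<integral>r. ?b r \<partial>lborel) * ennreal m \<le> ennreal (2 * umax powr (p - 1)) * ennreal m"
      using beta_integral_le[OF t] by (intro mult_right_mono ennreal_leI) auto
    finally show ?thesis .
  qed
  have Hin: "(\<integral>\<^sup>+w. ennreal \<bar>H z w\<bar> \<partial>lborel) \<le> ennreal (q z) * (ennreal D * (ennreal (2 * umax powr (p - 1)) * ennreal m))" for z
  proof (cases "q z = 0")
    case True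
    then have "H z w = 0" for w using kernel[of z w] by simp
    then show ?thesis by simp
  next
    case False
    then have t: "0 < fst z" "fst z \<le> umax" and qz: "q z = 1" by (auto simp: q_def indicator_def split: if_splits)
    have "(\<integral>\<^sup>+w. ennreal \<bar>H z w\<bar> \<partial>lborel) \<le> (\<integral>\<^sup>+w. ennreal D * ennreal (q w * ((p - 1) * \<bar>fst z - fst w\<bar> powr (p - 2))) \<partial>lborel)"
    proof (rule nn_integral_mono)
      fix w
      have "ennreal \<bar>H z w\<bar> \<le> ennreal (D * (q w * ((p - 1) * \<bar>fst z - fst w\<bar> powr (p - 2))))"
        using kernel[of z w] unfolding qz by (intro ennreal_leI) simp
      then show "ennreal \<bar>H z w\<bar> \<le> ennreal D * ennreal (q w * ((p - 1) * \<bar>fst z - fst w\<bar> powr (p - 2)))"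
        using D0 by (simp only: ennreal_mult')
    qed
    also have "\<dots> = ennreal D * (\<integral>\<^sup>+w. ennreal (q w * ((p - 1) * \<bar>fst z - fst w\<bar> powr (p - 2))) \<partial>lborel)"
      by (rule nn_integral_cmult) measurable
    also have "\<dots> \<le> ennreal D * (ennreal (2 * umax powr (p - 1)) * ennreal m)" by (intro mult_left_mono inner[OF t]) simp
    finally show ?thesis by (simp add: qz)
  qed
  have qfin: "(\<integral>\<^sup>+z. ennreal (q z) \<partial>lborel) < \<infinity>"
  proof -
    have "(\<integral>\<^sup>+z. ennreal (q z) \<partial>lborel) = (\<integral>\<^sup>+z. ennreal (q z) \<partial>(lborel \<Otimes>\<^sub>M lborel))" by (simp only: lborel_prod)
    also have "\<dots> = (\<integral>\<^sup>+r. (\<integral>\<^sup>+y. ennreal (q (r, y)) \<partial>lborel) \<partial>lborel)"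
      by (rule lborel.nn_integral_fst[symmetric]) (simp add: lborel_prod)
    also have "\<dots> = (\<integral>\<^sup>+r. ennreal m * indicator {0<..umax} r \<partial>lborel)"
    proof (rule nn_integral_cong)
      fix r :: real
      have "(\<integral>\<^sup>+y. ennreal (q (r, y)) \<partial>lborel) = (\<integral>\<^sup>+y. indicator {0<..umax} r * indicator {x. t1 < u x} y \<partial>lborel)"
        by (intro nn_integral_cong) (auto simp: q_def indicator_def)
      also have "\<dots> = indicator {0<..umax} r * ennreal m" by (subst nn_integral_cmult_indicator) (auto simp: em)
      finally show "(\<integral>\<^sup>+y. ennreal (q (r, y)) \<partial>lborel) = ennreal m * indicator {0<..umax} r" by (simp only: mult.commute)
    qed
    also have "\<dots> = ennreal m * ennreal umax" using umax_pos by (subst nn_integral_cmult_indicator) auto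
    also have "\<dots> < \<infinity>" by (simp add: ennreal_mult_less_top)
    finally show ?thesis .
  qed
  have Hi: "integrable (lborel \<Otimes>\<^sub>M lborel) (\<lambda>(z, w). H z w)"
  proof (rule integrableI_bounded)
    have "(\<integral>\<^sup>+x. ennreal (norm (case x of (z, w) \<Rightarrow> H z w)) \<partial>(lborel \<Otimes>\<^sub>M lborel)) = (\<integral>\<^sup>+z. (\<integral>\<^sup>+w. ennreal \<bar>H z w\<bar> \<partial>lborel) \<partial>lborel)"
      by (subst lborel.nn_integral_fst[symmetric]) auto
    also have "\<dots> \<le> (\<integral>\<^sup>+z. ennreal (q z) * (ennreal D * (ennreal (2 * umax powr (p - 1)) * ennreal m)) \<partial>lborel)"
      by (rule nn_integral_mono) (rule Hin)
    also have "\<dots> = (\<integral>\<^sup>+z. ennreal (q z) \<partial>lborel) * (ennreal D * (ennreal (2 * umax powr (p - 1)) * ennreal m))"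
      by (rule nn_integral_multc) measurable
    also have "\<dots> < \<infinity>" using qfin by (simp add: ennreal_mult_less_top)
    finally show "(\<integral>\<^sup>+x. ennreal (norm (case x of (z, w) \<Rightarrow> H z w)) \<partial>(lborel \<Otimes>\<^sub>M lborel)) < \<infinity>" .
  qed simp
  have anti: "H w z = - H z w" for z w
  proof -
    have "kk (fst w) (fst z) = kk (fst z) (fst w)" by (simp add: kk_def abs_minus_commute min.commute)
    moreover have "dker N \<epsilon> e (snd w - snd z) = - dker N \<epsilon> e (snd z - snd w)" using dker_minus[of N \<epsilon> e "snd z - snd w"] by simp
    ultimately show ?thesis by (simp add: H_def)
  qed
  have "(\<integral>z. (\<integral>w. H z w \<partial>lborel) \<partial>lborel) = (\<integral>w. (\<integral>z. H z w \<partial>lborel) \<partial>lborel)" by (rule lborel_pair.Fubini_integral[OF Hi, symmetric])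
  also have "\<dots> = (\<integral>w. (\<integral>z. - H w z \<partial>lborel) \<partial>lborel)" 
    by (intro Bochner_Integration.integral_cong refl anti)
  also have "\<dots> = - (\<integral>z. (\<integral>w. H z w \<partial>lborel) \<partial>lborel)"
    by (simp only: Bochner_Integration.integral_minus)
  finally have zero: "(\<integral>z. (\<integral>w. H z w \<partial>lborel) \<partial>lborel) = 0" by linarith
  have "(if inA l (fst z) (snd z) then Ps l \<tau> \<epsilon> (fst z) (snd z) else 0) = (\<integral>w. H z w \<partial>lborel)" for z
  proof (cases "inA l (fst z) (snd z) \<and> 0 < fst z")
    case True
    then have cz: "chi z = 1" using u_le[of "snd z"] by (auto simp: chi_def inA_def)
    have iw: "integrable (lborel \<Otimes>\<^sub>M lborel) (\<lambda>(r, y). H z (r, y))"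
    proof (rule integrableI_bounded)
      show "(\<lambda>(r, y). H z (r, y)) \<in> borel_measurable (lborel \<Otimes>\<^sub>M lborel)"
        unfolding case_prod_eta by (simp add: lborel_prod)
      have "(\<integral>\<^sup>+x. ennreal (norm (case x of (r, y) \<Rightarrow> H z (r, y))) \<partial>(lborel \<Otimes>\<^sub>M lborel)) = (\<integral>\<^sup>+w. ennreal \<bar>H z w\<bar> \<partial>lborel)"
        by (simp add: lborel_prod)
      also have "\<dots> < \<infinity>" by (rule le_less_trans[OF Hin]) (simp add: ennreal_mult_less_top)
      finally show "(\<integral>\<^sup>+x. ennreal (norm (case x of (r, y) \<Rightarrow> H z (r, y))) \<partial>(lborel \<Otimes>\<^sub>M lborel)) < \<infinity>" .
    qed
    have "(\<integral>w. H z w \<partial>lborel) = (\<integral>w. (case w of (r, y) \<Rightarrow> H z (r, y)) \<partial>(lborel \<Otimes>\<^sub>M lborel))" by (simp add: lborel_prod)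
    also have "\<dots> = (\<integral>y. (\<integral>r. H z (r, y) \<partial>lborel) \<partial>lborel)" by (rule lborel_pair.integral_snd[OF iw, symmetric])
    also have "\<dots> = (\<integral>y. Om2 l \<tau> (fst z) y * dker N \<epsilon> e (snd z - y) \<partial>lborel)"
    proof (rule Bochner_Integration.integral_cong[OF refl])
      fix y
      have "(\<integral>r. H z (r, y) \<partial>lborel) = (\<integral>r. (indicator {0<..umax} r * ((p - 1) * \<bar>fst z - r\<bar> powr (p - 2) * (if inA l r y then min (\<tau> (fst z)) (\<tau> r) else 0))) * dker N \<epsilon> e (snd z - y) \<partial>lborel)"
        unfolding H_def cz by (intro Bochner_Integration.integral_cong) (auto simp: chi_def kk_def indicator_def)
      also have "\<dots> = Om2 l \<tau> (fst z) y * dker N \<epsilon> e (snd z - y)"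
        unfolding Om2_def by (rule Bochner_Integration.integral_mult_left_zero)
      finally show "(\<integral>r. H z (r, y) \<partial>lborel) = Om2 l \<tau> (fst z) y * dker N \<epsilon> e (snd z - y)" .
    qed
    finally show ?thesis using True by (simp add: Ps_def)
  next
    case False
    then have cz: "H z w = 0" for w by (auto simp: H_def chi_def)
    have "Om2 l \<tau> (fst z) y = 0" if "fst z \<le> 0" for y
    proof -
      have "\<tau> (fst z) = 0" using that t1 by (intro \<tau>(3)) simp
      then have m0: "min (\<tau> (fst z)) (\<tau> r) = 0" for r using \<tau>(1)[of r] by simp
      show ?thesis unfolding Om2_def m0 by simp
    qed
    then have "inA l (fst z) (snd z) \<Longrightarrow> Ps l \<tau> \<epsilon> (fst z) (snd z) = 0" using False by (simp add: Ps_def)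
    then show ?thesis by (simp add: cz)
  qed
  then show ?thesis using zero by simp
qed


text \<open>Indicator of a set of finite measure that contains all (t,x) relevant to the test. Its
  integral is the constant that the exponential must finally exceed.\<close>

definition qq :: "real \<Rightarrow> real \<times> 'a \<Rightarrow> real" where
  "qq t1 z = indicator {0<..umax} (fst z) * indicator {x. t1 < u x} (snd z)"

lemma qq_measurable [measurable]: "qq t1 \<in> borel_measurable borel"
proof -
  note [measurable] = fst_borel snd_borel
  show ?thesis unfolding qq_def[abs_def] by measurable
qed

lemma qq_integrable:
  assumes t1: "0 < t1" shows "integrable lborel (qq t1)"
proof (rule integrableI_bounded)
  have "(\<integral>\<^sup>+z. ennreal (norm (qq t1 z)) \<partial>lborel) = (\<integral>\<^sup>+z. ennreal (norm (qq t1 z)) \<partial>(lborel \<Otimes>\<^sub>M lborel))" by (simp only: lborel_prod)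
  also have "\<dots> = (\<integral>\<^sup>+r. (\<integral>\<^sup>+y. ennreal (norm (qq t1 (r, y))) \<partial>lborel) \<partial>lborel)"
    by (rule lborel.nn_integral_fst[symmetric]) (simp add: lborel_prod)
  also have "\<dots> = (\<integral>\<^sup>+r. emeasure lborel {x. t1 < u x} * indicator {0<..umax} r \<partial>lborel)"
  proof (rule nn_integral_cong)
    fix r :: real
    have "(\<integral>\<^sup>+y. ennreal (norm (qq t1 (r, y))) \<partial>lborel) = (\<integral>\<^sup>+y. indicator {0<..umax} r * indicator {x. t1 < u x} y \<partial>lborel)"
      by (intro nn_integral_cong) (auto simp: qq_def indicator_def)
    also have "\<dots> = indicator {0<..umax} r * emeasure lborel {x. t1 < u x}" by (subst nn_integral_cmult_indicator) auto
    finally show "(\<integral>\<^sup>+y. ennreal (norm (qq t1 (r, y))) \<partial>lborel) = emeasure lborel {x. t1 < u x} * indicator {0<..umax} r" by (simp only: mult.commute)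
  qed
  also have "\<dots> = emeasure lborel {x. t1 < u x} * ennreal umax" using umax_pos by (subst nn_integral_cmult_indicator) auto
  also have "\<dots> < \<infinity>" using superlevel_finite[OF t1] by (simp add: ennreal_mult_less_top)
  finally show "(\<integral>\<^sup>+z. ennreal (norm (qq t1 z)) \<partial>lborel) < \<infinity>" .
qed simp

text \<open>The normalized test: bounded below pointwise by \<open>steiner_lower\<close>, while its
  integral equals that of \<open>FF\<close>.\<close>

definition GG :: "real \<Rightarrow> (real \<Rightarrow> real) \<Rightarrow> real \<Rightarrow> real \<times> 'a \<Rightarrow> real" where
  "GG l \<tau> \<epsilon> z = (if inA l (fst z) (snd z) then (\<integral>y. Om l \<tau> (fst z) y * (ker N \<epsilon> (rend (fst z) (snd z) - y) - ker N \<epsilon> (lend (fst z) (snd z) - y)) \<partial>lborel) / len (fst z) (snd z) else 0)"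

lemma Om2_zero:
  fixes \<tau> :: "real \<Rightarrow> real"
  assumes "\<tau> t = 0" "\<And>t. 0 \<le> \<tau> t" shows "Om2 l \<tau> t y = 0" "Ps l \<tau> \<epsilon> t x = 0"
proof -
  have m: "min (\<tau> t) (\<tau> r) = 0" for r using assms(1) assms(2)[of r] by simp
  have "Om2 l \<tau> t y = 0" for y unfolding Om2_def m by simp
  then show "Om2 l \<tau> t y = 0" "Ps l \<tau> \<epsilon> t x = 0" by (simp_all add: Ps_def)
qed

text \<open>The splitting \<open>Om_eq\<close> at both ends: the constant integrates to 0 against
  the kernel difference, the term with u gives the values of \<open>h\<close>, and
  \<open>Om2\<close> gives a component mean of \<open>Ps\<close>.\<close>

lemma GG_eq:
  fixes \<tau> :: "real \<Rightarrow> real"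
  assumes \<epsilon>: "0 < \<epsilon>" and \<tau>m [measurable]: "\<tau> \<in> borel_measurable borel" and \<tau>: "\<And>t. 0 \<le> \<tau> t" "\<And>t. t \<le> umax \<Longrightarrow> \<tau> t \<le> T" and t: "0 < t" and A: "inA l t x"
  shows "GG l \<tau> \<epsilon> (t, x) = FF l \<tau> \<epsilon> (t, x) - av t (Ps l \<tau> \<epsilon> t) x"
proof -
  have tu: "t < u x" "t \<le> umax" using A u_le[of x] by (auto simp: inA_def)
  define a where "a = lend t x"
  define b where "b = rend t x"
  have ub: "u a = t" "u b = t" by (simp_all add: a_def b_def u_lend[OF t tu(1)] u_rend[OF t tu(1)])
  let ?k = "\<lambda>y. ker N \<epsilon> (b - y) - ker N \<epsilon> (a - y)"
  let ?B = "T * (2 * umax powr (p - 1))"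
  have [measurable]: "Om2 l \<tau> t \<in> borel_measurable borel" by measurable
  have O2: "integrable lborel (\<lambda>y. Om2 l \<tau> t y * ?k y)"
    unfolding right_diff_distrib
    by (intro Bochner_Integration.integrable_diff integrable_mult_ker[OF \<epsilon> N_gt _ Om2_le[OF \<tau>m \<tau> t tu(2)]]) auto
  have hx: "integrable lborel (\<lambda>y. Gp p (t - u y) * ker N \<epsilon> (x' - y))" "(\<integral>y. Gp p (t - u y) * ker N \<epsilon> (x' - y) \<partial>lborel) = h \<epsilon> x'" if "u x' = t" for x'
    using h_integrable[OF \<epsilon>, of x'] that by (simp_all add: h_def)
  have i1: "integrable lborel (\<lambda>y. ker N \<epsilon> (x' - y))" "(\<integral>y. ker N \<epsilon> (x' - y) \<partial>lborel) = (\<integral>y. ker N \<epsilon> (y::'a) \<partial>lborel)" for x' :: 'a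
  proof -
    have eq: "ker N \<epsilon> (x' - y) = ker N \<epsilon> (y + (- x'))" for y using ker_commute[of N \<epsilon> x' y] by simp
    show "integrable lborel (\<lambda>y. ker N \<epsilon> (x' - y))" unfolding eq by (rule integrable_lborel_translate[OF integrable_ker[OF \<epsilon> N_gt]])
    show "(\<integral>y. ker N \<epsilon> (x' - y) \<partial>lborel) = (\<integral>y. ker N \<epsilon> (y::'a) \<partial>lborel)" unfolding eq by (rule integral_lborel_translate) measurable
  qed
  have k0: "integrable lborel ?k" "(\<integral>y. ?k y \<partial>lborel) = 0"
    using i1[of a] i1[of b] by (simp_all add: Bochner_Integration.integral_diff)
  have G: "integrable lborel (\<lambda>y. Gp p (t - u y) * ?k y)" "(\<integral>y. Gp p (t - u y) * ?k y \<partial>lborel) = h \<epsilon> b - h \<epsilon> a"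
    using hx[OF ub(1)] hx[OF ub(2)] unfolding right_diff_distrib by (simp_all add: Bochner_Integration.integral_diff)
  have "(\<integral>y. Om l \<tau> t y * ?k y \<partial>lborel) = (\<integral>y. (\<tau> t * (Gp p t * ?k y) - \<tau> t * (Gp p (t - u y) * ?k y)) - Om2 l \<tau> t y * ?k y \<partial>lborel)"
    unfolding Om_eq[OF \<tau>m \<tau>(1)] by (intro Bochner_Integration.integral_cong refl) (simp only: left_diff_distrib right_diff_distrib mult.assoc)
  also have "\<dots> = (\<tau> t * (Gp p t * 0) - \<tau> t * (h \<epsilon> b - h \<epsilon> a)) - (\<integral>y. Om2 l \<tau> t y * ?k y \<partial>lborel)"
  proof -
    have j1: "integrable lborel (\<lambda>y. \<tau> t * (Gp p t * ?k y))" by (intro integrable_mult_right k0(1))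
    have j2: "integrable lborel (\<lambda>y. \<tau> t * (Gp p (t - u y) * ?k y))" by (intro integrable_mult_right G(1))
    show ?thesis
      by (simp only: Bochner_Integration.integral_diff[OF Bochner_Integration.integrable_diff[OF j1 j2] O2]
        Bochner_Integration.integral_diff[OF j1 j2] Bochner_Integration.integral_mult_right_zero k0(2) G(2))
  qed
  finally have 1: "(\<integral>y. Om l \<tau> t y * ?k y \<partial>lborel) = \<tau> t * (h \<epsilon> a - h \<epsilon> b) - (\<integral>y. Om2 l \<tau> t y * ?k y \<partial>lborel)"
    by (simp add: right_diff_distrib)
  have l0: "- ll t x \<le> rr t x" using len_pos[OF t tu(1)] by (simp add: len_def)
  have "(\<integral>r. indicator {- ll t x<..<rr t x} r * Ps l \<tau> \<epsilon> t (x + r *\<^sub>R e) \<partial>lborel) = (\<integral>y. Om2 l \<tau> t y * (ker N \<epsilon> (x + rr t x *\<^sub>R e - y) - ker N \<epsilon> (x + (- ll t x) *\<^sub>R e - y)) \<partial>lborel)"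
    unfolding Ps_def by (rule integral_line_convolution[OF \<epsilon> norm_e l0 N_gt _ Om2_le[OF \<tau>m \<tau> t tu(2)]]) measurable
  also have "\<dots> = (\<integral>y. Om2 l \<tau> t y * ?k y \<partial>lborel)" by (simp add: a_def b_def lend_def rend_def)
  finally have 2: "av t (Ps l \<tau> \<epsilon> t) x = (\<integral>y. Om2 l \<tau> t y * ?k y \<partial>lborel) / len t x" by (simp only: av_def)
  show ?thesis using A unfolding 2 by (simp add: GG_def FF_def 1 a_def[symmetric] b_def[symmetric] diff_divide_distrib)
qed

text \<open>Component means do not change the integral over the moved set, because that set consists
  of whole components; so the \<open>Ps\<close> part vanishes by antisymmetry.\<close>

lemma GG_integral:
  fixes \<tau> :: "real \<Rightarrow> real"
  assumes \<epsilon>: "0 < \<epsilon>" and t1: "0 < t1" and \<tau>m [measurable]: "\<tau> \<in> borel_measurable borel" and \<tau>: "\<And>t. 0 \<le> \<tau> t" "\<And>t. t \<le> umax \<Longrightarrow> \<tau> t \<le> T" "\<And>t. t \<le> t1 \<Longrightarrow> \<tau> t = 0"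
    and FFi: "integrable lborel (FF l \<tau> \<epsilon>)"
  shows "integrable lborel (GG l \<tau> \<epsilon>)" "(\<integral>z. GG l \<tau> \<epsilon> z \<partial>lborel) = (\<integral>z. FF l \<tau> \<epsilon> z \<partial>lborel)"
    "\<And>t x. t \<le> t1 \<Longrightarrow> GG l \<tau> \<epsilon> (t, x) = 0"
proof -
  note [measurable] = fst_borel snd_borel
  define AV where "AV z = (if inA l (fst z) (snd z) then av (fst z) (Ps l \<tau> \<epsilon> (fst z)) (snd z) else 0)" for z
  define PP where "PP z = (if inA l (fst z) (snd z) then Ps l \<tau> \<epsilon> (fst z) (snd z) else 0)" for z
  let ?B = "T * (2 * umax powr (p - 1)) * (\<integral>y. \<bar>dker N \<epsilon> e (y::'a)\<bar> \<partial>lborel)"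
  have Pb: "\<bar>Ps l \<tau> \<epsilon> t x\<bar> \<le> ?B" if "0 < t" "t \<le> umax" for t x
    by (rule abs_Ps_le[OF \<epsilon> \<tau>m \<tau>(1) _ that]) (rule \<tau>(2))
  have Pm [measurable]: "Ps l \<tau> \<epsilon> t \<in> borel_measurable borel" for t by measurable
  have [measurable]: "PP \<in> borel_measurable borel" unfolding PP_def[abs_def] by measurable
  have "(\<lambda>z. av (fst z) (Ps l \<tau> \<epsilon> (fst z)) (snd z)) \<in> borel_measurable borel"
    by (rule av_measurable[of "Ps l \<tau> \<epsilon>"]) measurable
  then have [measurable]: "AV \<in> borel_measurable borel" unfolding AV_def[abs_def] by measurable
  have z0: "Ps l \<tau> \<epsilon> t = (\<lambda>x. 0)" if "t \<le> t1" for t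
    using Om2_zero(2)[of \<tau> t, OF \<tau>(3)[OF that] \<tau>(1)] by (simp add: fun_eq_iff)
  have bd: "\<bar>AV z\<bar> \<le> ?B * qq t1 z \<and> \<bar>PP z\<bar> \<le> ?B * qq t1 z" for z
  proof (cases "inA l (fst z) (snd z) \<and> t1 < fst z")
    case True
    then have t: "0 < fst z" "fst z < u (snd z)" "fst z \<le> umax" using t1 u_le[of "snd z"] by (auto simp: inA_def)
    have q1: "qq t1 z = 1" using True t by (auto simp: qq_def)
    show ?thesis unfolding q1 mult_1_right
      using True Pb[OF t(1,3), of "snd z"] abs_av_le[OF t(1,2) Pm Pb[OF t(1,3)]] by (simp add: AV_def PP_def)
  next
    case False
    then have "AV z = 0" "PP z = 0" using z0[of "fst z"] by (auto simp: AV_def PP_def av_def)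
    moreover have "0 \<le> ?B" using Pb[OF umax_pos order_refl, of 0] by (rule order_trans[OF abs_ge_zero])
    moreover have "0 \<le> qq t1 z" by (simp add: qq_def)
    ultimately show ?thesis by simp
  qed
  have iq: "integrable lborel (\<lambda>z. ?B * qq t1 z)" by (intro integrable_mult_right qq_integrable t1)
  have AVi: "integrable lborel AV"
  proof (rule Bochner_Integration.integrable_bound[OF iq])
    show "AE z in lborel. norm (AV z) \<le> norm (?B * qq t1 z)"
      using bd by (intro AE_I2) (unfold real_norm_def, blast intro: order_trans[OF _ abs_ge_self])
  qed measurable
  have PPi: "integrable lborel PP"
  proof (rule Bochner_Integration.integrable_bound[OF iq])
    show "AE z in lborel. norm (PP z) \<le> norm (?B * qq t1 z)"
      using bd by (intro AE_I2) (unfold real_norm_def, blast intro: order_trans[OF _ abs_ge_self])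
  qed measurable
  have split: "(\<integral>z. f z \<partial>lborel) = (\<integral>t. (\<integral>x. f (t, x) \<partial>lborel) \<partial>lborel)" if "integrable lborel f" for f :: "real \<times> 'a \<Rightarrow> real"
    using lborel_pair.integral_fst[of "\<lambda>t x. f (t, x)"] that by (simp add: lborel_prod)
  have "(\<integral>z. AV z \<partial>lborel) = (\<integral>t. (\<integral>x. AV (t, x) \<partial>lborel) \<partial>lborel)" by (rule split[OF AVi])
  also have "\<dots> = (\<integral>t. (\<integral>x. PP (t, x) \<partial>lborel) \<partial>lborel)"
  proof (rule Bochner_Integration.integral_cong[OF refl])
    fix t :: real
    consider "t \<le> t1" | "0 < t" "t \<le> umax" | "umax < t" using t1 by linarith
    then show "(\<integral>x. AV (t, x) \<partial>lborel) = (\<integral>x. PP (t, x) \<partial>lborel)"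
    proof cases
      case 1 then show ?thesis unfolding AV_def PP_def fst_conv snd_conv z0[OF 1] by (simp add: av_def cong: if_cong)
    next
      case 2
      then show ?thesis using integral_average[OF 2(1) Pm Pb[OF 2], of l] unfolding AV_def PP_def fst_conv snd_conv by simp
    next
      case 3
      then have "\<not> inA l t x" for x using u_le[of x] by (auto simp: inA_def)
      then show ?thesis by (simp add: AV_def PP_def)
    qed
  qed
  also have "\<dots> = (\<integral>z. PP z \<partial>lborel)" by (rule split[OF PPi, symmetric])
  also have "\<dots> = 0" unfolding PP_def by (rule Ps_antisymmetry[OF \<epsilon> t1 \<tau>m \<tau>])
  finally have AV0: "(\<integral>z. AV z \<partial>lborel) = 0" .
  have Gz: "GG l \<tau> \<epsilon> (t, x) = 0" if "t \<le> t1" for t x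
    using \<tau>(3)[OF that] Om2_zero(1)[of \<tau> t, OF \<tau>(3)[OF that] \<tau>(1)] by (simp add: GG_def Om_eq[OF \<tau>m \<tau>(1)])
  have eq: "GG l \<tau> \<epsilon> z = FF l \<tau> \<epsilon> z - AV z" for z
  proof -
    obtain t x where z: "z = (t, x)" by fastforce
    consider "t \<le> t1" | "0 < t" "inA l t x" | "\<not> inA l t x" using t1 by linarith
    then show ?thesis
    proof cases
      case 1 then show ?thesis using \<tau>(3)[OF 1] z0[OF 1] Gz[OF 1] by (simp add: z FF_def AV_def av_def)
    next
      case 2 then show ?thesis using GG_eq[OF \<epsilon> \<tau>m \<tau>(1) _ 2, of T] \<tau>(2) by (simp add: z AV_def)
    next
      case 3 then show ?thesis by (simp add: z GG_def FF_def AV_def)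
    qed
  qed
  show "integrable lborel (GG l \<tau> \<epsilon>)" unfolding eq[abs_def] by (rule Bochner_Integration.integrable_diff[OF FFi AVi])
  show "(\<integral>z. GG l \<tau> \<epsilon> z \<partial>lborel) = (\<integral>z. FF l \<tau> \<epsilon> z \<partial>lborel)"
    by (simp only: eq Bochner_Integration.integral_diff[OF FFi AVi] AV0 diff_zero)
  show "\<And>t x. t \<le> t1 \<Longrightarrow> GG l \<tau> \<epsilon> (t, x) = 0" by (rule Gz)
qed

end

section \<open>Conclusion\<close>

lemma power_le_exp:
  fixes x :: real assumes "0 \<le> x" shows "x ^ m / fact m \<le> exp x"
proof -
  have s: "(\<lambda>n. x ^ n /\<^sub>R fact n) sums exp x" by (rule exp_converges)
  have "(\<Sum>n\<in>{m}. x ^ n /\<^sub>R fact n) \<le> (\<Sum>n. x ^ n /\<^sub>R fact n)"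
    using assms by (intro sum_le_suminf sums_summable[OF s]) auto
  then show ?thesis using sums_unique[OF s] by (simp add: divide_inverse mult.commute)
qed

text \<open>The exponential of M^(-\<theta>) beats every power of M, however small \<theta> is. Used
  with M^(n+1), the order of the measure of a neighbourhood of a violation in level and
  space.\<close>

lemma exp_power_contradiction:
  fixes a b Q \<theta> s0 :: real and n :: nat
  assumes "0 < a" "0 < b" "0 \<le> Q" "0 < \<theta>"
  obtains \<omega> where "0 < \<omega>" "\<And>M. 0 < M \<Longrightarrow> M \<le> 1 \<Longrightarrow> M \<le> \<omega> \<Longrightarrow> Q < exp (a * M powr (- \<theta>)) * (b * M ^ Suc n)"
proof -
  \<comment> \<open>A Taylor term of this order is at least a multiple of M^(-(n+2)), one power more
    than needed, leaving 1/M.\<close>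
  obtain m :: nat where m: "(real n + 2) / \<theta> \<le> real m" using real_arch_simple by blast
  then have m': "real n + 2 \<le> real m * \<theta>" using assms(4) by (simp add: pos_divide_le_eq)
  define k where "k = a ^ m / fact m * b"
  have k: "0 < k" using assms by (simp add: k_def)
  show ?thesis
  proof (rule that[of "k / (Q + 1)"])
    show "0 < k / (Q + 1)" using k assms by simp
    fix M :: real assume M: "0 < M" "M \<le> 1" "M \<le> k / (Q + 1)"
    have "M powr (- (real n + 2)) \<le> (M powr (- \<theta>)) ^ m"
    proof -
      have "(M powr (- \<theta>)) ^ m = M powr (- (real m * \<theta>))"
        using M(1) by (simp add: powr_realpow[symmetric] powr_powr mult.commute)
      then show ?thesis using m' M by (simp add: powr_mono')
    qed
    then have "a ^ m / fact m * M powr (- (real n + 2)) \<le> a ^ m / fact m * (M powr (- \<theta>)) ^ m"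
      using assms(1) by (intro mult_left_mono) auto
    also have "\<dots> = (a * M powr (- \<theta>)) ^ m / fact m" by (simp add: power_mult_distrib)
    also have "\<dots> \<le> exp (a * M powr (- \<theta>))" using assms(1) by (intro power_le_exp) auto
    finally have e: "a ^ m / fact m * M powr (- (real n + 2)) \<le> exp (a * M powr (- \<theta>))" .
    have "M powr (- (real n + 2)) * M ^ Suc n = M powr (- (real n + 2) + real (Suc n))"
      using M(1) by (simp only: powr_add powr_realpow)
    also have "\<dots> = M powr (- 1)" by simp
    also have "\<dots> = 1 / M" using M(1) by (simp add: powr_minus_divide)
    finally have MM: "M powr (- (real n + 2)) * M ^ Suc n = 1 / M" .
    have "M * (Q + 1) \<le> k" using M(3) assms(3) by (simp add: pos_le_divide_eq)
    then have "Q + 1 \<le> k * (1 / M)" using M(1) by (simp add: pos_le_divide_eq mult.commute)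
    also have "k * (1 / M) = (a ^ m / fact m * M powr (- (real n + 2))) * (b * M ^ Suc n)"
      unfolding k_def MM[symmetric] by (simp only: mult_ac)
    also have "\<dots> \<le> exp (a * M powr (- \<theta>)) * (b * M ^ Suc n)"
      using e assms(2) M(1) by (intro mult_right_mono) auto
    finally show "Q < exp (a * M powr (- \<theta>)) * (b * M ^ Suc n)" by linarith
  qed
qed

text \<open>Convexity: the increment from r to t is at most the slope at the larger level times t -
  r. This one-sided slope bound is what the loss estimate asks of the weight.\<close>

lemma truncated_exp_slope:
  fixes K t1 r t :: real
  assumes K: "0 < K" and rt: "r \<le> t"
  defines "\<tau> \<equiv> \<lambda>t. if t1 < t then exp (K * (t - t1)) - 1 else 0"
  shows "\<tau> t - \<tau> r \<le> (if t1 < t then K * exp (K * (t - t1)) else 0) * (t - r)" "\<tau> r \<le> \<tau> t" "0 \<le> \<tau> t"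
proof -
  have conv: "exp x - exp y \<le> exp x * (x - y)" for x y :: real
  proof -
    have "exp x * (1 + (y - x)) \<le> exp x * exp (y - x)" by (intro mult_left_mono exp_ge_add_one_self) auto
    then show ?thesis by (simp add: exp_add[symmetric] algebra_simps)
  qed
  have ge1: "1 \<le> exp (K * (w - t1))" if "t1 < w" for w using that K by simp
  show "0 \<le> \<tau> t" using ge1[of t] by (simp add: \<tau>_def)
  show "\<tau> r \<le> \<tau> t" using rt K ge1[of t] by (auto simp: \<tau>_def)
  show "\<tau> t - \<tau> r \<le> (if t1 < t then K * exp (K * (t - t1)) else 0) * (t - r)"
  proof (cases "t1 < t")
    case True
    \<comment> \<open>The weight vanishes up to \<open>t1\<close>, so r may be raised to
      \<open>t1\<close>, which only shortens the interval.\<close>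
    define r' where "r' = max r t1"
    have "\<tau> r = exp (K * (r' - t1)) - 1" by (auto simp: \<tau>_def r'_def max_def)
    then have "\<tau> t - \<tau> r = exp (K * (t - t1)) - exp (K * (r' - t1))" using True by (simp add: \<tau>_def)
    also have "\<dots> \<le> exp (K * (t - t1)) * (K * (t - t1) - K * (r' - t1))" by (rule conv)
    also have "K * (t - t1) - K * (r' - t1) = K * (t - r')" by (simp add: algebra_simps)
    also have "exp (K * (t - t1)) * (K * (t - r')) \<le> exp (K * (t - t1)) * (K * (t - r))"
      using K by (intro mult_left_mono) (auto simp: r'_def)
    finally show ?thesis using True by (simp add: mult_ac)
  qed (use rt in \<open>simp add: \<tau>_def\<close>)
qed

section \<open>Size of the violation and the contradiction\<close>

context frac_p_nonsym begin

lemma uniform_continuity: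
  assumes \<omega>: "0 < \<omega>" obtains d where "0 < d" "\<And>x y. norm (x - y) \<le> d \<Longrightarrow> u x - u y \<le> \<omega>"
proof -
  obtain R where R: "0 < R" "\<And>x. R < norm x \<Longrightarrow> u x < \<omega>" using u_small_outside[OF \<omega>] by blast
  obtain L where L: "1 \<le> L" "\<And>x y. norm x \<le> R + 1 \<Longrightarrow> norm y \<le> R + 1 \<Longrightarrow> \<bar>u x - u y\<bar> \<le> L * norm (x - y)"
    by (rule local_lipschitz[of "R + 1"]) (rule that)
  show ?thesis
  proof (rule that[of "min 1 (\<omega> / L)"])
    show "0 < min 1 (\<omega> / L)" using L(1) \<omega> by simp
    fix x y :: 'a assume d: "norm (x - y) \<le> min 1 (\<omega> / L)"
    show "u x - u y \<le> \<omega>"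
    proof (cases "norm x \<le> R")
      case False
      then show ?thesis using R(2)[of x] u_pos[of y] by simp
    next
      case True
      have "norm y \<le> R + 1" using norm_triangle_sub[of y x] True d by (simp add: norm_minus_commute)
      then have "\<bar>u x - u y\<bar> \<le> L * norm (x - y)" using True by (intro L(2)) auto
      also have "\<dots> \<le> L * (\<omega> / L)" using d L(1) by (intro mult_left_mono) auto
      finally show ?thesis using L(1) by simp
    qed
  qed
qed

text \<open>A point between the critical plane and c is hardly moved by the reflection. A point left
  of the critical plane is compared with its reflection there, which does not decrease u and is
  close to the reflection at c.\<close>

lemma violation_small:
  assumes \<omega>: "0 < \<omega>"
  obtains d where "0 < d" "\<And>c y. c < lam e + d \<Longrightarrow> y \<bullet> e < c \<Longrightarrow> u y - u (refl_at e c y) \<le> \<omega>"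
proof -
  obtain d where d: "0 < d" "\<And>x y. norm (x - y) \<le> d \<Longrightarrow> u x - u y \<le> \<omega>" using uniform_continuity[OF \<omega>] by blast
  show ?thesis
  proof (rule that[of "d / 2"])
    fix c y assume c: "c < lam e + d / 2" "y \<bullet> e < c"
    show "u y - u (refl_at e c y) \<le> \<omega>"
    proof (cases "y \<bullet> e < lam e")
      case False
      have "y - refl_at e c y = (- (2 * (c - y \<bullet> e))) *\<^sub>R e" by (simp add: refl_at_def algebra_simps)
      then have "norm (y - refl_at e c y) = \<bar>- (2 * (c - y \<bullet> e))\<bar>" using norm_e by (simp only: norm_scaleR mult_1_right)
      also have "\<dots> \<le> d" using c False by (simp add: abs_le_iff)
      finally show ?thesis by (rule d(2))
    next
      case True
      show ?thesis
      proof (cases "c \<le> lam e")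
        case True then show ?thesis using strict[OF True c(2)] \<omega> by simp
      next
        case False
        have "refl_at e (lam e) y - refl_at e c y = (- (2 * (c - lam e))) *\<^sub>R e" by (simp add: refl_at_def algebra_simps)
        then have "norm (refl_at e (lam e) y - refl_at e c y) = \<bar>- (2 * (c - lam e))\<bar>" using norm_e by (simp only: norm_scaleR mult_1_right)
        also have "\<dots> \<le> d" using c False by (simp add: abs_le_iff)
        finally have "u (refl_at e (lam e) y) - u (refl_at e c y) \<le> \<omega>" by (rule d(2))
        then show ?thesis using strict[OF order_refl True] by simp
      qed
    qed
  qed (use d in simp)
qed

text \<open>M is the supremum over all planes below l, since the loss estimate meets planes at the
  centres of arbitrary moved components. It need not be attained, hence M/2. Passing to the minimum
  point for the chosen plane places the violation where u is at least \<open>s0\<close>, well above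
  the cut-off level of the weight.\<close>

lemma violation_sup:
  assumes l: "lam e < l" and \<omega>: "\<And>c y. c < l \<Longrightarrow> y \<bullet> e < c \<Longrightarrow> u y - u (refl_at e c y) \<le> \<omega>"
  obtains M c x where "0 < M" "M \<le> \<omega>" "\<And>c y. c < l \<Longrightarrow> y \<bullet> e < c \<Longrightarrow> u y - u (refl_at e c y) \<le> M"
    "lam e < c" "c < l" "x \<bullet> e < c" "s0 \<le> u x" "u (refl_at e c x) < u x - M / 2"
proof -
  define S where "S = {u y - u (refl_at e c y) | c y. c < l \<and> y \<bullet> e < c}"
  have bd: "bdd_above S" using \<omega> by (auto simp: S_def bdd_above_def)
  \<comment> \<open>The midpoint keeps the bad plane strictly below l.\<close>
  have "lam e < (lam e + l) / 2" using l by simp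
  then obtain c0 where c0: "lam e < c0" "c0 \<le> (lam e + l) / 2" "\<not> good e c0" by (rule not_good_above_lam[OF norm_e])
  then obtain z0 where z0: "z0 \<bullet> e < c0" "u (refl_at e c0 z0) < u z0" by (auto simp: good_def not_le)
  have in0: "u z0 - u (refl_at e c0 z0) \<in> S"
  proof -
    have "c0 < l" using c0(2) l by (simp add: field_simps)
    then show ?thesis using z0(1) unfolding S_def by blast
  qed
  define M where "M = Sup S"
  have up: "u y - u (refl_at e c y) \<le> M" if "c < l" "y \<bullet> e < c" for c y
    unfolding M_def by (rule cSup_upper[OF _ bd]) (use that in \<open>auto simp: S_def\<close>)
  have M0: "0 < M" using cSup_upper[OF in0 bd] z0(2) by (simp add: M_def)
  have "M / 2 < Sup S" using M0 by (simp add: M_def)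
  then obtain v where v: "v \<in> S" "M / 2 < v" using less_cSup_iff[OF _ bd, of "M / 2"] in0 by auto
  then obtain c y where cy: "c < l" "y \<bullet> e < c" "M / 2 < u y - u (refl_at e c y)" by (auto simp: S_def)
  have cl: "lam e < c"
  proof (rule ccontr)
    assume "\<not> lam e < c"
    then show False using strict[of c y] cy M0 by simp
  qed
  have "u (refl_at e c y) < u y" using cy(3) M0 by linarith
  from negative_min[OF norm_e cy(2) this] obtain x where x: "x \<bullet> e < c" "u (refl_at e c x) < u x" "s0 \<le> u x"
    "\<And>y. y \<bullet> e < c \<Longrightarrow> u (refl_at e c x) - u x \<le> u (refl_at e c y) - u y" by blast
  have M\<omega>: "M \<le> \<omega>" unfolding M_def by (rule cSup_least) (use in0 \<omega> in \<open>auto simp: S_def\<close>)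
  show ?thesis by (rule that[OF M0 M\<omega> up cl cy(1) x(1) x(3)]) (use x(4)[OF cy(2)] cy(3) in linarith)+
qed

text \<open>The integral of \<open>GG\<close> tends to 0, but with the chosen weight it is at least
  \<kappa>1 times (half of exp(K t1) times the measure of \<open>Z\<close>) minus a fixed multiple
  of Q. Since K is of order M^(-\<theta>) and \<open>Z\<close> has measure of order M^(n+1), this is
  impossible for small M.\<close>

lemma nonsymmetric_absurd: False
proof -
  \<comment> \<open>The levels used near the violation exceed \<open>s0\<close> - 3M/8, hence 2 t1 =
    s0/2 as soon as M is at most \<open>s0\<close>.\<close>
  define t1 where "t1 = s0 / 4"
  have t1: "0 < t1" using s0_pos by (simp add: t1_def)
  show ?thesis
  proof (rule steiner_lower[OF t1])
    fix \<epsilon>0 \<kappa>1 \<kappa>2 \<theta> :: real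
    assume pos: "0 < \<epsilon>0" "0 < \<kappa>1" "0 < \<kappa>2" "0 < \<theta>" and steiner:
      "\<And>l M \<tau> d\<tau> \<epsilon> t x. lam e < l \<Longrightarrow> l \<le> lam e + \<epsilon>0 \<Longrightarrow> 0 < M \<Longrightarrow> M \<le> 1 \<Longrightarrow>
        (\<And>c y. c < l \<Longrightarrow> y \<bullet> e < c \<Longrightarrow> u y - u (refl_at e c y) \<le> M) \<Longrightarrow>
        \<tau> \<in> borel_measurable borel \<Longrightarrow> (\<And>t. 0 \<le> \<tau> t) \<Longrightarrow> (\<And>r t. r \<le> t \<Longrightarrow> \<tau> t - \<tau> r \<le> d\<tau> t * (t - r)) \<Longrightarrow>
        mono \<tau> \<Longrightarrow> (\<And>t. 0 \<le> d\<tau> t) \<Longrightarrow> 0 < \<epsilon> \<Longrightarrow> \<epsilon> \<le> 1 \<Longrightarrow> t1 \<le> t \<Longrightarrow> inA l t x \<Longrightarrow>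
        (\<kappa>1 * \<tau> t - \<kappa>2 * M powr \<theta> * d\<tau> t) * len t x
          \<le> (\<integral>y. Om l \<tau> t y * (ker N \<epsilon> (rend t x - y) - ker N \<epsilon> (lend t x - y)) \<partial>lborel)"
    obtain R where R: "0 < R" "\<And>x. R < norm x \<Longrightarrow> u x < t1" using u_small_outside[OF t1] by blast
    define R2 where "R2 = R + 2 * (\<bar>lam e\<bar> + 1 + R)"
    obtain L where L: "1 \<le> L" "\<And>x y. norm x \<le> R2 + 1 \<Longrightarrow> norm y \<le> R2 + 1 \<Longrightarrow> \<bar>u x - u y\<bar> \<le> L * norm (x - y)"
      by (rule local_lipschitz[of "R2 + 1"]) (rule that)
    define Q where "Q = (\<integral>z. qq t1 z \<partial>lborel)"
    have Q0: "0 \<le> Q" unfolding Q_def by (rule Bochner_Integration.integral_nonneg) (simp add: qq_def)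
    define v1 where "v1 = measure lborel (ball (0::'a) 1)"
    have v1: "0 < v1" unfolding v1_def by (rule content_ball_pos) simp
    define b where "b = v1 * (1 / (8 * L)) ^ DIM('a) / 4"
    have b: "0 < b" using v1 L(1) by (simp add: b_def)
    define a where "a = \<kappa>1 * t1 / (2 * \<kappa>2)"
    have a: "0 < a" using pos t1 by (simp add: a_def)
    have Q2: "0 \<le> 2 * Q" using Q0 by simp
    obtain \<omega>1 where \<omega>1: "0 < \<omega>1" "\<And>M. 0 < M \<Longrightarrow> M \<le> 1 \<Longrightarrow> M \<le> \<omega>1 \<Longrightarrow> 2 * Q < exp (a * M powr (- \<theta>)) * (b * M ^ Suc DIM('a))"
      using exp_power_contradiction[OF a b Q2 pos(4), of "DIM('a)"] by blast
    define \<omega> where "\<omega> = min (min 1 s0) \<omega>1"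
    have \<omega>: "0 < \<omega>" "\<omega> \<le> 1" "\<omega> \<le> s0" "\<omega> \<le> \<omega>1" using s0_pos \<omega>1(1) by (auto simp: \<omega>_def)
    obtain d where d: "0 < d" "\<And>c y. c < lam e + d \<Longrightarrow> y \<bullet> e < c \<Longrightarrow> u y - u (refl_at e c y) \<le> \<omega>" using violation_small[OF \<omega>(1)] by blast
    define l where "l = lam e + min 1 (min \<epsilon>0 d)"
    have l: "lam e < l" "l \<le> lam e + \<epsilon>0" "l \<le> lam e + d" "l \<le> lam e + 1" using pos(1) d(1) by (auto simp: l_def)
    have l\<omega>: "\<And>c y. c < l \<Longrightarrow> y \<bullet> e < c \<Longrightarrow> u y - u (refl_at e c y) \<le> \<omega>" using d(2) l(3) by force
    obtain M c x where M: "0 < M" "M \<le> \<omega>" and wM: "\<And>c y. c < l \<Longrightarrow> y \<bullet> e < c \<Longrightarrow> u y - u (refl_at e c y) \<le> M"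
      and c: "lam e < c" "c < l" and x: "x \<bullet> e < c" "s0 \<le> u x" "u (refl_at e c x) < u x - M / 2"
      by (rule violation_sup[OF l(1), where \<omega> = \<omega>]) (erule (1) l\<omega>, rule that, assumption+)
    have M1: "M \<le> 1" "M \<le> s0" using M \<omega> by auto
    \<comment> \<open>Chosen so that the loss \<kappa>2 M^\<theta> \<tau>' is exactly half of
      \<kappa>1 times the exponential.\<close>
    define K where "K = \<kappa>1 / (2 * \<kappa>2) * M powr (- \<theta>)"
    have K: "0 < K" using pos M by (simp add: K_def)
    have Kt: "K * t1 = a * M powr (- \<theta>)" by (simp add: K_def a_def)
    have KM: "\<kappa>2 * M powr \<theta> * K = \<kappa>1 / 2"
    proof -
      have "M powr \<theta> * M powr (- \<theta>) = 1" using M(1) by (simp add: powr_add[symmetric])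
      moreover have "\<kappa>2 * M powr \<theta> * K = \<kappa>1 / 2 * (M powr \<theta> * M powr (- \<theta>))" using pos(3) by (simp add: K_def)
      ultimately show ?thesis by simp
    qed
    define \<tau> where "\<tau> t = (if t1 < t then exp (K * (t - t1)) - 1 else 0)" for t
    define d\<tau> where "d\<tau> t = (if t1 < t then K * exp (K * (t - t1)) else 0)" for t
    have \<tau>m [measurable]: "\<tau> \<in> borel_measurable borel" unfolding \<tau>_def[abs_def] by measurable
    have \<tau>: "\<And>t. 0 \<le> \<tau> t" "\<And>r t. r \<le> t \<Longrightarrow> \<tau> t - \<tau> r \<le> d\<tau> t * (t - r)" "mono \<tau>" "\<And>t. 0 \<le> d\<tau> t"
      using truncated_exp_slope[OF K, of _ _ t1] K by (auto simp: \<tau>_def d\<tau>_def intro!: monoI)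
    have \<tau>T: "\<tau> t \<le> exp (K * umax)" if "t \<le> umax" for t
    proof (cases "t1 < t")
      case True
      have "exp (K * (t - t1)) \<le> exp (K * umax)" using that K t1 by simp
      moreover have "\<tau> t = exp (K * (t - t1)) - 1" using True by (simp add: \<tau>_def)
      ultimately show ?thesis by linarith
    qed (simp add: \<tau>_def)
    have \<tau>0: "\<tau> t = 0" if "t \<le> t1" for t using that by (simp add: \<tau>_def)
    \<comment> \<open>On a ball of this radius u varies by at most M/8.\<close>
    define \<rho> where "\<rho> = M / (8 * L)"
    have \<rho>: "0 < \<rho>" "L * \<rho> = M / 8" "\<rho> \<le> 1" using M(1) M1 L(1) by (auto simp: \<rho>_def field_simps)
    \<comment> \<open>For y in the ball, u(y) is at least u(x) - M/8 and u at its mirror image is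
      below u(x) - 3M/8; the levels in between separate the two.\<close>
    define Z where "Z = {u x - 3 * M / 8<..<u x - M / 8} \<times> ball x \<rho>"
    have nx: "norm x \<le> R" using R(2)[of x] x(2) s0_pos by (force simp: t1_def not_less[symmetric])
    have cabs: "\<bar>c\<bar> \<le> \<bar>lam e\<bar> + 1" using c l by linarith
    have nRx: "norm (refl_at e c x) \<le> R2"
    proof -
      have "norm (refl_at e c x) \<le> norm x + \<bar>2 * (c - x \<bullet> e)\<bar>"
        unfolding refl_at_def using norm_triangle_ineq[of x "(2 * (c - x \<bullet> e)) *\<^sub>R e"] norm_e by (simp only: norm_scaleR mult_1_right)
      moreover have "\<bar>x \<bullet> e\<bar> \<le> R" using Cauchy_Schwarz_ineq2[of x e] norm_e nx by simp
      then have "\<bar>c - x \<bullet> e\<bar> \<le> \<bar>lam e\<bar> + 1 + R" using abs_triangle_ineq4[of c "x \<bullet> e"] cabs by linarith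
      then have "\<bar>2 * (c - x \<bullet> e)\<bar> \<le> 2 * (\<bar>lam e\<bar> + 1 + R)" by (simp only: abs_mult abs_numeral mult_left_mono zero_le_numeral)
      ultimately show ?thesis using nx unfolding R2_def by linarith
    qed
    have R2: "R \<le> R2" using R(1) by (simp add: R2_def)
    \<comment> \<open>A drop of M/2 needs a reflection of a certain length, so the whole ball stays
      left of the plane.\<close>
    have gap: "\<rho> < c - x \<bullet> e"
    proof -
      have "\<bar>u x - u (refl_at e c x)\<bar> \<le> L * norm (x - refl_at e c x)" using nx nRx R2 by (intro L(2)) auto
      then have "M / 2 < L * norm (x - refl_at e c x)" using x(3) by linarith
      also have "x - refl_at e c x = (- (2 * (c - x \<bullet> e))) *\<^sub>R e" by (simp add: refl_at_def algebra_simps)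
      also have "norm \<dots> = 2 * (c - x \<bullet> e)" using norm_e x(1) by (simp add: abs_mult)
      finally have "L * (4 * \<rho>) < L * (2 * (c - x \<bullet> e))" using \<rho>(2) by simp
      then have "4 * \<rho> < 2 * (c - x \<bullet> e)" using L(1) by (simp only: mult_less_cancel_left_pos)
      then show ?thesis using \<rho>(1) by simp
    qed
    have Zin: "inA l t y \<and> 2 * t1 \<le> t \<and> qq t1 (t, y) = 1" if z: "(t, y) \<in> Z" for t y
    proof -
      have t: "u x - 3 * M / 8 < t" "t < u x - M / 8" and y: "norm (y - x) < \<rho>"
        using z by (auto simp: Z_def dist_norm norm_minus_commute)
      have t2: "2 * t1 \<le> t" using t x(2) M1 by (simp add: t1_def)
      have t0: "0 < t" using t2 t1 by linarith
      have ny: "norm y \<le> R2 + 1" using norm_triangle_sub[of y x] y \<rho>(3) nx R2 by linarith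
      have nRR: "norm (refl_at e c y - refl_at e c x) = norm (y - x)" by (rule norm_refl_at_diff[OF norm_e])
      have nRy: "norm (refl_at e c y) \<le> R2 + 1" using norm_triangle_sub[of "refl_at e c y" "refl_at e c x"] nRR nRx y \<rho>(3) by linarith
      have Ly: "L * norm (y - x) \<le> M / 8" using y \<rho>(2) L(1) mult_left_mono[of "norm (y - x)" \<rho> L] by linarith
      have "\<bar>u y - u x\<bar> \<le> L * norm (y - x)" using ny nx R2 by (intro L(2)) auto
      then have ty: "t < u y" using Ly t(2) by linarith
      have "\<bar>u (refl_at e c y) - u (refl_at e c x)\<bar> \<le> L * norm (refl_at e c y - refl_at e c x)" using nRy nRx by (intro L(2)) auto
      then have Ry: "u (refl_at e c y) \<le> t" using Ly t(1) x(3) unfolding nRR by linarith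
      have "\<bar>(y - x) \<bullet> e\<bar> \<le> norm (y - x)" using Cauchy_Schwarz_ineq2[of "y - x" e] norm_e by simp
      then have "\<bar>y \<bullet> e - x \<bullet> e\<bar> \<le> norm (y - x)" by (simp only: inner_diff_left)
      then have yc: "y \<bullet> e < c" using y gap by linarith
      \<comment> \<open>The component ends no later than at the mirror image, and it begins strictly
        left of y; hence its centre is left of c < l and it is among the moved ones.\<close>
      have "rr t y \<le> 2 * (c - y \<bullet> e)" unfolding rr_def using yc Ry by (intro ret_upperI) (auto simp: refl_at_def)
      moreover have "0 < ll t y" unfolding ll_def by (rule ret_pos[OF norm_me t0 ty])
      ultimately have "cen t y < c" unfolding cen_def by (simp add: field_simps)
      then have A: "inA l t y" using ty c by (simp add: inA_def)
      moreover have "qq t1 (t, y) = 1" using t0 ty u_le[of y] t2 t1 by (simp add: qq_def)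
      ultimately show ?thesis using t2 by blast
    qed
    define E0 where "E0 = exp (K * t1)"
    have E0: "0 < E0" by (simp add: E0_def)
    have emZ: "emeasure lborel Z = ennreal (M / 4 * (v1 * \<rho> ^ DIM('a)))"
    proof -
      have "emeasure lborel Z = emeasure (lborel \<Otimes>\<^sub>M lborel) Z" by (simp only: lborel_prod)
      also have "\<dots> = emeasure lborel {u x - 3 * M / 8<..<u x - M / 8} * emeasure lborel (ball x \<rho>)"
        unfolding Z_def by (rule lborel.emeasure_pair_measure_Times) auto
      also have "emeasure lborel {u x - 3 * M / 8<..<u x - M / 8} = ennreal (M / 4)" using M(1) by simp
      also have "emeasure lborel (ball x \<rho>) = ennreal (measure lborel (ball x \<rho>))"
        using emeasure_lborel_ball_finite[of x \<rho>] by (intro emeasure_eq_ennreal_measure) auto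
      also have "measure lborel (ball x \<rho>) = v1 * \<rho> ^ DIM('a)"
        using content_ball_conv_unit_ball[of \<rho> x] \<rho>(1) by (simp add: v1_def)
      also have "ennreal (M / 4) * ennreal (v1 * \<rho> ^ DIM('a)) = ennreal (M / 4 * (v1 * \<rho> ^ DIM('a)))"
        using M(1) v1 \<rho>(1) by (intro ennreal_mult[symmetric]) auto
      finally show ?thesis .
    qed
    have [measurable]: "Z \<in> sets borel" unfolding Z_def by (intro borel_open open_Times) auto
    have Zm: "measure lborel Z = M / 4 * (v1 * \<rho> ^ DIM('a))"
      using emZ M(1) v1 \<rho>(1) by (intro measure_eq_emeasure_eq_ennreal) auto
    have Zi: "integrable lborel (indicat_real Z)" by (rule integrable_real_indicator) (auto simp: emZ)
    have qi: "integrable lborel (qq t1)" by (rule qq_integrable[OF t1])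
    \<comment> \<open>Minorant independent of \<epsilon>: the exponential is kept only on
      \<open>Z\<close>, and the -1 in the weight \<tau> produces the term with \<open>qq\<close>,
      whose integral does not depend on K.\<close>
    let ?P = "\<lambda>z. \<kappa>1 * (E0 / 2 * indicator Z z - qq t1 z)"
    have Pi: "integrable lborel ?P" using Zi qi by simp
    have PG: "?P z \<le> GG l \<tau> (eps n) z" for z n
    proof -
      obtain t y where z: "z = (t, y)" by fastforce
      note GGz = GG_integral(3)[OF eps_pos t1 \<tau>m \<tau>(1) _ \<tau>0 FF_integral_tendsto_0(1)[OF t1 \<tau>m \<tau>(1) _ \<tau>0]]
      have q0: "0 \<le> qq t1 z" by (simp add: qq_def)
      show ?thesis
      proof (cases "inA l t y \<and> t1 < t")
        case False
        then have "z \<notin> Z" using Zin[of t y] t1 by (auto simp: z)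
        moreover have "GG l \<tau> (eps n) z = 0"
          using False GGz[of "exp (K * umax)" "exp (K * umax)" t l n y] \<tau>T by (cases "inA l t y") (auto simp: z GG_def not_less)
        ultimately show ?thesis using q0 pos(2) by simp
      next
        case True
        have t: "0 < t" "t < u y" using True t1 by (auto simp: inA_def)
        have q1: "qq t1 z = 1" using True t u_le[of y] by (simp add: qq_def z)
        define X where "X = exp (K * (t - t1))"
        have "(\<kappa>1 * \<tau> t - \<kappa>2 * M powr \<theta> * d\<tau> t) * len t y \<le> (\<integral>w. Om l \<tau> t w * (ker N (eps n) (rend t y - w) - ker N (eps n) (lend t y - w)) \<partial>lborel)"
          using True by (intro steiner[OF l(1,2) M(1) M1(1) wM \<tau>m \<tau> eps_pos eps_le_1]) auto
        then have "\<kappa>1 * \<tau> t - \<kappa>2 * M powr \<theta> * d\<tau> t \<le> GG l \<tau> (eps n) z"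
          using True len_pos[OF t] by (simp add: GG_def z pos_le_divide_eq)
        moreover have "\<kappa>2 * M powr \<theta> * d\<tau> t = \<kappa>1 / 2 * X"
          unfolding KM[symmetric] using True by (simp add: d\<tau>_def X_def)
        moreover have "\<tau> t = X - 1" using True by (simp add: \<tau>_def X_def)
        ultimately have G: "\<kappa>1 * (X / 2 - 1) \<le> GG l \<tau> (eps n) z" by (simp add: algebra_simps)
        \<comment> \<open>On \<open>Z\<close> the level is at least 2 t1, so the exponent K(t - t1)
          is at least K t1.\<close>
        have "E0 / 2 * indicator Z z \<le> X / 2"
        proof (cases "z \<in> Z")
          case zZ: True
          then have "K * t1 \<le> K * (t - t1)" using Zin[of t y] K by (simp add: z)
          then show ?thesis using zZ by (simp add: E0_def X_def)
        qed (simp add: X_def)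
        then have "\<kappa>1 * (E0 / 2 * indicator Z z - 1) \<le> \<kappa>1 * (X / 2 - 1)" using pos(2) by (intro mult_left_mono) auto
        then show ?thesis using G by (simp only: q1)
      qed
    qed
    have le: "(\<integral>z. ?P z \<partial>lborel) \<le> (\<integral>z. FF l \<tau> (eps n) z \<partial>lborel)" for n
    proof -
      have Fi: "integrable lborel (FF l \<tau> (eps n))" by (rule FF_integral_tendsto_0(1)[OF t1 \<tau>m \<tau>(1) \<tau>T \<tau>0])
      have Gi: "integrable lborel (GG l \<tau> (eps n))" "(\<integral>z. GG l \<tau> (eps n) z \<partial>lborel) = (\<integral>z. FF l \<tau> (eps n) z \<partial>lborel)"
        by (rule GG_integral[OF eps_pos t1 \<tau>m \<tau>(1) \<tau>T \<tau>0 Fi], assumption+)+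
      show ?thesis unfolding Gi(2)[symmetric] by (rule integral_mono[OF Pi Gi(1) PG])
    qed
    have lim0: "(\<lambda>n. \<integral>z. FF l \<tau> (eps n) z \<partial>lborel) \<longlonglongrightarrow> 0" by (rule FF_integral_tendsto_0(2)[OF t1 \<tau>m \<tau>(1) \<tau>T \<tau>0])
    have "(\<integral>z. ?P z \<partial>lborel) \<le> 0" using le by (intro tendsto_lowerbound[OF lim0]) auto
    moreover have "(\<integral>z. ?P z \<partial>lborel) = \<kappa>1 * (E0 / 2 * measure lborel Z - Q)"
      using Zi qi by (simp add: Bochner_Integration.integral_diff Q_def)
    ultimately have "E0 / 2 * measure lborel Z \<le> Q" using pos(2) by (simp add: mult_le_0_iff)
    moreover have "measure lborel Z = b * M ^ Suc DIM('a)"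
    proof -
      have "\<rho> ^ DIM('a) = (1 / (8 * L)) ^ DIM('a) * M ^ DIM('a)"
        unfolding \<rho>_def power_mult_distrib[symmetric] by simp
      then show ?thesis unfolding Zm b_def by simp
    qed
    ultimately have "exp (a * M powr (- \<theta>)) * (b * M ^ Suc DIM('a)) \<le> 2 * Q" by (simp add: E0_def Kt)
    moreover have "2 * Q < exp (a * M powr (- \<theta>)) * (b * M ^ Suc DIM('a))" using M M1 \<omega>(4) by (intro \<omega>1(2)) auto
    ultimately show False by linarith
  qed
qed

end

context frac_p_solution begin

lemma symmetric_at_lam:
  assumes e: "norm e = 1" shows "u (refl_at e (lam e) x) = u x"
proof (rule ccontr)
  assume "u (refl_at e (lam e) x) \<noteq> u x"
  then have "\<forall>x. x \<bullet> e < lam e \<longrightarrow> u x < u (refl_at e (lam e) x)"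
    using good_strict_or_symmetric[OF e good_le_lam[OF e order_refl]] by blast
  then have "u x < u (refl_at e c x)" if "c \<le> lam e" "x \<bullet> e < c" for c x
    using strict_below_lam[OF e _ that(2)] that by (cases "c = lam e") auto
  then interpret frac_p_nonsym u g s p C s0 e
    by unfold_locales (use e in auto)
  show False by (rule nonsymmetric_absurd)
qed

end

theorem theorem4p1:
  fixes u :: "'a::euclidean_space \<Rightarrow> real" and g :: "real \<Rightarrow> real"
    and s p C :: real
  assumes "0 < s" and "s < 1" and "1 < p" and "0 < C"
    and "\<exists>s0>0. \<forall>t. 0 < t \<and> t < s0 \<longrightarrow>
           (\<exists>d. (g has_real_derivative d) (at t) \<and> d \<le> 0)"
    and "u \<in> C11_loc" and "u \<in> L_sp s p"
    and "\<forall>x. 0 < u x"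
    and "\<forall>x. frac_p_laplacian_eq C s p u x (g (u x))"
    and "(u \<longlongrightarrow> 0) at_infinity"
  shows "\<exists>x0. (\<forall>x y. dist x x0 = dist y x0 \<longrightarrow> u x = u y) \<and>
              (\<forall>x y. dist x x0 < dist y x0 \<longrightarrow> u y < u x)"
proof -
  obtain s0 where "0 < s0" "\<And>t. 0 < t \<Longrightarrow> t < s0 \<Longrightarrow> \<exists>d. (g has_real_derivative d) (at t) \<and> d \<le> 0"
    using assms(5) by blast
  then interpret frac_p_solution u g s p C s0
    using assms by unfold_locales auto
  show ?thesis by (rule radial) (rule symmetric_at_lam)
qed

end
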